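(* Let $X_0,X_1,\dots,X_n$ be real vector fields on a bounded domain $\Omega\subset\mathbb{R}^p$ satisfying assumptions (C) for some integer $r\ge2$. Let $\Omega'\Subset\Omega$, $x_0\in\Omega'$, and let $\{X_{[I_j]}\}_{I_j\in\eta}$, $\eta=\{I_1,\dots,I_p\}$, be any family of $p$ commutators (with $|I_j|\le r$) which span $\mathbb{R}^p$ at $x_0$ and satisfy $$\left|\det\{(X_{[I_j]})_{x_0}\}_{I_j\in\eta}\right|\ge(1-\varepsilon)\max_\zeta\left|\det\{(X_{[I_j]})_{x_0}\}_{I_j\in\zeta}\right|$$ for some $\varepsilon\in(0,1)$, where the maximum is over all families $\zeta$ of $p$ multiindices of weight at most $r$. Then there exist constants $\delta_1,\delta_2>0$, depending on $\Omega',\varepsilon$ and the $X_i$'s, such that the map $$(h_1,\dots,h_p)\mapsto E_{I_1}(h_1)E_{I_2}(h_2)\cdots E_{I_p}(h_p)(x_0)$$ is a $C^1$ diffeomorphism of the neighborhood of the origin $\{h:|h|<\delta_1\}$ onto a neighborhood $U(x_0)$ of $x_0$ containing $\{x:|x-x_0|<\delta_2\}$. Moreover, $(h_1,\dots,h_p,x)\mapsto E_{I_1}(h_1)\cdots E_{I_p}(h_p)(x)$ is a $C^1$ map in the joint variables for $x\in\Omega'$ and $|h|<\delta_1$.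
   Context: $\Omega'\Subset\Omega$ means $\Omega'$ is a domain (connected open set) with $\overline{\Omega'}$ compact and contained in $\Omega$. Weights: $p_0=2$ and $p_i=1$ for $i=1,\dots,n$. For a multiindex $I=(i_1,\dots,i_k)$ with entries in $\{0,1,\dots,n\}$, the weight is $|I|=\sum_{j=1}^k p_{i_j}$, the length is $\ell(I)=k$, $X_I=X_{i_1}\cdots X_{i_k}$, and $X_{[I]}=[X_{i_1},[X_{i_2},\dots[X_{i_{k-1}},X_{i_k}]\dots]]$ (with $X_{[I]}=X_{i_1}$ if $I=(i_1)$), where $[X,Y]=XY-YX$. $(X_{[I]})_x$ denotes $X_{[I]}$ evaluated at $x$. Assumptions (C), for an integer $r\ge2$: the coefficients of $X_1,\dots,X_n$ belong to $C^{r-1}(\overline\Omega)$; the coefficients of $X_0$ belong to $C^{r-2}(\overline\Omega)$ and, in the case $r=2$, moreover to $C^1$; the vectors $\{(X_{[I]})_x\}_{|I|\le r}$ span $\mathbb{R}^p$ at every $x\in\Omega$. Exponential: $\exp(tX)(x_0)=\varphi(t)$ where $\varphi'(\tau)=X_{\varphi(\tau)}$, $\varphi(0)=x_0$ (for $|t|$ small). Quasiexponential maps (products are compositions of maps, the rightmost applied first; defined for $t$ small): $C_1(t,X_{i_1})=\exp(t^{p_{i_1}}X_{i_1})$ and, for $l\ge2$, $$C_l(t,X_{i_1}\cdots X_{i_l})=C_{l-1}(t,X_{i_2}\cdots X_{i_l})^{-1}\exp(-t^{p_{i_1}}X_{i_1})\,C_{l-1}(t,X_{i_2}\cdots X_{i_l})\exp(t^{p_{i_1}}X_{i_1}).$$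 Then $E_I(t)=C_{\ell(I)}(t^{1/|I|},X_I)$ if $t\ge0$ and $E_I(t)=C_{\ell(I)}(|t|^{1/|I|},X_I)^{-1}$ if $t<0$. Dependence of constants (with $p,n,r,\Omega$ fixed): "depending on $\Omega'$ and the $X_i$'s" means depending on: (i) $\Omega'$; (ii) the $C^{r-1}(\overline\Omega)$ norms of the coefficients of $X_1,\dots,X_n$ and the $C^{r-2}(\overline\Omega)$ norms of those of $X_0$ (and, for $r=2$, the corresponding $C^1$ data of $X_0$); (iii) the moduli of continuity on $\overline\Omega$ of the highest order derivatives of the coefficients of the $X_i$'s; (iv) a constant $c_0>0$ with $\inf_{x\in\Omega'}\max_{|I_1|,\dots,|I_p|\le r}|\det((X_{[I_1]})_x,\dots,(X_{[I_p]})_x)|\ge c_0$. *)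

theory Defs
  imports "HOL-Analysis.Analysis"
begin

section \<open>Functions of class \<open>C\<^sup>k\<close>\<close>

definition partial ::
  "'a::euclidean_space \<Rightarrow> ('a \<Rightarrow> 'b::real_normed_vector) \<Rightarrow> 'a \<Rightarrow> 'b" where
  "partial b f x = frechet_derivative f (at x) b"

fun iter_partial ::
  "'a::euclidean_space list \<Rightarrow> ('a \<Rightarrow> 'b::real_normed_vector) \<Rightarrow> 'a \<Rightarrow> 'b" where
  "iter_partial [] f = f"
| "iter_partial (b # bs) f = partial b (iter_partial bs f)"

text \<open>Directions (with repetitions, in any order) of the partial derivatives of order at most \<open>k\<close>.\<close>

definition dirs_upto :: "nat \<Rightarrow> 'a::euclidean_space list set" where
  "dirs_upto k = {bs. set bs \<subseteq> Basis \<and> length bs \<le> k}"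

text \<open>Class \<open>C\<^sup>k\<close> on an open set.  Existence of derivatives is required in the sense of
  Frechet; since all partial derivatives are also required to be continuous, this is the classical
  notion.\<close>

definition Ck_on ::
  "nat \<Rightarrow> ('a::euclidean_space \<Rightarrow> 'b::real_normed_vector) \<Rightarrow> 'a set \<Rightarrow> bool" where
  "Ck_on k f S \<longleftrightarrow>
     (\<forall>bs \<in> dirs_upto k. continuous_on S (iter_partial bs f)) \<and>
     (\<forall>bs \<in> dirs_upto k. length bs < k \<longrightarrow> (\<forall>x\<in>S. iter_partial bs f differentiable (at x)))"

text \<open>Class \<open>C\<^sup>k\<close> on the closure of the open set \<open>S\<close>: the derivatives, which are taken in \<open>S\<close>, extend
  continuously to the closure.  Only the values of \<open>f\<close> in \<open>S\<close> matter.\<close>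

definition Ck_closure ::
  "nat \<Rightarrow> ('a::euclidean_space \<Rightarrow> 'b::real_normed_vector) \<Rightarrow> 'a set \<Rightarrow> bool" where
  "Ck_closure k f S \<longleftrightarrow> Ck_on k f S \<and>
     (\<forall>bs \<in> dirs_upto k. \<exists>g. continuous_on (closure S) g \<and> (\<forall>x\<in>S. g x = iter_partial bs f x))"

text \<open>The norm of \<open>C\<^sup>k\<close> of the closure of \<open>S\<close>, meaningful for bounded nonempty \<open>S\<close> and \<open>f\<close> in
  \<^const>\<open>Ck_closure\<close>; by continuity the supremum over \<open>S\<close> is the supremum over its closure.\<close>

definition Ck_norm ::
  "nat \<Rightarrow> ('a::euclidean_space \<Rightarrow> 'b::real_normed_vector) \<Rightarrow> 'a set \<Rightarrow> real" where
  "Ck_norm k f S = (SUP (bs, x) \<in> dirs_upto k \<times> S. norm (iter_partial bs f x))"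

text \<open>The derivatives of order exactly \<open>k\<close> have modulus of continuity \<open>\<omega>\<close>.\<close>

definition top_modulus ::
  "nat \<Rightarrow> ('a::euclidean_space \<Rightarrow> 'b::real_normed_vector) \<Rightarrow> 'a set \<Rightarrow> (real \<Rightarrow> real) \<Rightarrow> bool" where
  "top_modulus k f S \<omega> \<longleftrightarrow>
     (\<forall>bs \<in> dirs_upto k. length bs = k \<longrightarrow>
        (\<forall>x\<in>S. \<forall>y\<in>S. x \<noteq> y \<longrightarrow>
           norm (iter_partial bs f x - iter_partial bs f y) \<le> \<omega> (dist x y)))"

definition C1_diffeo_onto ::
  "('a::euclidean_space \<Rightarrow> 'b::euclidean_space) \<Rightarrow> 'a set \<Rightarrow> 'b set \<Rightarrow> bool" where
  "C1_diffeo_onto f S U \<longleftrightarrow>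
     open S \<and> open U \<and> bij_betw f S U \<and> Ck_on 1 f S \<and> Ck_on 1 (inv_into S f) U"

definition is_domain :: "'a::topological_space set \<Rightarrow> bool" where
  "is_domain S \<longleftrightarrow> open S \<and> connected S \<and> S \<noteq> {}"

definition compactly_inside :: "'a::topological_space set \<Rightarrow> 'a set \<Rightarrow> bool" where
  "compactly_inside S' S \<longleftrightarrow> is_domain S' \<and> compact (closure S') \<and> closure S' \<subseteq> S"


section \<open>Weighted multiindices and commutators\<close>

definition wt :: "nat \<Rightarrow> nat" where
  "wt i = (if i = 0 then 2 else 1)"

definition weight :: "nat list \<Rightarrow> nat" where
  "weight I = sum_list (map wt I)"

definition multiindices :: "nat \<Rightarrow> nat \<Rightarrow> nat list set" where
  "multiindices n r = {I. I \<noteq> [] \<and> set I \<subseteq> {0..n} \<and> weight I \<le> r}"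

text \<open>A vector field is identified with its vector of coefficients.  The first order operator
  \<open>XY - YX\<close> has \<open>j\<close>-th coefficient \<open>X(Y\<^sub>j) - Y(X\<^sub>j)\<close>.\<close>

definition lie_bracket :: "('a::real_normed_vector \<Rightarrow> 'a) \<Rightarrow> ('a \<Rightarrow> 'a) \<Rightarrow> 'a \<Rightarrow> 'a" where
  "lie_bracket X Y x =
     frechet_derivative Y (at x) (X x) - frechet_derivative X (at x) (Y x)"

text \<open>\<open>X\<^bsub>[I]\<^esub>\<close>; the value on the empty list is irrelevant.\<close>

fun commutator :: "(nat \<Rightarrow> 'a::real_normed_vector \<Rightarrow> 'a) \<Rightarrow> nat list \<Rightarrow> 'a \<Rightarrow> 'a" where
  "commutator X [] = (\<lambda>x. 0)"
| "commutator X [i] = X i"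
| "commutator X (i # j # I) = lie_bracket (X i) (commutator X (j # I))"

text \<open>A family of \<open>p\<close> multiindices is a function on the index type of \<open>\<real>\<^sup>p\<close>.\<close>

definition families :: "nat \<Rightarrow> nat \<Rightarrow> ('p \<Rightarrow> nat list) set" where
  "families n r = {\<zeta>. \<forall>j. \<zeta> j \<in> multiindices n r}"

definition family_det ::
  "(nat \<Rightarrow> real^'p::finite \<Rightarrow> real^'p) \<Rightarrow> ('p \<Rightarrow> nat list) \<Rightarrow> real^'p \<Rightarrow> real" where
  "family_det X \<zeta> x = det (\<chi> i j. commutator X (\<zeta> j) x $ i)"

definition max_det ::
  "nat \<Rightarrow> nat \<Rightarrow> (nat \<Rightarrow> real^'p::finite \<Rightarrow> real^'p) \<Rightarrow> real^'p \<Rightarrow> real" where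
  "max_det n r X x = (MAX \<zeta> \<in> families n r. \<bar>family_det X \<zeta> x\<bar>)"


section \<open>The standing assumptions\<close>

text \<open>The order of differentiability of the coefficients of \<open>X\<^sub>i\<close>.\<close>

definition reg :: "nat \<Rightarrow> nat \<Rightarrow> nat" where
  "reg r i = (if i = 0 then (if r = 2 then 1 else r - 2) else r - 1)"

definition assumptions_C ::
  "nat \<Rightarrow> nat \<Rightarrow> (real^'p::finite) set \<Rightarrow> (nat \<Rightarrow> real^'p \<Rightarrow> real^'p) \<Rightarrow> bool" where
  "assumptions_C n r \<Omega> X \<longleftrightarrow>
     (\<forall>i\<in>{0..n}. \<forall>j. Ck_closure (reg r i) (\<lambda>x. X i x $ j) \<Omega>) \<and>
     (\<forall>x\<in>\<Omega>. span ((\<lambda>I. commutator X I x) ` multiindices n r) = UNIV)"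

text \<open>The data on which constants may depend besides \<open>\<Omega>'\<close>: a bound \<open>M\<close> for the norms of the
  coefficients, a modulus of continuity \<open>\<omega>\<close> for their derivatives of highest order, and a lower
  bound \<open>c\<^sub>0\<close> for the maximal determinant on \<open>\<Omega>'\<close>.\<close>

definition data_bounds ::
  "nat \<Rightarrow> nat \<Rightarrow> (real^'p::finite) set \<Rightarrow> (real^'p) set \<Rightarrow> real \<Rightarrow> (real \<Rightarrow> real) \<Rightarrow> real
     \<Rightarrow> (nat \<Rightarrow> real^'p \<Rightarrow> real^'p) \<Rightarrow> bool" where
  "data_bounds n r \<Omega> \<Omega>' M \<omega> c0 X \<longleftrightarrow>
     (\<forall>i\<in>{0..n}. \<forall>j. Ck_norm (reg r i) (\<lambda>x. X i x $ j) \<Omega> \<le> M \<and>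
                      top_modulus (reg r i) (\<lambda>x. X i x $ j) \<Omega> \<omega>) \<and>
     (INF x\<in>\<Omega>'. max_det n r X x) \<ge> c0"


section \<open>Exponential and quasiexponential maps\<close>

text \<open>These maps are only partially defined, so they are represented by their graphs: \<open>(x, y)\<close>
  belongs to the relation iff the map is defined at \<open>x\<close> with value \<open>y\<close>.  The inverse map is then the
  converse relation.  The relational product \<open>R O S\<close> applies \<open>R\<close> first, so compositions appear
  in the order opposite to the usual one.\<close>

definition exp_rel ::
  "'a::real_normed_vector set \<Rightarrow> ('a \<Rightarrow> 'a) \<Rightarrow> real \<Rightarrow> ('a \<times> 'a) set" where
  "exp_rel \<Omega> V t =
     {(x, y). \<exists>\<phi>. \<phi> 0 = x \<and> \<phi> t = y \<and>
        (\<forall>\<tau> \<in> closed_segment 0 t. \<phi> \<tau> \<in> \<Omega> \<and>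
           (\<phi> has_vector_derivative V (\<phi> \<tau>)) (at \<tau> within closed_segment 0 t))}"

text \<open>\<open>C\<^sub>l(t, X\<^sub>I)\<close> with \<open>l\<close> the length of \<open>I\<close>; the value on the empty list is irrelevant.\<close>

fun C_rel ::
  "'a::real_normed_vector set \<Rightarrow> (nat \<Rightarrow> 'a \<Rightarrow> 'a) \<Rightarrow> real \<Rightarrow> nat list \<Rightarrow> ('a \<times> 'a) set" where
  "C_rel \<Omega> X t [] = Id"
| "C_rel \<Omega> X t [i] = exp_rel \<Omega> (X i) (t ^ wt i)"
| "C_rel \<Omega> X t (i # j # I) =
     exp_rel \<Omega> (X i) (t ^ wt i) O C_rel \<Omega> X t (j # I) O
     exp_rel \<Omega> (X i) (- (t ^ wt i)) O (C_rel \<Omega> X t (j # I))\<inverse>"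

definition E_rel ::
  "'a::real_normed_vector set \<Rightarrow> (nat \<Rightarrow> 'a \<Rightarrow> 'a) \<Rightarrow> nat list \<Rightarrow> real \<Rightarrow> ('a \<times> 'a) set" where
  "E_rel \<Omega> X I t =
     (if t \<ge> 0 then C_rel \<Omega> X (root (weight I) t) I
      else (C_rel \<Omega> X (root (weight I) \<bar>t\<bar>) I)\<inverse>)"

text \<open>\<open>E\<^bsub>I\<^sub>1\<^esub>(h\<^sub>1) \<dots> E\<^bsub>I\<^sub>p\<^esub>(h\<^sub>p)\<close>, where the index type, carrying a linear order, plays the role of
  \<open>{1, \<dots>, p}\<close>; the factor with the largest index acts first.\<close>

definition E_prod ::
  "(real, 'p::{finite,linorder}) vec set \<Rightarrow> (nat \<Rightarrow> (real, 'p) vec \<Rightarrow> (real, 'p) vec) \<Rightarrow>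
     ('p \<Rightarrow> nat list) \<Rightarrow> (real, 'p) vec \<Rightarrow> ((real, 'p) vec \<times> (real, 'p) vec) set" where
  "E_prod \<Omega> X \<eta> h =
     foldr (\<lambda>j R. R O E_rel \<Omega> X (\<eta> j) (h $ j)) (sorted_list_of_set UNIV) Id"

end

theory Submission
  imports Defs
begin

text \<open>
  All estimates are uniform for \<open>x\<close> near \<open>\<Omega>'\<close> and for all fields with the given data.  If \<open>f\<close> is of class
  \<open>C\<^sup>m\<close> with \<open>m \<le> r\<close> and \<open>R\<^sub>t\<close> is a composition of flows \<open>exp(\<plusminus>t\<^sup>pX\<^sub>i)\<close> with \<open>p\<close> the weight of \<open>i\<close>, then
  \<open>f \<circ> R\<^sub>t\<close> has an expansion in powers of \<open>t\<close> with remainder \<open>o(t\<^sup>m)\<close>, which may be differentiated in \<open>t\<close>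
  term by term: the remainder of the expansion for a single flow up to order \<open>m - 1\<close> has the Lipschitz
  constant \<open>o(t\<^bsup>m-1\<^esup>)\<close> in \<open>x\<close>, hence stays small when it is differentiated along the motion caused by the
  preceding flows.  The coefficients are determined by the values of \<open>f \<circ> R\<^sub>t\<close> alone, so it suffices to
  show that the quasiexponential map of \<open>I\<close> is \<open>x + t\<^sup>kX\<^bsub>[I]\<^esub>(x) + o(t\<^sup>k)\<close> with \<open>k\<close> the weight of \<open>I\<close>; its
  derivative in \<open>t\<close> then is \<open>kt\<^bsup>k-1\<^esup>X\<^bsub>[I]\<^esub> + o(t\<^bsup>k-1\<^esup>)\<close>.  Consequently \<open>E\<^sub>I(h)(x)\<close> is jointly \<open>C\<^sup>1\<close>, and its derivative
  tends to \<open>(\<tau>, v) \<mapsto> \<tau>X\<^bsub>[I]\<^esub>(x) + v\<close> as \<open>h\<close> tends to \<open>0\<close>.  The derivative of the product map in \<open>h\<close> is therefore close to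
  the matrix with columns \<open>X\<^bsub>[I\<^sub>j]\<^esub>(x\<^sub>0)\<close>, which is bounded with determinant bounded away from \<open>0\<close>.
\<close>

section \<open>Flows of vector fields for short times\<close>

text \<open>The derivative in h of E_I(h) = C(h^(1/k)) is t^(1-k)/k times the derivative of C in t =
  h^(1/k). An error o(t^k) in the values of C therefore says nothing about it; an error o(t^(k-1))
  in the derivative has to be known. The obstacle is regularity: a commutator of weight r is merely
  continuous, and for r = 2 the fields and their flows are merely of class C^1, so that neither a
  Taylor formula in several times nor second derivatives of the compositions are at hand. Hence
  remainders are carried along with Lipschitz constants in x, which survive integration in t. Since
  \<delta>1 and \<delta>2 are chosen before the fields, every estimate concerns a whole family
  \<Theta> of fields at once. In the end a constant c bounds the matrix with columns X_[I_j](x_0)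
  from below, R is a radius on which the derivative of the product map deviates from that matrix by
  at most c/2, and \<delta>1 = R/2, \<delta>2 = (c/2)(R/2).\<close>

lemma mvt_bound:
  fixes u :: "real \<Rightarrow> 'b::real_normed_vector"
  assumes "0 \<le> t" and cont: "continuous_on {0..t} u"
    and der: "\<And>s. 0 < s \<Longrightarrow> s < t \<Longrightarrow> (u has_vector_derivative u' s) (at s)"
    and bd: "\<And>s. 0 < s \<Longrightarrow> s < t \<Longrightarrow> norm (u' s) \<le> B"
  shows "norm (u t - u 0) \<le> B * t"
proof (cases "t = 0")
  case False
  with assms have "0 < t" by simp
  have "norm (u t - u 0) \<le> (\<lambda>s. B * s) t - (\<lambda>s. B * s) 0"
  proof (rule differentiable_bound_general[where f' = u' and \<phi>' = "\<lambda>_. B"])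
    show "((*) B has_vector_derivative B) (at x)" for x :: real
      by (auto intro!: derivative_eq_intros)
  qed (use assms \<open>0 < t\<close> in \<open>auto intro!: continuous_intros\<close>)
  then show ?thesis by simp
qed simp

lemma has_vector_derivative_interior:
  fixes u :: "real \<Rightarrow> 'b::real_normed_vector"
  assumes "(u has_vector_derivative d) (at s within {0..t})" "0 < s" "s < t"
  shows "(u has_vector_derivative d) (at s)"
  using assms at_within_interior[of s "{0..t}"] by simp

lemma continuous_on_vector_derivative:
  assumes "\<And>s. s \<in> S \<Longrightarrow> (u has_vector_derivative u' s) (at s within S)"
  shows "continuous_on S u"
  using assms has_vector_derivative_continuous continuous_on_eq_continuous_within by blast

text \<open>At a maximum of \<open>norm (u s)\<close> the mean value bound contains at most half of
  this maximum, because \<open>L * t\<close> is at most 1/2, and this half is absorbed. The factor 2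
  takes the place of an exponential.\<close>

lemma short_gronwall:
  fixes u :: "real \<Rightarrow> 'b::real_normed_vector"
  assumes "0 \<le> t" "0 \<le> c" and L: "0 \<le> L" "L * t \<le> 1/2"
    and der: "\<And>s. s \<in> {0..t} \<Longrightarrow> (u has_vector_derivative u' s) (at s within {0..t})"
    and bd: "\<And>s. s \<in> {0..t} \<Longrightarrow> norm (u' s) \<le> L * norm (u s) + c"
    and "s \<in> {0..t}"
  shows "norm (u s) \<le> 2 * norm (u 0) + 2 * c * t"
proof -
  have cont: "continuous_on {0..t} u" by (rule continuous_on_vector_derivative[OF der])
  obtain s0 where s0: "s0 \<in> {0..t}" "\<And>s. s \<in> {0..t} \<Longrightarrow> norm (u s) \<le> norm (u s0)"
    using continuous_attains_sup[of "{0..t}" "\<lambda>s. norm (u s)"] continuous_on_norm[OF cont] \<open>0 \<le> t\<close>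
    by (metis atLeastAtMost_iff compact_Icc empty_iff order_refl)
  let ?m = "norm (u s0)"
  have "norm (u s0 - u 0) \<le> (L * ?m + c) * s0"
  proof (rule mvt_bound)
    show "continuous_on {0..s0} u" using s0 by (auto intro: continuous_on_subset[OF cont])
    fix s assume s: "0 < s" "s < s0"
    show "(u has_vector_derivative u' s) (at s)"
      by (rule has_vector_derivative_interior[OF der]) (use s s0 in auto)
    have "L * norm (u s) \<le> L * ?m"
      by (rule mult_left_mono[OF s0(2)]) (use s s0 L in auto)
    then show "norm (u' s) \<le> L * ?m + c"
      using bd[of s] s s0 by force
  qed (use s0 in auto)
  also have "\<dots> \<le> (L * ?m + c) * t"
    using s0 L \<open>0 \<le> c\<close> by (intro mult_left_mono) auto
  also have "\<dots> = (L * t) * ?m + c * t" by (simp add: algebra_simps)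
  also have "\<dots> \<le> (1/2) * ?m + c * t" by (intro add_right_mono mult_right_mono L) auto
  finally have "norm (u s0 - u 0) \<le> (1/2) * ?m + c * t" .
  moreover have "?m \<le> norm (u s0 - u 0) + norm (u 0)"
    by (metis diff_add_cancel norm_triangle_ineq)
  ultimately have "?m \<le> 2 * norm (u 0) + 2 * c * t" by simp
  then show ?thesis using s0(2)[OF \<open>s \<in> {0..t}\<close>] by linarith
qed

text \<open>Formulated in a Banach space with a right-hand side depending on time, as it serves both
  the trajectories and the variational equation, whose unknown is a linear map. The bound on
  \<open>M * T\<close> keeps the iterates in the ball, the one on \<open>L * T\<close> makes the
  integral operator a contraction.\<close>

lemma picard_forward:
  fixes F :: "real \<Rightarrow> 'e::banach \<Rightarrow> 'e"
  assumes T: "0 \<le> T" and b: "0 \<le> b"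
    and cont: "continuous_on ({0..T} \<times> cball y0 b) (\<lambda>(s, y). F s y)"
    and lip: "\<And>s y z. s \<in> {0..T} \<Longrightarrow> y \<in> cball y0 b \<Longrightarrow> z \<in> cball y0 b \<Longrightarrow>
                norm (F s y - F s z) \<le> L * norm (y - z)"
    and bnd: "\<And>s y. s \<in> {0..T} \<Longrightarrow> y \<in> cball y0 b \<Longrightarrow> norm (F s y) \<le> M"
    and M: "0 \<le> M" "M * T \<le> b" and L: "0 \<le> L" "L * T \<le> 1/2"
  shows "\<exists>\<phi>. \<phi> 0 = y0 \<and> (\<forall>s\<in>{0..T}. \<phi> s \<in> cball y0 b \<and>
           (\<phi> has_vector_derivative F s (\<phi> s)) (at s within {0..T}))"
proof -
  \<comment> \<open>Clamping the time turns functions on \<open>{0..T}\<close> into bounded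
    continuous functions on the whole line, which form a complete space.\<close>
  define cl where "cl s = max 0 (min T s)" for s :: real
  have cl: "cl s \<in> {0..T}" for s using T by (auto simp: cl_def)
  have cl_id: "s \<in> {0..T} \<Longrightarrow> cl s = s" for s by (auto simp: cl_def)
  have cl_cont: "continuous_on UNIV cl" unfolding cl_def by (intro continuous_intros)
  define K :: "(real \<Rightarrow>\<^sub>C 'e) set" where "K = PiC UNIV (\<lambda>_. cball y0 b)"
  have K: "apply_bcontfun g s \<in> cball y0 b" if "g \<in> K" for g s
    using that by (auto simp: K_def mem_PiC_iff)
  have Fcont: "continuous_on {0..T} (\<lambda>u. F u (apply_bcontfun g u))" if "g \<in> K" for g
  proof -
    have "continuous_on {0..T} (\<lambda>u. (\<lambda>(s, y). F s y) (u, apply_bcontfun g u))"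
      by (rule continuous_on_compose2[OF cont]) (use K[OF that] in \<open>auto intro!: continuous_intros\<close>)
    then show ?thesis by simp
  qed
  define P0 where "P0 g s = y0 + integral {0..cl s} (\<lambda>u. F u (apply_bcontfun g u))" for g s
  have P0_in: "P0 g s \<in> cball y0 b" if "g \<in> K" for g s
  proof -
    have "norm (integral {0..cl s} (\<lambda>u. F u (apply_bcontfun g u))) \<le> M * (cl s - 0)"
      by (rule integral_bound) (use cl[of s] bnd K[OF that] in
          \<open>auto intro!: continuous_on_subset[OF Fcont[OF that]]\<close>)
    also have "\<dots> \<le> M * T" using cl[of s] M by (auto intro: mult_left_mono)
    finally show ?thesis using M by (simp add: P0_def dist_norm norm_minus_commute)
  qed
  have P0_der: "((\<lambda>u. integral {0..u} (\<lambda>u. F u (apply_bcontfun g u))) has_vector_derivative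
      F s (apply_bcontfun g s)) (at s within {0..T})" if "g \<in> K" "s \<in> {0..T}" for g s
    by (rule integral_has_vector_derivative[OF Fcont[OF that(1)] that(2)])
  have P0_cont: "continuous_on UNIV (P0 g)" if "g \<in> K" for g
  proof -
    have "continuous_on {0..T} (\<lambda>u. integral {0..u} (\<lambda>u. F u (apply_bcontfun g u)))"
      by (rule continuous_on_vector_derivative[OF P0_der[OF that]])
    then have "continuous_on UNIV (\<lambda>s. integral {0..cl s} (\<lambda>u. F u (apply_bcontfun g u)))"
      by (rule continuous_on_compose2[OF _ cl_cont]) (use cl in auto)
    then show ?thesis unfolding P0_def by (intro continuous_intros)
  qed
  have P0_bcont: "P0 g \<in> bcontfun" if "g \<in> K" for g
    using P0_cont[OF that] P0_in[OF that]
    by (auto simp: bcontfun_def intro!: bounded_subset[OF bounded_cball[of y0 b]])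
  define P where "P g = Bcontfun (P0 g)" for g
  have P: "apply_bcontfun (P g) = P0 g" if "g \<in> K" for g
    using P0_bcont[OF that] by (simp add: P_def Bcontfun_inverse)
  have "\<exists>!g\<in>K. P g = g"
  proof (rule Banach_fix[where c = "1/2"])
    show "complete K" unfolding K_def
      by (intro closed_PiC[THEN complete_eq_closed[THEN iffD2]]) auto
    have "const_bcontfun y0 \<in> K"
      using b by (auto simp: K_def mem_PiC_iff const_bcontfun.rep_eq)
    then show "K \<noteq> {}" by blast
    show "P ` K \<subseteq> K" using P P0_in by (auto simp: K_def mem_PiC_iff)
    show "dist (P g) (P h) \<le> 1/2 * dist g h" if "g \<in> K" "h \<in> K" for g h
    proof (rule dist_bound)
      fix s
      have ig: "(\<lambda>u. F u (apply_bcontfun g' u)) integrable_on {0..cl s}" if "g' \<in> K" for g'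
        using cl[of s] by (intro integrable_continuous_real continuous_on_subset[OF Fcont[OF that]]) auto
      have "dist (apply_bcontfun (P g) s) (apply_bcontfun (P h) s) =
          norm (integral {0..cl s} (\<lambda>u. F u (apply_bcontfun g u) - F u (apply_bcontfun h u)))"
        using that ig by (simp add: P P0_def dist_norm integral_diff)
      also have "\<dots> \<le> (L * dist g h) * (cl s - 0)"
      proof (rule integral_bound)
        fix t assume t: "t \<in> {0..cl s}"
        have "norm (F t (apply_bcontfun g t) - F t (apply_bcontfun h t))
            \<le> L * dist (apply_bcontfun g t) (apply_bcontfun h t)"
          using lip[of t "apply_bcontfun g t" "apply_bcontfun h t"] that K t cl[of s]
          by (auto simp: dist_norm)
        also have "\<dots> \<le> L * dist g h" by (intro mult_left_mono dist_bounded L)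
        finally show "norm (F t (apply_bcontfun g t) - F t (apply_bcontfun h t)) \<le> L * dist g h" .
      qed (use cl[of s] that in \<open>auto intro!: continuous_intros continuous_on_subset[OF Fcont]\<close>)
      also have "\<dots> \<le> (L * dist g h) * T" using cl[of s] L by (intro mult_left_mono) auto
      also have "\<dots> = (L * T) * dist g h" by simp
      also have "\<dots> \<le> 1/2 * dist g h" using L by (intro mult_right_mono) auto
      finally show "dist (apply_bcontfun (P g) s) (apply_bcontfun (P h) s) \<le> 1/2 * dist g h" .
    qed
  qed auto
  then obtain g where g: "g \<in> K" "P g = g" by blast
  have geq: "apply_bcontfun g s = y0 + integral {0..cl s} (\<lambda>u. F u (apply_bcontfun g u))" for s
    using P[OF g(1)] g(2) by (metis P0_def)
  have "apply_bcontfun g 0 = y0" using geq[of 0] T by (simp add: cl_def)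
  moreover have "(apply_bcontfun g has_vector_derivative F s (apply_bcontfun g s)) (at s within {0..T})"
    if s: "s \<in> {0..T}" for s
  proof -
    have "((\<lambda>s. y0 + integral {0..s} (\<lambda>u. F u (apply_bcontfun g u))) has_vector_derivative
        0 + F s (apply_bcontfun g s)) (at s within {0..T})"
      by (intro has_vector_derivative_add has_vector_derivative_const P0_der g s)
    then have "((\<lambda>s. y0 + integral {0..s} (\<lambda>u. F u (apply_bcontfun g u))) has_vector_derivative
        F s (apply_bcontfun g s)) (at s within {0..T})" by simp
    then show ?thesis
    proof (rule has_vector_derivative_transform[OF s, rotated])
      show "apply_bcontfun g t = y0 + integral {0..t} (\<lambda>u. F u (apply_bcontfun g u))"
        if "t \<in> {0..T}" for t using geq[of t] unfolding cl_id[OF that] .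
    qed
  qed
  ultimately show ?thesis using K[OF g(1)] by blast
qed


section \<open>Existence, uniqueness and differentiability of the flow near a set\<close>

lemma lipschitz_segment:
  fixes V :: "'a::real_normed_vector \<Rightarrow> 'b::real_normed_vector"
  assumes "convex C" "\<And>x. x \<in> C \<Longrightarrow> (V has_derivative V' x) (at x)"
    and "\<And>x. x \<in> C \<Longrightarrow> onorm (V' x) \<le> L" and "x \<in> C" "y \<in> C"
  shows "norm (V x - V y) \<le> L * norm (x - y)"
  by (rule differentiable_bound[where f' = V' and S = C])
     (use assms in \<open>auto intro: has_derivative_at_withinI\<close>)

text \<open>Only forward time occurs: a backward flow is treated later as the forward flow of the
  opposite field.\<close>

definition solves :: "'a::real_normed_vector set \<Rightarrow> ('a \<Rightarrow> 'a) \<Rightarrow> 'a \<Rightarrow> real \<Rightarrow> (real \<Rightarrow> 'a) \<Rightarrow> bool" where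
  "solves \<Omega> V x t \<phi> \<longleftrightarrow> \<phi> 0 = x \<and>
     (\<forall>\<tau>\<in>{0..t}. \<phi> \<tau> \<in> \<Omega> \<and> (\<phi> has_vector_derivative V (\<phi> \<tau>)) (at \<tau> within {0..t}))"

lemma exp_rel_solves:
  "0 \<le> t \<Longrightarrow> (x, y) \<in> exp_rel \<Omega> V t \<longleftrightarrow> (\<exists>\<phi>. solves \<Omega> V x t \<phi> \<and> \<phi> t = y)"
  by (auto simp: exp_rel_def solves_def closed_segment_eq_real_ivl)

lemma solves_subinterval:
  "solves \<Omega> V x t \<phi> \<Longrightarrow> s \<le> t \<Longrightarrow> solves \<Omega> V x s \<phi>"
  unfolding solves_def by (auto intro: has_vector_derivative_within_subset[where S = "{0..t}"])

text \<open>The flow, with an arbitrary value where it is undefined or not unique.\<close>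

definition flow :: "'a::real_normed_vector set \<Rightarrow> ('a \<Rightarrow> 'a) \<Rightarrow> real \<Rightarrow> 'a \<Rightarrow> 'a" where
  "flow \<Omega> V t x = (THE y. (x, y) \<in> exp_rel \<Omega> V t)"

text \<open>Trajectories start in \<open>S\<close> and move by at most \<open>b\<close>; one that
  starts within \<open>b\<close> of x stays within \<open>2 * b\<close> of x, which leaves room for
  the segments between two of them in the ball of radius \<open>3 * b\<close>. The speed is bounded
  on all of \<Omega>, so that every solution in \<Omega> is confined, and uniqueness holds among all
  of them.\<close>

locale flow_box =
  fixes \<Omega> G S :: "'a::euclidean_space set" and V :: "'a \<Rightarrow> 'a" and V' :: "'a \<Rightarrow> 'a \<Rightarrow>\<^sub>L 'a"
    and T b M L :: real
  assumes GO: "G \<subseteq> \<Omega>"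
    and speed: "\<And>x. x \<in> \<Omega> \<Longrightarrow> norm (V x) \<le> M"
    and der: "\<And>x. x \<in> G \<Longrightarrow> (V has_derivative blinfun_apply (V' x)) (at x)"
    and V'_uc: "uniformly_continuous_on G V'"
    and V'_bd: "\<And>x. x \<in> G \<Longrightarrow> norm (V' x) \<le> L"
    and room: "\<And>x. x \<in> S \<Longrightarrow> cball x (3 * b) \<subseteq> G"
    and open_S: "open S"
    and pos: "0 < T" "0 < b" "0 \<le> M" "0 \<le> L"
    and short: "M * T \<le> b" "L * T \<le> 1/2"
begin

lemma V_lip:
  assumes "x \<in> S" "y \<in> cball x (3 * b)" "z \<in> cball x (3 * b)"
  shows "norm (V y - V z) \<le> L * norm (y - z)"
  by (rule lipschitz_segment[where C = "cball x (3 * b)" and V' = "\<lambda>x. blinfun_apply (V' x)"])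
     (use assms room[OF assms(1)] in \<open>auto intro: der V'_bd simp: norm_blinfun.rep_eq[symmetric]\<close>)

lemma V_cont: "continuous_on G V"
  using der has_derivative_continuous continuous_at_imp_continuous_on by blast

lemma solves_displacement:
  assumes "solves \<Omega> V x t \<phi>" "0 \<le> s" "s \<le> t"
  shows "norm (\<phi> s - x) \<le> M * s"
proof -
  have "norm (\<phi> s - \<phi> 0) \<le> M * s"
  proof (rule mvt_bound)
    show "continuous_on {0..s} \<phi>"
      by (rule continuous_on_vector_derivative)
         (use solves_subinterval[OF assms(1,3)] in \<open>auto simp: solves_def\<close>)
    fix \<tau> assume "0 < \<tau>" "\<tau> < s"
    then show "(\<phi> has_vector_derivative V (\<phi> \<tau>)) (at \<tau>)" "norm (V (\<phi> \<tau>)) \<le> M"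
      using assms by (auto simp: solves_def intro!: has_vector_derivative_interior[where t = t] speed)
  qed (use assms in auto)
  then show ?thesis using assms by (simp add: solves_def)
qed

lemma displacement_le: "s \<le> T \<Longrightarrow> M * s \<le> b"
  using short pos by (meson mult_left_mono order_trans)

text \<open>Gronwall bounds the distance of the trajectories. Inserted into the equation for their
  difference, this bounds the difference of the displacements with an extra factor t: the flow minus
  the identity has a small Lipschitz constant, on which the later estimates rest.\<close>

lemma solves_compare:
  assumes x: "x \<in> S" and xy: "norm (x - y) \<le> b" and t: "0 \<le> t" "t \<le> T"
    and \<phi>: "solves \<Omega> V x t \<phi>" and \<psi>: "solves \<Omega> V y t \<psi>"
  shows "norm (\<phi> t - \<psi> t) \<le> 2 * norm (x - y)"
    and "norm ((\<phi> t - x) - (\<psi> t - y)) \<le> 2 * L * t * norm (x - y)"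
proof -
  have in\<phi>: "\<phi> s \<in> cball x (3 * b)" "\<psi> s \<in> cball x (3 * b)" if "s \<in> {0..t}" for s
  proof -
    have "norm (\<phi> s - x) \<le> b" "norm (\<psi> s - y) \<le> b"
      using solves_displacement[OF \<phi>, of s] solves_displacement[OF \<psi>, of s] that t displacement_le[of s]
      by auto
    moreover have "norm (x - \<psi> s) \<le> norm (x - y) + norm (\<psi> s - y)"
      by norm
    ultimately show "\<phi> s \<in> cball x (3 * b)" "\<psi> s \<in> cball x (3 * b)"
      using xy pos by (auto simp: dist_norm norm_minus_commute)
  qed
  define u where "u s = \<phi> s - \<psi> s" for s
  have u: "(u has_vector_derivative V (\<phi> s) - V (\<psi> s)) (at s within {0..t})" if "s \<in> {0..t}" for s
    unfolding u_def using \<phi> \<psi> that by (intro has_vector_derivative_diff) (auto simp: solves_def)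
  have bd: "norm (V (\<phi> s) - V (\<psi> s)) \<le> L * norm (u s)" if "s \<in> {0..t}" for s
    using V_lip[OF x in\<phi>[OF that]] by (simp add: u_def)
  have Lt: "L * t \<le> 1/2" using short t pos by (meson mult_left_mono order_trans)
  have u0: "u 0 = x - y" using \<phi> \<psi> by (simp add: u_def solves_def)
  have le: "norm (u s) \<le> 2 * norm (x - y)" if "s \<in> {0..t}" for s
    using short_gronwall[of t 0 L u "\<lambda>s. V (\<phi> s) - V (\<psi> s)" s] u bd that t Lt pos u0 by auto
  then show "norm (\<phi> t - \<psi> t) \<le> 2 * norm (x - y)" using t by (auto simp: u_def)
  have "norm (u t - u 0) \<le> (2 * L * norm (x - y)) * t"
  proof (rule mvt_bound)
    show "continuous_on {0..t} u" by (rule continuous_on_vector_derivative[OF u])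
    fix s assume s: "0 < s" "s < t"
    show "(u has_vector_derivative V (\<phi> s) - V (\<psi> s)) (at s)"
      by (rule has_vector_derivative_interior[OF u s]) (use s in auto)
    have "norm (V (\<phi> s) - V (\<psi> s)) \<le> L * norm (u s)" using bd s by simp
    also have "\<dots> \<le> L * (2 * norm (x - y))" using le s pos by (intro mult_left_mono) auto
    finally show "norm (V (\<phi> s) - V (\<psi> s)) \<le> 2 * L * norm (x - y)" by simp
  qed (use t in auto)
  then show "norm ((\<phi> t - x) - (\<psi> t - y)) \<le> 2 * L * t * norm (x - y)"
    by (simp add: u_def u0[unfolded u_def] algebra_simps)
qed

lemma exists_solves: "x \<in> S \<Longrightarrow> \<exists>\<phi>. solves \<Omega> V x T \<phi>"
proof -
  assume x: "x \<in> S"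
  have cb: "cball x b \<subseteq> cball x (3 * b)" using pos by auto
  have "\<exists>\<phi>. \<phi> 0 = x \<and> (\<forall>s\<in>{0..T}. \<phi> s \<in> cball x b \<and>
           (\<phi> has_vector_derivative V (\<phi> s)) (at s within {0..T}))"
  proof (rule picard_forward)
    have "continuous_on ({0..T} \<times> cball x b) (\<lambda>p. V (snd p))"
      by (rule continuous_on_compose2[OF V_cont]) (use room[OF x] cb in \<open>auto intro!: continuous_intros\<close>)
    then show "continuous_on ({0..T} \<times> cball x b) (\<lambda>(s, y). V y)"
      by (simp add: case_prod_beta')
    show "norm (V y) \<le> M" if "y \<in> cball x b" for y
      by (rule speed) (use that cb room[OF x] GO in blast)
  qed (use V_lip[OF x] cb pos short in auto)
  then show ?thesis using cb room[OF x] GO by (force simp: solves_def)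
qed

lemma flow_unique:
  assumes "x \<in> S" "0 \<le> t" "t \<le> T" "solves \<Omega> V x t \<phi>"
  shows "flow \<Omega> V t x = \<phi> t"
  unfolding flow_def
proof (rule the_equality)
  show "(x, \<phi> t) \<in> exp_rel \<Omega> V t" using assms(4) unfolding exp_rel_solves[OF assms(2)] by auto
  show "y = \<phi> t" if xy: "(x, y) \<in> exp_rel \<Omega> V t" for y
  proof -
    obtain \<psi> where \<psi>: "solves \<Omega> V x t \<psi>" "\<psi> t = y" using xy unfolding exp_rel_solves[OF assms(2)] by auto
    have "norm (\<phi> t - \<psi> t) \<le> 2 * norm (x - x)"
      by (rule solves_compare(1)) (use assms \<psi> pos in auto)
    then show ?thesis using \<psi> by simp
  qed
qed

lemma exp_rel_flow:
  assumes "x \<in> S" "0 \<le> t" "t \<le> T"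
  shows "(x, y) \<in> exp_rel \<Omega> V t \<longleftrightarrow> y = flow \<Omega> V t x"
  using assms exp_rel_solves[of t x y] flow_unique[OF assms] exists_solves[OF assms(1)]
    solves_subinterval[OF _ assms(3)] by metis

lemma flow_solves:
  assumes "x \<in> S"
  shows "solves \<Omega> V x T (\<lambda>t. flow \<Omega> V t x)"
proof -
  obtain \<phi> where \<phi>: "solves \<Omega> V x T \<phi>" using exists_solves[OF assms] by blast
  have eq: "flow \<Omega> V t x = \<phi> t" if "t \<in> {0..T}" for t
    using flow_unique[OF assms, of t] solves_subinterval[OF \<phi>, of t] that by auto
  show ?thesis unfolding solves_def
  proof (intro conjI ballI)
    show "flow \<Omega> V 0 x = x" using eq[of 0] \<phi> pos by (auto simp: solves_def)
    fix t assume t: "t \<in> {0..T}"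
    then show "flow \<Omega> V t x \<in> \<Omega>" using eq[OF t] \<phi> by (auto simp: solves_def)
    have "(\<phi> has_vector_derivative V (flow \<Omega> V t x)) (at t within {0..T})"
      using \<phi> t eq[OF t] by (auto simp: solves_def)
    then show "((\<lambda>t. flow \<Omega> V t x) has_vector_derivative V (flow \<Omega> V t x)) (at t within {0..T})"
      by (rule has_vector_derivative_transform[OF t, rotated]) (use eq in simp)
  qed
qed

lemma flow_0: "x \<in> S \<Longrightarrow> flow \<Omega> V 0 x = x"
  using flow_solves by (auto simp: solves_def)

lemma flow_near: "x \<in> S \<Longrightarrow> 0 \<le> t \<Longrightarrow> t \<le> T \<Longrightarrow> norm (flow \<Omega> V t x - x) \<le> M * t"
  using solves_displacement[OF flow_solves] by blast

lemma flow_in: "x \<in> S \<Longrightarrow> 0 \<le> t \<Longrightarrow> t \<le> T \<Longrightarrow> flow \<Omega> V t x \<in> cball x b"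
  using flow_near[of x t] displacement_le[of t] by (auto simp: dist_norm norm_minus_commute)

lemma flow_in_G: "x \<in> S \<Longrightarrow> 0 \<le> t \<Longrightarrow> t \<le> T \<Longrightarrow> flow \<Omega> V t x \<in> G"
  using flow_in[of x t] room[of x] pos by auto

lemma flow_lip:
  assumes "x \<in> S" "y \<in> S" "norm (x - y) \<le> b" "0 \<le> t" "t \<le> T"
  shows "norm (flow \<Omega> V t x - flow \<Omega> V t y) \<le> 2 * norm (x - y)"
    and "norm ((flow \<Omega> V t x - x) - (flow \<Omega> V t y - y)) \<le> 2 * L * t * norm (x - y)"
  using solves_compare[OF assms(1,3,4,5) solves_subinterval[OF flow_solves[OF assms(1)] assms(5)]
      solves_subinterval[OF flow_solves[OF assms(2)] assms(5)]] by auto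

lemma flow_vector_derivative:
  "x \<in> S \<Longrightarrow> t \<in> {0..T} \<Longrightarrow>
    ((\<lambda>t. flow \<Omega> V t x) has_vector_derivative V (flow \<Omega> V t x)) (at t within {0..T})"
  using flow_solves[of x] by (auto simp: solves_def)

lemma flow_cont_time: "x \<in> S \<Longrightarrow> continuous_on {0..T} (\<lambda>t. flow \<Omega> V t x)"
  by (rule continuous_on_vector_derivative[OF flow_vector_derivative])

text \<open>The derivative of the flow in the initial point, as a solution of the variational equation.\<close>

definition jac :: "'a \<Rightarrow> real \<Rightarrow> 'a \<Rightarrow>\<^sub>L 'a" where
  "jac x = (SOME J. J 0 = id_blinfun \<and> (\<forall>s\<in>{0..T}. norm (J s) \<le> 2 \<and>
      (J has_vector_derivative (V' (flow \<Omega> V s x) o\<^sub>L J s)) (at s within {0..T})))"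

lemma jac:
  assumes x: "x \<in> S"
  shows jac_0: "jac x 0 = id_blinfun"
    and jac_bound: "\<And>s. s \<in> {0..T} \<Longrightarrow> norm (jac x s) \<le> 2"
    and jac_der: "\<And>s. s \<in> {0..T} \<Longrightarrow>
      (jac x has_vector_derivative (V' (flow \<Omega> V s x) o\<^sub>L jac x s)) (at s within {0..T})"
proof -
  define A where "A s = V' (flow \<Omega> V s x)" for s
  have A_cont: "continuous_on {0..T} A"
    unfolding A_def
    by (rule continuous_on_compose2[OF uniformly_continuous_imp_continuous[OF V'_uc] flow_cont_time[OF x]])
       (use flow_in_G[OF x] in auto)
  have A_bd: "norm (A s) \<le> L" if "s \<in> {0..T}" for s
    unfolding A_def using flow_in_G[OF x, of s] that by (intro V'_bd) auto
  have id1: "norm (id_blinfun :: 'a \<Rightarrow>\<^sub>L 'a) = 1" by simp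
  have le2: "norm Y \<le> 2" if "Y \<in> cball (id_blinfun :: 'a \<Rightarrow>\<^sub>L 'a) 1" for Y
  proof -
    have "norm Y \<le> norm (id_blinfun :: 'a \<Rightarrow>\<^sub>L 'a) + norm (id_blinfun - Y)" by norm
    then show ?thesis using that id1 by (simp add: dist_norm)
  qed
  have "\<exists>J. J 0 = id_blinfun \<and> (\<forall>s\<in>{0..T}. J s \<in> cball id_blinfun 1 \<and>
      (J has_vector_derivative (A s o\<^sub>L J s)) (at s within {0..T}))"
  \<comment> \<open>On the unit ball about the identity the right-hand side is at most
    \<open>2 * L\<close>, and \<open>2 * L * T\<close> is at most 1, the radius of that
    ball.\<close>
  proof (rule picard_forward[where M = "2 * L" and L = L])
    have "continuous_on ({0..T} \<times> cball id_blinfun 1) (\<lambda>p. A (fst p) o\<^sub>L (snd p :: 'a \<Rightarrow>\<^sub>L 'a))"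
      by (intro bounded_bilinear.continuous_on[OF bounded_bilinear_blinfun_compose]
           continuous_on_compose2[OF A_cont] continuous_intros) auto
    then show "continuous_on ({0..T} \<times> cball id_blinfun 1) (\<lambda>(s, y). A s o\<^sub>L (y :: 'a \<Rightarrow>\<^sub>L 'a))"
      by (simp add: case_prod_beta')
    fix s and y z :: "'a \<Rightarrow>\<^sub>L 'a" assume s: "s \<in> {0..T}" and y: "y \<in> cball id_blinfun 1"
    have "(A s o\<^sub>L y) - (A s o\<^sub>L z) = A s o\<^sub>L (y - z)"
      by (rule blinfun_eqI) (simp add: blinfun.bilinear_simps)
    also have "norm \<dots> \<le> norm (A s) * norm (y - z)" by (rule norm_blinfun_compose)
    also have "\<dots> \<le> L * norm (y - z)" using A_bd[OF s] by (intro mult_right_mono) auto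
    finally show "norm ((A s o\<^sub>L y) - (A s o\<^sub>L z)) \<le> L * norm (y - z)" .
    have "norm (A s o\<^sub>L y) \<le> norm (A s) * norm y" by (rule norm_blinfun_compose)
    also have "\<dots> \<le> L * 2" using A_bd[OF s] le2[OF y] pos by (intro mult_mono) auto
    finally show "norm (A s o\<^sub>L y) \<le> 2 * L" by simp
  qed (use pos short in auto)
  then have "\<exists>J. J 0 = id_blinfun \<and> (\<forall>s\<in>{0..T}. norm (J s) \<le> 2 \<and>
      (J has_vector_derivative (V' (flow \<Omega> V s x) o\<^sub>L J s)) (at s within {0..T}))"
    using le2 unfolding A_def by blast
  from someI_ex[OF this] show "jac x 0 = id_blinfun"
    "\<And>s. s \<in> {0..T} \<Longrightarrow> norm (jac x s) \<le> 2"
    "\<And>s. s \<in> {0..T} \<Longrightarrow>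
      (jac x has_vector_derivative (V' (flow \<Omega> V s x) o\<^sub>L jac x s)) (at s within {0..T})"
    by (auto simp: jac_def)
qed

text \<open>The difference of two Jacobians satisfies the variational equation along one trajectory
  up to an error governed by the oscillation of \<open>V'\<close> between the two trajectories. The
  estimate is uniform in time, which turns separate continuity into joint continuity in
  \<open>flow_C1\<close>.\<close>

lemma jac_cont_space:
  assumes "0 < e"
  shows "\<exists>d>0. \<forall>x\<in>S. \<forall>y\<in>S. dist x y < d \<longrightarrow> (\<forall>t\<in>{0..T}. norm (jac x t - jac y t) \<le> e)"
proof -
  \<comment> \<open>Gronwall yields the bound \<open>2 * (2 * e') * T\<close>, which equals
    e.\<close>
  define e' where "e' = e / (4 * T)"
  have "0 < e'" using assms pos by (simp add: e'_def)
  then obtain d where d: "0 < d" "\<And>x y. x \<in> G \<Longrightarrow> y \<in> G \<Longrightarrow> dist x y < d \<Longrightarrow> dist (V' x) (V' y) < e'"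
    using V'_uc unfolding uniformly_continuous_on_def by metis
  show ?thesis
  \<comment> \<open>The flow at most doubles distances, whence \<open>d/2\<close>; the comparison of
    trajectories is available up to distance \<open>b\<close>.\<close>
  proof (intro exI[of _ "min (d/2) b"] conjI ballI impI)
    show "0 < min (d/2) b" using d pos by simp
    fix x y t assume x: "x \<in> S" and y: "y \<in> S" and xy: "dist x y < min (d/2) b" and t: "t \<in> {0..T}"
    define u where "u s = jac x s - jac y s" for s
    define u' where "u' s = (V' (flow \<Omega> V s x) o\<^sub>L jac x s) - (V' (flow \<Omega> V s y) o\<^sub>L jac y s)" for s
    have "norm (u t) \<le> 2 * norm (u 0) + 2 * (2 * e') * T"
    proof (rule short_gronwall)
      fix s assume s: "s \<in> {0..T}"
      show "(u has_vector_derivative u' s) (at s within {0..T})"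
        unfolding u_def u'_def by (intro has_vector_derivative_diff jac_der x y s)
      have f: "flow \<Omega> V s x \<in> G" "flow \<Omega> V s y \<in> G" using flow_in_G x y s by auto
      have "norm (flow \<Omega> V s x - flow \<Omega> V s y) \<le> 2 * norm (x - y)"
        using flow_lip(1)[OF x y, of s] xy s by (auto simp: dist_norm)
      then have "dist (V' (flow \<Omega> V s x)) (V' (flow \<Omega> V s y)) < e'"
        using xy by (intro d(2) f) (auto simp: dist_norm)
      then have le: "norm (V' (flow \<Omega> V s x) - V' (flow \<Omega> V s y)) \<le> e'" by (simp add: dist_norm)
      have "u' s = (V' (flow \<Omega> V s x) o\<^sub>L u s) + ((V' (flow \<Omega> V s x) - V' (flow \<Omega> V s y)) o\<^sub>L jac y s)"
        unfolding u_def u'_def by (rule blinfun_eqI) (simp add: blinfun.bilinear_simps)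
      also have "norm \<dots> \<le> norm (V' (flow \<Omega> V s x)) * norm (u s)
          + norm (V' (flow \<Omega> V s x) - V' (flow \<Omega> V s y)) * norm (jac y s)"
        by (intro norm_triangle_le add_mono norm_blinfun_compose)
      also have "\<dots> \<le> L * norm (u s) + e' * 2"
        using V'_bd[OF f(1)] jac_bound[OF y s] le \<open>0 < e'\<close> pos
        by (intro add_mono mult_mono) auto
      finally show "norm (u' s) \<le> L * norm (u s) + 2 * e'" by simp
    qed (use \<open>0 < e'\<close> pos short t in auto)
    also have "\<dots> = e" using pos by (simp add: u_def jac_0 x y e'_def)
    finally show "norm (jac x t - jac y t) \<le> e" by (simp add: u_def)
  qed
qed

text \<open>The error of linearization satisfies the variational equation up to
  \<open>V q - V p - V' p (q - p)\<close>, where p and q are the moving points. By uniform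
  continuity of \<open>V'\<close> along the segment from p to q this is small compared with the
  initial distance, and Gronwall concludes.\<close>

lemma flow_space_derivative:
  assumes x: "x \<in> S" and t: "t \<in> {0..T}"
  shows "(flow \<Omega> V t has_derivative jac x t) (at x)"
proof (rule has_derivativeI[OF blinfun.bounded_linear_right])
  have "\<forall>\<^sub>F y in at x. norm ((flow \<Omega> V t y - flow \<Omega> V t x - jac x t (y - x)) /\<^sub>R norm (y - x)) \<le> e"
    if e: "0 < e" for e
  proof -
    define e' where "e' = e / (4 * T)"
    have "0 < e'" using e pos by (simp add: e'_def)
    then obtain d where d: "0 < d" "\<And>x y. x \<in> G \<Longrightarrow> y \<in> G \<Longrightarrow> dist x y < d \<Longrightarrow> dist (V' x) (V' y) < e'"
      using V'_uc unfolding uniformly_continuous_on_def by metis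
    have "\<forall>\<^sub>F y in at x. y \<in> S" using open_S x eventually_at_in_open' by blast
    moreover have "\<forall>\<^sub>F y in at x. dist y x < min (d/2) b"
      using d pos by (auto simp: eventually_at intro!: exI[of _ "min (d/2) b"])
    moreover have "\<forall>\<^sub>F y in at x. y \<noteq> x" by (simp add: eventually_at_filter)
    ultimately show ?thesis
    proof eventually_elim
      fix y assume y: "y \<in> S" and yx: "dist y x < min (d/2) b" and ne: "y \<noteq> x"
      define w where "w s = flow \<Omega> V s y - flow \<Omega> V s x - jac x s (y - x)" for s
      define w' where "w' s = V (flow \<Omega> V s y) - V (flow \<Omega> V s x) - (V' (flow \<Omega> V s x) o\<^sub>L jac x s) (y - x)" for s
      have "norm (w t) \<le> 2 * norm (w 0) + 2 * (e' * (2 * norm (y - x))) * T"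
      proof (rule short_gronwall)
        fix s assume s: "s \<in> {0..T}"
        show "(w has_vector_derivative w' s) (at s within {0..T})"
          unfolding w_def w'_def
          by (intro has_vector_derivative_diff flow_vector_derivative x y s
              bounded_linear.has_vector_derivative[OF blinfun.bounded_linear_left] jac_der)
        let ?p = "flow \<Omega> V s x" and ?q = "flow \<Omega> V s y"
        have f: "?p \<in> G" using flow_in_G x s by auto
        have pq: "norm (?q - ?p) \<le> 2 * norm (y - x)"
          using flow_lip(1)[OF y x, of s] yx s by (auto simp: dist_norm)
        have "?p \<in> cball x b" using flow_in[OF x] s by auto
        then have px: "norm (?p - x) \<le> b" by (simp add: dist_norm norm_minus_commute)
        have seg: "closed_segment ?p ?q \<subseteq> ball ?p d \<inter> G"
        proof -
          have "norm (z - ?p) \<le> norm (?q - ?p)" if "z \<in> closed_segment ?p ?q" for z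
            using segment_bound1[OF that] by (simp add: norm_minus_commute)
          moreover have "z \<in> cball x (3 * b)" if "norm (z - ?p) \<le> norm (?q - ?p)" for z
          proof -
            have "norm (z - x) \<le> norm (z - ?p) + norm (?p - x)" by norm
            then show ?thesis using that pq yx px by (auto simp: dist_norm norm_minus_commute)
          qed
          ultimately show ?thesis using room[OF x] pq yx
            by (fastforce simp: dist_norm norm_minus_commute)
        qed
        have "norm (V ?q - V ?p - V' ?p (?q - ?p)) \<le> norm (?q - ?p) * e'"
        proof (rule differentiable_bound_linearization[where S = "ball ?p d \<inter> G"
              and f' = "\<lambda>z. blinfun_apply (V' z)"])
          show "?p + t *\<^sub>R (?q - ?p) \<in> ball ?p d \<inter> G" if "t \<in> {0..1}" for t
          proof -
            have "?p + t *\<^sub>R (?q - ?p) \<in> closed_segment ?p ?q"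
              using that by (auto simp: in_segment algebra_simps intro!: exI[of _ t])
            then show ?thesis using seg by blast
          qed
          show "(V has_derivative blinfun_apply (V' z)) (at z within ball ?p d \<inter> G)" if "z \<in> ball ?p d \<inter> G" for z
            using that by (auto intro: has_derivative_at_withinI der)
          show "onorm (blinfun_apply (V' z) - blinfun_apply (V' ?p)) \<le> e'" if "z \<in> ball ?p d \<inter> G" for z
          proof -
            have "onorm (blinfun_apply (V' z) - blinfun_apply (V' ?p)) = norm (V' z - V' ?p)"
              by (simp add: norm_blinfun.rep_eq minus_blinfun.rep_eq fun_diff_def)
            then show ?thesis using d(2)[of z ?p] that f by (auto simp: dist_norm norm_minus_commute)
          qed
          show "?p \<in> ball ?p d \<inter> G" using d f by auto
        qed
        then have lin: "norm (V ?q - V ?p - V' ?p (?q - ?p)) \<le> e' * (2 * norm (y - x))"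
          using pq \<open>0 < e'\<close> by (smt (verit) mult.commute mult_left_mono)
        have "w' s = V' ?p (w s) + (V ?q - V ?p - V' ?p (?q - ?p))"
          unfolding w_def w'_def by (simp add: blinfun.bilinear_simps)
        also have "norm \<dots> \<le> norm (V' ?p) * norm (w s) + e' * (2 * norm (y - x))"
          by (intro norm_triangle_le add_mono norm_blinfun lin)
        also have "\<dots> \<le> L * norm (w s) + e' * (2 * norm (y - x))"
          using V'_bd[OF f] by (intro add_mono mult_right_mono) auto
        finally show "norm (w' s) \<le> L * norm (w s) + e' * (2 * norm (y - x))" .
      qed (use \<open>0 < e'\<close> pos short t in auto)
      also have "\<dots> = e * norm (y - x)"
        using pos by (simp add: w_def jac_0 flow_0 x y e'_def)
      finally show "norm ((flow \<Omega> V t y - flow \<Omega> V t x - jac x t (y - x)) /\<^sub>R norm (y - x)) \<le> e"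
        using ne by (simp add: w_def divide_simps)
    qed
  qed
  note * = this
  show "((\<lambda>y. (flow \<Omega> V t y - flow \<Omega> V t x - jac x t (y - x)) /\<^sub>R norm (y - x)) \<longlongrightarrow> 0) (at x)"
  proof (rule tendstoI)
    fix e :: real assume "0 < e"
    then show "\<forall>\<^sub>F y in at x.
        dist ((flow \<Omega> V t y - flow \<Omega> V t x - jac x t (y - x)) /\<^sub>R norm (y - x)) 0 < e"
      unfolding dist_norm diff_zero by (intro eventually_mono[OF *[of "e/2"]]) linarith+
  qed
qed

end

section \<open>Maps of class C^1 with operator-valued derivative\<close>

definition C1_on :: "('a::real_normed_vector \<Rightarrow> 'b::real_normed_vector) \<Rightarrow> 'a set \<Rightarrow> bool" where
  "C1_on g S \<longleftrightarrow> (\<exists>g'. (\<forall>z\<in>S. (g has_derivative blinfun_apply (g' z)) (at z)) \<and> continuous_on S g')"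

lemma C1_on_compose:
  assumes "C1_on g S" "C1_on f U" "f ` U \<subseteq> S"
  shows "C1_on (\<lambda>x. g (f x)) U"
proof -
  obtain g' f' where g: "\<And>z. z \<in> S \<Longrightarrow> (g has_derivative blinfun_apply (g' z)) (at z)" "continuous_on S g'"
    and f: "\<And>z. z \<in> U \<Longrightarrow> (f has_derivative blinfun_apply (f' z)) (at z)" "continuous_on U f'"
    using assms unfolding C1_on_def by metis
  have fc: "continuous_on U f"
    using f(1) has_derivative_continuous continuous_at_imp_continuous_on by blast
  show ?thesis unfolding C1_on_def
  proof (intro exI[of _ "\<lambda>x. g' (f x) o\<^sub>L f' x"] conjI ballI)
    show "((\<lambda>x. g (f x)) has_derivative blinfun_apply (g' (f z) o\<^sub>L f' z)) (at z)" if "z \<in> U" for z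
      using has_derivative_compose[OF f(1)[OF that] g(1)] assms(3) that
      by (auto simp: image_subset_iff blinfun_compose.rep_eq o_def)
    show "continuous_on U (\<lambda>x. g' (f x) o\<^sub>L f' x)"
      by (intro bounded_bilinear.continuous_on[OF bounded_bilinear_blinfun_compose] f(2)
           continuous_on_compose2[OF g(2) fc assms(3)])
  qed
qed

lemma C1_on_subset: "C1_on g S \<Longrightarrow> T \<subseteq> S \<Longrightarrow> C1_on g T"
  unfolding C1_on_def by (meson continuous_on_subset subsetD)

lemma C1_on_imp_continuous_on: "C1_on g S \<Longrightarrow> continuous_on S g"
  unfolding C1_on_def by (meson has_derivative_continuous continuous_at_imp_continuous_on)

lemma frechet_eq: "(f has_derivative f') (at x) \<Longrightarrow> frechet_derivative f (at x) = f'"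
  using frechet_derivative_at by metis

definition bd :: "('a::real_normed_vector \<Rightarrow> 'b::real_normed_vector) \<Rightarrow> 'a \<Rightarrow> 'a \<Rightarrow>\<^sub>L 'b" where
  "bd g z = Blinfun (frechet_derivative g (at z))"

lemma bd_eq: "(g has_derivative blinfun_apply D) (at z) \<Longrightarrow> bd g z = D"
  by (simp add: bd_def frechet_eq blinfun_apply_inverse)

lemma C1_on_bd:
  assumes "C1_on g S"
  shows "z \<in> S \<Longrightarrow> (g has_derivative blinfun_apply (bd g z)) (at z)" and "continuous_on S (bd g)"
proof -
  obtain g' where g': "\<And>z. z \<in> S \<Longrightarrow> (g has_derivative blinfun_apply (g' z)) (at z)" "continuous_on S g'"
    using assms unfolding C1_on_def by blast
  have eq: "bd g z = g' z" if "z \<in> S" for z using bd_eq[OF g'(1)[OF that]] .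
  show "(g has_derivative blinfun_apply (bd g z)) (at z)" if "z \<in> S" using g'(1)[OF that] eq[OF that] by simp
  show "continuous_on S (bd g)" by (rule continuous_on_eq[OF g'(2)]) (simp add: eq)
qed

lemma C1_on_bdI:
  assumes "\<And>z. z \<in> S \<Longrightarrow> (g has_derivative blinfun_apply (g' z)) (at z)" "continuous_on S g'"
  shows "C1_on g S"
  using assms unfolding C1_on_def by blast

lemma C1_on_linear: "bounded_linear f \<Longrightarrow> C1_on f U"
  unfolding C1_on_def
  by (intro exI[of _ "\<lambda>_. Blinfun f"])
     (simp add: bounded_linear_Blinfun_apply bounded_linear_imp_has_derivative continuous_on_const)

lemma C1_on_Pair:
  fixes f :: "'a::real_normed_vector \<Rightarrow> 'b::real_normed_vector" and g :: "'a \<Rightarrow> 'c::real_normed_vector"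
  assumes "C1_on f U" "C1_on g U"
  shows "C1_on (\<lambda>z. (f z, g z)) U"
proof -
  have bl: "bounded_linear (\<lambda>x::'b. (x, 0::'c))" "bounded_linear (\<lambda>y::'c. (0::'b, y))"
    by (intro bounded_linear_Pair bounded_linear_zero bounded_linear_ident)+
  define D :: "'a \<Rightarrow> 'a \<Rightarrow>\<^sub>L ('b \<times> 'c)" where
    "D z = (Blinfun (\<lambda>x. (x, 0)) o\<^sub>L bd f z) + (Blinfun (\<lambda>y. (0, y)) o\<^sub>L bd g z)" for z
  show ?thesis
  proof (rule C1_on_bdI)
    show "((\<lambda>z. (f z, g z)) has_derivative blinfun_apply (D z)) (at z)" if "z \<in> U" for z
      by (rule has_derivative_eq_rhs[OF has_derivative_Pair[OF C1_on_bd(1)[OF assms(1) that] C1_on_bd(1)[OF assms(2) that]]])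
         (simp add: D_def fun_eq_iff blinfun.bilinear_simps bounded_linear_Blinfun_apply[OF bl(1)]
            bounded_linear_Blinfun_apply[OF bl(2)])
    show "continuous_on U D" unfolding D_def
      by (intro continuous_intros C1_on_bd(2) assms)
  qed
qed

text \<open>Both partial derivatives, the velocity and \<open>jac\<close>, are jointly continuous:
  continuity in time at a fixed point is combined with estimates in x that are uniform in time. Time
  0 is left out because \<open>C1_on\<close> asks for derivatives in full neighbourhoods; it is
  recovered only for the quasiexponential maps, in \<open>two_sided_C1\<close>.\<close>

lemma (in flow_box) flow_C1: "C1_on (\<lambda>(t, x). flow \<Omega> V t x) ({0<..<T} \<times> S)"
proof -
  have lip: "continuous_on (({0..T}) \<times> S) (\<lambda>(t, x). flow \<Omega> V t x)"
    unfolding continuous_on_iff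
  proof (intro ballI allI impI)
    fix z e assume z: "z \<in> {0..T} \<times> S" and e: "0 < (e::real)"
    obtain t x where z_eq: "z = (t, x)" by force
    have t: "t \<in> {0..T}" and x: "x \<in> S" using z z_eq by auto
    from flow_cont_time[OF x] t obtain d where d: "0 < d"
      "\<And>s. s \<in> {0..T} \<Longrightarrow> dist s t < d \<Longrightarrow> dist (flow \<Omega> V s x) (flow \<Omega> V t x) < e/2"
      unfolding continuous_on_iff using e half_gt_zero by metis
    show "\<exists>d>0. \<forall>x'\<in>{0..T} \<times> S. dist x' z < d \<longrightarrow>
        dist (case x' of (t, x) \<Rightarrow> flow \<Omega> V t x) (case z of (t, x) \<Rightarrow> flow \<Omega> V t x) < e"
    proof (intro exI[of _ "min d (min b (e/4))"] conjI ballI impI)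
      show "0 < min d (min b (e/4))" using d e pos by auto
      fix z' assume z': "z' \<in> {0..T} \<times> S" and dz: "dist z' z < min d (min b (e/4))"
      obtain s y where z'_eq: "z' = (s, y)" by force
      have "dist s t \<le> dist z' z" "dist y x \<le> dist z' z"
        using dist_fst_le[of z' z] dist_snd_le[of z' z] by (auto simp: z_eq z'_eq)
      then have ds: "dist s t < d" "dist y x < b" "dist y x < e/4" using dz by auto
      have "dist (flow \<Omega> V s y) (flow \<Omega> V t x) \<le> dist (flow \<Omega> V s y) (flow \<Omega> V s x) + dist (flow \<Omega> V s x) (flow \<Omega> V t x)"
        by (rule dist_triangle)
      moreover have "dist (flow \<Omega> V s y) (flow \<Omega> V s x) \<le> 2 * dist y x"
        using flow_lip(1)[of y x s] z' z'_eq x ds by (auto simp: dist_norm)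
      moreover have "dist (flow \<Omega> V s x) (flow \<Omega> V t x) < e/2" using d(2)[of s] z' z'_eq ds by auto
      ultimately show "dist (case z' of (t, x) \<Rightarrow> flow \<Omega> V t x) (case z of (t, x) \<Rightarrow> flow \<Omega> V t x) < e"
        using ds by (simp add: z_eq z'_eq)
    qed
  qed
  have jac_cont: "continuous_on ({0..T} \<times> S) (\<lambda>(t, x). jac x t)"
    unfolding continuous_on_iff
  proof (intro ballI allI impI)
    fix z e assume z: "z \<in> {0..T} \<times> S" and e: "0 < (e::real)"
    obtain t x where z_eq: "z = (t, x)" by force
    have t: "t \<in> {0..T}" and x: "x \<in> S" using z z_eq by auto
    have "continuous_on {0..T} (jac x)" by (rule continuous_on_vector_derivative[OF jac_der[OF x]])
    then obtain d where d: "0 < d"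
      "\<And>s. s \<in> {0..T} \<Longrightarrow> dist s t < d \<Longrightarrow> dist (jac x s) (jac x t) < e/2"
      unfolding continuous_on_iff using e t half_gt_zero by metis
    obtain d' where d': "0 < d'" "\<And>y x s. x \<in> S \<Longrightarrow> y \<in> S \<Longrightarrow> dist x y < d' \<Longrightarrow> s \<in> {0..T} \<Longrightarrow> norm (jac x s - jac y s) \<le> e/2"
      using jac_cont_space[of "e/2"] e by force
    show "\<exists>d>0. \<forall>x'\<in>{0..T} \<times> S. dist x' z < d \<longrightarrow>
        dist (case x' of (t, x) \<Rightarrow> jac x t) (case z of (t, x) \<Rightarrow> jac x t) < e"
    proof (intro exI[of _ "min d d'"] conjI ballI impI)
      show "0 < min d d'" using d d' by auto
      fix z' assume z': "z' \<in> {0..T} \<times> S" and dz: "dist z' z < min d d'"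
      obtain s y where z'_eq: "z' = (s, y)" by force
      have "dist s t \<le> dist z' z" "dist y x \<le> dist z' z"
        using dist_fst_le[of z' z] dist_snd_le[of z' z] by (auto simp: z_eq z'_eq)
      then have ds: "dist s t < d" "dist y x < d'" using dz by auto
      have "dist (jac y s) (jac x t) \<le> dist (jac y s) (jac x s) + dist (jac x s) (jac x t)"
        by (rule dist_triangle)
      moreover have "dist (jac y s) (jac x s) \<le> e/2"
        using d'(2)[of y x s] z' z'_eq x ds by (auto simp: dist_norm)
      moreover have "dist (jac x s) (jac x t) < e/2" using d(2)[of s] z' z'_eq ds by auto
      ultimately show "dist (case z' of (t, x) \<Rightarrow> jac x t) (case z of (t, x) \<Rightarrow> jac x t) < e"
        by (simp add: z_eq z'_eq)
    qed
  qed
  let ?U = "{0<..<T} \<times> S"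
  have U: "?U \<subseteq> {0..T} \<times> S" "open ?U" using open_S by (auto intro: open_Times)
  define D where "D = (\<lambda>z. (blinfun_scaleR_left (V (flow \<Omega> V (fst z) (snd z))) o\<^sub>L fst_blinfun)
      + (jac (snd z) (fst z) o\<^sub>L snd_blinfun) :: (real \<times> 'a) \<Rightarrow>\<^sub>L 'a)"
  show ?thesis unfolding C1_on_def
  proof (intro exI[of _ D] conjI ballI)
    have fc: "continuous_on ?U (\<lambda>z. flow \<Omega> V (fst z) (snd z))"
      using continuous_on_subset[OF lip U(1)] by (simp add: case_prod_beta')
    have jc: "continuous_on ?U (\<lambda>z. jac (snd z) (fst z))"
      using continuous_on_subset[OF jac_cont U(1)] by (simp add: case_prod_beta')
    have Vc: "continuous_on ?U (\<lambda>z. V (flow \<Omega> V (fst z) (snd z)))"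
      by (rule continuous_on_compose2[OF V_cont fc]) (auto intro: flow_in_G)
    show "continuous_on ?U D"
      unfolding D_def
      by (intro continuous_on_add bounded_bilinear.continuous_on[OF bounded_bilinear_blinfun_compose]
          continuous_on_const jc bounded_linear.continuous_on[OF bounded_linear_blinfun_scaleR_left] Vc)
    fix z assume z: "z \<in> ?U"
    obtain t x where z_eq: "z = (t, x)" by force
    have tx: "0 < t" "t < T" "x \<in> S" using z z_eq by auto
    obtain r where r: "0 < r" "ball x r \<subseteq> S" using open_S tx open_contains_ball by metis
    have "((\<lambda>(t, x). flow \<Omega> V t x) has_derivative (\<lambda>(ds, dx). ds *\<^sub>R V (flow \<Omega> V t x) + jac x t dx))
        (at (t, x) within {0<..<T} \<times> ball x r)"
    \<comment> \<open>Joint differentiability follows from the derivative in t at the given point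
      and the jointly continuous derivative in x.\<close>
    proof (rule has_derivative_partialsI[where fy = "\<lambda>t x. jac x t"])
      show "((\<lambda>t. flow \<Omega> V t x) has_derivative (\<lambda>ds. ds *\<^sub>R V (flow \<Omega> V t x))) (at t within {0<..<T})"
        using flow_vector_derivative[OF tx(3), of t] tx(1,2)
        unfolding has_vector_derivative_def
        by (auto intro: has_derivative_subset)
      show "(flow \<Omega> V s has_derivative blinfun_apply (jac y s)) (at y within ball x r)"
        if "s \<in> {0<..<T}" "y \<in> ball x r" for s y
        using flow_space_derivative[OF subsetD[OF r(2) that(2)], of s] that by (auto intro: has_derivative_at_withinI)
      have "continuous (at (t, x) within ?U) (\<lambda>(t, x). jac x t)"
        using continuous_on_subset[OF jac_cont U(1)] z z_eq continuous_on_eq_continuous_within by blast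
      then show "continuous (at (t, x) within {0<..<T} \<times> ball x r) (\<lambda>(t, x). jac x t)"
        by (rule continuous_within_subset) (use r in auto)
    qed (use r in auto)
    moreover have "at (t, x) within {0<..<T} \<times> ball x r = at (t, x)"
      by (rule at_within_open) (use tx r in \<open>auto intro: open_Times\<close>)
    moreover have "(\<lambda>(ds, dx). ds *\<^sub>R V (flow \<Omega> V t x) + jac x t dx) = blinfun_apply (D z)"
      by (auto simp: D_def z_eq fun_eq_iff blinfun.bilinear_simps)
    ultimately show "((\<lambda>(t, x). flow \<Omega> V t x) has_derivative blinfun_apply (D z)) (at z)"
      by (simp add: z_eq)
  qed
qed


section \<open>Uniform classes of functions near a set\<close>

definition nb :: "'a::metric_space set \<Rightarrow> real \<Rightarrow> 'a set" where
  "nb S d = (\<Union>y\<in>S. ball y d)"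

lemma nb_mono: "d \<le> e \<Longrightarrow> nb S d \<subseteq> nb S e"
  by (force simp: nb_def)

lemma open_nb: "open (nb S d)"
  by (auto simp: nb_def)

lemma nb_step: "x \<in> nb S d \<Longrightarrow> dist x y \<le> e \<Longrightarrow> y \<in> nb S (d + e)"
  unfolding nb_def by clarsimp (smt (verit) dist_triangle)

lemma ball_subset_nb: "x \<in> nb S d \<Longrightarrow> ball x e \<subseteq> nb S (d + e)"
  using nb_step by (metis mem_ball less_imp_le subsetI)

lemma cball_subset_nb: "x \<in> nb S d \<Longrightarrow> cball x e \<subseteq> nb S (d + e)"
  using nb_step by (metis mem_cball subsetI)

lemma subset_nb: "0 < d \<Longrightarrow> S \<subseteq> nb S d"
  by (auto simp: nb_def)

lemma nb_subset_open:
  fixes S :: "'a::heine_borel set"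
  assumes "compact (closure S)" "open W" "closure S \<subseteq> W"
  shows "\<exists>d>0. nb S d \<subseteq> W"
proof (cases "W = UNIV")
  case False
  have "\<exists>d>0. \<forall>x\<in>closure S. \<forall>y\<in>- W. d \<le> dist x y"
    by (rule separate_compact_closed) (use assms in auto)
  then obtain d where d: "d > 0" "\<And>x y. x \<in> closure S \<Longrightarrow> y \<in> - W \<Longrightarrow> d \<le> dist x y" by blast
  have "nb S d \<subseteq> W"
    unfolding nb_def using d(2) closure_subset[of S] by force
  then show ?thesis using d(1) by blast
qed (auto intro: exI[of _ 1])

locale germs =
  fixes \<Theta> :: "'x set" and S :: "'a::euclidean_space set"
begin

text \<open>One radius serves all members of \<Theta>. This uniformity is what makes the final
  constants depend on the data of the fields only.\<close>

definition near :: "('x \<Rightarrow> 'a \<Rightarrow> bool) \<Rightarrow> bool" where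
  "near P \<longleftrightarrow> (\<exists>d>0. \<forall>X\<in>\<Theta>. \<forall>x\<in>nb S d. P X x)"

lemma near_mono: "near P \<Longrightarrow> (\<And>X x. X \<in> \<Theta> \<Longrightarrow> P X x \<Longrightarrow> Q X x) \<Longrightarrow> near Q"
  unfolding near_def by meson

lemma near_conj: "near P \<Longrightarrow> near Q \<Longrightarrow> near (\<lambda>X x. P X x \<and> Q X x)"
  unfolding near_def
proof (elim exE conjE)
  fix d e :: real assume "0 < d" "0 < e" "\<forall>X\<in>\<Theta>. \<forall>x\<in>nb S d. P X x" "\<forall>X\<in>\<Theta>. \<forall>x\<in>nb S e. Q X x"
  then show "\<exists>d>0. \<forall>X\<in>\<Theta>. \<forall>x\<in>nb S d. P X x \<and> Q X x"
    using nb_mono[of "min d e" d S] nb_mono[of "min d e" e S] by (intro exI[of _ "min d e"]) auto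
qed

text \<open>The neighbourhood of \<open>S\<close> is itself the open set about each of its points;
  thus properties valid near \<open>S\<close> can be used when derivatives at nearby points are
  taken.\<close>

lemma near_ball:
  assumes "near P"
  shows "near (\<lambda>X x. \<exists>W. open W \<and> x \<in> W \<and> (\<forall>y\<in>W. P X y))"
  using assms unfolding near_def by (meson open_nb)

lemma near_ball_Basis:
  assumes "finite B" "\<And>b. b \<in> B \<Longrightarrow> near (P b)"
  shows "near (\<lambda>X x. \<forall>b\<in>B. P b X x)"
  using assms
proof (induction B)
  case empty show ?case by (auto simp: near_def intro: exI[of _ 1])
next
  case (insert b B)
  then have "near (\<lambda>X x. P b X x \<and> (\<forall>b\<in>B. P b X x))" by (intro near_conj) auto
  then show ?case by (rule near_mono) auto
qed

text \<open>The counterpart, uniform over \<Theta>, of continuity near the closure of a bounded set: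
  boundedness and equicontinuity.\<close>

definition UC :: "('x \<Rightarrow> 'a \<Rightarrow> 'b::real_normed_vector) \<Rightarrow> bool" where
  "UC f \<longleftrightarrow> (\<exists>\<rho>>0. (\<exists>B. \<forall>X\<in>\<Theta>. \<forall>x\<in>nb S \<rho>. norm (f X x) \<le> B) \<and>
     (\<forall>e>0. \<exists>d>0. \<forall>X\<in>\<Theta>. \<forall>x\<in>nb S \<rho>. \<forall>y\<in>nb S \<rho>. dist x y < d \<longrightarrow> norm (f X x - f X y) \<le> e))"

text \<open>All smaller radii are included, so that the estimate passes at once to smaller
  neighbourhoods when several of them are intersected.\<close>

abbreviation osc_le :: "real \<Rightarrow> real \<Rightarrow> real \<Rightarrow> ('x \<Rightarrow> 'a \<Rightarrow> 'b::real_normed_vector) \<Rightarrow> bool" where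
  "osc_le \<rho> d e f \<equiv> \<forall>\<rho>'\<le>\<rho>. \<forall>X\<in>\<Theta>. \<forall>x\<in>nb S \<rho>'. \<forall>y\<in>nb S \<rho>'. dist x y < d \<longrightarrow> norm (f X x - f X y) \<le> e"

lemma UC_E:
  assumes "UC f"
  obtains \<rho> B where "0 < \<rho>" "0 \<le> B"
    "\<And>\<rho>' X x. \<rho>' \<le> \<rho> \<Longrightarrow> X \<in> \<Theta> \<Longrightarrow> x \<in> nb S \<rho>' \<Longrightarrow> norm (f X x) \<le> B"
    "\<And>e. 0 < e \<Longrightarrow> \<exists>d>0. osc_le \<rho> d e f"
proof -
  obtain \<rho> B where \<rho>: "0 < \<rho>" and B: "\<forall>X\<in>\<Theta>. \<forall>x\<in>nb S \<rho>. norm (f X x) \<le> B"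
    and u: "\<forall>e>0. \<exists>d>0. \<forall>X\<in>\<Theta>. \<forall>x\<in>nb S \<rho>. \<forall>y\<in>nb S \<rho>. dist x y < d \<longrightarrow> norm (f X x - f X y) \<le> e"
    using assms unfolding UC_def by blast
  show ?thesis
  proof (rule that[of \<rho> "max B 0"])
    fix \<rho>' X x assume "\<rho>' \<le> \<rho>" "X \<in> \<Theta>" "x \<in> nb S \<rho>'"
    then have "x \<in> nb S \<rho>" using nb_mono by blast
    then show "norm (f X x) \<le> max B 0" using B \<open>X \<in> \<Theta>\<close> by fastforce
  next
    fix e :: real assume "0 < e"
    with u obtain d where d: "d > 0"
      "\<forall>X\<in>\<Theta>. \<forall>x\<in>nb S \<rho>. \<forall>y\<in>nb S \<rho>. dist x y < d \<longrightarrow> norm (f X x - f X y) \<le> e" by blast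
    show "\<exists>d>0. osc_le \<rho> d e f"
      using d nb_mono by (intro exI[of _ d]) blast
  qed (use \<rho> in auto)
qed

lemma UC_I:
  assumes "0 < \<rho>" "\<And>X x. X \<in> \<Theta> \<Longrightarrow> x \<in> nb S \<rho> \<Longrightarrow> norm (f X x) \<le> B"
    "\<And>e. 0 < e \<Longrightarrow> \<exists>d>0. \<forall>X\<in>\<Theta>. \<forall>x\<in>nb S \<rho>. \<forall>y\<in>nb S \<rho>. dist x y < d \<longrightarrow> norm (f X x - f X y) \<le> e"
  shows "UC f"
  using assms unfolding UC_def by metis

lemma UC_cong:
  assumes "UC f" "near (\<lambda>X x. f X x = g X x)"
  shows "UC g"
proof -
  from \<open>UC f\<close> obtain \<rho> B where f: "0 < \<rho>"
    "\<And>\<rho>' X x. \<rho>' \<le> \<rho> \<Longrightarrow> X \<in> \<Theta> \<Longrightarrow> x \<in> nb S \<rho>' \<Longrightarrow> norm (f X x) \<le> B"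
    "\<And>e. 0 < e \<Longrightarrow> \<exists>d>0. osc_le \<rho> d e f"
    by (rule UC_E) blast
  from assms(2) obtain d where d: "d > 0" "\<And>X x. X \<in> \<Theta> \<Longrightarrow> x \<in> nb S d \<Longrightarrow> g X x = f X x"
    unfolding near_def by metis
  have sub: "x \<in> nb S (min \<rho> d) \<Longrightarrow> x \<in> nb S d" for x using nb_mono[of "min \<rho> d" d S] by auto
  show ?thesis
  proof (rule UC_I[of "min \<rho> d" _ B])
    fix X x assume "X \<in> \<Theta>" "x \<in> nb S (min \<rho> d)"
    then show "norm (g X x) \<le> B" using d(2)[of X x] sub f(2)[of "min \<rho> d" X x] by simp
  next
    fix e :: real assume "0 < e"
    then obtain d' where d': "d' > 0" "osc_le \<rho> d' e f"
      using f(3) by blast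
    then show "\<exists>d'>0. \<forall>X\<in>\<Theta>. \<forall>x\<in>nb S (min \<rho> d). \<forall>y\<in>nb S (min \<rho> d). dist x y < d' \<longrightarrow> norm (g X x - g X y) \<le> e"
      using d(2) sub by (intro exI[of _ d'] conjI ballI impI) (simp_all add: d' d'(2)[rule_format, of "min \<rho> d"])
  qed (use f d in auto)
qed

lemma UC_const: "UC (\<lambda>_ _. c)"
  by (rule UC_I[of 1 _ "norm c"]) (auto intro: exI[of _ 1])

lemma UC_id:
  assumes "bounded S" shows "UC (\<lambda>_ x. x)"
proof -
  obtain B where B: "\<And>x. x \<in> S \<Longrightarrow> norm x \<le> B" using assms bounded_iff by blast
  show ?thesis
  proof (rule UC_I[of 1 _ "B + 1"])
    show "norm x \<le> B + 1" if "x \<in> nb S 1" for x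
    proof -
      from that obtain y where "y \<in> S" "dist y x < 1" by (auto simp: nb_def)
      moreover have "norm x \<le> norm y + dist y x" unfolding dist_norm by norm
      ultimately show ?thesis using B[of y] by linarith
    qed
    show "\<exists>d>0. \<forall>X\<in>\<Theta>. \<forall>x\<in>nb S 1. \<forall>y\<in>nb S 1. dist x y < d \<longrightarrow> norm (x - y) \<le> e"
      if "0 < e" for e using that by (intro exI[of _ e]) (auto simp: dist_norm)
  qed simp
qed

lemma UC_linear:
  assumes "bounded_linear h" "UC f"
  shows "UC (\<lambda>X x. h (f X x))"
proof -
  interpret h: bounded_linear h by fact
  obtain K where K: "K > 0" "\<And>v. norm (h v) \<le> norm v * K" using h.pos_bounded by blast
  from \<open>UC f\<close> obtain \<rho> B where f: "0 < \<rho>" "0 \<le> B"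
    "\<And>\<rho>' X x. \<rho>' \<le> \<rho> \<Longrightarrow> X \<in> \<Theta> \<Longrightarrow> x \<in> nb S \<rho>' \<Longrightarrow> norm (f X x) \<le> B"
    "\<And>e. 0 < e \<Longrightarrow> \<exists>d>0. osc_le \<rho> d e f"
    by (rule UC_E) blast
  show ?thesis
  proof (rule UC_I[of \<rho> _ "B * K"])
    show "norm (h (f X x)) \<le> B * K" if "X \<in> \<Theta>" "x \<in> nb S \<rho>" for X x
      using K(2)[of "f X x"] f(3)[OF order_refl that] K(1) by (meson mult_right_mono less_imp_le order_trans)
    fix e :: real assume "0 < e"
    then obtain d where d: "d > 0" "\<forall>\<rho>'\<le>\<rho>. \<forall>X\<in>\<Theta>. \<forall>x\<in>nb S \<rho>'. \<forall>y\<in>nb S \<rho>'. dist x y < d \<longrightarrow> norm (f X x - f X y) \<le> e / K"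
      using f(4)[of "e / K"] K by auto
    show "\<exists>d>0. \<forall>X\<in>\<Theta>. \<forall>x\<in>nb S \<rho>. \<forall>y\<in>nb S \<rho>. dist x y < d \<longrightarrow> norm (h (f X x) - h (f X y)) \<le> e"
    proof (intro exI[of _ d] conjI ballI impI)
      fix X x y assume a: "X \<in> \<Theta>" "x \<in> nb S \<rho>" "y \<in> nb S \<rho>" "dist x y < d"
      have "norm (h (f X x) - h (f X y)) \<le> norm (f X x - f X y) * K"
        using K(2)[of "f X x - f X y"] by (simp add: h.diff)
      also have "\<dots> \<le> e / K * K" using d(2) a K(1) by (intro mult_right_mono) auto
      finally show "norm (h (f X x) - h (f X y)) \<le> e" using K by simp
    qed (use d in auto)
  qed (use f in auto)
qed

lemma UC_Pair:
  assumes "UC f" "UC g"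
  shows "UC (\<lambda>X x. (f X x, g X x))"
proof -
  from \<open>UC f\<close> obtain \<rho>1 B1 where f: "0 < \<rho>1" "0 \<le> B1"
    "\<And>\<rho>' X x. \<rho>' \<le> \<rho>1 \<Longrightarrow> X \<in> \<Theta> \<Longrightarrow> x \<in> nb S \<rho>' \<Longrightarrow> norm (f X x) \<le> B1"
    "\<And>e. 0 < e \<Longrightarrow> \<exists>d>0. osc_le \<rho>1 d e f"
    by (rule UC_E) blast
  from \<open>UC g\<close> obtain \<rho>2 B2 where g: "0 < \<rho>2" "0 \<le> B2"
    "\<And>\<rho>' X x. \<rho>' \<le> \<rho>2 \<Longrightarrow> X \<in> \<Theta> \<Longrightarrow> x \<in> nb S \<rho>' \<Longrightarrow> norm (g X x) \<le> B2"
    "\<And>e. 0 < e \<Longrightarrow> \<exists>d>0. osc_le \<rho>2 d e g"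
    by (rule UC_E) blast
  have pn: "norm (a, b) \<le> norm a + norm b" for a :: 'b and b :: 'c
    by (rule norm_Pair_le)
  let ?\<rho> = "min \<rho>1 \<rho>2"
  show ?thesis
  proof (rule UC_I[of ?\<rho> _ "B1 + B2"])
    show "norm (f X x, g X x) \<le> B1 + B2" if "X \<in> \<Theta>" "x \<in> nb S ?\<rho>" for X x
      using f(3)[of ?\<rho> X x] g(3)[of ?\<rho> X x] that pn[of "f X x" "g X x"] by simp
    fix e :: real assume "0 < e"
    then have e2: "0 < e/2" by simp
    obtain d1 where d1: "d1 > 0" "\<forall>\<rho>'\<le>\<rho>1. \<forall>X\<in>\<Theta>. \<forall>x\<in>nb S \<rho>'. \<forall>y\<in>nb S \<rho>'. dist x y < d1 \<longrightarrow> norm (f X x - f X y) \<le> e/2"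
      using f(4)[OF e2] by blast
    obtain d2 where d2: "d2 > 0" "\<forall>\<rho>'\<le>\<rho>2. \<forall>X\<in>\<Theta>. \<forall>x\<in>nb S \<rho>'. \<forall>y\<in>nb S \<rho>'. dist x y < d2 \<longrightarrow> norm (g X x - g X y) \<le> e/2"
      using g(4)[OF e2] by blast
    show "\<exists>d>0. \<forall>X\<in>\<Theta>. \<forall>x\<in>nb S ?\<rho>. \<forall>y\<in>nb S ?\<rho>. dist x y < d \<longrightarrow> norm ((f X x, g X x) - (f X y, g X y)) \<le> e"
    proof (intro exI[of _ "min d1 d2"] conjI ballI impI)
      fix X x y assume a: "X \<in> \<Theta>" "x \<in> nb S ?\<rho>" "y \<in> nb S ?\<rho>" "dist x y < min d1 d2"
      have "norm (f X x - f X y) \<le> e/2" "norm (g X x - g X y) \<le> e/2"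
        using d1(2)[rule_format, of ?\<rho> X x y] d2(2)[rule_format, of ?\<rho> X x y] a by auto
      then show "norm ((f X x, g X x) - (f X y, g X y)) \<le> e"
        using pn[of "f X x - f X y" "g X x - g X y"] by simp
    qed (use d1 d2 in auto)
  qed (use f g in auto)
qed

lemma UC_add: "UC f \<Longrightarrow> UC g \<Longrightarrow> UC (\<lambda>X x. f X x + g X x)"
  using UC_linear[OF bounded_linear_add[OF bounded_linear_fst bounded_linear_snd] UC_Pair[of f g]] by simp

lemma UC_sum: "(\<And>i. i \<in> I \<Longrightarrow> UC (f i)) \<Longrightarrow> UC (\<lambda>X x. \<Sum>i\<in>I. f i X x)"
proof (induction I rule: infinite_finite_induct)
  case (insert i I) then show ?case by (simp add: UC_add)
qed (simp_all add: UC_const)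

lemma UC_prod:
  assumes "bounded_bilinear pr" "UC f" "UC g"
  shows "UC (\<lambda>X x. pr (f X x) (g X x))"
proof -
  interpret bounded_bilinear pr by fact
  obtain K where K: "K > 0" "\<And>a b. norm (pr a b) \<le> norm a * norm b * K" using pos_bounded by blast
  from \<open>UC f\<close> obtain \<rho>1 B1 where f: "0 < \<rho>1" "0 \<le> B1"
    "\<And>\<rho>' X x. \<rho>' \<le> \<rho>1 \<Longrightarrow> X \<in> \<Theta> \<Longrightarrow> x \<in> nb S \<rho>' \<Longrightarrow> norm (f X x) \<le> B1"
    "\<And>e. 0 < e \<Longrightarrow> \<exists>d>0. osc_le \<rho>1 d e f"
    by (rule UC_E) blast
  from \<open>UC g\<close> obtain \<rho>2 B2 where g: "0 < \<rho>2" "0 \<le> B2"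
    "\<And>\<rho>' X x. \<rho>' \<le> \<rho>2 \<Longrightarrow> X \<in> \<Theta> \<Longrightarrow> x \<in> nb S \<rho>' \<Longrightarrow> norm (g X x) \<le> B2"
    "\<And>e. 0 < e \<Longrightarrow> \<exists>d>0. osc_le \<rho>2 d e g"
    by (rule UC_E) blast
  let ?\<rho> = "min \<rho>1 \<rho>2"
  show ?thesis
  proof (rule UC_I[of ?\<rho> _ "B1 * B2 * K"])
    show "norm (pr (f X x) (g X x)) \<le> B1 * B2 * K" if "X \<in> \<Theta>" "x \<in> nb S ?\<rho>" for X x
    proof (rule order_trans[OF K(2)])
      show "norm (f X x) * norm (g X x) * K \<le> B1 * B2 * K"
        using f(2) f(3)[of ?\<rho> X x] g(3)[of ?\<rho> X x] that K(1) by (intro mult_right_mono mult_mono) auto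
    qed
    fix e :: real assume "0 < e"
    define c where "c = e / (2 * K * (B1 + B2 + 1))"
    have c: "0 < c" using \<open>0 < e\<close> K f(2) g(2) by (auto simp: c_def intro!: divide_pos_pos mult_pos_pos)
    obtain d1 where d1: "d1 > 0" "\<forall>\<rho>'\<le>\<rho>1. \<forall>X\<in>\<Theta>. \<forall>x\<in>nb S \<rho>'. \<forall>y\<in>nb S \<rho>'. dist x y < d1 \<longrightarrow> norm (f X x - f X y) \<le> c"
      using f(4)[OF c] by blast
    obtain d2 where d2: "d2 > 0" "\<forall>\<rho>'\<le>\<rho>2. \<forall>X\<in>\<Theta>. \<forall>x\<in>nb S \<rho>'. \<forall>y\<in>nb S \<rho>'. dist x y < d2 \<longrightarrow> norm (g X x - g X y) \<le> c"
      using g(4)[OF c] by blast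
    show "\<exists>d>0. \<forall>X\<in>\<Theta>. \<forall>x\<in>nb S ?\<rho>. \<forall>y\<in>nb S ?\<rho>. dist x y < d \<longrightarrow>
        norm (pr (f X x) (g X x) - pr (f X y) (g X y)) \<le> e"
    proof (intro exI[of _ "min d1 d2"] conjI ballI impI)
      fix X x y assume a: "X \<in> \<Theta>" "x \<in> nb S ?\<rho>" "y \<in> nb S ?\<rho>" "dist x y < min d1 d2"
      have fg: "norm (f X x - f X y) \<le> c" "norm (g X x - g X y) \<le> c" "norm (f X x) \<le> B1" "norm (g X y) \<le> B2"
        using d1(2)[rule_format, of ?\<rho> X x y] d2(2)[rule_format, of ?\<rho> X x y] a f(3)[of ?\<rho> X x] g(3)[of ?\<rho> X y]
        by auto
      have "pr (f X x) (g X x) - pr (f X y) (g X y) = pr (f X x) (g X x - g X y) + pr (f X x - f X y) (g X y)"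
        by (simp add: diff_left diff_right)
      also have "norm \<dots> \<le> norm (f X x) * norm (g X x - g X y) * K + norm (f X x - f X y) * norm (g X y) * K"
        by (intro norm_triangle_le add_mono K)
      also have "\<dots> \<le> B1 * c * K + c * B2 * K"
        using fg K(1) f(2) g(2) c by (intro add_mono mult_right_mono mult_mono) auto
      also have "\<dots> \<le> 2 * K * (B1 + B2 + 1) * c"
        using K c f(2) g(2) by (simp add: algebra_simps)
      also have "\<dots> = e"
      proof -
        have "K * (B1 + B2 + 1) \<noteq> 0" using K f(2) g(2) by auto
        then show ?thesis by (simp add: c_def)
      qed
      finally show "norm (pr (f X x) (g X x) - pr (f X y) (g X y)) \<le> e" .
    qed (use d1 d2 in auto)
  qed (use f g in auto)
qed

text \<open>The uniform counterpart of class C^k near \<open>S\<close>. Differentiability is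
  demanded on some neighbourhood only, which may differ from one derivative to the next.\<close>

primrec UCk :: "nat \<Rightarrow> ('x \<Rightarrow> 'a \<Rightarrow> 'b::real_normed_vector) \<Rightarrow> bool" where
  "UCk 0 f = UC f"
| "UCk (Suc k) f = (UC f \<and> near (\<lambda>X x. f X differentiable (at x)) \<and>
     (\<forall>b\<in>Basis. UCk k (\<lambda>X. partial b (f X))))"

lemma UCk_UC: "UCk k f \<Longrightarrow> UC f"
  by (cases k) auto

lemma UCk_mono: "UCk k f \<Longrightarrow> j \<le> k \<Longrightarrow> UCk j f"
proof (induction k arbitrary: j f)
  case (Suc k)
  then show ?case by (cases j) auto
qed simp

lemma near_partial_eq:
  assumes "near (\<lambda>X x. f X x = g X x)"
  shows "near (\<lambda>X x. frechet_derivative (f X) (at x) = frechet_derivative (g X) (at x) \<and>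
            (f X differentiable (at x) \<longleftrightarrow> g X differentiable (at x)))"
proof (rule near_mono[OF near_ball[OF assms]])
  fix X x assume "\<exists>W. open W \<and> x \<in> W \<and> (\<forall>y\<in>W. f X y = g X y)"
  then obtain W where W: "open W" "x \<in> W" "\<And>y. y \<in> W \<Longrightarrow> f X y = g X y" by blast
  have "(f X has_derivative D) (at x) \<longleftrightarrow> (g X has_derivative D) (at x)" for D
    using W by (metis has_derivative_transform_within_open)
  then show "frechet_derivative (f X) (at x) = frechet_derivative (g X) (at x) \<and>
            (f X differentiable (at x) \<longleftrightarrow> g X differentiable (at x))"
    unfolding frechet_derivative_def differentiable_def by simp
qed

lemma UCk_cong: "UCk k f \<Longrightarrow> near (\<lambda>X x. f X x = g X x) \<Longrightarrow> UCk k g"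
proof (induction k arbitrary: f g)
  case (Suc k)
  have "near (\<lambda>X x. g X differentiable (at x))"
    using near_conj[OF near_partial_eq[OF Suc.prems(2)]] Suc.prems(1) by (force elim: near_mono)
  moreover have "UCk k (\<lambda>X. partial b (g X))" if "b \<in> Basis" for b
  proof (rule Suc.IH)
    show "UCk k (\<lambda>X. partial b (f X))" using Suc.prems(1) that by simp
    show "near (\<lambda>X x. partial b (f X) x = partial b (g X) x)"
      by (rule near_mono[OF near_partial_eq[OF Suc.prems(2)]]) (simp add: partial_def)
  qed
  ultimately show ?case using Suc.prems UC_cong by auto
qed (simp add: UC_cong)

lemma UCk_const: "UCk k (\<lambda>_ _. c)"
proof (induction k arbitrary: c)
  case (Suc k)
  have "partial b (\<lambda>_. c) = (\<lambda>_. 0)" for b :: 'a and c :: 'b by (auto simp: partial_def)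
  then show ?case using Suc UC_const[of c] by (auto simp: near_def intro: exI[of _ 1])
qed (simp add: UC_const)

lemma UCk_id:
  assumes "bounded S" shows "UCk k (\<lambda>_ x. x)"
proof (cases k)
  case (Suc k)
  have "partial b (\<lambda>x. x) = (\<lambda>_. b)" for b :: 'a
    by (auto simp: partial_def frechet_eq[OF has_derivative_ident])
  then show ?thesis using Suc UCk_const UC_id[OF assms] by (auto simp: near_def intro: exI[of _ 1])
qed (simp add: UC_id assms)

lemma UCk_linear:
  assumes "bounded_linear h" shows "UCk k f \<Longrightarrow> UCk k (\<lambda>X x. h (f X x))"
proof (induction k arbitrary: f)
  case (Suc k)
  have d: "near (\<lambda>X x. f X differentiable (at x))" using Suc.prems by simp
  have "UCk k (\<lambda>X. partial b (\<lambda>x. h (f X x)))" if "b \<in> Basis" for b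
  proof (rule UCk_cong[OF Suc.IH])
    show "UCk k (\<lambda>X. partial b (f X))" using Suc.prems that by simp
    show "near (\<lambda>X x. h (partial b (f X) x) = partial b (\<lambda>x. h (f X x)) x)"
    proof (rule near_mono[OF d])
      fix X x assume "f X differentiable (at x)"
      then have "((\<lambda>x. h (f X x)) has_derivative (\<lambda>v. h (frechet_derivative (f X) (at x) v))) (at x)"
        by (intro bounded_linear.has_derivative[OF assms]) (simp add: frechet_derivative_works)
      then show "h (partial b (f X) x) = partial b (\<lambda>x. h (f X x)) x"
        by (simp add: partial_def frechet_eq)
    qed
  qed
  moreover have "near (\<lambda>X x. (\<lambda>x. h (f X x)) differentiable (at x))"
    using d by (rule near_mono) (auto simp: differentiable_def dest: bounded_linear.has_derivative[OF assms])
  ultimately show ?case using Suc.prems UC_linear[OF assms] by auto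
qed (simp add: UC_linear assms)

lemma UCk_add: "UCk k f \<Longrightarrow> UCk k g \<Longrightarrow> UCk k (\<lambda>X x. f X x + g X x)"
proof (induction k arbitrary: f g)
  case (Suc k)
  have d: "near (\<lambda>X x. f X differentiable (at x) \<and> g X differentiable (at x))"
    using Suc.prems by (intro near_conj) auto
  have "UCk k (\<lambda>X. partial b (\<lambda>x. f X x + g X x))" if "b \<in> Basis" for b
  proof (rule UCk_cong[OF Suc.IH])
    show "UCk k (\<lambda>X. partial b (f X))" "UCk k (\<lambda>X. partial b (g X))" using Suc.prems that by auto
    show "near (\<lambda>X x. partial b (f X) x + partial b (g X) x = partial b (\<lambda>x. f X x + g X x) x)"
    proof (rule near_mono[OF d])
      fix X x assume "f X differentiable (at x) \<and> g X differentiable (at x)"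
      then have "((\<lambda>x. f X x + g X x) has_derivative
          (\<lambda>v. frechet_derivative (f X) (at x) v + frechet_derivative (g X) (at x) v)) (at x)"
        by (intro has_derivative_add) (auto simp: frechet_derivative_works)
      then show "partial b (f X) x + partial b (g X) x = partial b (\<lambda>x. f X x + g X x) x"
        by (simp add: partial_def frechet_eq)
    qed
  qed
  moreover have "near (\<lambda>X x. (\<lambda>x. f X x + g X x) differentiable (at x))"
    using d by (rule near_mono) auto
  ultimately show ?case using Suc.prems UC_add by auto
qed (simp add: UC_add)

lemma UCk_sum: "(\<And>i. i \<in> I \<Longrightarrow> UCk k (f i)) \<Longrightarrow> UCk k (\<lambda>X x. \<Sum>i\<in>I. f i X x)"
proof (induction I rule: infinite_finite_induct)
  case (insert i I) then show ?case by (simp add: UCk_add)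
qed (simp_all add: UCk_const)

lemma UCk_scaleR_const: "UCk k f \<Longrightarrow> UCk k (\<lambda>X x. c *\<^sub>R f X x)"
  by (rule UCk_linear[OF bounded_linear_scaleR_right])

lemma UCk_diff: "UCk k f \<Longrightarrow> UCk k g \<Longrightarrow> UCk k (\<lambda>X x. f X x - g X x)"
  using UCk_add[of k f "\<lambda>X x. (-1) *\<^sub>R g X x"] UCk_scaleR_const[of k g "-1"] by simp

lemma UCk_prod:
  assumes "bounded_bilinear pr"
  shows "UCk k f \<Longrightarrow> UCk k g \<Longrightarrow> UCk k (\<lambda>X x. pr (f X x) (g X x))"
proof (induction k arbitrary: f g)
  case (Suc k)
  have d: "near (\<lambda>X x. f X differentiable (at x) \<and> g X differentiable (at x))"
    using Suc.prems by (intro near_conj) auto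
  have der: "((\<lambda>x. pr (f X x) (g X x)) has_derivative (\<lambda>v. pr (f X x) (frechet_derivative (g X) (at x) v)
        + pr (frechet_derivative (f X) (at x) v) (g X x))) (at x)"
    if "f X differentiable (at x) \<and> g X differentiable (at x)" for X x
    using that by (intro bounded_bilinear.FDERIV[OF assms]) (auto simp: frechet_derivative_works)
  have "UCk k (\<lambda>X. partial b (\<lambda>x. pr (f X x) (g X x)))" if "b \<in> Basis" for b
  proof (rule UCk_cong[OF UCk_add[OF Suc.IH[of f "\<lambda>X. partial b (g X)"]
        Suc.IH[of "\<lambda>X. partial b (f X)" g]]])
    show "UCk k (\<lambda>X. partial b (f X))" "UCk k (\<lambda>X. partial b (g X))" using Suc.prems that by auto
    show "UCk k f" "UCk k g" using Suc.prems UCk_mono[of "Suc k" _ k] by auto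
    show "near (\<lambda>X x. pr (f X x) (partial b (g X) x) + pr (partial b (f X) x) (g X x) =
        partial b (\<lambda>x. pr (f X x) (g X x)) x)"
      using d by (rule near_mono) (simp add: partial_def frechet_eq[OF der])
  qed
  moreover have "near (\<lambda>X x. (\<lambda>x. pr (f X x) (g X x)) differentiable (at x))"
    using d by (rule near_mono) (use der differentiable_def in blast)
  ultimately show ?case using Suc.prems UC_prod[OF assms] by auto
qed (simp add: UC_prod assms)

definition lie :: "('x \<Rightarrow> 'a \<Rightarrow> 'a) \<Rightarrow> ('x \<Rightarrow> 'a \<Rightarrow> 'b::real_normed_vector) \<Rightarrow> 'x \<Rightarrow> 'a \<Rightarrow> 'b" where
  "lie V f X x = frechet_derivative (f X) (at x) (V X x)"

lemma frechet_derivative_Basis: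
  assumes "f differentiable (at x)"
  shows "frechet_derivative f (at x) v = (\<Sum>b\<in>Basis. (v \<bullet> b) *\<^sub>R partial b f (x :: 'a))"
proof -
  have "linear (frechet_derivative f (at x))" using assms by (rule linear_frechet_derivative)
  then have "frechet_derivative f (at x) (\<Sum>b\<in>Basis. (v \<bullet> b) *\<^sub>R b) = (\<Sum>b\<in>Basis. (v \<bullet> b) *\<^sub>R partial b f x)"
    by (simp add: linear_sum linear_scale partial_def)
  then show ?thesis by (simp add: euclidean_representation)
qed

text \<open>In coordinates the derivative along \<open>V\<close> is the sum of the components of
  \<open>V\<close> times the partial derivatives of \<open>f\<close>; only \<open>f\<close> loses an
  order.\<close>

lemma UCk_lie:
  assumes "UCk k V" "UCk (Suc k) f"
  shows "UCk k (lie V f)"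
proof (rule UCk_cong)
  show "UCk k (\<lambda>X x. \<Sum>b\<in>Basis. (V X x \<bullet> b) *\<^sub>R partial b (f X) x)"
    using assms by (intro UCk_sum UCk_prod[OF bounded_bilinear_scaleR] UCk_linear[OF bounded_linear_inner_left]) auto
  have "near (\<lambda>X x. f X differentiable (at x))" using assms by simp
  then show "near (\<lambda>X x. (\<Sum>b\<in>Basis. (V X x \<bullet> b) *\<^sub>R partial b (f X) x) = lie V f X x)"
    by (rule near_mono) (simp add: lie_def frechet_derivative_Basis)
qed

text \<open>The derivative assembled from the partial derivatives. In this form it inherits uniform
  continuity from them by linearity, while the agreement with the Frechet derivative is a separate
  fact about points of differentiability.\<close>

definition dblin :: "('a \<Rightarrow> 'b::real_normed_vector) \<Rightarrow> 'a \<Rightarrow> 'a \<Rightarrow>\<^sub>L 'b" where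
  "dblin f x = (\<Sum>b\<in>Basis. blinfun_scaleR_left (partial b f x) o\<^sub>L blinfun_inner_left b)"

lemma dblin_apply: "dblin f x v = (\<Sum>b\<in>Basis. (v \<bullet> b) *\<^sub>R partial b f x)"
  by (simp add: dblin_def blinfun.sum_left inner_commute)

lemma dblin_frechet: "f differentiable (at x) \<Longrightarrow> blinfun_apply (dblin f x) = frechet_derivative f (at x)"
  by (rule ext) (simp add: dblin_apply frechet_derivative_Basis)

lemma dblin_has_derivative: "f differentiable (at x) \<Longrightarrow> (f has_derivative blinfun_apply (dblin f x)) (at x)"
  by (simp add: dblin_frechet frechet_derivative_works[symmetric])

lemma bounded_linear_partial_blinfun:
  "bounded_linear (\<lambda>v. blinfun_scaleR_left v o\<^sub>L blinfun_inner_left b)"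
  by (rule bounded_linear_compose[OF bounded_bilinear.bounded_linear_left[OF bounded_bilinear_blinfun_compose]
        bounded_linear_blinfun_scaleR_left])

lemma UC_dblin: "UCk (Suc k) f \<Longrightarrow> UC (\<lambda>X. dblin (f X))"
  unfolding dblin_def
  by (intro UC_sum UC_linear[OF bounded_linear_partial_blinfun]) (auto dest: UCk_UC)

end


section \<open>Uniform asymptotics in small time\<close>

lemma mvt_bound_Icc:
  fixes u :: "real \<Rightarrow> 'b::real_normed_vector"
  assumes "a \<le> b" and der: "\<And>s. a \<le> s \<Longrightarrow> s \<le> b \<Longrightarrow> (u has_vector_derivative u' s) (at s)"
    and bd: "\<And>s. a \<le> s \<Longrightarrow> s \<le> b \<Longrightarrow> norm (u' s) \<le> B"
  shows "norm (u b - u a) \<le> B * (b - a)"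
proof (cases "a = b")
  case False
  with assms have "a < b" by simp
  have "norm (u b - u a) \<le> (\<lambda>s. B * s) b - (\<lambda>s. B * s) a"
  proof (rule differentiable_bound_general[where f' = u' and \<phi>' = "\<lambda>_. B"])
    show "((*) B has_vector_derivative B) (at x)" for x :: real
      by (auto intro!: derivative_eq_intros)
    show "continuous_on {a..b} u"
      by (rule continuous_on_vector_derivative[where u' = u'])
         (auto intro: has_vector_derivative_at_within der)
  qed (use assms \<open>a < b\<close> in \<open>auto intro!: continuous_intros\<close>)
  then show ?thesis by (simp add: right_diff_distrib)
qed simp

text \<open>Difference quotients in direction \<open>v\<close> obey the Lipschitz bound and converge
  to \<open>h' v\<close>. This converts Lipschitz constants of remainders into bounds for their
  derivatives; only differences from the centre \<open>y\<close> enter.\<close>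

lemma has_derivative_lipschitz_bound:
  fixes h :: "'a::real_normed_vector \<Rightarrow> 'b::real_normed_vector"
  assumes h: "(h has_derivative h') (at y)" and "0 < r"
    and lip: "\<And>z. dist y z < r \<Longrightarrow> norm (h y - h z) \<le> K * norm (y - z)"
  shows "norm (h' v) \<le> K * norm v"
proof -
  interpret h': bounded_linear h' using h by (rule has_derivative_bounded_linear)
  show ?thesis
  proof (cases "v = 0")
    case False
    show ?thesis
    proof (rule field_le_epsilon)
      fix \<eta> :: real assume "\<eta> > 0"
      then have "0 < \<eta> / norm v" using False by simp
      then obtain d where d: "d > 0" "\<And>z. norm (z - y) < d \<Longrightarrow>
          norm (h z - h y - h' (z - y)) \<le> \<eta> / norm v * norm (z - y)"
        using h unfolding has_derivative_at_alt by blast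
      define \<theta> where "\<theta> = min d r / (2 * norm v)"
      have \<theta>: "0 < \<theta>" "\<theta> * norm v < d" "\<theta> * norm v < r"
        using d \<open>0 < r\<close> False by (auto simp: \<theta>_def)
      let ?z = "y + \<theta> *\<^sub>R v"
      have 1: "norm (h ?z - h y - h' (\<theta> *\<^sub>R v)) \<le> \<eta> / norm v * (\<theta> * norm v)"
        using d(2)[of ?z] \<theta> by simp
      have 2: "norm (h y - h ?z) \<le> K * (\<theta> * norm v)"
        using lip[of ?z] \<theta> by (simp add: dist_norm)
      have "norm (h' (\<theta> *\<^sub>R v)) \<le> norm (h ?z - h y - h' (\<theta> *\<^sub>R v)) + norm (h y - h ?z)" by norm
      then have "\<theta> * norm (h' v) \<le> \<theta> * (K * norm v + \<eta>)"
        using 1 2 \<theta> False by (simp add: h'.scaleR algebra_simps)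
      then show "norm (h' v) \<le> K * norm v + \<eta>" using \<theta> by simp
    qed
  qed (simp add: h'.zero)
qed

context germs
begin

text \<open>Times are strictly positive, since the derivatives in t asserted later are two-sided and
  the steps are flows run forward from time 0.\<close>

definition evt_at :: "real \<Rightarrow> (real \<Rightarrow> 'x \<Rightarrow> 'a \<Rightarrow> bool) \<Rightarrow> bool" where
  "evt_at \<rho> P \<longleftrightarrow> (\<exists>d>0. \<forall>t X x. 0 < t \<longrightarrow> t < d \<longrightarrow> X \<in> \<Theta> \<longrightarrow> x \<in> nb S \<rho> \<longrightarrow> P t X x)"

definition evt :: "(real \<Rightarrow> 'x \<Rightarrow> 'a \<Rightarrow> bool) \<Rightarrow> bool" where
  "evt P \<longleftrightarrow> (\<exists>\<rho>>0. evt_at \<rho> P)"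

definition smallo_at :: "real \<Rightarrow> nat \<Rightarrow> (real \<Rightarrow> 'x \<Rightarrow> 'a \<Rightarrow> 'b::real_normed_vector) \<Rightarrow> bool" where
  "smallo_at \<rho> m g \<longleftrightarrow> (\<forall>e>0. evt_at \<rho> (\<lambda>t X x. norm (g t X x) \<le> e * t ^ m))"

text \<open>The neighbourhood of \<open>S\<close> must not shrink with \<open>e\<close>: otherwise an expansion would determine its
  coefficients only on \<open>S\<close>, and not at the nearby points that the flows reach.\<close>

definition smallo :: "nat \<Rightarrow> (real \<Rightarrow> 'x \<Rightarrow> 'a \<Rightarrow> 'b::real_normed_vector) \<Rightarrow> bool" where
  "smallo m g \<longleftrightarrow> (\<exists>\<rho>>0. smallo_at \<rho> m g)"

abbreviation lip_le :: "real \<Rightarrow> real \<Rightarrow> nat \<Rightarrow> (real \<Rightarrow> 'x \<Rightarrow> 'a \<Rightarrow> 'b::real_normed_vector) \<Rightarrow> real \<Rightarrow> 'x \<Rightarrow> 'a \<Rightarrow> bool" where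
  "lip_le \<rho> e m g t X x \<equiv> \<forall>y. dist x y < \<rho> \<longrightarrow> norm (g t X x - g t X y) \<le> e * t ^ m * norm (x - y)"

text \<open>A Lipschitz constant o(t^m) in the space variable, at a scale \<open>\<rho>\<close> that
  shrinks neither with t nor with the accuracy. A fixed scale is what allows near-identity maps to
  be inserted.\<close>

definition lipo :: "nat \<Rightarrow> (real \<Rightarrow> 'x \<Rightarrow> 'a \<Rightarrow> 'b::real_normed_vector) \<Rightarrow> bool" where
  "lipo m g \<longleftrightarrow> (\<exists>\<rho>>0. \<forall>e>0. evt_at \<rho> (\<lambda>t X x. lip_le \<rho> e m g t X x))"

lemma evt_at_mono:
  assumes "evt_at \<rho> P" "\<rho>' \<le> \<rho>"
    and "\<And>t X x. 0 < t \<Longrightarrow> t \<le> 1 \<Longrightarrow> X \<in> \<Theta> \<Longrightarrow> x \<in> nb S \<rho>' \<Longrightarrow> P t X x \<Longrightarrow> Q t X x"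
  shows "evt_at \<rho>' Q"
proof -
  from assms(1) obtain d where "d > 0" "\<And>t X x. 0 < t \<Longrightarrow> t < d \<Longrightarrow> X \<in> \<Theta> \<Longrightarrow> x \<in> nb S \<rho> \<Longrightarrow> P t X x"
    unfolding evt_at_def by blast
  then show ?thesis
    unfolding evt_at_def using assms(3) subsetD[OF nb_mono[OF assms(2), of S]]
    by (intro exI[of _ "min d 1"]) auto
qed

lemma evt_at_antimono: "evt_at \<rho> P \<Longrightarrow> \<rho>' \<le> \<rho> \<Longrightarrow> evt_at \<rho>' P"
  by (erule evt_at_mono)

lemma evt_at_conj:
  assumes "evt_at \<rho> P" "evt_at \<rho> Q"
  shows "evt_at \<rho> (\<lambda>t X x. P t X x \<and> Q t X x)"
proof -
  from assms obtain d e where "d > 0" "e > 0"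
    "\<And>t X x. 0 < t \<Longrightarrow> t < d \<Longrightarrow> X \<in> \<Theta> \<Longrightarrow> x \<in> nb S \<rho> \<Longrightarrow> P t X x"
    "\<And>t X x. 0 < t \<Longrightarrow> t < e \<Longrightarrow> X \<in> \<Theta> \<Longrightarrow> x \<in> nb S \<rho> \<Longrightarrow> Q t X x"
    unfolding evt_at_def by metis
  then show ?thesis unfolding evt_at_def by (intro exI[of _ "min d e"]) auto
qed

lemma evt_at_less: "0 < c \<Longrightarrow> evt_at \<rho> (\<lambda>t X x. t < c)"
  unfolding evt_at_def by auto

lemma evt_mono:
  assumes "evt P" "\<And>t X x. 0 < t \<Longrightarrow> t \<le> 1 \<Longrightarrow> X \<in> \<Theta> \<Longrightarrow> P t X x \<Longrightarrow> Q t X x"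
  shows "evt Q"
  using assms evt_at_mono[OF _ order_refl] unfolding evt_def by (metis (no_types, lifting))

lemma evtI:
  "0 < \<rho> \<Longrightarrow> 0 < d \<Longrightarrow> (\<And>t X x. 0 < t \<Longrightarrow> t < d \<Longrightarrow> X \<in> \<Theta> \<Longrightarrow> x \<in> nb S \<rho> \<Longrightarrow> P t X x) \<Longrightarrow> evt P"
  unfolding evt_def evt_at_def by blast

lemma evt_conj:
  assumes "evt P" "evt Q"
  shows "evt (\<lambda>t X x. P t X x \<and> Q t X x)"
proof -
  from assms obtain \<rho>1 \<rho>2 where "\<rho>1 > 0" "evt_at \<rho>1 P" "\<rho>2 > 0" "evt_at \<rho>2 Q" unfolding evt_def by auto
  then show ?thesis unfolding evt_def
    by (intro exI[of _ "min \<rho>1 \<rho>2"] conjI evt_at_conj)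
       (auto elim: evt_at_antimono)
qed

lemma evt_less: "0 < c \<Longrightarrow> evt (\<lambda>t X x. t < c)"
  unfolding evt_def using evt_at_less by (intro exI[of _ 1]) auto

lemma evt_True: "evt (\<lambda>t X x. True)"
  by (rule evt_mono[OF evt_less[of 1]]) auto

lemma evt_ball:
  assumes "finite I" "\<And>i. i \<in> I \<Longrightarrow> evt (P i)"
  shows "evt (\<lambda>t X x. \<forall>i\<in>I. P i t X x)"
  using assms
proof (induction I)
  case (insert i I)
  then have "evt (\<lambda>t X x. P i t X x \<and> (\<forall>i\<in>I. P i t X x))" by (intro evt_conj) auto
  then show ?case by (rule evt_mono) auto
qed (simp add: evt_True)

lemma near_evt: "near P \<Longrightarrow> evt (\<lambda>t. P)"
  unfolding near_def evt_def evt_at_def by (meson zero_less_one)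

lemma smallo_at_mono: "smallo_at \<rho> m g \<Longrightarrow> \<rho>' \<le> \<rho> \<Longrightarrow> smallo_at \<rho>' m g"
  unfolding smallo_at_def by (auto intro: evt_at_mono)

lemma smallo_bound:
  assumes "smallo m g" "evt (\<lambda>t X x. norm (h t X x) \<le> C * norm (g t X x))"
  shows "smallo m h"
proof -
  obtain \<rho> where \<rho>: "\<rho> > 0" "smallo_at \<rho> m g" using assms(1) unfolding smallo_def by auto
  obtain \<rho>' where \<rho>': "\<rho>' > 0" "evt_at \<rho>' (\<lambda>t X x. norm (h t X x) \<le> C * norm (g t X x))"
    using assms(2) unfolding evt_def by auto
  have "smallo_at (min \<rho> \<rho>') m h" unfolding smallo_at_def
  proof (intro allI impI)
    fix e :: real assume e: "e > 0"
    then have "0 < e / (\<bar>C\<bar> + 1)" by (simp add: add_nonneg_pos)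
    then have "evt_at \<rho> (\<lambda>t X x. norm (g t X x) \<le> e / (\<bar>C\<bar> + 1) * t ^ m)"
      using \<rho>(2) unfolding smallo_at_def by blast
    from evt_at_conj[OF evt_at_mono[OF this, of "min \<rho> \<rho>'"] evt_at_mono[OF \<rho>'(2), of "min \<rho> \<rho>'"]]
    show "evt_at (min \<rho> \<rho>') (\<lambda>t X x. norm (h t X x) \<le> e * t ^ m)"
    proof (rule evt_at_mono)
      fix t :: real and X :: 'x and x :: 'a
      assume "0 < t" and a: "norm (g t X x) \<le> e / (\<bar>C\<bar> + 1) * t ^ m \<and> norm (h t X x) \<le> C * norm (g t X x)"
      then have "norm (h t X x) \<le> (\<bar>C\<bar> + 1) * norm (g t X x)"
        by (smt (verit, ccfv_SIG) mult_right_mono norm_ge_zero)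
      also have "\<dots> \<le> (\<bar>C\<bar> + 1) * (e / (\<bar>C\<bar> + 1) * t ^ m)" using a by (intro mult_left_mono) auto
      also have "\<dots> = e * t ^ m" by (simp add: add_nonneg_pos less_imp_neq[THEN not_sym])
      finally show "norm (h t X x) \<le> e * t ^ m" .
    qed auto
  qed
  then show ?thesis unfolding smallo_def using \<rho> \<rho>' by (intro exI[of _ "min \<rho> \<rho>'"]) auto
qed

lemma smallo_cong: "smallo m g \<Longrightarrow> evt (\<lambda>t X x. h t X x = g t X x) \<Longrightarrow> smallo m h"
  by (rule smallo_bound[where C = 1]) (auto elim: evt_mono)

lemma smallo_cong': "smallo m g \<Longrightarrow> (\<And>t X x. 0 < t \<Longrightarrow> X \<in> \<Theta> \<Longrightarrow> h t X x = g t X x) \<Longrightarrow> smallo m h"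
  by (erule smallo_cong) (rule evt_mono[OF evt_True], auto)

lemma smallo_add:
  assumes "smallo m g" "smallo m h"
  shows "smallo m (\<lambda>t X x. g t X x + h t X x)"
proof -
  obtain \<rho>1 \<rho>2 where \<rho>: "\<rho>1 > 0" "smallo_at \<rho>1 m g" "\<rho>2 > 0" "smallo_at \<rho>2 m h"
    using assms unfolding smallo_def by auto
  have "smallo_at (min \<rho>1 \<rho>2) m (\<lambda>t X x. g t X x + h t X x)" unfolding smallo_at_def
  proof (intro allI impI)
    fix e :: real assume "e > 0"
    then have "evt_at (min \<rho>1 \<rho>2) (\<lambda>t X x. norm (g t X x) \<le> e/2 * t ^ m)"
      "evt_at (min \<rho>1 \<rho>2) (\<lambda>t X x. norm (h t X x) \<le> e/2 * t ^ m)"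
      using smallo_at_mono[OF \<rho>(2), of "min \<rho>1 \<rho>2"] smallo_at_mono[OF \<rho>(4), of "min \<rho>1 \<rho>2"]
      unfolding smallo_at_def by (auto dest!: spec[of _ "e/2"])
    from evt_at_conj[OF this] show "evt_at (min \<rho>1 \<rho>2) (\<lambda>t X x. norm (g t X x + h t X x) \<le> e * t ^ m)"
      by (rule evt_at_mono) (use norm_triangle_mono in \<open>fastforce\<close>)+
  qed
  then show ?thesis unfolding smallo_def using \<rho> by (intro exI[of _ "min \<rho>1 \<rho>2"]) auto
qed

lemma smallo_linear:
  assumes "bounded_linear h" "smallo m g"
  shows "smallo m (\<lambda>t X x. h (g t X x))"
proof -
  obtain K where K: "\<And>v. norm (h v) \<le> norm v * K" using bounded_linear.bounded[OF assms(1)] by blast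
  show ?thesis
    by (rule smallo_bound[OF assms(2), where C = K], rule evt_mono[OF evt_True])
       (use K in \<open>simp add: mult.commute\<close>)
qed

lemma smallo_scaleR_const: "smallo m g \<Longrightarrow> smallo m (\<lambda>t X x. c *\<^sub>R g t X x)"
  by (rule smallo_linear[OF bounded_linear_scaleR_right])

lemma smallo_minus: "smallo m g \<Longrightarrow> smallo m (\<lambda>t X x. - g t X x)"
  by (rule smallo_linear[OF bounded_linear_minus[OF bounded_linear_ident]])

lemma smallo_diff: "smallo m g \<Longrightarrow> smallo m h \<Longrightarrow> smallo m (\<lambda>t X x. g t X x - h t X x)"
  using smallo_add[OF _ smallo_minus, of m g h] by simp

lemma smallo_zero: "smallo m (\<lambda>t X x. 0)"
  unfolding smallo_def smallo_at_def
  by (intro exI[of _ 1] conjI allI impI) (auto simp: evt_at_def intro!: exI[of _ 1])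

lemma smallo_sum: "(\<And>i. i \<in> I \<Longrightarrow> smallo m (g i)) \<Longrightarrow> smallo m (\<lambda>t X x. \<Sum>i\<in>I. g i t X x)"
proof (induction I rule: infinite_finite_induct)
  case (insert i I) then show ?case by (simp add: smallo_add)
qed (simp_all add: smallo_zero)

lemma smallo_tpow:
  assumes "smallo m g"
  shows "smallo (j + m) (\<lambda>t X x. t ^ j *\<^sub>R g t X x)"
proof -
  obtain \<rho> where \<rho>: "\<rho> > 0" "smallo_at \<rho> m g" using assms unfolding smallo_def by auto
  have "smallo_at \<rho> (j + m) (\<lambda>t X x. t ^ j *\<^sub>R g t X x)" unfolding smallo_at_def
  proof (intro allI impI)
    fix e :: real assume "e > 0"
    then have "evt_at \<rho> (\<lambda>t X x. norm (g t X x) \<le> e * t ^ m)" using \<rho> by (simp add: smallo_at_def)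
    then show "evt_at \<rho> (\<lambda>t X x. norm (t ^ j *\<^sub>R g t X x) \<le> e * t ^ (j + m))"
    proof (rule evt_at_mono)
      fix t :: real and X :: 'x and x :: 'a
      assume "0 < t" "norm (g t X x) \<le> e * t ^ m"
      then have "t ^ j * norm (g t X x) \<le> t ^ j * (e * t ^ m)" by (intro mult_left_mono) auto
      then show "norm (t ^ j *\<^sub>R g t X x) \<le> e * t ^ (j + m)" using \<open>0 < t\<close> by (simp add: power_add mult_ac)
    qed auto
  qed
  then show ?thesis using \<rho> smallo_def by auto
qed

lemma smallo_tpow': "smallo m g \<Longrightarrow> k = j + m \<Longrightarrow> smallo k (\<lambda>t X x. t ^ j *\<^sub>R g t X x)"
  by (simp add: smallo_tpow)

lemma smallo_mono:
  assumes "smallo m g" "k \<le> m" shows "smallo k g"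
proof -
  obtain \<rho> where \<rho>: "\<rho> > 0" "smallo_at \<rho> m g" using assms unfolding smallo_def by auto
  have "smallo_at \<rho> k g" unfolding smallo_at_def
  proof (intro allI impI)
    fix e :: real assume "e > 0"
    then have "evt_at \<rho> (\<lambda>t X x. norm (g t X x) \<le> e * t ^ m)" using \<rho> by (simp add: smallo_at_def)
    then show "evt_at \<rho> (\<lambda>t X x. norm (g t X x) \<le> e * t ^ k)"
    proof (rule evt_at_mono)
      fix t :: real and X :: 'x and x :: 'a
      assume t: "0 < t" "t \<le> 1" and le: "norm (g t X x) \<le> e * t ^ m"
      have "e * t ^ m \<le> e * t ^ k"
        using t \<open>e > 0\<close> assms(2) by (intro mult_left_mono power_decreasing) auto
      with le show "norm (g t X x) \<le> e * t ^ k" by linarith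
    qed auto
  qed
  then show ?thesis using \<rho> smallo_def by auto
qed

lemma smallo_bigo:
  assumes "evt (\<lambda>t X x. norm (g t X x) \<le> C * t ^ k)" "m < k"
  shows "smallo m g"
proof -
  obtain \<rho> where \<rho>: "\<rho> > 0" "evt_at \<rho> (\<lambda>t X x. norm (g t X x) \<le> C * t ^ k)"
    using assms unfolding evt_def by auto
  have "smallo_at \<rho> m g" unfolding smallo_at_def
  proof (intro allI impI)
    fix e :: real assume "e > 0"
    then have "0 < e / (\<bar>C\<bar> + 1)" by (simp add: add_nonneg_pos)
    from evt_at_conj[OF \<rho>(2) evt_at_less[OF this]]
    show "evt_at \<rho> (\<lambda>t X x. norm (g t X x) \<le> e * t ^ m)"
    proof (rule evt_at_mono)
      fix t :: real and X :: 'x and x :: 'a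
      assume t: "0 < t" "t \<le> 1" and a: "norm (g t X x) \<le> C * t ^ k \<and> t < e / (\<bar>C\<bar> + 1)"
      have "C * t ^ k \<le> (\<bar>C\<bar> + 1) * t ^ k" using t by (intro mult_right_mono) auto
      also have "\<dots> \<le> (\<bar>C\<bar> + 1) * t ^ Suc m" using t assms(2) by (intro mult_left_mono power_decreasing) auto
      also have "\<dots> = ((\<bar>C\<bar> + 1) * t) * t ^ m" by simp
      also have "\<dots> \<le> e * t ^ m"
        using a t by (intro mult_right_mono) (auto simp: pos_less_divide_eq add_nonneg_pos mult.commute less_imp_le)
      finally show "norm (g t X x) \<le> e * t ^ m" using a by linarith
    qed auto
  qed
  then show ?thesis using \<rho> smallo_def by auto
qed

lemma smallo_E:
  assumes "smallo m g" "0 < e"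
  shows "evt (\<lambda>t X x. norm (g t X x) \<le> e * t ^ m)"
  using assms unfolding smallo_def smallo_at_def evt_def by blast

text \<open>Maps converging uniformly to the identity as t tends to 0. They send points near
  \<open>S\<close> to points near \<open>S\<close>, so that statements about small times may be
  composed with them.\<close>

definition nid :: "(real \<Rightarrow> 'x \<Rightarrow> 'a \<Rightarrow> 'a) \<Rightarrow> bool" where
  "nid A \<longleftrightarrow> smallo 0 (\<lambda>t X x. A t X x - x)"

lemma nid_moves:
  assumes "nid A"
  obtains \<rho> where "\<rho> > 0" "\<And>\<rho>'. 0 < \<rho>' \<Longrightarrow> evt_at \<rho> (\<lambda>t X x. dist x (A t X x) \<le> \<rho>')"
  using assms unfolding nid_def smallo_def smallo_at_def dist_norm
  by (auto simp: norm_minus_commute)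

text \<open>The new radius is chosen before \<open>P\<close>. In applications \<open>P\<close>
  contains an accuracy, and \<open>smallo\<close> and \<open>lipo\<close> require one radius for all
  accuracies.\<close>

lemma evt_comp_at:
  assumes "nid A" "0 < \<rho>"
  shows "\<exists>\<rho>'>0. \<rho>' \<le> \<rho> \<and> (\<forall>P. evt_at \<rho> P \<longrightarrow> evt_at \<rho>' (\<lambda>t X x. P t X (A t X x)))"
proof -
  obtain \<rho>1 where \<rho>1: "\<rho>1 > 0" "\<And>\<rho>'. 0 < \<rho>' \<Longrightarrow> evt_at \<rho>1 (\<lambda>t X x. dist x (A t X x) \<le> \<rho>')"
    using nid_moves[OF assms(1)] by blast
  let ?\<rho> = "min \<rho>1 (\<rho>/2)"
  have "evt_at ?\<rho> (\<lambda>t X x. P t X (A t X x))" if P: "evt_at \<rho> P" for P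
  proof -
    obtain d where d: "d > 0" "\<And>t X x. 0 < t \<Longrightarrow> t < d \<Longrightarrow> X \<in> \<Theta> \<Longrightarrow> x \<in> nb S \<rho> \<Longrightarrow> P t X x"
      using P unfolding evt_at_def by blast
    have "evt_at ?\<rho> (\<lambda>t X x. dist x (A t X x) \<le> \<rho>/2)"
      by (rule evt_at_antimono[OF \<rho>1(2)]) (use assms in auto)
    from evt_at_conj[OF this evt_at_less[OF d(1)]] show ?thesis
    proof (rule evt_at_mono)
      fix t X x assume a: "0 < t" "X \<in> \<Theta>" "x \<in> nb S ?\<rho>" "dist x (A t X x) \<le> \<rho>/2 \<and> t < d"
      then have "A t X x \<in> nb S (?\<rho> + \<rho>/2)" by (intro nb_step) auto
      then have "A t X x \<in> nb S \<rho>" by (rule subsetD[OF nb_mono, rotated]) (simp add: min_def)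
      then show "P t X (A t X x)" using d(2) a by blast
    qed auto
  qed
  then show ?thesis using \<rho>1 assms by (intro exI[of _ ?\<rho>]) auto
qed

lemma evt_comp: "nid A \<Longrightarrow> evt P \<Longrightarrow> evt (\<lambda>t X x. P t X (A t X x))"
proof -
  assume A: "nid A" and "evt P"
  then obtain \<rho> where "\<rho> > 0" "evt_at \<rho> P" unfolding evt_def by auto
  with evt_comp_at[OF A \<open>\<rho> > 0\<close>] show ?thesis unfolding evt_def by auto
qed

lemma smallo_comp: "nid A \<Longrightarrow> smallo m g \<Longrightarrow> smallo m (\<lambda>t X x. g t X (A t X x))"
proof -
  assume A: "nid A" and "smallo m g"
  then obtain \<rho> where \<rho>: "\<rho> > 0" "smallo_at \<rho> m g" unfolding smallo_def by auto
  from evt_comp_at[OF A \<open>\<rho> > 0\<close>] obtain \<rho>' where \<rho>': "\<rho>' > 0"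
    "\<And>P. evt_at \<rho> P \<Longrightarrow> evt_at \<rho>' (\<lambda>t X x. P t X (A t X x))" by blast
  have "smallo_at \<rho>' m (\<lambda>t X x. g t X (A t X x))"
    unfolding smallo_at_def
  proof (intro allI impI)
    fix e :: real assume "e > 0"
    then have "evt_at \<rho> (\<lambda>t X x. norm (g t X x) \<le> e * t ^ m)" using \<rho>(2) by (simp add: smallo_at_def)
    from \<rho>'(2)[OF this] show "evt_at \<rho>' (\<lambda>t X x. norm (g t X (A t X x)) \<le> e * t ^ m)" .
  qed
  with \<rho>' show ?thesis unfolding smallo_def by auto
qed

lemma nid_comp: "nid A \<Longrightarrow> nid B \<Longrightarrow> nid (\<lambda>t X x. A t X (B t X x))"
  using smallo_add[OF smallo_comp[of B 0 "\<lambda>t X x. A t X x - x"], of "\<lambda>t X x. B t X x - x"]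
  by (simp add: nid_def)

lemma UC_smallo:
  assumes "UC f" "nid A"
  shows "smallo 0 (\<lambda>t X x. f X (A t X x) - f X x)"
proof -
  from \<open>UC f\<close> obtain \<rho> B where f: "0 < \<rho>"
    "\<And>e. 0 < e \<Longrightarrow> \<exists>d>0. osc_le \<rho> d e f"
    by (rule UC_E) blast
  obtain \<rho>1 where \<rho>1: "\<rho>1 > 0" "\<And>\<rho>'. 0 < \<rho>' \<Longrightarrow> evt_at \<rho>1 (\<lambda>t X x. dist x (A t X x) \<le> \<rho>')"
    using nid_moves[OF assms(2)] by blast
  let ?\<rho> = "min \<rho>1 (\<rho>/2)"
  have "smallo_at ?\<rho> 0 (\<lambda>t X x. f X (A t X x) - f X x)" unfolding smallo_at_def
  proof (intro allI impI)
    fix e :: real assume "0 < e"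
    then obtain d where d: "d > 0" "osc_le \<rho> d e f"
      using f(2) by blast
    have pos: "0 < min (d/2) (\<rho>/2)" using d f by simp
    show "evt_at ?\<rho> (\<lambda>t X x. norm (f X (A t X x) - f X x) \<le> e * t ^ 0)"
    proof (rule evt_at_mono[OF \<rho>1(2)[OF pos]])
      fix t X x assume a: "X \<in> \<Theta>" "x \<in> nb S ?\<rho>" "dist x (A t X x) \<le> min (d/2) (\<rho>/2)"
      then have "A t X x \<in> nb S (?\<rho> + \<rho>/2)" by (intro nb_step) auto
      then have "A t X x \<in> nb S \<rho>" by (rule subsetD[OF nb_mono, rotated]) (simp add: min_def)
      moreover have "x \<in> nb S \<rho>" using a(2) by (rule subsetD[OF nb_mono, rotated]) (use f(1) in simp)
      moreover have "dist (A t X x) x < d" using a d by (simp add: dist_commute)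
      ultimately show "norm (f X (A t X x) - f X x) \<le> e * t ^ 0" using d(2)[rule_format, of \<rho>] a by simp
    qed auto
  qed
  then show ?thesis unfolding smallo_def using \<rho>1 f by (intro exI[of _ ?\<rho>]) auto
qed

lemma UC_bounded: "UC f \<Longrightarrow> \<exists>B\<ge>0. near (\<lambda>X x. norm (f X x) \<le> B)"
  by (erule UC_E) (force simp: near_def)

lemma UCk_lipschitz:
  assumes "UCk (Suc k) f"
  shows "\<exists>B\<ge>0. \<exists>\<rho>>0. \<forall>X\<in>\<Theta>. \<forall>x\<in>nb S \<rho>. \<forall>y. dist x y < \<rho> \<longrightarrow> norm (f X x - f X y) \<le> B * norm (x - y)"
proof -
  obtain B where B: "B \<ge> 0" "near (\<lambda>X x. norm (dblin (f X) x) \<le> B)" using UC_bounded[OF UC_dblin[OF assms]] by blast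
  have "near (\<lambda>X x. norm (dblin (f X) x) \<le> B \<and> f X differentiable (at x))"
    using assms B by (intro near_conj) auto
  then obtain \<rho> where \<rho>: "\<rho> > 0" "\<And>X x. X \<in> \<Theta> \<Longrightarrow> x \<in> nb S \<rho> \<Longrightarrow> norm (dblin (f X) x) \<le> B \<and> f X differentiable (at x)"
    unfolding near_def by auto
  show ?thesis
  proof (rule exI[of _ B], rule conjI[OF B(1)], rule exI[of _ "\<rho>/2"], intro conjI ballI allI impI)
    fix X x y assume X: "X \<in> \<Theta>" and x: "x \<in> nb S (\<rho>/2)" and xy: "dist x y < \<rho>/2"
    have sub: "ball x (\<rho>/2) \<subseteq> nb S \<rho>" using ball_subset_nb[OF x, of "\<rho>/2"] by simp
    show "norm (f X x - f X y) \<le> B * norm (x - y)"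
    proof (rule lipschitz_segment[where C = "ball x (\<rho>/2)" and V' = "\<lambda>z. blinfun_apply (dblin (f X) z)"])
      show "(f X has_derivative blinfun_apply (dblin (f X) z)) (at z)" if "z \<in> ball x (\<rho>/2)" for z
        using \<rho>(2)[OF X subsetD[OF sub that]] by (auto intro: dblin_has_derivative)
      show "onorm (blinfun_apply (dblin (f X) z)) \<le> B" if "z \<in> ball x (\<rho>/2)" for z
        using \<rho>(2)[OF X subsetD[OF sub that]] by (simp add: norm_blinfun.rep_eq)
    qed (use xy \<rho> in auto)
  qed (use B \<rho> in auto)
qed

lemma UCk_comp_bound:
  assumes "UCk (Suc k) f" "nid A"
  shows "\<exists>B. evt (\<lambda>t X x. norm (f X (A t X x) - f X x) \<le> B * norm (A t X x - x))"
proof -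
  obtain B \<rho> where B: "B \<ge> 0" "\<rho> > 0"
    "\<And>X x y. X \<in> \<Theta> \<Longrightarrow> x \<in> nb S \<rho> \<Longrightarrow> dist x y < \<rho> \<Longrightarrow> norm (f X x - f X y) \<le> B * norm (x - y)"
    using UCk_lipschitz[OF assms(1)] by metis
  have "near (\<lambda>X x. x \<in> nb S \<rho>)" unfolding near_def using B by auto
  from evt_conj[OF near_evt[OF this] smallo_E[OF assms(2)[unfolded nid_def], of "\<rho>/2"]]
  have "evt (\<lambda>t X x. norm (f X (A t X x) - f X x) \<le> B * norm (A t X x - x))"
  proof (rule evt_mono)
    fix t X x assume X: "X \<in> \<Theta>" and a: "x \<in> nb S \<rho> \<and> norm (A t X x - x) \<le> \<rho>/2 * t ^ 0"
    then have "dist x (A t X x) < \<rho>" using B(2) by (simp add: dist_norm norm_minus_commute)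
    then show "norm (f X (A t X x) - f X x) \<le> B * norm (A t X x - x)"
      using B(3)[OF X, of x "A t X x"] a by (simp add: norm_minus_commute)
  qed (use B(2) in simp)
  then show ?thesis by blast
qed

text \<open>Integration from a small positive time s to t gains one power of t; as s tends to 0 the
  initial value disappears by \<open>u0\<close>. Time 0 itself cannot be the lower limit, because
  the derivative is known for positive times only.\<close>

lemma smallo_integrate:
  assumes m: "0 < m" and D: "smallo m (\<lambda>t X x. t *\<^sub>R D t X x)"
    and der: "evt (\<lambda>t X x. ((\<lambda>t. u t X x) has_vector_derivative D t X x) (at t))"
    and u0: "smallo 0 u"
  shows "smallo m u"
proof -
  obtain \<rho>1 \<rho>2 \<rho>3 where \<rho>: "\<rho>1 > 0" "smallo_at \<rho>1 m (\<lambda>t X x. t *\<^sub>R D t X x)"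
    "\<rho>2 > 0" "evt_at \<rho>2 (\<lambda>t X x. ((\<lambda>t. u t X x) has_vector_derivative D t X x) (at t))"
    "\<rho>3 > 0" "smallo_at \<rho>3 0 u"
    using D der u0 unfolding smallo_def evt_def by auto
  define \<rho> where "\<rho> = min \<rho>1 (min \<rho>2 \<rho>3)"
  have "\<rho> > 0" using \<rho> by (simp add: \<rho>_def)
  have D': "smallo_at \<rho> m (\<lambda>t X x. t *\<^sub>R D t X x)" and u': "smallo_at \<rho> 0 u"
    using smallo_at_mono[OF \<rho>(2), of \<rho>] smallo_at_mono[OF \<rho>(6), of \<rho>] by (auto simp: \<rho>_def)
  have der': "evt_at \<rho> (\<lambda>t X x. ((\<lambda>t. u t X x) has_vector_derivative D t X x) (at t))"
    by (rule evt_at_antimono[OF \<rho>(4)]) (simp add: \<rho>_def)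
  have "smallo_at \<rho> m u" unfolding smallo_at_def
  proof (intro allI impI)
    fix e :: real assume "0 < e"
    then have "evt_at \<rho> (\<lambda>t X x. norm (t *\<^sub>R D t X x) \<le> e * t ^ m)" using D' by (simp add: smallo_at_def)
    from evt_at_conj[OF der' this] obtain d where d: "d > 0"
      "\<And>t X x. 0 < t \<Longrightarrow> t < d \<Longrightarrow> X \<in> \<Theta> \<Longrightarrow> x \<in> nb S \<rho> \<Longrightarrow>
        ((\<lambda>t. u t X x) has_vector_derivative D t X x) (at t) \<and> norm (t *\<^sub>R D t X x) \<le> e * t ^ m"
      unfolding evt_at_def by auto
    have "norm (u t X x) \<le> e * t ^ m" if t: "0 < t" "t < d" and X: "X \<in> \<Theta>" and x: "x \<in> nb S \<rho>" for t X x
    proof (rule field_le_epsilon)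
      fix \<eta> :: real assume "\<eta> > 0"
      then have "evt_at \<rho> (\<lambda>t X x. norm (u t X x) \<le> \<eta> * t ^ 0)" using u' unfolding smallo_at_def by blast
      then obtain d' where d': "d' > 0" "\<And>t. 0 < t \<Longrightarrow> t < d' \<Longrightarrow> norm (u t X x) \<le> \<eta>"
        using X x unfolding evt_at_def by auto
      \<comment> \<open>Below \<open>d'\<close> the initial value is at most \<open>\<eta>\<close>,
        and s does not exceed t.\<close>
      define s where "s = min (t/2) (d'/2)"
      have s: "0 < s" "s < d'" "s \<le> t" using d' t by (auto simp: s_def)
      have "norm (u t X x - u s X x) \<le> (e * t ^ (m - 1)) * (t - s)"
      proof (rule mvt_bound_Icc)
        fix \<sigma> assume \<sigma>: "s \<le> \<sigma>" "\<sigma> \<le> t"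
        then have \<sigma>': "0 < \<sigma>" "\<sigma> < d" using s t by auto
        show "((\<lambda>t. u t X x) has_vector_derivative D \<sigma> X x) (at \<sigma>)" using d(2)[OF \<sigma>' X x] by blast
        have "\<sigma> * norm (D \<sigma> X x) \<le> \<sigma> * (e * \<sigma> ^ (m - 1))"
          using d(2)[OF \<sigma>' X x] \<sigma>' m by (simp add: power_eq_if mult_ac split: if_splits)
        then have "norm (D \<sigma> X x) \<le> e * \<sigma> ^ (m - 1)" using \<sigma>' by simp
        also have "\<dots> \<le> e * t ^ (m - 1)" using \<sigma> \<sigma>' \<open>0 < e\<close> by (intro mult_left_mono power_mono) auto
        finally show "norm (D \<sigma> X x) \<le> e * t ^ (m - 1)" .
      qed (use s in auto)
      also have "\<dots> \<le> (e * t ^ (m - 1)) * t" using s \<open>0 < e\<close> t by (intro mult_left_mono) auto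
      also have "\<dots> = e * t ^ m" using m by (simp add: power_eq_if mult_ac)
      finally have "norm (u t X x - u s X x) \<le> e * t ^ m" .
      moreover have "norm (u t X x) \<le> norm (u t X x - u s X x) + norm (u s X x)" by norm
      ultimately show "norm (u t X x) \<le> e * t ^ m + \<eta>" using d'(2)[OF s(1,2)] by linarith
    qed
    then show "evt_at \<rho> (\<lambda>t X x. norm (u t X x) \<le> e * t ^ m)" using d(1) unfolding evt_at_def by blast
  qed
  then show ?thesis using \<open>\<rho> > 0\<close> smallo_def by auto
qed

lemma lipo_tpow:
  assumes "lipo m g"
  shows "lipo (j + m) (\<lambda>t X x. t ^ j *\<^sub>R g t X x)"
proof -
  obtain \<rho> where \<rho>: "\<rho> > 0" "\<And>e. e > 0 \<Longrightarrow> evt_at \<rho> (\<lambda>t X x. lip_le \<rho> e m g t X x)" using assms unfolding lipo_def by auto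
  have "evt_at \<rho> (\<lambda>t X x. \<forall>y. dist x y < \<rho> \<longrightarrow>
      norm (t ^ j *\<^sub>R g t X x - t ^ j *\<^sub>R g t X y) \<le> e * t ^ (j + m) * norm (x - y))" if "e > 0" for e
  proof (rule evt_at_mono[OF \<rho>(2)[OF that]])
    fix t :: real and X x assume t: "0 < t" and a: "lip_le \<rho> e m g t X x"
    show "\<forall>y. dist x y < \<rho> \<longrightarrow>
      norm (t ^ j *\<^sub>R g t X x - t ^ j *\<^sub>R g t X y) \<le> e * t ^ (j + m) * norm (x - y)"
    proof (intro allI impI)
      fix y assume "dist x y < \<rho>"
      then have "t ^ j * norm (g t X x - g t X y) \<le> t ^ j * (e * t ^ m * norm (x - y))"
        using a t by (intro mult_left_mono) auto
      then show "norm (t ^ j *\<^sub>R g t X x - t ^ j *\<^sub>R g t X y) \<le> e * t ^ (j + m) * norm (x - y)"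
        using t by (simp add: scaleR_diff_right[symmetric] power_add mult_ac)
    qed
  qed auto
  then show ?thesis using \<rho>(1) unfolding lipo_def by auto
qed

lemma lipo_cong:
  assumes "lipo m g" "\<And>t X x. 0 < t \<Longrightarrow> X \<in> \<Theta> \<Longrightarrow> h t X x = g t X x"
  shows "lipo m h"
proof -
  obtain \<rho> where \<rho>: "\<rho> > 0" "\<And>e. e > 0 \<Longrightarrow> evt_at \<rho> (\<lambda>t X x. lip_le \<rho> e m g t X x)" using assms(1) unfolding lipo_def by auto
  show ?thesis unfolding lipo_def
    by (intro exI[of _ \<rho>] conjI allI impI \<rho>(1), rule evt_at_mono[OF \<rho>(2)]) (auto simp: assms(2))
qed

lemma lipo_scaleR_const:
  assumes "lipo m g" shows "lipo m (\<lambda>t X x. c *\<^sub>R g t X x)"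
proof -
  obtain \<rho> where \<rho>: "\<rho> > 0" "\<And>e. e > 0 \<Longrightarrow> evt_at \<rho> (\<lambda>t X x. lip_le \<rho> e m g t X x)" using assms(1) unfolding lipo_def by auto
  have "evt_at \<rho> (\<lambda>t X x. \<forall>y. dist x y < \<rho> \<longrightarrow>
      norm (c *\<^sub>R g t X x - c *\<^sub>R g t X y) \<le> e * t ^ m * norm (x - y))" if "e > 0" for e
  proof -
    have "0 < e / (\<bar>c\<bar> + 1)" using that by (simp add: add_nonneg_pos)
    then show ?thesis
    proof (rule evt_at_mono[OF \<rho>(2)])
      fix t :: real and X x assume t: "0 < t" and
        a: "lip_le \<rho> (e / (\<bar>c\<bar> + 1)) m g t X x"
      show "\<forall>y. dist x y < \<rho> \<longrightarrow>
        norm (c *\<^sub>R g t X x - c *\<^sub>R g t X y) \<le> e * t ^ m * norm (x - y)"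
      proof (intro allI impI)
        fix y assume "dist x y < \<rho>"
        then have "(\<bar>c\<bar> + 1) * norm (g t X x - g t X y) \<le> (\<bar>c\<bar> + 1) * (e / (\<bar>c\<bar> + 1) * t ^ m * norm (x - y))"
          using a t by (intro mult_left_mono) auto
        also have "\<dots> = e * t ^ m * norm (x - y)" by (simp add: add_nonneg_pos less_imp_neq[THEN not_sym])
        finally have "(\<bar>c\<bar> + 1) * norm (g t X x - g t X y) \<le> e * t ^ m * norm (x - y)" .
        moreover have "norm (c *\<^sub>R g t X x - c *\<^sub>R g t X y) \<le> (\<bar>c\<bar> + 1) * norm (g t X x - g t X y)"
          by (simp add: scaleR_diff_right[symmetric] mult_right_mono)
        ultimately show "norm (c *\<^sub>R g t X x - c *\<^sub>R g t X y) \<le> e * t ^ m * norm (x - y)" by linarith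
      qed
    qed auto
  qed
  then show ?thesis using \<rho>(1) unfolding lipo_def by auto
qed

text \<open>The argument of \<open>smallo_integrate\<close> applied to the difference of
  \<open>u\<close> at two points. The radius is halved so that the second point also lies where the
  estimates hold.\<close>

lemma lipo_integrate:
  assumes D: "lipo m D"
    and der: "evt (\<lambda>t X x. ((\<lambda>t. u t X x) has_vector_derivative D t X x) (at t))"
    and u0: "smallo 0 u"
  shows "lipo (Suc m) u"
proof -
  obtain \<rho>1 \<rho>2 \<rho>3 where \<rho>: "\<rho>1 > 0" "\<And>e. e > 0 \<Longrightarrow> evt_at \<rho>1 (\<lambda>t X x. lip_le \<rho>1 e m D t X x)"
    "\<rho>2 > 0" "evt_at \<rho>2 (\<lambda>t X x. ((\<lambda>t. u t X x) has_vector_derivative D t X x) (at t))"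
    "\<rho>3 > 0" "smallo_at \<rho>3 0 u"
    using D der u0 unfolding smallo_def evt_def lipo_def by auto
  define \<rho> where "\<rho> = min \<rho>1 (min \<rho>2 \<rho>3)"
  have "\<rho> > 0" using \<rho> by (simp add: \<rho>_def)
  have D': "\<And>e. e > 0 \<Longrightarrow> evt_at \<rho> (\<lambda>t X x. lip_le \<rho>1 e m D t X x)"
    by (rule evt_at_antimono[OF \<rho>(2)]) (simp_all add: \<rho>_def)
  have u': "smallo_at \<rho> 0 u" by (rule smallo_at_mono[OF \<rho>(6)]) (simp add: \<rho>_def)
  have der': "evt_at \<rho> (\<lambda>t X x. ((\<lambda>t. u t X x) has_vector_derivative D t X x) (at t))"
    by (rule evt_at_antimono[OF \<rho>(4)]) (simp add: \<rho>_def)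
  have "evt_at (\<rho>/2) (\<lambda>t X x. \<forall>y. dist x y < \<rho>/2 \<longrightarrow>
      norm (u t X x - u t X y) \<le> e * t ^ Suc m * norm (x - y))" if "e > 0" for e
  proof -
    from evt_at_conj[OF der' D'[OF that]] obtain d where d: "d > 0"
      "\<And>t X x. 0 < t \<Longrightarrow> t < d \<Longrightarrow> X \<in> \<Theta> \<Longrightarrow> x \<in> nb S \<rho> \<Longrightarrow>
        ((\<lambda>t. u t X x) has_vector_derivative D t X x) (at t) \<and>
        (lip_le \<rho>1 e m D t X x)"
      unfolding evt_at_def by auto
    have "norm (u t X x - u t X y) \<le> e * t ^ Suc m * norm (x - y)"
      if t: "0 < t" "t < d" and X: "X \<in> \<Theta>" and x2: "x \<in> nb S (\<rho>/2)" and xy: "dist x y < \<rho>/2" for t X x y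
    proof (rule field_le_epsilon)
      have y: "y \<in> nb S \<rho>" using nb_step[OF x2, of y "\<rho>/2"] xy by simp
      have x: "x \<in> nb S \<rho>" using x2 nb_mono[of "\<rho>/2" \<rho> S] \<open>\<rho> > 0\<close> by auto
      have xy1: "dist x y < \<rho>1" using xy \<open>\<rho> > 0\<close> by (simp add: \<rho>_def)
      fix \<eta> :: real assume "\<eta> > 0"
      then have "evt_at \<rho> (\<lambda>t X x. norm (u t X x) \<le> (\<eta>/2) * t ^ 0)" using u' unfolding smallo_at_def by (meson half_gt_zero)
      then obtain d' where d': "d' > 0" "\<And>t z. 0 < t \<Longrightarrow> t < d' \<Longrightarrow> z \<in> nb S \<rho> \<Longrightarrow> norm (u t X z) \<le> \<eta>/2"
        using X unfolding evt_at_def by auto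
      define s where "s = min (t/2) (d'/2)"
      have s: "0 < s" "s < d'" "s \<le> t" using d' t by (auto simp: s_def)
      define w where "w t = u t X x - u t X y" for t
      have "norm (w t - w s) \<le> (e * t ^ m * norm (x - y)) * (t - s)"
      proof (rule mvt_bound_Icc)
        fix \<sigma> assume \<sigma>: "s \<le> \<sigma>" "\<sigma> \<le> t"
        then have \<sigma>': "0 < \<sigma>" "\<sigma> < d" using s t by auto
        show "(w has_vector_derivative D \<sigma> X x - D \<sigma> X y) (at \<sigma>)"
          unfolding w_def using d(2)[OF \<sigma>' X x] d(2)[OF \<sigma>' X y] by (intro has_vector_derivative_diff) auto
        have "norm (D \<sigma> X x - D \<sigma> X y) \<le> e * \<sigma> ^ m * norm (x - y)" using d(2)[OF \<sigma>' X x] xy1 by blast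
        also have "\<dots> \<le> e * t ^ m * norm (x - y)"
          using \<sigma> \<sigma>' \<open>0 < e\<close> by (intro mult_left_mono mult_right_mono power_mono) auto
        finally show "norm (D \<sigma> X x - D \<sigma> X y) \<le> e * t ^ m * norm (x - y)" .
      qed (use s in auto)
      also have "\<dots> \<le> (e * t ^ m * norm (x - y)) * t" using s \<open>0 < e\<close> t by (intro mult_left_mono) auto
      also have "\<dots> = e * t ^ Suc m * norm (x - y)" by (simp add: mult_ac)
      finally have "norm (w t - w s) \<le> e * t ^ Suc m * norm (x - y)" .
      moreover have "norm (w t) \<le> norm (w t - w s) + norm (u s X x) + norm (u s X y)"
        unfolding w_def by norm
      ultimately show "norm (u t X x - u t X y) \<le> e * t ^ Suc m * norm (x - y) + \<eta>"
        using d'(2)[OF s(1,2) x] d'(2)[OF s(1,2) y] by (simp add: w_def)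
    qed
    then show ?thesis using d(1) unfolding evt_at_def by blast
  qed
  then show ?thesis using \<open>\<rho> > 0\<close> unfolding lipo_def by (intro exI[of _ "\<rho>/2"]) auto
qed

text \<open>The derivative of f(A x) - f(x) is the sum of (f'(A x) - f'(x)) A'(x) and f'(x) (A'(x) -
  1). The first term is small by \<open>df\<close>, the second because the Lipschitz constant of A -
  id bounds A' - 1. No second derivative of \<open>f\<close> enters.\<close>

lemma lipo_comp_diff:
  assumes f: "UCk 1 f" and A: "nid A" "lipo k (\<lambda>t X x. A t X x - x)"
    and dA: "evt (\<lambda>t X x. A t X differentiable (at x))"
    and df: "smallo k (\<lambda>t X x. dblin (f X) (A t X x) - dblin (f X) x)"
  shows "lipo k (\<lambda>t X x. f X (A t X x) - f X x)"
proof -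
  obtain B where B: "B \<ge> 0" "near (\<lambda>X x. norm (dblin (f X) x) \<le> B)"
    using UC_bounded[OF UC_dblin[OF f[unfolded One_nat_def]]] by blast
  have fd: "near (\<lambda>X x. f X differentiable (at x))" using f by simp
  obtain \<rho>1 where \<rho>1: "\<rho>1 > 0" "\<And>e. e > 0 \<Longrightarrow> evt_at \<rho>1 (\<lambda>t X x. \<forall>y. dist x y < \<rho>1 \<longrightarrow>
      norm ((A t X x - x) - (A t X y - y)) \<le> e * t ^ k * norm (x - y))"
    using A(2) unfolding lipo_def by auto
  obtain \<rho>2 where \<rho>2: "\<rho>2 > 0" "evt_at \<rho>2 (\<lambda>t X x. A t X differentiable (at x) \<and> norm (dblin (f X) x) \<le> B \<and>
      f X differentiable (at x) \<and> f X differentiable (at (A t X x)))"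
    using evt_conj[OF dA evt_conj[OF near_evt[OF B(2)] evt_conj[OF near_evt[OF fd] evt_comp[OF A(1) near_evt[OF fd]]]]]
    unfolding evt_def by auto
  obtain \<rho>3 where \<rho>3: "\<rho>3 > 0" "smallo_at \<rho>3 k (\<lambda>t X x. dblin (f X) (A t X x) - dblin (f X) x)"
    using df unfolding smallo_def by auto
  define \<rho> where "\<rho> = min \<rho>1 (min \<rho>2 \<rho>3)"
  have "\<rho> > 0" using \<rho>1 \<rho>2 \<rho>3 by (simp add: \<rho>_def)
  have "evt_at (\<rho>/2) (\<lambda>t X x. \<forall>y. dist x y < \<rho>/2 \<longrightarrow>
      norm ((f X (A t X x) - f X x) - (f X (A t X y) - f X y)) \<le> e * t ^ k * norm (x - y))" if "e > 0" for e
  proof -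
    \<comment> \<open>The bound \<open>c \<le> 1\<close> gives norm at most 2 for the derivative of
      \<open>A\<close>, and the two terms of the derivative then add up to
      \<open>(B + 2) * c\<close>.\<close>
    define c where "c = min 1 (e / (B + 2))"
    have c: "0 < c" "c \<le> 1" "(B + 2) * c \<le> e"
      using that B(1) by (auto simp: c_def min_def divide_simps mult_ac)
    have 1: "evt_at \<rho> (\<lambda>t X x. \<forall>y. dist x y < \<rho>1 \<longrightarrow>
        norm ((A t X x - x) - (A t X y - y)) \<le> c * t ^ k * norm (x - y))"
      using \<rho>1(2)[OF c(1)] by (rule evt_at_mono) (auto simp: \<rho>_def)
    have 2: "evt_at \<rho> (\<lambda>t X x. A t X differentiable (at x) \<and> norm (dblin (f X) x) \<le> B \<and>
      f X differentiable (at x) \<and> f X differentiable (at (A t X x)))"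
      using \<rho>2(2) by (rule evt_at_mono) (auto simp: \<rho>_def)
    have 3: "evt_at \<rho> (\<lambda>t X x. norm (dblin (f X) (A t X x) - dblin (f X) x) \<le> c * t ^ k)"
      using \<rho>3(2) c(1) unfolding smallo_at_def by (elim allE impE evt_at_mono) (auto simp: \<rho>_def)
    from evt_at_conj[OF evt_at_less[OF zero_less_one] evt_at_conj[OF 1 evt_at_conj[OF 2 3]]]
    obtain d where d: "d > 0" "\<And>t X x. 0 < t \<Longrightarrow> t < d \<Longrightarrow> X \<in> \<Theta> \<Longrightarrow> x \<in> nb S \<rho> \<Longrightarrow> t < 1 \<and>
        (\<forall>y. dist x y < \<rho>1 \<longrightarrow> norm ((A t X x - x) - (A t X y - y)) \<le> c * t ^ k * norm (x - y)) \<and>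
        (A t X differentiable (at x) \<and> norm (dblin (f X) x) \<le> B \<and>
      f X differentiable (at x) \<and> f X differentiable (at (A t X x))) \<and>
        norm (dblin (f X) (A t X x) - dblin (f X) x) \<le> c * t ^ k"
      unfolding evt_at_def by blast
    have "norm ((f X (A t X x) - f X x) - (f X (A t X y) - f X y)) \<le> e * t ^ k * norm (x - y)"
      if t: "0 < t" "t < d" and X: "X \<in> \<Theta>" and x: "x \<in> nb S (\<rho>/2)" and xy: "dist x y < \<rho>/2" for t X x y
    proof -
      have sub: "ball x (\<rho>/2) \<subseteq> nb S \<rho>" using ball_subset_nb[OF x, of "\<rho>/2"] by simp
      let ?A' = "\<lambda>z. frechet_derivative (A t X) (at z)"
      let ?h' = "\<lambda>z v. dblin (f X) (A t X z) (?A' z v) - dblin (f X) z v"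
      show ?thesis
      proof (rule lipschitz_segment[where C = "ball x (\<rho>/2)" and V' = ?h' and V = "\<lambda>z. f X (A t X z) - f X z"])
        fix z assume "z \<in> ball x (\<rho>/2)"
        then have z: "z \<in> nb S \<rho>" using sub by blast
        note dz = d(2)[OF t X z]
        have A': "(A t X has_derivative ?A' z) (at z)" using dz by (simp add: frechet_derivative_works[symmetric])
        show "((\<lambda>z. f X (A t X z) - f X z) has_derivative ?h' z) (at z)"
          using dz by (intro has_derivative_diff has_derivative_compose[OF A'] dblin_has_derivative) auto
        show "onorm (?h' z) \<le> e * t ^ k"
        proof (rule onorm_bound)
          fix v
          have "((\<lambda>z. A t X z - z) has_derivative (\<lambda>v. ?A' z v - v)) (at z)"
            by (intro has_derivative_diff A' has_derivative_ident)
          then have n1: "norm (?A' z v - v) \<le> c * t ^ k * norm v"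
            by (rule has_derivative_lipschitz_bound[OF _ \<rho>1(1)]) (use dz in blast)
          have "t ^ k \<le> 1" using t dz by (simp add: power_le_one)
          then have "c * t ^ k \<le> 1" using c(1,2) t by (meson mult_le_one less_imp_le zero_le_power)
          then have "c * t ^ k * norm v \<le> 1 * norm v" by (rule mult_right_mono) simp
          moreover have "norm (?A' z v) \<le> norm (?A' z v - v) + norm v" by norm
          ultimately have n2: "norm (?A' z v) \<le> 2 * norm v" using n1 by linarith
          have "?h' z v = (dblin (f X) (A t X z) - dblin (f X) z) (?A' z v) + dblin (f X) z (?A' z v - v)"
            by (simp add: blinfun.bilinear_simps)
          also have "norm \<dots> \<le> norm (dblin (f X) (A t X z) - dblin (f X) z) * norm (?A' z v)
              + norm (dblin (f X) z) * norm (?A' z v - v)"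
            by (intro norm_triangle_le add_mono norm_blinfun)
          also have "\<dots> \<le> (c * t ^ k) * (2 * norm v) + B * (c * t ^ k * norm v)"
            using dz n1 n2 c t B by (intro add_mono mult_mono) auto
          also have "\<dots> = ((B + 2) * c) * (t ^ k * norm v)" by (simp add: algebra_simps)
          also have "\<dots> \<le> e * (t ^ k * norm v)" using c t by (intro mult_right_mono) auto
          finally show "norm (?h' z v) \<le> e * t ^ k * norm v" by (simp add: mult_ac)
        qed (use \<open>e > 0\<close> t in auto)
      qed (use xy \<open>\<rho> > 0\<close> in auto)
    qed
    then show ?thesis using d(1) unfolding evt_at_def by blast
  qed
  then show ?thesis using \<open>\<rho> > 0\<close> unfolding lipo_def by (intro exI[of _ "\<rho>/2"]) auto
qed

text \<open>Here the Lipschitz estimates pay off: the derivative of a remainder along a bounded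
  velocity is at most its Lipschitz constant at the moved point times that bound.\<close>

lemma lipo_derivative_smallo:
  assumes g: "lipo m g" and A: "nid A"
    and g': "evt (\<lambda>t X x. (g t X has_derivative g' t X x) (at (A t X x)))"
    and v: "evt (\<lambda>t X x. norm (v t X x) \<le> B)"
  shows "smallo m (\<lambda>t X x. g' t X x (v t X x))"
proof -
  obtain \<rho> where \<rho>: "\<rho> > 0" "\<And>e. e > 0 \<Longrightarrow> evt_at \<rho> (\<lambda>t X x. lip_le \<rho> e m g t X x)" using g unfolding lipo_def by auto
  obtain \<rho>' where \<rho>': "\<rho>' > 0" "\<And>P. evt_at \<rho> P \<Longrightarrow> evt_at \<rho>' (\<lambda>t X x. P t X (A t X x))"
    using evt_comp_at[OF A \<rho>(1)] by blast
  obtain \<rho>2 where \<rho>2: "\<rho>2 > 0" "evt_at \<rho>2 (\<lambda>t X x. (g t X has_derivative g' t X x) (at (A t X x)) \<and> norm (v t X x) \<le> B)"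
    using evt_conj[OF g' v] unfolding evt_def by auto
  have "smallo_at (min \<rho>' \<rho>2) m (\<lambda>t X x. g' t X x (v t X x))"
    unfolding smallo_at_def
  proof (intro allI impI)
    fix e :: real assume e: "e > 0"
    define c where "c = e / (\<bar>B\<bar> + 1)"
    have c: "0 < c" "c * (\<bar>B\<bar> + 1) = e" using e by (auto simp: c_def add_nonneg_pos less_imp_neq[THEN not_sym])
    from evt_at_conj[OF evt_at_antimono[OF \<rho>'(2)[OF \<rho>(2)[OF c(1)]], of "min \<rho>' \<rho>2"] evt_at_antimono[OF \<rho>2(2), of "min \<rho>' \<rho>2"]]
    show "evt_at (min \<rho>' \<rho>2) (\<lambda>t X x. norm (g' t X x (v t X x)) \<le> e * t ^ m)"
    proof (rule evt_at_mono)
      fix t :: real and X x assume t: "0 < t"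
        and a: "(\<forall>y. dist (A t X x) y < \<rho> \<longrightarrow> norm (g t X (A t X x) - g t X y) \<le> c * t ^ m * norm (A t X x - y)) \<and>
          ((g t X has_derivative g' t X x) (at (A t X x)) \<and> norm (v t X x) \<le> B)"
      then have "norm (g' t X x (v t X x)) \<le> c * t ^ m * norm (v t X x)"
        by (intro has_derivative_lipschitz_bound[OF _ \<rho>(1)]) auto
      also have "\<dots> \<le> c * t ^ m * (\<bar>B\<bar> + 1)"
        using a c t by (intro mult_left_mono) auto
      also have "\<dots> = e * t ^ m" using c(2) by (simp add: mult_ac)
      finally show "norm (g' t X x (v t X x)) \<le> e * t ^ m" .
    qed auto
  qed
  then show ?thesis using \<rho>' \<rho>2 unfolding smallo_def by (intro exI[of _ "min \<rho>' \<rho>2"]) auto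
qed

end


section \<open>Expansions along compositions of flows\<close>

lemma has_vector_derivative_chain:
  assumes "(u has_vector_derivative u') (at t)" "(g has_derivative g') (at (u t))"
  shows "((\<lambda>t. g (u t)) has_vector_derivative g' u') (at t)"
proof -
  have "linear g'" using assms(2) has_derivative_linear by blast
  then have "g' (h *\<^sub>R u') = h *\<^sub>R g' u'" for h by (rule linear_scale)
  then show ?thesis
    using has_derivative_compose[OF assms(1)[unfolded has_vector_derivative_def] assms(2)]
    by (simp add: has_vector_derivative_def)
qed

lemma differentiable_snd:
  assumes "(\<lambda>(t, x). g t x) differentiable (at (t, x))"
  shows "g t differentiable (at x)"
proof -
  obtain P where P: "((\<lambda>(t, x). g t x) has_derivative P) (at (t, x))"
    using assms unfolding differentiable_def by blast
  have "((\<lambda>y. (t, y)) has_derivative (\<lambda>v. (0, v))) (at x)" by (auto intro!: derivative_eq_intros)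
  from has_derivative_compose[OF this P] show ?thesis unfolding differentiable_def by auto
qed

lemma has_vector_derivative_poly:
  "((\<lambda>t. \<Sum>b\<in>I. t ^ b *\<^sub>R a b) has_vector_derivative (\<Sum>b\<in>I. (real b * t ^ (b - 1)) *\<^sub>R a b)) (at t)"
  for a :: "nat \<Rightarrow> 'b::real_normed_vector"
proof (intro has_vector_derivative_sum)
  fix b
  have "((\<lambda>t. t ^ b) has_field_derivative (real b * t ^ (b - 1))) (at t)"
    using DERIV_pow[of b t] by simp
  from has_vector_derivative_scaleR[OF this has_vector_derivative_const[of "a b"]]
  show "((\<lambda>t. t ^ b *\<^sub>R a b) has_vector_derivative (real b * t ^ (b - 1)) *\<^sub>R a b) (at t)" by simp
qed

text \<open>The factor t compensates the truncated exponent \<open>b - 1\<close>; the term with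
  \<open>b = 0\<close> vanishes on both sides.\<close>

lemma scaleR_poly_derivative:
  "t *\<^sub>R (\<Sum>b\<in>I. (real b * t ^ (b - 1)) *\<^sub>R a b) = (\<Sum>b\<in>I. (real b * t ^ b) *\<^sub>R a b)"
  for a :: "nat \<Rightarrow> 'b::real_normed_vector"
proof -
  have "t *\<^sub>R (real b * t ^ (b - 1)) *\<^sub>R a b = (real b * t ^ b) *\<^sub>R a b" for b
    by (cases b) (simp_all add: mult_ac)
  then show ?thesis by (simp only: scaleR_sum_right)
qed

lemma sum_shift_le:
  fixes h :: "nat \<Rightarrow> 'b::comm_monoid_add"
  assumes "p \<le> m" "\<And>b. b < p \<Longrightarrow> h b = 0"
  shows "(\<Sum>b\<le>m. h b) = (\<Sum>c\<le>m - p. h (c + p))"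
proof -
  have "(\<Sum>b\<le>m. h b) = sum h {0 + p..(m - p) + p}"
    using assms by (intro sum.mono_neutral_right) auto
  also have "\<dots> = (\<Sum>c\<le>m - p. h (c + p))"
    unfolding sum.shift_bounds_cl_nat_ivl atMost_atLeast0 ..
  finally show ?thesis .
qed

lemma sum_shift_less:
  fixes h :: "nat \<Rightarrow> 'b::comm_monoid_add"
  assumes "p \<le> m" "\<And>b. b < p \<Longrightarrow> h b = 0"
  shows "(\<Sum>b<m. h b) = (\<Sum>c<m - p. h (c + p))"
proof -
  have "(\<Sum>b<m. h b) = sum h {0 + p..<(m - p) + p}"
    using assms by (intro sum.mono_neutral_right) auto
  also have "\<dots> = (\<Sum>c<m - p. h (c + p))"
    unfolding sum.shift_bounds_nat_ivl atLeast0LessThan ..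
  finally show ?thesis .
qed

text \<open>As t tends to 0 the bound forces the constant coefficient to vanish; division by t leads
  to the induction hypothesis.\<close>

lemma polynomial_smallo_imp_zero:
  fixes c :: "nat \<Rightarrow> 'b::real_normed_vector"
  assumes "\<And>e. e > 0 \<Longrightarrow> \<exists>d>0. \<forall>t. 0 < t \<longrightarrow> t < d \<longrightarrow> norm (\<Sum>b\<le>m. t ^ b *\<^sub>R c b) \<le> e * t ^ m"
  shows "b \<le> m \<Longrightarrow> c b = 0"
  using assms
proof (induction m arbitrary: c b)
  case 0
  have "norm (c 0) \<le> e" if "e > 0" for e
  proof -
    obtain d where "d > 0" "\<forall>t. 0 < t \<longrightarrow> t < d \<longrightarrow> norm (\<Sum>b\<le>0. t ^ b *\<^sub>R c b) \<le> e * t ^ 0"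
      using "0.prems"(2)[OF \<open>e > 0\<close>] by blast
    then show ?thesis using dense[of 0 d] by auto
  qed
  then have "norm (c 0) \<le> 0" by (rule field_le_epsilon[of _ 0, simplified])
  then show ?case using 0 by simp
next
  case (Suc m)
  define q where "q t = (\<Sum>b\<le>Suc m. t ^ b *\<^sub>R c b)" for t :: real
  have q: "q t = c 0 + t *\<^sub>R (\<Sum>b\<le>m. t ^ b *\<^sub>R c (Suc b))" for t
    unfolding q_def by (subst sum.atMost_Suc_shift) (simp add: scaleR_sum_right)
  have "continuous (at 0) q" unfolding q_def by (intro continuous_intros)
  then have "((\<lambda>t. norm (q t)) \<longlongrightarrow> norm (q 0)) (at_right 0)"
    by (intro tendsto_norm) (auto simp: continuous_at intro: tendsto_within_subset)
  have c0: "c 0 = 0"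
  proof -
    have "norm (q 0) \<le> 0"
    proof (rule tendsto_le[OF _ _ \<open>((\<lambda>t. norm (q t)) \<longlongrightarrow> norm (q 0)) (at_right 0)\<close>])
      show "((\<lambda>t. t ^ Suc m) \<longlongrightarrow> 0) (at_right (0::real))"
        by (auto intro!: tendsto_eq_intros)
      obtain d where d: "d > 0" "\<forall>t. 0 < t \<longrightarrow> t < d \<longrightarrow> norm (\<Sum>b\<le>Suc m. t ^ b *\<^sub>R c b) \<le> 1 * t ^ Suc m"
        using Suc.prems(2)[of 1] by auto
      then show "\<forall>\<^sub>F t in at_right 0. norm (q t) \<le> t ^ Suc m"
        unfolding eventually_at_right_field q_def by auto
    qed simp
    then show ?thesis by (simp add: q)
  qed
  have "c (Suc b) = 0" if "b \<le> m" for b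
  proof (rule Suc.IH[OF that])
    fix e :: real assume "e > 0"
    then obtain d where d: "d > 0" "\<forall>t. 0 < t \<longrightarrow> t < d \<longrightarrow> norm (\<Sum>b\<le>Suc m. t ^ b *\<^sub>R c b) \<le> e * t ^ Suc m"
      using Suc.prems(2)[of e] by auto
    show "\<exists>d>0. \<forall>t. 0 < t \<longrightarrow> t < d \<longrightarrow> norm (\<Sum>b\<le>m. t ^ b *\<^sub>R c (Suc b)) \<le> e * t ^ m"
    proof (intro exI[of _ d] conjI allI impI d(1))
      fix t :: real assume t: "0 < t" "t < d"
      have "norm (q t) \<le> e * t ^ Suc m" using d(2) t unfolding q_def by blast
      then have "t * norm (\<Sum>b\<le>m. t ^ b *\<^sub>R c (Suc b)) \<le> t * (e * t ^ m)"
        using t by (simp add: q c0 mult_ac)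
      then show "norm (\<Sum>b\<le>m. t ^ b *\<^sub>R c (Suc b)) \<le> e * t ^ m" using t by simp
    qed
  qed
  then show ?case using c0 Suc.prems(1) by (cases b) auto
qed

context germs
begin

text \<open>The field and the point are held fixed while t tends to 0. The same neighbourhood serves
  all accuracies, so every point of it is admissible.\<close>

lemma smallo_poly_unique:
  assumes "smallo m (\<lambda>t X x. \<Sum>b\<le>m. t ^ b *\<^sub>R c b X x)"
  shows "near (\<lambda>X x. \<forall>b\<le>m. c b X x = 0)"
proof -
  obtain \<rho> where \<rho>: "\<rho> > 0" "smallo_at \<rho> m (\<lambda>t X x. \<Sum>b\<le>m. t ^ b *\<^sub>R c b X x)"
    using assms unfolding smallo_def by auto
  have "c b X x = 0" if X: "X \<in> \<Theta>" and x: "x \<in> nb S \<rho>" and "b \<le> m" for b X x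
  proof (rule polynomial_smallo_imp_zero[OF _ \<open>b \<le> m\<close>])
    fix e :: real assume "e > 0"
    then have "evt_at \<rho> (\<lambda>t X x. norm (\<Sum>b\<le>m. t ^ b *\<^sub>R c b X x) \<le> e * t ^ m)"
      using \<rho>(2) by (simp add: smallo_at_def)
    then show "\<exists>d>0. \<forall>t. 0 < t \<longrightarrow> t < d \<longrightarrow> norm (\<Sum>b\<le>m. t ^ b *\<^sub>R c b X x) \<le> e * t ^ m"
      using X x unfolding evt_at_def by blast
  qed
  then show ?thesis using \<rho>(1) unfolding near_def by blast
qed

lemma smallo_UC_tpow:
  assumes "UC a" "m < b"
  shows "smallo m (\<lambda>t X x. t ^ b *\<^sub>R a X x)"
proof -
  obtain B where "B \<ge> 0" "near (\<lambda>X x. norm (a X x) \<le> B)" using UC_bounded[OF assms(1)] by blast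
  then have "evt (\<lambda>t X x. norm (t ^ b *\<^sub>R a X x) \<le> B * t ^ b)"
    by (intro evt_mono[OF near_evt]) (auto simp: mult.commute intro: mult_right_mono)
  then show ?thesis by (rule smallo_bigo[OF _ assms(2)])
qed

text \<open>\<open>F\<close> has an expansion of order \<open>m\<close> which \<open>D\<close>, its derivative in \<open>t\<close>, inherits.  The factor \<open>t\<close> before
  \<open>D\<close> gives both remainders the same order; for \<open>m = 0\<close> the choice \<open>D = 0\<close> is then always possible.\<close>

definition Expd :: "nat \<Rightarrow> (real \<Rightarrow> 'x \<Rightarrow> 'a \<Rightarrow> 'b::real_normed_vector) \<Rightarrow> (real \<Rightarrow> 'x \<Rightarrow> 'a \<Rightarrow> 'b) \<Rightarrow> bool" where
  "Expd m F D \<longleftrightarrow> (\<exists>a. (\<forall>b\<le>m. UCk (m - b) (a b)) \<and>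
     smallo m (\<lambda>t X x. F t X x - (\<Sum>b\<le>m. t ^ b *\<^sub>R a b X x)) \<and>
     smallo m (\<lambda>t X x. t *\<^sub>R D t X x - (\<Sum>b\<le>m. (real b * t ^ b) *\<^sub>R a b X x)))"

lemma Expd_add:
  assumes "Expd m F D" "Expd m F' D'"
  shows "Expd m (\<lambda>t X x. F t X x + F' t X x) (\<lambda>t X x. D t X x + D' t X x)"
proof -
  from assms obtain a a' where
    a: "\<forall>b\<le>m. UCk (m - b) (a b)" "smallo m (\<lambda>t X x. F t X x - (\<Sum>b\<le>m. t ^ b *\<^sub>R a b X x))"
    "smallo m (\<lambda>t X x. t *\<^sub>R D t X x - (\<Sum>b\<le>m. (real b * t ^ b) *\<^sub>R a b X x))"
    and a': "\<forall>b\<le>m. UCk (m - b) (a' b)" "smallo m (\<lambda>t X x. F' t X x - (\<Sum>b\<le>m. t ^ b *\<^sub>R a' b X x))"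
    "smallo m (\<lambda>t X x. t *\<^sub>R D' t X x - (\<Sum>b\<le>m. (real b * t ^ b) *\<^sub>R a' b X x))"
    unfolding Expd_def by auto
  show ?thesis unfolding Expd_def
  proof (intro exI[of _ "\<lambda>b X x. a b X x + a' b X x"] conjI)
    show "\<forall>b\<le>m. UCk (m - b) (\<lambda>X x. a b X x + a' b X x)" using a(1) a'(1) by (auto intro: UCk_add)
    show "smallo m (\<lambda>t X x. F t X x + F' t X x - (\<Sum>b\<le>m. t ^ b *\<^sub>R (a b X x + a' b X x)))"
      by (rule smallo_cong'[OF smallo_add[OF a(2) a'(2)]]) (simp add: algebra_simps sum.distrib)
    show "smallo m (\<lambda>t X x. t *\<^sub>R (D t X x + D' t X x) - (\<Sum>b\<le>m. (real b * t ^ b) *\<^sub>R (a b X x + a' b X x)))"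
      by (rule smallo_cong'[OF smallo_add[OF a(3) a'(3)]]) (simp add: algebra_simps sum.distrib)
  qed
qed

lemma Expd_zero: "Expd m (\<lambda>t X x. 0) (\<lambda>t X x. 0)"
  unfolding Expd_def by (intro exI[of _ "\<lambda>b X x. 0"]) (simp add: UCk_const smallo_zero)

lemma Expd_sum:
  assumes "\<And>i. i \<in> I \<Longrightarrow> Expd m (F i) (D i)"
  shows "Expd m (\<lambda>t X x. \<Sum>i\<in>I. F i t X x) (\<lambda>t X x. \<Sum>i\<in>I. D i t X x)"
  using assms
proof (induction I rule: infinite_finite_induct)
  case (insert i I) then show ?case by (simp add: Expd_add)
qed (simp_all add: Expd_zero)

text \<open>Multiplication by t^j shifts the coefficients by j degrees, and
  \<open>m - (b - j)\<close> is exactly the class required in degree b of an expansion of order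
  \<open>j + m\<close>. The derivative follows the product rule.\<close>

lemma Expd_tpow:
  assumes "Expd m F D"
  shows "Expd (j + m) (\<lambda>t X x. t ^ j *\<^sub>R F t X x)
    (\<lambda>t X x. (real j * t ^ (j - 1)) *\<^sub>R F t X x + t ^ j *\<^sub>R D t X x)"
proof -
  from assms obtain a where
    a: "\<forall>b\<le>m. UCk (m - b) (a b)" "smallo m (\<lambda>t X x. F t X x - (\<Sum>b\<le>m. t ^ b *\<^sub>R a b X x))"
    "smallo m (\<lambda>t X x. t *\<^sub>R D t X x - (\<Sum>b\<le>m. (real b * t ^ b) *\<^sub>R a b X x))"
    unfolding Expd_def by auto
  define a' where "a' b = (if b < j then (\<lambda>X x. 0) else a (b - j))" for b
  have s1: "(\<Sum>b\<le>j + m. t ^ b *\<^sub>R a' b X x) = t ^ j *\<^sub>R (\<Sum>c\<le>m. t ^ c *\<^sub>R a c X x)" for t X x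
    by (subst sum_shift_le[where p = j]) (auto simp: a'_def scaleR_sum_right power_add mult_ac)
  have s2: "(\<Sum>b\<le>j + m. (real b * t ^ b) *\<^sub>R a' b X x) =
      (real j * t ^ j) *\<^sub>R (\<Sum>c\<le>m. t ^ c *\<^sub>R a c X x) + t ^ j *\<^sub>R (\<Sum>c\<le>m. (real c * t ^ c) *\<^sub>R a c X x)" for t X x
    by (subst sum_shift_le[where p = j])
       (auto simp: a'_def scaleR_sum_right power_add algebra_simps sum.distrib[symmetric])
  \<comment> \<open>For \<open>j = 0\<close> the truncated exponent is wrong, but then the term
    carries the factor 0.\<close>
  have tj: "j = 0 \<or> t * t ^ (j - Suc 0) = t ^ j" for t :: real
    by (cases j) auto
  show ?thesis unfolding Expd_def
  proof (intro exI[of _ a'] conjI)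
    show "\<forall>b\<le>j + m. UCk (j + m - b) (a' b)"
    proof (intro allI impI)
      fix b assume b: "b \<le> j + m"
      show "UCk (j + m - b) (a' b)"
      proof (cases "b < j")
        case False
        then have "j + m - b = m - (b - j)" "b - j \<le> m" using b by auto
        then show ?thesis using a(1) False by (metis a'_def)
      qed (simp add: a'_def UCk_const)
    qed
    show "smallo (j + m) (\<lambda>t X x. t ^ j *\<^sub>R F t X x - (\<Sum>b\<le>j + m. t ^ b *\<^sub>R a' b X x))"
      by (rule smallo_cong'[OF smallo_tpow[OF a(2)]]) (simp add: s1 scaleR_diff_right)
    show "smallo (j + m) (\<lambda>t X x. t *\<^sub>R ((real j * t ^ (j - 1)) *\<^sub>R F t X x + t ^ j *\<^sub>R D t X x)
        - (\<Sum>b\<le>j + m. (real b * t ^ b) *\<^sub>R a' b X x))"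
      by (rule smallo_cong'[OF smallo_add[OF smallo_scaleR_const[OF smallo_tpow[OF a(2)], where c = "real j"] smallo_tpow[OF a(3)]]])
         (use tj in \<open>auto simp: s2 algebra_simps\<close>)
  qed
qed

lemma Expd_perturb:
  assumes "Expd m F D" "smallo m (\<lambda>t X x. F' t X x - F t X x)" "smallo m (\<lambda>t X x. t *\<^sub>R D' t X x - t *\<^sub>R D t X x)"
  shows "Expd m F' D'"
proof -
  from assms(1) obtain a where
    a: "\<forall>b\<le>m. UCk (m - b) (a b)" "smallo m (\<lambda>t X x. F t X x - (\<Sum>b\<le>m. t ^ b *\<^sub>R a b X x))"
    "smallo m (\<lambda>t X x. t *\<^sub>R D t X x - (\<Sum>b\<le>m. (real b * t ^ b) *\<^sub>R a b X x))"
    unfolding Expd_def by auto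
  have "smallo m (\<lambda>t X x. F' t X x - (\<Sum>b\<le>m. t ^ b *\<^sub>R a b X x))"
    by (rule smallo_cong'[OF smallo_add[OF a(2) assms(2)]]) simp
  moreover have "smallo m (\<lambda>t X x. t *\<^sub>R D' t X x - (\<Sum>b\<le>m. (real b * t ^ b) *\<^sub>R a b X x))"
    by (rule smallo_cong'[OF smallo_add[OF a(3) assms(3)]]) simp
  ultimately show ?thesis using a(1) unfolding Expd_def by auto
qed

lemma Expd_const:
  assumes "UCk m f"
  shows "Expd m (\<lambda>t. f) (\<lambda>t X x. 0)"
proof -
  have e1: "(\<Sum>b\<le>m. t ^ b *\<^sub>R (if b = 0 then f else (\<lambda>X x. 0)) X x) = f X x" for t X x
    using sum.remove[of "{..m}" 0 "\<lambda>b. t ^ b *\<^sub>R (if b = 0 then f else (\<lambda>X x. 0)) X x"] by simp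
  have e2: "(\<Sum>b\<le>m. (real b * t ^ b) *\<^sub>R (if b = 0 then f else (\<lambda>X x. 0)) X x) = 0" for t X x
    by (rule sum.neutral) simp
  show ?thesis unfolding Expd_def
    by (intro exI[of _ "\<lambda>b. if b = 0 then f else (\<lambda>X x. 0)"] conjI)
       (auto simp: e1 e2 smallo_zero UCk_const assms)
qed

text \<open>For \<open>j = 0\<close> uniform continuity suffices and the rate of the displacement is
  immaterial; for positive j the function is Lipschitz, and O(t^s) is o(t^j).\<close>

lemma UCk_comp_smallo:
  assumes "UCk j f" "nid A" "evt (\<lambda>t X x. norm (A t X x - x) \<le> C * t ^ s)" "j < s"
  shows "smallo j (\<lambda>t X x. f X (A t X x) - f X x)"
proof (cases j)
  case 0
  then show ?thesis using UC_smallo[OF UCk_UC[OF assms(1)] assms(2)] by simp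
next
  case (Suc i)
  obtain B where B: "evt (\<lambda>t X x. norm (f X (A t X x) - f X x) \<le> B * norm (A t X x - x))"
    using UCk_comp_bound[OF assms(1)[unfolded Suc] assms(2)] by blast
  have "smallo j (\<lambda>t X x. A t X x - x)" by (rule smallo_bigo[OF assms(3,4)])
  from smallo_bound[OF this B] show ?thesis .
qed

end

text \<open>An axiomatic form of the motions exp(t^p X), sufficient for the expansions. The factor
  \<open>real (p e) * t ^ (p e - 1)\<close> stems from the time change t^p. For \<open>r = 2\<close>
  and weight 2 the maximum with 1 is the additional C^1 assumption on X_0.\<close>

locale steps = germs \<Theta> S for \<Theta> :: "'x set" and S :: "'a::euclidean_space set" +
  fixes st :: "'e \<Rightarrow> real \<Rightarrow> 'x \<Rightarrow> 'a \<Rightarrow> 'a" and vf :: "'e \<Rightarrow> 'x \<Rightarrow> 'a \<Rightarrow> 'a" and p :: "'e \<Rightarrow> nat"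
    and E :: "'e set" and r :: nat
  assumes p: "e \<in> E \<Longrightarrow> p e = 1 \<or> p e = 2"
    and r: "1 \<le> r"
    and bounded_S: "bounded S"
    and vf: "e \<in> E \<Longrightarrow> UCk (max 1 (r - p e)) (vf e)"
    and st_near: "e \<in> E \<Longrightarrow> \<exists>C. evt (\<lambda>t X x. norm (st e t X x - x) \<le> C * t ^ p e)"
    and st_lip: "e \<in> E \<Longrightarrow> k < p e \<Longrightarrow> lipo k (\<lambda>t X x. st e t X x - x)"
    and st_der: "e \<in> E \<Longrightarrow> evt (\<lambda>t X x. ((\<lambda>t. st e t X x) has_vector_derivative
          (real (p e) * t ^ (p e - 1)) *\<^sub>R vf e X (st e t X x)) (at t))"
    and st_diff: "e \<in> E \<Longrightarrow> evt (\<lambda>t X x. (\<lambda>(t, x). st e t X x) differentiable (at (t, x)))"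
begin

lemma p_pos: "e \<in> E \<Longrightarrow> 0 < p e"
  using p by force

lemma nid_st: "e \<in> E \<Longrightarrow> nid (st e)"
  unfolding nid_def using st_near by (auto intro: smallo_bigo p_pos)

text \<open>The class drops by the weight and not by one, since a field of weight 2 is in general
  only of class r - 2. This is what makes weights count orders of t and of regularity alike.\<close>

lemma UCk_lie_vf:
  assumes "e \<in> E" "UCk m f" "m \<le> r" "p e \<le> m"
  shows "UCk (m - p e) (lie (vf e) f)"
proof (rule UCk_lie)
  show "UCk (m - p e) (vf e)" using vf[OF assms(1)] by (rule UCk_mono) (use assms in auto)
  show "UCk (Suc (m - p e)) f" using assms(2) by (rule UCk_mono) (use assms p_pos[OF assms(1)] in auto)
qed

lemma st_comp_der:
  assumes "e \<in> E" "UCk (Suc k) f"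
  shows "evt (\<lambda>t X x. ((\<lambda>t. f X (st e t X x)) has_vector_derivative
          (real (p e) * t ^ (p e - 1)) *\<^sub>R lie (vf e) f X (st e t X x)) (at t))"
proof -
  have "near (\<lambda>X x. f X differentiable (at x))" using assms(2) by simp
  from evt_conj[OF st_der[OF assms(1)] evt_comp[OF nid_st[OF assms(1)] near_evt[OF this]]]
  show ?thesis
  proof (rule evt_mono)
    fix t X x
    assume a: "((\<lambda>t. st e t X x) has_vector_derivative (real (p e) * t ^ (p e - 1)) *\<^sub>R vf e X (st e t X x)) (at t)
      \<and> f X differentiable (at (st e t X x))"
    then have "(f X has_derivative frechet_derivative (f X) (at (st e t X x))) (at (st e t X x))"
      by (simp add: frechet_derivative_works[symmetric])
    from has_vector_derivative_chain[OF conjunct1[OF a] this]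
    show "((\<lambda>t. f X (st e t X x)) has_vector_derivative
          (real (p e) * t ^ (p e - 1)) *\<^sub>R lie (vf e) f X (st e t X x)) (at t)"
      using linear_frechet_derivative[OF conjunct2[OF a]] by (simp add: lie_def linear_scale)
  qed
qed

lemma st_space_diff: "e \<in> E \<Longrightarrow> evt (\<lambda>t X x. st e t X differentiable (at x))"
  by (rule evt_mono[OF st_diff]) (auto dest: differentiable_snd)

text \<open>The partial derivatives are of class \<open>p e - 1\<close> and the displacement is
  O(t^p), one order better than their class.\<close>

lemma st_dblin_smallo:
  assumes "e \<in> E" "UCk (p e) f"
  shows "smallo (p e - 1) (\<lambda>t X x. dblin (f X) (st e t X x) - dblin (f X) x)"
proof -
  obtain C where C: "evt (\<lambda>t X x. norm (st e t X x - x) \<le> C * t ^ p e)" using st_near[OF assms(1)] by blast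
  obtain j where j: "p e = Suc j" using p_pos[OF assms(1)] by (cases "p e") auto
  have "smallo j (\<lambda>t X x. \<Sum>b\<in>Basis. blinfun_scaleR_left (partial b (f X) (st e t X x) - partial b (f X) x) o\<^sub>L blinfun_inner_left b)"
    using assms(2) j C
    by (intro smallo_sum smallo_linear[OF bounded_linear_partial_blinfun] UCk_comp_smallo[OF _ nid_st[OF assms(1)] C]) auto
  moreover have "dblin (f X) y - dblin (f X) x =
      (\<Sum>b\<in>Basis. blinfun_scaleR_left (partial b (f X) y - partial b (f X) x) o\<^sub>L blinfun_inner_left b)" for X x y
    by (rule blinfun_eqI)
       (simp add: dblin_apply blinfun.bilinear_simps blinfun.sum_left scaleR_diff_right sum_subtractf inner_commute)
  ultimately show ?thesis using j by simp
qed

text \<open>The estimates follow by integration in \<open>t\<close> from those for \<^term>\<open>lie (vf e) f\<close>, except for the Lipschitz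
  estimate if \<open>m = p e\<close>: then \<^term>\<open>lie (vf e) f\<close> is merely continuous, and the derivative in \<open>x\<close> is
  estimated instead.\<close>

lemma step_expansion:
  assumes e: "e \<in> E"
  shows "UCk m f \<Longrightarrow> m \<le> r \<Longrightarrow> \<exists>a D. (\<forall>b\<le>m. UCk (m - b) (a b)) \<and>
     smallo m (\<lambda>t X x. f X (st e t X x) - (\<Sum>b\<le>m. t ^ b *\<^sub>R a b X x)) \<and>
     smallo m (\<lambda>t X x. t *\<^sub>R D t X x - (\<Sum>b\<le>m. (real b * t ^ b) *\<^sub>R a b X x)) \<and>
     (0 < m \<longrightarrow> evt (\<lambda>t X x. ((\<lambda>t. f X (st e t X x)) has_vector_derivative D t X x) (at t)) \<and>
        lipo (m - 1) (\<lambda>t X x. f X (st e t X x) - (\<Sum>b<m. t ^ b *\<^sub>R a b X x)))"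
proof (induction m arbitrary: f rule: less_induct)
  case (less m)
  note f = less.prems(1)
  note nid = nid_st[OF e]
  obtain C where C: "evt (\<lambda>t X x. norm (st e t X x - x) \<le> C * t ^ p e)" using st_near[OF e] by blast
  \<comment> \<open>Applied with \<open>k = 1\<close> when the weight 2 exceeds
    \<open>m = 1\<close>, and with \<open>k = p e = m\<close> in the exceptional case.\<close>
  have lip_diff: "lipo (k - 1) (\<lambda>t X x. f X (st e t X x) - f X x)"
    if "k = 1 \<or> k = p e" "UCk k f" for k
  proof (rule lipo_comp_diff[OF _ nid _ st_space_diff[OF e]])
    show "UCk 1 f" by (rule UCk_mono[of k]) (use that p_pos[OF e] in auto)
    show "lipo (k - 1) (\<lambda>t X x. st e t X x - x)" using that p_pos[OF e] by (intro st_lip[OF e]) auto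
    show "smallo (k - 1) (\<lambda>t X x. dblin (f X) (st e t X x) - dblin (f X) x)"
      using that(1)
    proof
      assume "k = 1"
      then show ?thesis using UC_smallo[OF UC_dblin[of 0 f] nid] that by simp
    qed (use st_dblin_smallo[OF e] that in blast)
  qed
  \<comment> \<open>The expansion in which the motion is not visible, with \<open>f\<close> itself
    in degree 0; it is the right one as long as \<open>m < p e\<close>.\<close>
  define f0 where "f0 b = (if b = (0::nat) then f else (\<lambda>X x. 0))" for b
  have f0_sum: "(\<Sum>b\<le>m. t ^ b *\<^sub>R f0 b X x) = f X x" "(\<Sum>b\<le>m. (real b * t ^ b) *\<^sub>R f0 b X x) = 0"
    "0 < m \<Longrightarrow> (\<Sum>b<m. t ^ b *\<^sub>R f0 b X x) = f X x" for t X x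
    using sum.remove[of "{..m}" 0 "\<lambda>b. t ^ b *\<^sub>R f0 b X x"] sum.remove[of "{..<m}" 0 "\<lambda>b. t ^ b *\<^sub>R f0 b X x"]
    by (auto simp: f0_def intro: sum.neutral)
  \<comment> \<open>As the weights are 1 and 2, \<open>m < p e\<close> leaves only order 0 and order
    1 with weight 2.\<close>
  consider "m = 0" | "m = 1" "p e = 2" | "p e \<le> m" using p[OF e] by linarith
  then show ?case
  proof cases
    case 1
    show ?thesis
      by (rule exI[of _ f0], rule exI[of _ "\<lambda>t X x. 0"])
         (use f 1 UC_smallo[OF UCk_UC[OF f] nid] in \<open>simp add: f0_def smallo_zero\<close>)
  next
    case 2
    define D where "D t X x = (real (p e) * t ^ (p e - 1)) *\<^sub>R lie (vf e) f X (st e t X x)" for t X x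
    have f1: "UCk (Suc 0) f" using f 2 by simp
    have "UCk 0 (lie (vf e) f)" by (rule UCk_lie[OF UCk_mono[OF vf[OF e]] f1]) simp
    then obtain B where B: "B \<ge> 0" "near (\<lambda>X x. norm (lie (vf e) f X x) \<le> B)" using UC_bounded by auto
    have "evt (\<lambda>t X x. norm (t *\<^sub>R D t X x) \<le> (2 * B) * t ^ 2)"
    proof (rule evt_mono[OF evt_comp[OF nid near_evt[OF B(2)]]])
      fix t :: real and X x assume "0 < t" "norm (lie (vf e) f X (st e t X x)) \<le> B"
      then have "(t * (2 * t)) * norm (lie (vf e) f X (st e t X x)) \<le> (t * (2 * t)) * B"
        by (intro mult_left_mono) auto
      then show "norm (t *\<^sub>R D t X x) \<le> (2 * B) * t ^ 2" using 2 \<open>0 < t\<close>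
        by (simp add: D_def power2_eq_square mult_ac)
    qed
    then have tD: "smallo 1 (\<lambda>t X x. t *\<^sub>R D t X x)" by (rule smallo_bigo) simp
    have "smallo 1 (\<lambda>t X x. f X (st e t X x) - f X x)"
      using UCk_comp_smallo[OF _ nid C, of 1 f] f 2 by simp
    moreover have "lipo 0 (\<lambda>t X x. f X (st e t X x) - f X x)" using lip_diff[of 1] f 2 by simp
    moreover have "evt (\<lambda>t X x. ((\<lambda>t. f X (st e t X x)) has_vector_derivative D t X x) (at t))"
      using st_comp_der[OF e f1] unfolding D_def .
    moreover have "\<forall>b\<le>m. UCk (m - b) (f0 b)" using f 2 by (auto simp: f0_def UCk_const)
    moreover have "0 < m" using 2 by simp
    moreover have "(\<Sum>b<(1::nat). f0 b X x) = f X x" for X x by (simp add: f0_def)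
    ultimately show ?thesis
      by (intro exI[of _ f0] exI[of _ D]) (use tD in \<open>simp add: f0_sum[unfolded 2(1)] 2(1) del: One_nat_def\<close>)
  next
    case 3
    have m: "0 < m" using 3 p_pos[OF e] by simp
    define g where "g = lie (vf e) f"
    define c where "c = real (p e)"
    have cpos: "c > 0" using p_pos[OF e] by (simp add: c_def)
    have g: "UCk (m - p e) g" unfolding g_def by (rule UCk_lie_vf[OF e f less.prems(2) 3])
    obtain a' D' where a': "\<forall>b\<le>m - p e. UCk (m - p e - b) (a' b)"
      "smallo (m - p e) (\<lambda>t X x. g X (st e t X x) - (\<Sum>b\<le>m - p e. t ^ b *\<^sub>R a' b X x))"
      "0 < m - p e \<Longrightarrow> lipo (m - p e - 1) (\<lambda>t X x. g X (st e t X x) - (\<Sum>b<m - p e. t ^ b *\<^sub>R a' b X x))"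
      using less.IH[OF _ g] less.prems(2) m p_pos[OF e] by (auto simp: le_diff_conv)
    \<comment> \<open>The t-derivative is \<open>c * t ^ (p e - 1)\<close> times the motion applied
      to g. Integrating its term of degree b - 1 yields the factor \<open>c / real b\<close> and the
      coefficient of g in degree \<open>b - p e\<close>.\<close>
    define a where "a b = (if b = 0 then f else if b < p e then (\<lambda>X x. 0) else (\<lambda>X x. (c / real b) *\<^sub>R a' (b - p e) X x))" for b
    define D where "D t X x = (c * t ^ (p e - 1)) *\<^sub>R g X (st e t X x)" for t X x
    have f1: "UCk (Suc (m - 1)) f" using f m by simp
    have der: "evt (\<lambda>t X x. ((\<lambda>t. f X (st e t X x)) has_vector_derivative D t X x) (at t))"
      using st_comp_der[OF e f1] unfolding D_def c_def g_def .
    have a: "UCk (m - b) (a b)" if "b \<le> m" for b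
    proof -
      have "UCk (m - b) (a' (b - p e))" if "p e \<le> b"
        using that \<open>b \<le> m\<close> a'(1)[rule_format, of "b - p e"] by (simp add: diff_le_mono)
      then show ?thesis using f that by (auto simp: a_def UCk_const intro!: UCk_scaleR_const)
    qed
    have ba: "(real b * s) *\<^sub>R a b X x = (if b < p e then 0 else (c * s) *\<^sub>R a' (b - p e) X x)" for b s X x
      using p_pos[OF e] by (auto simp: a_def)
    have tp: "t * t ^ (p e - 1) = t ^ p e" for t :: real using p_pos[OF e] by (simp add: power_eq_if)
    have sum_le: "(\<Sum>b\<le>m. (real b * t ^ b) *\<^sub>R a b X x) = (c * t ^ p e) *\<^sub>R (\<Sum>b\<le>m - p e. t ^ b *\<^sub>R a' b X x)" for t X x
      unfolding ba by (subst sum_shift_le[OF 3]) (auto simp: scaleR_sum_right power_add mult_ac)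
    have sum_less: "(\<Sum>b<m. (real b * t ^ (b - 1)) *\<^sub>R a b X x) = (c * t ^ (p e - 1)) *\<^sub>R (\<Sum>b<m - p e. t ^ b *\<^sub>R a' b X x)" for t X x
      unfolding ba using p_pos[OF e] by (subst sum_shift_less[OF 3])
        (auto simp: scaleR_sum_right mult_ac power_add[symmetric] intro!: sum.cong)
    have tD: "smallo m (\<lambda>t X x. t *\<^sub>R D t X x - (\<Sum>b\<le>m. (real b * t ^ b) *\<^sub>R a b X x))"
    proof (rule smallo_cong')
      show "smallo m (\<lambda>t X x. c *\<^sub>R (t ^ p e *\<^sub>R (g X (st e t X x) - (\<Sum>b\<le>m - p e. t ^ b *\<^sub>R a' b X x))))"
        by (intro smallo_scaleR_const smallo_tpow'[OF a'(2)]) (use 3 in simp)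
      show "t *\<^sub>R D t X x - (\<Sum>b\<le>m. (real b * t ^ b) *\<^sub>R a b X x) =
          c *\<^sub>R (t ^ p e *\<^sub>R (g X (st e t X x) - (\<Sum>b\<le>m - p e. t ^ b *\<^sub>R a' b X x)))" for t X x
        unfolding sum_le D_def by (simp add: scaleR_diff_right tp[symmetric] mult_ac)
    qed
    \<comment> \<open>The remainders tend to 0 with t, which is the initial condition for the
      integrations below. The set \<open>I\<close> covers both the sum up to m and the sum below
      m.\<close>
    have lim: "smallo 0 (\<lambda>t X x. f X (st e t X x) - (\<Sum>b\<in>I. t ^ b *\<^sub>R a b X x))"
      if I: "I \<subseteq> {..m}" "0 \<in> I" "finite I" for I
    proof (rule smallo_cong')
      show "smallo 0 (\<lambda>t X x. (f X (st e t X x) - f X x) - (\<Sum>b\<in>I - {0}. t ^ b *\<^sub>R a b X x))"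
        by (intro smallo_diff UC_smallo[OF UCk_UC[OF f] nid] smallo_sum smallo_UC_tpow UCk_UC[OF a]) (use I in auto)
      show "f X (st e t X x) - (\<Sum>b\<in>I. t ^ b *\<^sub>R a b X x) =
          (f X (st e t X x) - f X x) - (\<Sum>b\<in>I - {0}. t ^ b *\<^sub>R a b X x)" for t X x
        using sum.remove[OF I(3,2), of "\<lambda>b. t ^ b *\<^sub>R a b X x"] by (simp add: a_def)
    qed
    have C0: "smallo m (\<lambda>t X x. f X (st e t X x) - (\<Sum>b\<le>m. t ^ b *\<^sub>R a b X x))"
    proof (rule smallo_integrate[OF m])
      show "smallo m (\<lambda>t X x. t *\<^sub>R (D t X x - (\<Sum>b\<le>m. (real b * t ^ (b - 1)) *\<^sub>R a b X x)))"
        using tD by (rule smallo_cong') (simp only: scaleR_diff_right scaleR_poly_derivative)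
      show "evt (\<lambda>t X x. ((\<lambda>t. f X (st e t X x) - (\<Sum>b\<le>m. t ^ b *\<^sub>R a b X x)) has_vector_derivative
          D t X x - (\<Sum>b\<le>m. (real b * t ^ (b - 1)) *\<^sub>R a b X x)) (at t))"
        using der by (rule evt_mono) (intro has_vector_derivative_diff has_vector_derivative_poly)
    qed (rule lim, auto)
    have "lipo (m - 1) (\<lambda>t X x. f X (st e t X x) - (\<Sum>b<m. t ^ b *\<^sub>R a b X x))"
    proof (cases "m = p e")
      case True
      have "(\<Sum>b<m. t ^ b *\<^sub>R a b X x) = f X x" for t X x
        using sum.remove[of "{..<m}" 0 "\<lambda>b. t ^ b *\<^sub>R a b X x"] m True by (simp add: a_def)
      then show ?thesis using lip_diff[of "p e"] f True by simp
    next
      case False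
      \<comment> \<open>The order of the Lipschitz estimate is made up of \<open>p e - 1\<close>
        from the power of t, \<open>m - p e - 1\<close> from the induction hypothesis and 1 from the
        integration.\<close>
      then have m2: "m - 1 = Suc ((p e - 1) + (m - p e - 1))" using 3 p_pos[OF e] by simp
      show ?thesis unfolding m2
      proof (rule lipo_integrate)
        show "lipo ((p e - 1) + (m - p e - 1)) (\<lambda>t X x. D t X x - (\<Sum>b<m. (real b * t ^ (b - 1)) *\<^sub>R a b X x))"
        proof (rule lipo_cong)
          show "lipo ((p e - 1) + (m - p e - 1)) (\<lambda>t X x. t ^ (p e - 1) *\<^sub>R (c *\<^sub>R (g X (st e t X x) - (\<Sum>b<m - p e. t ^ b *\<^sub>R a' b X x))))"
            by (intro lipo_tpow lipo_scaleR_const a'(3)) (use False 3 in simp)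
          show "D t X x - (\<Sum>b<m. (real b * t ^ (b - 1)) *\<^sub>R a b X x) =
            t ^ (p e - 1) *\<^sub>R (c *\<^sub>R (g X (st e t X x) - (\<Sum>b<m - p e. t ^ b *\<^sub>R a' b X x)))" for t X x
            unfolding sum_less D_def by (simp add: scaleR_diff_right mult_ac)
        qed
        show "evt (\<lambda>t X x. ((\<lambda>t. f X (st e t X x) - (\<Sum>b<m. t ^ b *\<^sub>R a b X x)) has_vector_derivative
          D t X x - (\<Sum>b<m. (real b * t ^ (b - 1)) *\<^sub>R a b X x)) (at t))"
          using der by (rule evt_mono) (intro has_vector_derivative_diff has_vector_derivative_poly)
      qed (rule lim, use m in auto)
    qed
    then show ?thesis using a C0 tD der by (intro exI[of _ a] exI[of _ D]) auto
  qed
qed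

end


section \<open>First order expansions and maps Lipschitz-close to the identity\<close>

context germs
begin

text \<open>A displacement of order t^q makes the linearization error o(t^q) by uniform continuity
  of the derivative along the segment from x to A x. Continuity of \<open>V\<close> is enough, as
  \<open>V\<close> is not differentiated.\<close>

lemma first_order_expansion:
  assumes f: "UCk (Suc k) f" and A: "smallo q (\<lambda>t X x. A t X x - x - t ^ q *\<^sub>R V X x)"
    and q: "0 < q" and V: "UC V"
  shows "smallo q (\<lambda>t X x. f X (A t X x) - f X x - t ^ q *\<^sub>R lie V f X x)"
proof -
  have nid: "nid A"
    unfolding nid_def
    using smallo_add[OF smallo_mono[OF A] smallo_UC_tpow[OF V q]] by simp
  obtain BV where BV: "BV \<ge> 0" "near (\<lambda>X x. norm (V X x) \<le> BV)" using UC_bounded[OF V] by blast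
  obtain B where B: "B \<ge> 0" "near (\<lambda>X x. norm (dblin (f X) x) \<le> B)" using UC_bounded[OF UC_dblin[OF f]] by blast
  have fd: "near (\<lambda>X x. f X differentiable (at x))" using f by simp
  define rem where "rem t X x = f X (A t X x) - f X x - dblin (f X) x (A t X x - x)" for t X x
  have bigA: "evt (\<lambda>t X x. norm (A t X x - x) \<le> (BV + 1) * t ^ q)"
  proof (rule evt_mono[OF evt_conj[OF smallo_E[OF A zero_less_one] near_evt[OF BV(2)]]])
    fix t :: real and X x assume "0 < t"
      and a: "norm (A t X x - x - t ^ q *\<^sub>R V X x) \<le> 1 * t ^ q \<and> norm (V X x) \<le> BV"
    then have "norm (t ^ q *\<^sub>R V X x) \<le> t ^ q * BV" by (auto intro: mult_left_mono)
    moreover have "norm (A t X x - x) \<le> norm (A t X x - x - t ^ q *\<^sub>R V X x) + norm (t ^ q *\<^sub>R V X x)"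
      using norm_triangle_ineq[of "A t X x - x - t ^ q *\<^sub>R V X x" "t ^ q *\<^sub>R V X x"] by simp
    moreover have "(BV + 1) * t ^ q = t ^ q * BV + t ^ q" by (simp add: algebra_simps)
    ultimately show "norm (A t X x - x) \<le> (BV + 1) * t ^ q" using a by linarith
  qed
  obtain \<rho> where \<rho>: "\<rho> > 0" "\<And>X x. X \<in> \<Theta> \<Longrightarrow> x \<in> nb S \<rho> \<Longrightarrow> f X differentiable (at x)"
    using fd unfolding near_def by auto
  from UC_dblin[OF f] obtain \<rho>1 where \<rho>1: "0 < \<rho>1"
    "\<And>e. 0 < e \<Longrightarrow> \<exists>d>0. osc_le \<rho>1 d e (\<lambda>X. dblin (f X))"
    by (rule UC_E) blast
  obtain \<rho>2 where \<rho>2: "\<rho>2 > 0" "evt_at \<rho>2 (\<lambda>t X x. norm (A t X x - x) \<le> (BV + 1) * t ^ q)"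
    using bigA unfolding evt_def by auto
  obtain \<rho>3 where \<rho>3: "\<rho>3 > 0" "\<And>\<rho>'. 0 < \<rho>' \<Longrightarrow> evt_at \<rho>3 (\<lambda>t X x. dist x (A t X x) \<le> \<rho>')"
    using nid_moves[OF nid] by blast
  \<comment> \<open>Halving lets the balls of radius \<open>\<rho>0\<close> about points near
    \<open>S\<close> stay where \<open>f\<close> is differentiable and its derivative is
    controlled.\<close>
  define \<rho>0 where "\<rho>0 = min \<rho> \<rho>1 / 2"
  define \<rho>' where "\<rho>' = min \<rho>0 (min \<rho>2 \<rho>3)"
  have \<rho>0: "\<rho>0 > 0" "2 * \<rho>0 \<le> \<rho>" "2 * \<rho>0 \<le> \<rho>1" using \<rho> \<rho>1 by (auto simp: \<rho>0_def)
  have rem: "smallo_at \<rho>' q rem"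
    unfolding smallo_at_def
  proof (intro allI impI)
    fix e :: real assume "0 < e"
    then have "0 < e / (BV + 1)" using BV(1) by simp
    then obtain d where d: "d > 0" "\<And>\<rho>' X x y. \<rho>' \<le> \<rho>1 \<Longrightarrow> X \<in> \<Theta> \<Longrightarrow> x \<in> nb S \<rho>' \<Longrightarrow> y \<in> nb S \<rho>' \<Longrightarrow> dist x y < d
        \<Longrightarrow> norm (dblin (f X) x - dblin (f X) y) \<le> e / (BV + 1)"
      using \<rho>1(2) by metis
    define d' where "d' = min (d/2) (\<rho>0/2)"
    have d': "0 < d'" "d' < d" "d' < \<rho>0" using d \<rho>0 by (auto simp: d'_def)
    have "evt_at \<rho>' (\<lambda>t X x. norm (A t X x - x) \<le> (BV + 1) * t ^ q)"
      by (rule evt_at_antimono[OF \<rho>2(2)]) (simp add: \<rho>'_def)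
    moreover have "evt_at \<rho>' (\<lambda>t X x. dist x (A t X x) \<le> d')"
      by (rule evt_at_antimono[OF \<rho>3(2)[OF d'(1)]]) (simp add: \<rho>'_def)
    ultimately have "evt_at \<rho>' (\<lambda>t X x. norm (A t X x - x) \<le> (BV + 1) * t ^ q \<and> dist x (A t X x) \<le> d')"
      by (rule evt_at_conj)
    then show "evt_at \<rho>' (\<lambda>t X x. norm (rem t X x) \<le> e * t ^ q)"
    proof (rule evt_at_mono)
      fix t X x assume X: "X \<in> \<Theta>" and x: "x \<in> nb S \<rho>'"
        and a: "norm (A t X x - x) \<le> (BV + 1) * t ^ q \<and> dist x (A t X x) \<le> d'"
      let ?C = "ball x \<rho>0 \<inter> ball x d"
      have x0: "x \<in> nb S \<rho>0" using x nb_mono[of \<rho>' \<rho>0 S] by (auto simp: \<rho>'_def)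
      have sub: "z \<in> nb S \<rho>" "z \<in> nb S \<rho>1" if "z \<in> ball x \<rho>0" for z
        using ball_subset_nb[OF x0, of \<rho>0] nb_mono[OF \<rho>0(2), of S] nb_mono[OF \<rho>0(3), of S] that by auto
      have x1: "x \<in> nb S \<rho>1" using sub \<rho>0 by simp
      have "norm (f X (A t X x) - f X x - dblin (f X) x (A t X x - x)) \<le> norm (A t X x - x) * (e / (BV + 1))"
      proof (rule differentiable_bound_linearization[where S = ?C and f' = "\<lambda>z. blinfun_apply (dblin (f X) z)"])
        fix s :: real assume s: "s \<in> {0..1}"
        have "s * norm (A t X x - x) \<le> 1 * norm (A t X x - x)" using s by (intro mult_right_mono) auto
        then have "norm (s *\<^sub>R (A t X x - x)) \<le> d'" using a s by (simp add: dist_norm norm_minus_commute)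
        then show "x + s *\<^sub>R (A t X x - x) \<in> ?C" using d' by (auto simp: dist_norm)
      next
        fix z assume z: "z \<in> ?C"
        then show "(f X has_derivative blinfun_apply (dblin (f X) z)) (at z within ?C)"
          using \<rho>(2)[OF X, of z] sub[of z] by (auto intro!: has_derivative_at_withinI dblin_has_derivative)
        have "onorm (blinfun_apply (dblin (f X) z) - blinfun_apply (dblin (f X) x)) = norm (dblin (f X) z - dblin (f X) x)"
          by (simp add: norm_blinfun.rep_eq minus_blinfun.rep_eq fun_diff_def)
        then show "onorm (blinfun_apply (dblin (f X) z) - blinfun_apply (dblin (f X) x)) \<le> e / (BV + 1)"
          using d(2)[of \<rho>1 X z x] X x1 sub[of z] z by (simp add: dist_commute)
      qed (use \<rho>0 d in simp)
      also have "\<dots> \<le> ((BV + 1) * t ^ q) * (e / (BV + 1))"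
        using a \<open>0 < e / (BV + 1)\<close> by (intro mult_right_mono) auto
      also have "\<dots> = e * t ^ q" using BV(1) by simp
      finally show "norm (rem t X x) \<le> e * t ^ q" by (simp add: rem_def)
    qed auto
  qed
  have "0 < \<rho>'" using \<rho>0 \<rho>2 \<rho>3 by (simp add: \<rho>'_def)
  then have rem': "smallo q rem" using rem smallo_def by auto
  have lin: "smallo q (\<lambda>t X x. dblin (f X) x (A t X x - x - t ^ q *\<^sub>R V X x))"
  proof (rule smallo_bound[OF A, where C = B])
    show "evt (\<lambda>t X x. norm (dblin (f X) x (A t X x - x - t ^ q *\<^sub>R V X x)) \<le> B * norm (A t X x - x - t ^ q *\<^sub>R V X x))"
    proof (rule evt_mono[OF near_evt[OF B(2)]])
      fix t X x assume "norm (dblin (f X) x) \<le> B"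
      then have "norm (dblin (f X) x) * norm (A t X x - x - t ^ q *\<^sub>R V X x) \<le> B * norm (A t X x - x - t ^ q *\<^sub>R V X x)"
        by (rule mult_right_mono) simp
      then show "norm (dblin (f X) x (A t X x - x - t ^ q *\<^sub>R V X x)) \<le> B * norm (A t X x - x - t ^ q *\<^sub>R V X x)"
        using norm_blinfun order_trans by blast
    qed
  qed
  show ?thesis
  proof (rule smallo_cong[OF smallo_add[OF rem' lin]])
    show "evt (\<lambda>t X x. f X (A t X x) - f X x - t ^ q *\<^sub>R lie V f X x = rem t X x + dblin (f X) x (A t X x - x - t ^ q *\<^sub>R V X x))"
      using near_evt[OF fd]
      by (rule evt_mono) (simp add: rem_def lie_def dblin_frechet[symmetric] blinfun.bilinear_simps)
  qed
qed

text \<open>A B - id is the sum of (A - id) B and B - id, and \<open>B\<close> at most doubles small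
  distances; this accounts for the fraction \<open>e / 3\<close>.\<close>

lemma lipo_near_id_comp:
  assumes A: "lipo 0 (\<lambda>t X x. A t X x - x)" and B: "lipo 0 (\<lambda>t X x. B t X x - x)" "nid B"
  shows "lipo 0 (\<lambda>t X x. A t X (B t X x) - x)"
proof -
  obtain \<rho>1 where \<rho>1: "\<rho>1 > 0" "\<And>e. e > 0 \<Longrightarrow> evt_at \<rho>1 (\<lambda>t X x. \<forall>y. dist x y < \<rho>1 \<longrightarrow>
      norm (A t X x - x - (A t X y - y)) \<le> e * t ^ 0 * norm (x - y))" using A unfolding lipo_def by auto
  obtain \<rho>2 where \<rho>2: "\<rho>2 > 0" "\<And>e. e > 0 \<Longrightarrow> evt_at \<rho>2 (\<lambda>t X x. \<forall>y. dist x y < \<rho>2 \<longrightarrow>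
      norm (B t X x - x - (B t X y - y)) \<le> e * t ^ 0 * norm (x - y))" using B(1) unfolding lipo_def by auto
  obtain \<rho>3 where \<rho>3: "\<rho>3 > 0" "\<rho>3 \<le> \<rho>1" "\<And>P. evt_at \<rho>1 P \<Longrightarrow> evt_at \<rho>3 (\<lambda>t X x. P t X (B t X x))"
    using evt_comp_at[OF B(2) \<rho>1(1)] by blast
  define \<rho> where "\<rho> = min \<rho>2 \<rho>3 / 2"
  have \<rho>: "\<rho> > 0" "\<rho> \<le> \<rho>3" "\<rho> < \<rho>2" "2 * \<rho> \<le> \<rho>1" using \<rho>2 \<rho>3 by (auto simp: \<rho>_def)
  have "evt_at \<rho> (\<lambda>t X x. \<forall>y. dist x y < \<rho> \<longrightarrow>
      norm (A t X (B t X x) - x - (A t X (B t X y) - y)) \<le> e * t ^ 0 * norm (x - y))" if e: "e > 0" for e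
  proof -
    define c where "c = min 1 (e / 3)"
    have c: "0 < c" "c \<le> 1" "3 * c \<le> e" using e by (auto simp: c_def)
    from evt_at_conj[OF evt_at_antimono[OF \<rho>3(3)[OF \<rho>1(2)[OF c(1)]], of \<rho>] evt_at_antimono[OF \<rho>2(2)[OF c(1)], of \<rho>]]
    show ?thesis
    proof (rule evt_at_mono)
      fix t X x
      assume a: "(\<forall>y. dist (B t X x) y < \<rho>1 \<longrightarrow> norm (A t X (B t X x) - B t X x - (A t X y - y)) \<le> c * t ^ 0 * norm (B t X x - y)) \<and>
        (\<forall>y. dist x y < \<rho>2 \<longrightarrow> norm (B t X x - x - (B t X y - y)) \<le> c * t ^ 0 * norm (x - y))"
      show "\<forall>y. dist x y < \<rho> \<longrightarrow> norm (A t X (B t X x) - x - (A t X (B t X y) - y)) \<le> e * t ^ 0 * norm (x - y)"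
      proof (intro allI impI)
        fix y assume y: "dist x y < \<rho>"
        let ?a = "B t X x" and ?b = "B t X y" and ?n = "norm (x - y)"
        have 1: "norm (?a - x - (?b - y)) \<le> c * ?n" using a y \<rho> by simp
        have "c * ?n \<le> 1 * ?n" using c by (intro mult_right_mono) auto
        moreover have "norm (?a - ?b) \<le> norm (?a - x - (?b - y)) + ?n" by norm
        ultimately have ab: "norm (?a - ?b) \<le> 2 * ?n" using 1 by linarith
        then have "dist ?a ?b < \<rho>1" using y \<rho> by (simp add: dist_norm)
        then have 2: "norm (A t X ?a - ?a - (A t X ?b - ?b)) \<le> c * norm (?a - ?b)" using a by simp
        have "norm (A t X ?a - x - (A t X ?b - y)) \<le> norm (A t X ?a - ?a - (A t X ?b - ?b)) + norm (?a - x - (?b - y))"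
          by norm
        also have "\<dots> \<le> c * (2 * ?n) + c * ?n"
          using 1 order_trans[OF 2 mult_left_mono[OF ab]] c by simp
        also have "\<dots> = (3 * c) * ?n" by simp
        also have "\<dots> \<le> e * ?n" using c by (intro mult_right_mono) auto
        finally show "norm (A t X ?a - x - (A t X ?b - y)) \<le> e * t ^ 0 * ?n" by simp
      qed
    qed (use \<rho> in auto)
  qed
  then show ?thesis using \<rho> unfolding lipo_def by (intro exI[of _ \<rho>]) auto
qed

text \<open>The expression is the difference of K - id at two points at distance O(t^k), and the
  Lipschitz constant of K - id tends to 0.\<close>

lemma lipo_near_id_smallo:
  assumes K: "lipo 0 (\<lambda>t X x. K t X x - x)" and A: "nid A" and B: "nid B"
    and AB: "evt (\<lambda>t X x. norm (A t X x - B t X x) \<le> C * t ^ k)"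
  shows "smallo k (\<lambda>t X x. (K t X (A t X x) - K t X (B t X x)) - (A t X x - B t X x))"
proof -
  obtain \<rho>1 where \<rho>1: "\<rho>1 > 0" "\<And>e. e > 0 \<Longrightarrow> evt_at \<rho>1 (\<lambda>t X x. \<forall>y. dist x y < \<rho>1 \<longrightarrow>
      norm (K t X x - x - (K t X y - y)) \<le> e * t ^ 0 * norm (x - y))" using K unfolding lipo_def by auto
  obtain \<rho>2 where \<rho>2: "\<rho>2 > 0" "\<And>P. evt_at \<rho>1 P \<Longrightarrow> evt_at \<rho>2 (\<lambda>t X x. P t X (A t X x))"
    using evt_comp_at[OF A \<rho>1(1)] by blast
  have "smallo 0 (\<lambda>t X x. A t X x - B t X x)"
    using smallo_diff[OF A[unfolded nid_def] B[unfolded nid_def]] by simp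
  from evt_conj[OF AB smallo_E[OF this, of "\<rho>1/2"]]
  obtain \<rho>3 where \<rho>3: "\<rho>3 > 0" "evt_at \<rho>3 (\<lambda>t X x. norm (A t X x - B t X x) \<le> C * t ^ k \<and>
      norm (A t X x - B t X x) \<le> \<rho>1/2 * t ^ 0)" using \<rho>1(1) unfolding evt_def by auto
  define \<rho> where "\<rho> = min \<rho>2 \<rho>3"
  have "smallo_at \<rho> k (\<lambda>t X x. (K t X (A t X x) - K t X (B t X x)) - (A t X x - B t X x))"
    unfolding smallo_at_def
  proof (intro allI impI)
    fix e :: real assume e: "0 < e"
    define c where "c = e / (\<bar>C\<bar> + 1)"
    have c: "0 < c" "c * \<bar>C\<bar> \<le> e" using e by (auto simp: c_def add_nonneg_pos divide_simps mult_left_mono)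
    have "evt_at \<rho> (\<lambda>t X x. \<forall>y. dist (A t X x) y < \<rho>1 \<longrightarrow>
      norm (K t X (A t X x) - A t X x - (K t X y - y)) \<le> c * t ^ 0 * norm (A t X x - y))"
      by (rule evt_at_antimono[OF \<rho>2(2)[OF \<rho>1(2)[OF c(1)]]]) (simp add: \<rho>_def)
    moreover have "evt_at \<rho> (\<lambda>t X x. norm (A t X x - B t X x) \<le> C * t ^ k \<and>
      norm (A t X x - B t X x) \<le> \<rho>1/2 * t ^ 0)"
      by (rule evt_at_antimono[OF \<rho>3(2)]) (simp add: \<rho>_def)
    ultimately have "evt_at \<rho> (\<lambda>t X x. (\<forall>y. dist (A t X x) y < \<rho>1 \<longrightarrow>
      norm (K t X (A t X x) - A t X x - (K t X y - y)) \<le> c * t ^ 0 * norm (A t X x - y)) \<and>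
      (norm (A t X x - B t X x) \<le> C * t ^ k \<and> norm (A t X x - B t X x) \<le> \<rho>1/2 * t ^ 0))"
      by (rule evt_at_conj)
    then show "evt_at \<rho> (\<lambda>t X x. norm ((K t X (A t X x) - K t X (B t X x)) - (A t X x - B t X x)) \<le> e * t ^ k)"
    proof (rule evt_at_mono)
      fix t :: real and X x
      assume "0 < t" and a: "(\<forall>y. dist (A t X x) y < \<rho>1 \<longrightarrow>
        norm (K t X (A t X x) - A t X x - (K t X y - y)) \<le> c * t ^ 0 * norm (A t X x - y)) \<and>
        (norm (A t X x - B t X x) \<le> C * t ^ k \<and> norm (A t X x - B t X x) \<le> \<rho>1/2 * t ^ 0)"
      then have "dist (A t X x) (B t X x) < \<rho>1" using \<rho>1(1) by (simp add: dist_norm)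
      then have "norm (K t X (A t X x) - A t X x - (K t X (B t X x) - B t X x)) \<le> c * norm (A t X x - B t X x)"
        using a by simp
      also have "\<dots> \<le> c * (\<bar>C\<bar> * t ^ k)"
      proof (rule mult_left_mono)
        have "C * t ^ k \<le> \<bar>C\<bar> * t ^ k" using \<open>0 < t\<close> by (intro mult_right_mono) auto
        then show "norm (A t X x - B t X x) \<le> \<bar>C\<bar> * t ^ k" using a by linarith
      qed (use c in simp)
      also have "\<dots> = (c * \<bar>C\<bar>) * t ^ k" by simp
      also have "\<dots> \<le> e * t ^ k" using c \<open>0 < t\<close> by (intro mult_right_mono) auto
      finally show "norm ((K t X (A t X x) - K t X (B t X x)) - (A t X x - B t X x)) \<le> e * t ^ k"
        by (simp add: algebra_simps)
    qed auto
  qed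
  moreover have "\<rho> > 0" using \<rho>2 \<rho>3 by (simp add: \<rho>_def)
  ultimately show ?thesis using smallo_def by auto
qed

end

section \<open>Expansions along lists of steps\<close>

context steps
begin

text \<open>The last element of the list acts first.\<close>

primrec run :: "'e list \<Rightarrow> real \<Rightarrow> 'x \<Rightarrow> 'a \<Rightarrow> 'a" where
  "run [] t X x = x"
| "run (e # l) t X x = st e t X (run l t X x)"

lemma run_append: "run (l @ l') t X x = run l t X (run l' t X x)"
  by (induction l) auto

lemma nid_run: "set l \<subseteq> E \<Longrightarrow> nid (run l)"
proof (induction l)
  case (Cons e l) then show ?case using nid_comp[OF nid_st[of e] Cons.IH] by simp
qed (simp add: nid_def smallo_zero)

lemma lipo_run: "set l \<subseteq> E \<Longrightarrow> lipo 0 (\<lambda>t X x. run l t X x - x)"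
proof (induction l)
  case Nil
  then show ?case unfolding lipo_def by (intro exI[of _ 1]) (auto simp: evt_at_def intro!: exI[of _ 1])
next
  case (Cons e l)
  then show ?case
    using lipo_near_id_comp[OF st_lip[of e 0] Cons.IH nid_run] p_pos[of e] by simp
qed

lemma run_diff: "set l \<subseteq> E \<Longrightarrow> evt (\<lambda>t X x. (\<lambda>(t, x). run l t X x) differentiable (at (t, x)))"
proof (induction l)
  case Nil
  have "(\<lambda>(t::real, x::'a). x) differentiable (at z)" for z
    unfolding differentiable_def by (auto simp: case_prod_unfold intro!: derivative_eq_intros)
  then show ?case by (auto intro: evt_mono[OF evt_True])
next
  case (Cons e l)
  then have e: "e \<in> E" and l: "set l \<subseteq> E" by auto
  from evt_conj[OF Cons.IH[OF l] evt_comp[OF nid_run[OF l] st_diff[OF e]]]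
  show ?case
  proof (rule evt_mono)
    fix t X x
    assume "(\<lambda>(t, x). run l t X x) differentiable (at (t, x)) \<and>
      (\<lambda>(t, x). st e t X x) differentiable (at (t, run l t X x))"
    then obtain P Q where P: "((\<lambda>(t, x). run l t X x) has_derivative P) (at (t, x))"
      and Q: "((\<lambda>(t, x). st e t X x) has_derivative Q) (at (t, run l t X x))"
      unfolding differentiable_def by blast
    have "((\<lambda>z. (fst z, (\<lambda>(t, x). run l t X x) z)) has_derivative (\<lambda>h. (fst h, P h))) (at (t, x))"
      by (intro has_derivative_Pair has_derivative_fst has_derivative_ident P)
    from has_derivative_compose[OF this, of "\<lambda>(t, x). st e t X x" Q] Q
    show "(\<lambda>(t, x). run (e # l) t X x) differentiable (at (t, x))"
      unfolding differentiable_def by (auto simp: case_prod_unfold)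
  qed
qed


text \<open>The expansion of order 1 says that t D equals t times the coefficient of degree 1 up to
  o(t), so D is that bounded coefficient up to o(1).\<close>

lemma run_velocity_bounded:
  assumes l: "set l \<subseteq> E" and D: "Expd 1 (\<lambda>t X x. run l t X x) D"
  shows "\<exists>B. evt (\<lambda>t X x. norm (D t X x) \<le> B)"
proof -
  obtain a where a: "\<forall>b\<le>1. UCk (1 - b) (a b)"
    "smallo 1 (\<lambda>t X x. t *\<^sub>R D t X x - (\<Sum>b\<le>1. (real b * t ^ b) *\<^sub>R a b X x))"
    using D unfolding Expd_def by auto
  obtain B where B: "near (\<lambda>X x. norm (a 1 X x) \<le> B)" using UC_bounded[OF UCk_UC] a(1) by blast
  have "evt (\<lambda>t X x. norm (D t X x) \<le> B + 1)"
  proof (rule evt_mono[OF evt_conj[OF smallo_E[OF a(2) zero_less_one] near_evt[OF B]]])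
    fix t :: real and X x assume t: "0 < t" and
      h: "norm (t *\<^sub>R D t X x - (\<Sum>b\<le>1. (real b * t ^ b) *\<^sub>R a b X x)) \<le> 1 * t ^ 1 \<and> norm (a 1 X x) \<le> B"
    have "norm (t *\<^sub>R (D t X x - a 1 X x)) \<le> t" using h by (simp add: scaleR_diff_right)
    then have "t * norm (D t X x - a 1 X x) \<le> t * 1" using t by simp
    then have "norm (D t X x - a 1 X x) \<le> 1" using t by simp
    moreover have "norm (D t X x) \<le> norm (D t X x - a 1 X x) + norm (a 1 X x)" by norm
    ultimately show "norm (D t X x) \<le> B + 1" using h by linarith
  qed
  then show ?thesis by blast
qed

text \<open>The outermost step is expanded first, which produces coefficients \<open>a b\<close> of
  class \<open>m - b\<close>. Their compositions with the remaining steps are expanded to order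
  \<open>m - b\<close> by induction, and t^b restores the order m; hence the generality in
  \<open>f\<close> and \<open>m\<close>. The remainder is evaluated at a moving point, where the
  Lipschitz estimate controls the derivative caused by the motion.\<close>

lemma run_expansion:
  fixes f :: "'x \<Rightarrow> 'a \<Rightarrow> 'a"
  shows "set l \<subseteq> E \<Longrightarrow> UCk m f \<Longrightarrow> m \<le> r \<Longrightarrow> \<exists>D. Expd m (\<lambda>t X x. f X (run l t X x)) D \<and>
     (0 < m \<longrightarrow> evt (\<lambda>t X x. ((\<lambda>t. f X (run l t X x)) has_vector_derivative D t X x) (at t)))"
proof (induction l arbitrary: m f)
  case Nil
  then show ?case using Expd_const[of m f]
    by (intro exI[of _ "\<lambda>t X x. 0"]) (auto intro!: evt_mono[OF evt_True])
next
  case (Cons e l)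
  have e: "e \<in> E" and l: "set l \<subseteq> E" using Cons.prems by auto
  note nid = nid_run[OF l]
  obtain a D1 where a: "\<forall>b\<le>m. UCk (m - b) (a b)"
    "smallo m (\<lambda>t X x. f X (st e t X x) - (\<Sum>b\<le>m. t ^ b *\<^sub>R a b X x))"
    "smallo m (\<lambda>t X x. t *\<^sub>R D1 t X x - (\<Sum>b\<le>m. (real b * t ^ b) *\<^sub>R a b X x))"
    "0 < m \<Longrightarrow> evt (\<lambda>t X x. ((\<lambda>t. f X (st e t X x)) has_vector_derivative D1 t X x) (at t))"
    "0 < m \<Longrightarrow> lipo (m - 1) (\<lambda>t X x. f X (st e t X x) - (\<Sum>b<m. t ^ b *\<^sub>R a b X x))"
    using step_expansion[OF e Cons.prems(2,3)] by blast
  have "\<exists>D. Expd (m - b) (\<lambda>t X x. a b X (run l t X x)) D \<and>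
     (0 < m - b \<longrightarrow> evt (\<lambda>t X x. ((\<lambda>t. a b X (run l t X x)) has_vector_derivative D t X x) (at t)))" if "b \<le> m" for b
    by (rule Cons.IH[OF l]) (use a(1) that Cons.prems(3) in auto)
  then have "\<forall>b. \<exists>D. b \<le> m \<longrightarrow> Expd (m - b) (\<lambda>t X x. a b X (run l t X x)) D \<and>
     (0 < m - b \<longrightarrow> evt (\<lambda>t X x. ((\<lambda>t. a b X (run l t X x)) has_vector_derivative D t X x) (at t)))"
    by blast
  from choice[OF this] obtain Db where Db': "\<forall>b. b \<le> m \<longrightarrow> Expd (m - b) (\<lambda>t X x. a b X (run l t X x)) (Db b) \<and>
     (0 < m - b \<longrightarrow> evt (\<lambda>t X x. ((\<lambda>t. a b X (run l t X x)) has_vector_derivative Db b t X x) (at t)))"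
    by blast
  then have Db: "\<And>b. b \<le> m \<Longrightarrow> Expd (m - b) (\<lambda>t X x. a b X (run l t X x)) (Db b)"
    "\<And>b. b < m \<Longrightarrow> evt (\<lambda>t X x. ((\<lambda>t. a b X (run l t X x)) has_vector_derivative Db b t X x) (at t))"
    by simp_all
  obtain Y where Y: "Expd 1 (\<lambda>t X x. run l t X x) Y"
    "evt (\<lambda>t X x. ((\<lambda>t. run l t X x) has_vector_derivative Y t X x) (at t))"
    using Cons.IH[OF l UCk_id[OF bounded_S] r] by auto
  obtain B where B: "evt (\<lambda>t X x. norm (Y t X x) \<le> B)" using run_velocity_bounded[OF l Y(1)] by blast
  define F where "F t X x = (\<Sum>b\<le>m. t ^ b *\<^sub>R a b X (run l t X x))" for t X x
  \<comment> \<open>A formal derivative: the top coefficient is merely continuous, and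
    \<open>Db m\<close> is only known to fit into an expansion of order 0.\<close>
  define DF where "DF t X x = (\<Sum>b\<le>m. (real b * t ^ (b - 1)) *\<^sub>R a b X (run l t X x) + t ^ b *\<^sub>R Db b t X x)" for t X x
  have EF: "Expd m F DF"
    unfolding F_def DF_def
  proof (rule Expd_sum)
    fix b assume "b \<in> {..m}"
    then show "Expd m (\<lambda>t X x. t ^ b *\<^sub>R a b X (run l t X x))
        (\<lambda>t X x. (real b * t ^ (b - 1)) *\<^sub>R a b X (run l t X x) + t ^ b *\<^sub>R Db b t X x)"
      using Expd_tpow[OF Db(1)[of b], of b] by simp
  qed
  have C0: "smallo m (\<lambda>t X x. f X (run (e # l) t X x) - F t X x)"
    using smallo_comp[OF nid a(2)] by (simp add: F_def)
  show ?case
  proof (cases "m = 0")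
    case True
    then show ?thesis using Expd_perturb[OF EF C0, of DF] smallo_zero by auto
  next
    case False
    then have m: "0 < m" by simp
    \<comment> \<open>The degree m is omitted, because the coefficient there cannot be
      differentiated in space.\<close>
    define h where "h t X y = f X (st e t X y) - (\<Sum>b<m. t ^ b *\<^sub>R a b X y)" for t X y
    define h' where "h' t X x = frechet_derivative (h t X) (at (run l t X x))" for t X x
    \<comment> \<open>The true derivative: the outer step's own time derivative, plus the motion of
      the inner point split into the polynomial part and the remainder \<open>h\<close>.\<close>
    define D2 where "D2 t X x = D1 t X (run l t X x) + (\<Sum>b<m. t ^ b *\<^sub>R Db b t X x) + h' t X x (Y t X x)" for t X x
    have fd: "near (\<lambda>X x. f X differentiable (at x))"
      using Cons.prems(2) m by (cases m) auto
    have ad: "near (\<lambda>X x. \<forall>b\<in>{..<m}. a b X differentiable (at x))"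
    proof (rule near_ball_Basis)
      fix b assume "b \<in> {..<m}"
      then have "UCk (Suc (m - b - 1)) (a b)" by (intro UCk_mono[OF a(1)[rule_format, of b]]) auto
      then show "near (\<lambda>X x. a b X differentiable (at x))" by simp
    qed simp
    have aD: "evt (\<lambda>t X x. \<forall>b\<in>{..<m}. ((\<lambda>t. a b X (run l t X x)) has_vector_derivative Db b t X x) (at t))"
      by (rule evt_ball) (auto intro: Db(2))
    have ev: "evt (\<lambda>t X x. ((\<lambda>t. f X (run (e # l) t X x)) has_vector_derivative D2 t X x) (at t) \<and>
        (h t X has_derivative h' t X x) (at (run l t X x)))"
    proof (rule evt_mono[OF evt_conj[OF Y(2) evt_conj[OF evt_comp[OF nid st_diff[OF e]] evt_conj[OF
              evt_comp[OF nid evt_comp[OF nid_st[OF e] near_evt[OF fd]]] evt_conj[OF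
              evt_comp[OF nid a(4)[OF m]] evt_conj[OF aD evt_comp[OF nid near_evt[OF ad]]]]]]]])
      fix t X x
      assume H: "((\<lambda>t. run l t X x) has_vector_derivative Y t X x) (at t) \<and>
        (\<lambda>(t, x). st e t X x) differentiable (at (t, run l t X x)) \<and>
        f X differentiable (at (st e t X (run l t X x))) \<and>
        ((\<lambda>s. f X (st e s X (run l t X x))) has_vector_derivative D1 t X (run l t X x)) (at t) \<and>
        (\<forall>b\<in>{..<m}. ((\<lambda>t. a b X (run l t X x)) has_vector_derivative Db b t X x) (at t)) \<and>
        (\<forall>b\<in>{..<m}. a b X differentiable (at (run l t X x)))"
      let ?y = "run l t X x"
      obtain Q where Q: "((\<lambda>(t, x). st e t X x) has_derivative Q) (at (t, ?y))"
        using H unfolding differentiable_def by blast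
      have "(f X has_derivative frechet_derivative (f X) (at (st e t X ?y))) (at (st e t X ?y))"
        using H by (simp add: frechet_derivative_works[symmetric])
      then obtain P where P: "((\<lambda>z. f X (st e (fst z) X (snd z))) has_derivative P) (at (t, ?y))"
        using has_derivative_compose[OF Q, of "f X"] by (auto simp: case_prod_unfold)
      have linP: "linear P" using P has_derivative_linear by blast
      \<comment> \<open>The composite is the outer step evaluated along the curve s -> (s, run l s X
        x); its velocity (1, Y) splits into (1, 0), which yields \<open>D1\<close>, and (0, Y), the
        motion of the inner point.\<close>
      have "((\<lambda>s. (s, run l s X x)) has_vector_derivative (1, Y t X x)) (at t)"
        by (intro has_vector_derivative_Pair has_vector_derivative_id conjunct1[OF H])
      from has_vector_derivative_chain[OF this P]
      have tot: "((\<lambda>t. f X (run (e # l) t X x)) has_vector_derivative P (1, Y t X x)) (at t)" by simp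
      have "((\<lambda>s. (s, ?y)) has_vector_derivative (1, 0)) (at t)"
        by (intro has_vector_derivative_Pair has_vector_derivative_id has_vector_derivative_const)
      from has_vector_derivative_chain[OF this P] have "P (1, 0) = D1 t X ?y"
        using H vector_derivative_unique_at by fastforce
      moreover have "P (1, Y t X x) = P (1, 0) + P (0, Y t X x)"
        using linear_add[OF linP, of "(1, 0)" "(0, Y t X x)"] by simp
      ultimately have PY: "P (1, Y t X x) = D1 t X ?y + P (0, Y t X x)" by simp
      have "((\<lambda>y. (t, y)) has_derivative (\<lambda>v. (0, v))) (at ?y)" by (auto intro!: derivative_eq_intros)
      from has_derivative_compose[OF this P]
      have d1: "((\<lambda>y. f X (st e t X y)) has_derivative (\<lambda>v. P (0, v))) (at ?y)" by simp
      let ?A = "\<lambda>b. frechet_derivative (a b X) (at ?y)"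
      have dA: "(a b X has_derivative ?A b) (at ?y)" if "b < m" for b
        using H that by (simp add: frechet_derivative_works[symmetric])
      have hd: "(h t X has_derivative (\<lambda>v. P (0, v) - (\<Sum>b<m. t ^ b *\<^sub>R ?A b v))) (at ?y)"
        unfolding h_def by (intro has_derivative_diff d1 has_derivative_sum has_derivative_scaleR_right dA) auto
      then have h'eq: "h' t X x = (\<lambda>v. P (0, v) - (\<Sum>b<m. t ^ b *\<^sub>R ?A b v))"
        unfolding h'_def by (rule frechet_eq)
      have "?A b (Y t X x) = Db b t X x" if "b < m" for b
        using has_vector_derivative_chain[OF conjunct1[OF H] dA[OF that]] H that vector_derivative_unique_at by blast
      then have "D2 t X x = P (1, Y t X x)" by (simp add: D2_def h'eq PY)
      then show "((\<lambda>t. f X (run (e # l) t X x)) has_vector_derivative D2 t X x) (at t) \<and>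
        (h t X has_derivative h' t X x) (at ?y)" using tot hd h'eq by simp
    qed
    have "lipo (m - 1) h" using a(5)[OF m] unfolding h_def[abs_def] .
    then have rem: "smallo (m - 1) (\<lambda>t X x. h' t X x (Y t X x))"
      by (rule lipo_derivative_smallo[OF _ nid evt_mono[OF ev] B]) auto
    \<comment> \<open>In order 0 the derivative part of \<open>Expd\<close> says precisely this. It
      makes the term by which \<open>D2\<close> and the formal derivative differ in degree m
      negligible.\<close>
    have "smallo 0 (\<lambda>t X x. t *\<^sub>R Db m t X x)"
      using Db(1)[of m] unfolding Expd_def by auto
    then have last: "smallo m (\<lambda>t X x. t ^ m *\<^sub>R (t *\<^sub>R Db m t X x))"
      by (rule smallo_tpow') simp
    have "smallo m (\<lambda>t X x. t *\<^sub>R D2 t X x - t *\<^sub>R DF t X x)"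
    proof (rule smallo_cong')
      show "smallo m (\<lambda>t X x. (t *\<^sub>R D1 t X (run l t X x) - (\<Sum>b\<le>m. (real b * t ^ b) *\<^sub>R a b X (run l t X x)))
          + t ^ 1 *\<^sub>R h' t X x (Y t X x) - t ^ m *\<^sub>R (t *\<^sub>R Db m t X x))"
        by (intro smallo_diff smallo_add last smallo_comp[OF nid a(3)] smallo_tpow'[OF rem]) (use m in simp)
      fix t X x
      have "(\<Sum>b\<le>m. t ^ b *\<^sub>R Db b t X x) = (\<Sum>b<m. t ^ b *\<^sub>R Db b t X x) + t ^ m *\<^sub>R Db m t X x"
        using sum.lessThan_Suc[of "\<lambda>b. t ^ b *\<^sub>R Db b t X x" m] by (simp add: lessThan_Suc_atMost)
      then have "t *\<^sub>R DF t X x = (\<Sum>b\<le>m. (real b * t ^ b) *\<^sub>R a b X (run l t X x)) +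
          t *\<^sub>R (\<Sum>b<m. t ^ b *\<^sub>R Db b t X x) + t ^ m *\<^sub>R (t *\<^sub>R Db m t X x)"
        by (simp only: DF_def sum.distrib scaleR_add_right scaleR_poly_derivative) (simp add: mult.commute)
      then show "t *\<^sub>R D2 t X x - t *\<^sub>R DF t X x =
          (t *\<^sub>R D1 t X (run l t X x) - (\<Sum>b\<le>m. (real b * t ^ b) *\<^sub>R a b X (run l t X x)))
          + t ^ 1 *\<^sub>R h' t X x (Y t X x) - t ^ m *\<^sub>R (t *\<^sub>R Db m t X x)"
        by (simp add: D2_def scaleR_add_right)
    qed
    then have "Expd m (\<lambda>t X x. f X (run (e # l) t X x)) D2" by (rule Expd_perturb[OF EF C0])
    moreover have "evt (\<lambda>t X x. ((\<lambda>t. f X (run (e # l) t X x)) has_vector_derivative D2 t X x) (at t))"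
      by (rule evt_mono[OF ev]) auto
    ultimately show ?thesis by auto
  qed
qed

text \<open>Two polynomial approximations of the same values up to o(t^k) agree through degree k.
  Thus the abstract coefficients of an expansion are read off from knowledge of the values
  alone.\<close>

lemma leading_coefficients:
  assumes a: "\<forall>b\<le>m. UCk (m - b) (a b)" "smallo m (\<lambda>t X x. A t X x - (\<Sum>b\<le>m. t ^ b *\<^sub>R a b X x))"
    and A: "smallo k (\<lambda>t X x. A t X x - x - t ^ k *\<^sub>R V X x)" and k: "0 < k" "k \<le> m"
  shows "near (\<lambda>X x. \<forall>b\<le>k. a b X x = (if b = 0 then x else if b = k then V X x else 0))"
proof -
  define c where "c b X x = a b X x - (if b = 0 then x else if b = k then V X x else 0)" for b X x
  have "smallo k (\<lambda>t X x. \<Sum>b\<le>k. t ^ b *\<^sub>R c b X x)"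
  proof (rule smallo_cong')
    show "smallo k (\<lambda>t X x. (A t X x - x - t ^ k *\<^sub>R V X x) - (A t X x - (\<Sum>b\<le>m. t ^ b *\<^sub>R a b X x))
        - (\<Sum>b\<in>{k<..m}. t ^ b *\<^sub>R a b X x))"
      by (intro smallo_diff A smallo_mono[OF a(2) k(2)] smallo_sum smallo_UC_tpow UCk_UC[OF a(1)[rule_format]]) auto
    fix t X x
    have "{..m} = {..k} \<union> {k<..m}" "{..k} \<inter> {k<..m} = {}" using k by auto
    then have 1: "(\<Sum>b\<le>m. t ^ b *\<^sub>R a b X x) = (\<Sum>b\<le>k. t ^ b *\<^sub>R a b X x) + (\<Sum>b\<in>{k<..m}. t ^ b *\<^sub>R a b X x)"
      using sum.union_disjoint[of "{..k}" "{k<..m}" "\<lambda>b. t ^ b *\<^sub>R a b X x"] by auto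
    have "(\<Sum>b\<le>k. t ^ b *\<^sub>R (if b = 0 then x else if b = k then V X x else 0)) =
        (\<Sum>b\<in>{0, k}. t ^ b *\<^sub>R (if b = 0 then x else if b = k then V X x else 0))"
      by (rule sum.mono_neutral_right) auto
    also have "\<dots> = x + t ^ k *\<^sub>R V X x" using k by simp
    finally show "(\<Sum>b\<le>k. t ^ b *\<^sub>R c b X x) = (A t X x - x - t ^ k *\<^sub>R V X x) - (A t X x - (\<Sum>b\<le>m. t ^ b *\<^sub>R a b X x))
        - (\<Sum>b\<in>{k<..m}. t ^ b *\<^sub>R a b X x)"
      unfolding c_def 1 by (simp add: scaleR_diff_right sum_subtractf)
  qed
  from smallo_poly_unique[OF this] show ?thesis
    by (rule near_mono) (simp add: c_def)
qed

text \<open>The values and the derivative share their coefficients. Knowing the leading term of the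
  values therefore gives that of the derivative, although the approximation of the values was never
  differentiated.\<close>

lemma run_leading_derivative:
  assumes l: "set l \<subseteq> E" and k: "0 < k" "k \<le> r" and V: "smallo k (\<lambda>t X x. run l t X x - x - t ^ k *\<^sub>R V X x)"
  shows "\<exists>D. evt (\<lambda>t X x. ((\<lambda>t. run l t X x) has_vector_derivative D t X x) (at t)) \<and>
    smallo k (\<lambda>t X x. t *\<^sub>R D t X x - (real k * t ^ k) *\<^sub>R V X x)"
proof -
  obtain D where D: "Expd k (\<lambda>t X x. run l t X x) D"
    "evt (\<lambda>t X x. ((\<lambda>t. run l t X x) has_vector_derivative D t X x) (at t))"
    using run_expansion[OF l UCk_id[OF bounded_S] k(2)] k(1) by auto
  then obtain a where a: "\<forall>b\<le>k. UCk (k - b) (a b)"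
    "smallo k (\<lambda>t X x. run l t X x - (\<Sum>b\<le>k. t ^ b *\<^sub>R a b X x))"
    "smallo k (\<lambda>t X x. t *\<^sub>R D t X x - (\<Sum>b\<le>k. (real b * t ^ b) *\<^sub>R a b X x))"
    unfolding Expd_def by auto
  have "smallo k (\<lambda>t X x. t *\<^sub>R D t X x - (real k * t ^ k) *\<^sub>R V X x)"
  proof (rule smallo_cong[OF a(3)], rule evt_mono[OF near_evt[OF leading_coefficients[OF a(1,2) V k(1) order_refl]]])
    fix t :: real and X x assume eq: "\<forall>b\<le>k. a b X x = (if b = 0 then x else if b = k then V X x else 0)"
    then have "(\<Sum>b\<le>k. (real b * t ^ b) *\<^sub>R a b X x) = (\<Sum>b\<in>{k}. (real b * t ^ b) *\<^sub>R a b X x)"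
      by (intro sum.mono_neutral_right) auto
    also have "a k X x = V X x" using eq k by simp
    then have "(\<Sum>b\<in>{k}. (real b * t ^ b) *\<^sub>R a b X x) = (real k * t ^ k) *\<^sub>R V X x" by simp
    finally show "t *\<^sub>R D t X x - (real k * t ^ k) *\<^sub>R V X x = t *\<^sub>R D t X x - (\<Sum>b\<le>k. (real b * t ^ b) *\<^sub>R a b X x)"
      by simp
  qed
  then show ?thesis using D(2) by blast
qed

lemma leading_bound:
  assumes A: "smallo k (\<lambda>t X x. A t X x - x - t ^ k *\<^sub>R V X x)" and V: "UC V"
  shows "\<exists>C. evt (\<lambda>t X x. norm (A t X x - x) \<le> C * t ^ k)"
proof -
  obtain B where B: "near (\<lambda>X x. norm (V X x) \<le> B)" using UC_bounded[OF V] by blast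
  have "evt (\<lambda>t X x. norm (A t X x - x) \<le> (B + 1) * t ^ k)"
  proof (rule evt_mono[OF evt_conj[OF smallo_E[OF A zero_less_one] near_evt[OF B]]])
    fix t :: real and X x assume "0 < t"
      and a: "norm (A t X x - x - t ^ k *\<^sub>R V X x) \<le> 1 * t ^ k \<and> norm (V X x) \<le> B"
    then have "norm (t ^ k *\<^sub>R V X x) \<le> t ^ k * B" by (auto intro: mult_left_mono)
    moreover have "norm (A t X x - x) \<le> norm (A t X x - x - t ^ k *\<^sub>R V X x) + norm (t ^ k *\<^sub>R V X x)"
      using norm_triangle_ineq[of "A t X x - x - t ^ k *\<^sub>R V X x" "t ^ k *\<^sub>R V X x"] by simp
    moreover have "(B + 1) * t ^ k = t ^ k * B + t ^ k" by (simp add: algebra_simps)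
    ultimately show "norm (A t X x - x) \<le> (B + 1) * t ^ k" using a by linarith
  qed
  then show ?thesis by blast
qed

text \<open>The expansion of \<open>run l1\<close> to order s1 + s2 is compared at
  \<open>run l2 t X x\<close> and at x. Degree 0 contributes the displacement of \<open>l2\<close>,
  the degrees strictly between 0 and s1 vanish, degree s1 contributes the derivative of
  \<open>V1\<close> along \<open>V2\<close>, and the higher coefficients change too little.\<close>

lemma run_comp_leading:
  assumes l: "set l1 \<subseteq> E" "set l2 \<subseteq> E" and s: "0 < s1" "0 < s2" "s1 + s2 \<le> r"
    and V1: "smallo s1 (\<lambda>t X x. run l1 t X x - x - t ^ s1 *\<^sub>R V1 X x)" "UCk 1 V1"
    and V2: "smallo s2 (\<lambda>t X x. run l2 t X x - x - t ^ s2 *\<^sub>R V2 X x)" "UC V2"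
  shows "smallo (s1 + s2) (\<lambda>t X x. run l1 t X (run l2 t X x) - run l2 t X x - (run l1 t X x - x)
    - t ^ (s1 + s2) *\<^sub>R lie V2 V1 X x)"
proof -
  define k where "k = s1 + s2"
  have k: "k \<le> r" using s by (simp add: k_def)
  note nid = nid_run[OF l(2)]
  obtain D where "Expd k (\<lambda>t X x. run l1 t X x) D"
    using run_expansion[OF l(1) UCk_id[OF bounded_S] k] by auto
  then obtain a where a: "\<forall>b\<le>k. UCk (k - b) (a b)"
    "smallo k (\<lambda>t X x. run l1 t X x - (\<Sum>b\<le>k. t ^ b *\<^sub>R a b X x))"
    unfolding Expd_def by auto
  have lead: "near (\<lambda>X x. \<forall>b\<le>s1. a b X x = (if b = 0 then x else if b = s1 then V1 X x else 0))"
    by (rule leading_coefficients[OF a V1(1) s(1)]) (simp add: k_def)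
  obtain C where C: "evt (\<lambda>t X x. norm (run l2 t X x - x) \<le> C * t ^ s2)" using leading_bound[OF V2] by blast
  \<comment> \<open>The contribution of degree b to this comparison, less what degrees 0 and s1 are
    expected to give.\<close>
  define T where "T b t X x = t ^ b *\<^sub>R (a b X (run l2 t X x) - a b X x)
      - (if b = 0 then run l2 t X x - x else 0) - (if b = s1 then t ^ k *\<^sub>R lie V2 V1 X x else 0)" for b t X x
  have T: "smallo k (T b)" if b: "b \<le> k" for b
  proof (cases "b \<le> s1")
    case True
    have ev: "evt (\<lambda>t X x. a b X x = (if b = 0 then x else if b = s1 then V1 X x else 0) \<and>
        a b X (run l2 t X x) = (if b = 0 then run l2 t X x else if b = s1 then V1 X (run l2 t X x) else 0))"
      by (rule evt_mono[OF evt_conj[OF near_evt[OF lead] evt_comp[OF nid near_evt[OF lead]]]]) (use True in blast)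
    show ?thesis
    proof (cases "b = s1")
      case eq: True
      have "smallo k (\<lambda>t X x. t ^ s1 *\<^sub>R (V1 X (run l2 t X x) - V1 X x - t ^ s2 *\<^sub>R lie V2 V1 X x))"
        by (rule smallo_tpow'[OF first_order_expansion[OF V1(2)[unfolded One_nat_def] V2(1) s(2) V2(2)]]) (simp add: k_def)
      then show ?thesis
        by (rule smallo_cong, intro evt_mono[OF ev])
           (use eq s in \<open>auto simp: T_def k_def scaleR_diff_right power_add\<close>)
    next
      case False
      show ?thesis
        by (rule smallo_cong[OF smallo_zero], rule evt_mono[OF ev]) (use False s in \<open>auto simp: T_def\<close>)
    qed
  next
    case False
    \<comment> \<open>The class \<open>k - b\<close> of the coefficient lies below the order of the
      displacement, so the coefficient changes by o(t^(k-b)).\<close>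
    then have "k - b < s2" using b by (simp add: k_def)
    from UCk_comp_smallo[OF a(1)[rule_format, OF b] nid C this]
    have "smallo k (\<lambda>t X x. t ^ b *\<^sub>R (a b X (run l2 t X x) - a b X x))"
      by (rule smallo_tpow') (use b in simp)
    then show ?thesis by (rule smallo_cong') (use False in \<open>simp add: T_def\<close>)
  qed
  have "smallo k (\<lambda>t X x. run l1 t X (run l2 t X x) - run l2 t X x - (run l1 t X x - x)
    - t ^ k *\<^sub>R lie V2 V1 X x)"
  proof (rule smallo_cong')
    show "smallo k (\<lambda>t X x. (run l1 t X (run l2 t X x) - (\<Sum>b\<le>k. t ^ b *\<^sub>R a b X (run l2 t X x)))
        - (run l1 t X x - (\<Sum>b\<le>k. t ^ b *\<^sub>R a b X x)) + (\<Sum>b\<le>k. T b t X x))"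
      by (intro smallo_add smallo_diff smallo_comp[OF nid a(2)] a(2) smallo_sum T) simp
    fix t X x
    have "(\<Sum>b\<le>k. T b t X x) = (\<Sum>b\<le>k. t ^ b *\<^sub>R a b X (run l2 t X x)) - (\<Sum>b\<le>k. t ^ b *\<^sub>R a b X x)
        - (run l2 t X x - x) - t ^ k *\<^sub>R lie V2 V1 X x"
      by (simp add: T_def sum_subtractf scaleR_diff_right k_def)
    then show "run l1 t X (run l2 t X x) - run l2 t X x - (run l1 t X x - x)
    - t ^ k *\<^sub>R lie V2 V1 X x = (run l1 t X (run l2 t X x) - (\<Sum>b\<le>k. t ^ b *\<^sub>R a b X (run l2 t X x)))
        - (run l1 t X x - (\<Sum>b\<le>k. t ^ b *\<^sub>R a b X x)) + (\<Sum>b\<le>k. T b t X x)" by simp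
  qed
  then show ?thesis by (simp add: k_def)
qed

text \<open>The velocity at the moving point differs from that at x by o(1) times t^(p-1), by mere
  continuity of the field; integration gives the claim.\<close>

lemma st_leading:
  assumes e: "e \<in> E"
  shows "smallo (p e) (\<lambda>t X x. run [e] t X x - x - t ^ p e *\<^sub>R vf e X x)"
proof (rule smallo_integrate[OF p_pos[OF e]])
  let ?D = "\<lambda>t X x. (real (p e) * t ^ (p e - 1)) *\<^sub>R vf e X (st e t X x) - (real (p e) * t ^ (p e - 1)) *\<^sub>R vf e X x"
  have tp: "t * t ^ (p e - 1) = t ^ p e" for t :: real using p_pos[OF e] by (simp add: power_eq_if)
  have uc: "UC (vf e)" using UCk_UC[OF vf[OF e]] .
  have "smallo (p e) (\<lambda>t X x. real (p e) *\<^sub>R (t ^ p e *\<^sub>R (vf e X (st e t X x) - vf e X x)))"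
    by (intro smallo_scaleR_const smallo_tpow'[OF UC_smallo[OF uc nid_st[OF e]]]) simp
  then show "smallo (p e) (\<lambda>t X x. t *\<^sub>R ?D t X x)"
    by (rule smallo_cong') (simp add: scaleR_diff_right mult_ac tp[symmetric])
  show "evt (\<lambda>t X x. ((\<lambda>t. run [e] t X x - x - t ^ p e *\<^sub>R vf e X x) has_vector_derivative ?D t X x) (at t))"
  proof (rule evt_mono[OF st_der[OF e]])
    fix t X x
    assume a: "((\<lambda>t. st e t X x) has_vector_derivative (real (p e) * t ^ (p e - 1)) *\<^sub>R vf e X (st e t X x)) (at t)"
    have "((\<lambda>t. t ^ p e *\<^sub>R vf e X x) has_vector_derivative (real (p e) * t ^ (p e - 1)) *\<^sub>R vf e X x) (at t)"
      using has_vector_derivative_poly[of "\<lambda>_. vf e X x" "{p e}" t] by simp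
    from has_vector_derivative_diff[OF has_vector_derivative_diff[OF a has_vector_derivative_const[of x]] this]
    show "((\<lambda>t. run [e] t X x - x - t ^ p e *\<^sub>R vf e X x) has_vector_derivative ?D t X x) (at t)" by simp
  qed
  show "smallo 0 (\<lambda>t X x. run [e] t X x - x - t ^ p e *\<^sub>R vf e X x)"
    using smallo_diff[OF nid_st[OF e, unfolded nid_def] smallo_UC_tpow[OF uc p_pos[OF e]]] by simp
qed

end

section \<open>Inverse compositions and the commutator of two motions\<close>

locale invertible_steps = steps \<Theta> S st vf p E r
  for \<Theta> :: "'x set" and S :: "'a::euclidean_space set"
    and st :: "'e \<Rightarrow> real \<Rightarrow> 'x \<Rightarrow> 'a \<Rightarrow> 'a" and vf p E r +
  fixes bw :: "'e \<Rightarrow> 'e"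
  assumes bw: "e \<in> E \<Longrightarrow> bw e \<in> E" "bw (bw e) = e"
    and st_bw: "e \<in> E \<Longrightarrow> evt (\<lambda>t X x. st (bw e) t X (st e t X x) = x)"
begin

definition bwl :: "'e list \<Rightarrow> 'e list" where "bwl l = rev (map bw l)"

lemma set_bwl: "set l \<subseteq> E \<Longrightarrow> set (bwl l) \<subseteq> E"
  using bw(1) by (auto simp: bwl_def)

lemma bwl_bwl: "bwl (bwl l) = l"
  by (simp add: bwl_def rev_map[symmetric] o_def bw(2))

lemma run_bwl: "set l \<subseteq> E \<Longrightarrow> evt (\<lambda>t X x. run (bwl l) t X (run l t X x) = x)"
proof (induction l)
  case Nil then show ?case by (simp add: bwl_def evt_True)
next
  case (Cons e l)
  then have e: "e \<in> E" and l: "set l \<subseteq> E" by auto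
  from evt_conj[OF Cons.IH[OF l] evt_comp[OF nid_run[OF l] st_bw[OF e]]]
  show ?case by (rule evt_mono) (simp add: bwl_def run_append)
qed

text \<open>With y the image of x under the inverse, x = y + t^k V(y) + o(t^k), and V(y) may be
  replaced by V(x) by continuity.\<close>

lemma bwl_leading:
  assumes l: "set l \<subseteq> E" and V: "smallo k (\<lambda>t X x. run l t X x - x - t ^ k *\<^sub>R V X x)" "UC V"
  shows "smallo k (\<lambda>t X x. run (bwl l) t X x - x - t ^ k *\<^sub>R (- V X x))"
proof (rule smallo_cong)
  note nid = nid_run[OF set_bwl[OF l]]
  have "smallo k (\<lambda>t X x. t ^ k *\<^sub>R (V X (run (bwl l) t X x) - V X x))"
    by (rule smallo_tpow'[OF UC_smallo[OF V(2) nid]]) simp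
  then show "smallo k (\<lambda>t X x. - (run l t X (run (bwl l) t X x) - run (bwl l) t X x - t ^ k *\<^sub>R V X (run (bwl l) t X x))
      - t ^ k *\<^sub>R (V X (run (bwl l) t X x) - V X x))"
    by (intro smallo_diff smallo_minus smallo_comp[OF nid V(1)])
  show "evt (\<lambda>t X x. run (bwl l) t X x - x - t ^ k *\<^sub>R (- V X x) =
      - (run l t X (run (bwl l) t X x) - run (bwl l) t X x - t ^ k *\<^sub>R V X (run (bwl l) t X x))
      - t ^ k *\<^sub>R (V X (run (bwl l) t X x) - V X x))"
    using run_bwl[OF set_bwl[OF l]] unfolding bwl_bwl
    by (rule evt_mono) (simp add: scaleR_diff_right)
qed

text \<open>Let \<open>A\<close> and \<open>B\<close> be the compositions of the step \<open>e\<close> and of \<open>run l\<close> in the two orders.  Their difference is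
  \<open>t\<^sup>k\<close> times the commutator up to \<open>o(t\<^sup>k)\<close>.  The map \<open>K\<close> inverts \<open>B\<close> and is close to the identity in the Lipschitz sense,
  so that \<open>K \<circ> A - id = K \<circ> A - K \<circ> B\<close> differs from \<open>A - B\<close> by \<open>o(t\<^sup>k)\<close>.\<close>

lemma commutator_leading:
  assumes e: "e \<in> E" and l: "set l \<subseteq> E" and q: "0 < q" "p e + q \<le> r"
    and V: "smallo q (\<lambda>t X x. run l t X x - x - t ^ q *\<^sub>R V X x)" "UCk 1 V"
  shows "smallo (p e + q) (\<lambda>t X x. run (bwl l @ bw e # l @ [e]) t X x - x
    - t ^ (p e + q) *\<^sub>R (lie (vf e) V X x - lie V (vf e) X x))"
proof -
  define k where "k = p e + q"
  define A where "A t X x = run l t X (run [e] t X x)" for t X x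
  define B where "B t X x = run [e] t X (run l t X x)" for t X x
  \<comment> \<open>First the step \<open>e\<close> is undone, then the list \<open>l\<close>; this
    inverts \<open>B\<close>.\<close>
  define K where "K = run (bwl l @ [bw e])"
  have E: "set [e] \<subseteq> E" "set (bwl l @ [bw e]) \<subseteq> E" using e bw(1) set_bwl[OF l] by auto
  have vf1: "UCk 1 (vf e)" by (rule UCk_mono[OF vf[OF e]]) simp
  have UCV: "UC V" "UC (vf e)" using V(2) vf1 UCk_UC by auto
  have nA: "nid A" and nB: "nid B"
    unfolding A_def B_def using nid_comp[OF nid_run[OF l] nid_run[OF E(1)]] nid_comp[OF nid_run[OF E(1)] nid_run[OF l]] by auto
  have 1: "smallo k (\<lambda>t X x. A t X x - run [e] t X x - (run l t X x - x) - t ^ k *\<^sub>R lie (vf e) V X x)"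
    using run_comp_leading[OF l E(1) q(1) p_pos[OF e] _ V st_leading[OF e] UCV(2)] q(2)
    by (simp add: A_def k_def add.commute)
  have 2: "smallo k (\<lambda>t X x. B t X x - run l t X x - (run [e] t X x - x) - t ^ k *\<^sub>R lie V (vf e) X x)"
    using run_comp_leading[OF E(1) l p_pos[OF e] q(1) q(2) st_leading[OF e] vf1 V(1) UCV(1)]
    by (simp add: B_def k_def)
  have AB: "smallo k (\<lambda>t X x. A t X x - B t X x - t ^ k *\<^sub>R (lie (vf e) V X x - lie V (vf e) X x))"
    by (rule smallo_cong'[OF smallo_diff[OF 1 2]]) (simp add: scaleR_diff_right)
  have uc: "UC (\<lambda>X x. lie (vf e) V X x - lie V (vf e) X x)"
    using UCk_lie[of 0 "vf e" V] UCk_lie[of 0 V "vf e"] vf1 V(2) UCV UCk_diff[of 0 "lie (vf e) V" "lie V (vf e)"] by simp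
  \<comment> \<open>Adding and subtracting x brings A - B into the form that
    \<open>leading_bound\<close> expects.\<close>
  have "smallo k (\<lambda>t X x. x + (A t X x - B t X x) - x - t ^ k *\<^sub>R (lie (vf e) V X x - lie V (vf e) X x))"
    using AB by simp
  from leading_bound[OF this uc] obtain C where C: "evt (\<lambda>t X x. norm (A t X x - B t X x) \<le> C * t ^ k)" by auto
  have KK: "smallo k (\<lambda>t X x. (K t X (A t X x) - K t X (B t X x)) - (A t X x - B t X x))"
    unfolding K_def by (rule lipo_near_id_smallo[OF lipo_run[OF E(2)] nA nB C])
  have "smallo k (\<lambda>t X x. run (bwl l @ bw e # l @ [e]) t X x - x - t ^ k *\<^sub>R (lie (vf e) V X x - lie V (vf e) X x))"
  proof (rule smallo_cong[OF smallo_add[OF KK AB]])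
    show "evt (\<lambda>t X x. run (bwl l @ bw e # l @ [e]) t X x - x - t ^ k *\<^sub>R (lie (vf e) V X x - lie V (vf e) X x) =
        K t X (A t X x) - K t X (B t X x) - (A t X x - B t X x) +
        (A t X x - B t X x - t ^ k *\<^sub>R (lie (vf e) V X x - lie V (vf e) X x)))"
      using evt_conj[OF run_bwl[OF l] evt_comp[OF nid_run[OF l] st_bw[OF e]]]
      by (rule evt_mono) (simp add: K_def A_def B_def run_append)
  qed
  then show ?thesis by (simp add: k_def)
qed

end


section \<open>The flows of the given fields\<close>

lemma has_vector_derivative_affine:
  fixes \<phi> :: "real \<Rightarrow> 'b::real_normed_vector"
  assumes "(\<phi> has_vector_derivative v) (at (a + c * \<tau>) within A)" "\<And>s. s \<in> B \<Longrightarrow> a + c * s \<in> A"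
  shows "((\<lambda>s. \<phi> (a + c * s)) has_vector_derivative c *\<^sub>R v) (at \<tau> within B)"
proof -
  have "((\<lambda>s. a + c * s) has_vector_derivative c) (at \<tau> within B)"
    by (auto intro!: derivative_eq_intros simp: has_real_derivative_iff_has_vector_derivative[symmetric])
  moreover have "(\<phi> has_vector_derivative v) (at (a + c * \<tau>) within (\<lambda>s. a + c * s) ` B)"
    by (rule has_vector_derivative_within_subset[OF assms(1)]) (use assms(2) in auto)
  ultimately show ?thesis
    using vector_diff_chain_within[of "\<lambda>s. a + c * s" c \<tau> B \<phi> v] by (simp add: o_def)
qed

lemma exp_rel_converse_subset:
  assumes "(x, y) \<in> exp_rel \<Omega> V t"
  shows "(y, x) \<in> exp_rel \<Omega> V (- t)"
proof -
  obtain \<phi> where \<phi>: "\<phi> 0 = x" "\<phi> t = y" "\<And>\<tau>. \<tau> \<in> closed_segment 0 t \<Longrightarrow> \<phi> \<tau> \<in> \<Omega> \<and>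
      (\<phi> has_vector_derivative V (\<phi> \<tau>)) (at \<tau> within closed_segment 0 t)"
    using assms by (auto simp: exp_rel_def)
  have seg: "\<tau> \<in> closed_segment 0 (- t) \<Longrightarrow> t + 1 * \<tau> \<in> closed_segment 0 t" for \<tau>
    by (auto simp: closed_segment_eq_real_ivl split: if_splits)
  have "((\<lambda>s. \<phi> (t + 1 * s)) has_vector_derivative 1 *\<^sub>R V (\<phi> (t + 1 * \<tau>))) (at \<tau> within closed_segment 0 (- t))"
    if "\<tau> \<in> closed_segment 0 (- t)" for \<tau>
    using \<phi>(3)[OF seg[OF that]] seg by (intro has_vector_derivative_affine[where A = "closed_segment 0 t"]) auto
  then show ?thesis unfolding exp_rel_def
    using \<phi>(1,2) \<phi>(3)[OF seg] by (intro CollectI case_prodI exI[of _ "\<lambda>s. \<phi> (t + 1 * s)"]) simp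
qed

lemma exp_rel_converse: "(x, y) \<in> exp_rel \<Omega> V t \<longleftrightarrow> (y, x) \<in> exp_rel \<Omega> V (- t)"
  using exp_rel_converse_subset[of x y \<Omega> V t] exp_rel_converse_subset[of y x \<Omega> V "- t"] by auto

lemma exp_rel_uminus_subset:
  assumes "(x, y) \<in> exp_rel \<Omega> V t"
  shows "(x, y) \<in> exp_rel \<Omega> (\<lambda>x. - V x) (- t)"
proof -
  obtain \<phi> where \<phi>: "\<phi> 0 = x" "\<phi> t = y" "\<And>\<tau>. \<tau> \<in> closed_segment 0 t \<Longrightarrow> \<phi> \<tau> \<in> \<Omega> \<and>
      (\<phi> has_vector_derivative V (\<phi> \<tau>)) (at \<tau> within closed_segment 0 t)"
    using assms by (auto simp: exp_rel_def)
  have seg: "\<tau> \<in> closed_segment 0 (- t) \<Longrightarrow> 0 + (- 1) * \<tau> \<in> closed_segment 0 t" for \<tau>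
    by (auto simp: closed_segment_eq_real_ivl split: if_splits)
  have "((\<lambda>s. \<phi> (0 + (- 1) * s)) has_vector_derivative (- 1) *\<^sub>R V (\<phi> (0 + (- 1) * \<tau>))) (at \<tau> within closed_segment 0 (- t))"
    if "\<tau> \<in> closed_segment 0 (- t)" for \<tau>
    using \<phi>(3)[OF seg[OF that]] seg by (intro has_vector_derivative_affine[where A = "closed_segment 0 t"]) auto
  then show ?thesis unfolding exp_rel_def
    using \<phi>(1,2) \<phi>(3)[OF seg] by (intro CollectI case_prodI exI[of _ "\<lambda>s. \<phi> (0 + (- 1) * s)"]) simp
qed

lemma exp_rel_uminus: "exp_rel \<Omega> (\<lambda>x. - V x) t = exp_rel \<Omega> V (- t)"
  using exp_rel_uminus_subset[of _ _ \<Omega> V "- t"] exp_rel_uminus_subset[of _ _ \<Omega> "\<lambda>x. - V x" t] by auto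

text \<open>For time 0 the segment is a single point, where every vector is a derivative within it;
  so the constant curve qualifies.\<close>

lemma exp_rel_0: "(x, y) \<in> exp_rel \<Omega> V 0 \<longleftrightarrow> x \<in> \<Omega> \<and> y = x"
proof
  show "x \<in> \<Omega> \<and> y = x" if "(x, y) \<in> exp_rel \<Omega> V 0" using that by (auto simp: exp_rel_def)
  assume "x \<in> \<Omega> \<and> y = x"
  then show "(x, y) \<in> exp_rel \<Omega> V 0"
    unfolding exp_rel_def by (intro CollectI case_prodI exI[of _ "\<lambda>_. x"])
      (auto simp: has_vector_derivative_def has_derivative_def at_within_def inf_principal bounded_linear_scaleR_left)
qed

lemma C1_on_time_power: "C1_on (\<lambda>(t::real, x::'a::euclidean_space). (t ^ p, x)) U"
proof -
  define D :: "real \<times> 'a \<Rightarrow> (real \<times> 'a) \<Rightarrow>\<^sub>L (real \<times> 'a)" where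
    "D z = (real p * fst z ^ (p - 1)) *\<^sub>R (blinfun_scaleR_left (1, 0) o\<^sub>L fst_blinfun) +
        (Blinfun (\<lambda>x. (0, x)) o\<^sub>L snd_blinfun)" for z
  have bl: "bounded_linear (\<lambda>x::'a. (0::real, x))"
    by (intro bounded_linear_Pair bounded_linear_zero bounded_linear_ident)
  have "((\<lambda>(t, x). (t ^ p, x)) has_derivative blinfun_apply (D z)) (at z)" for z
    unfolding case_prod_unfold
    by (auto intro!: derivative_eq_intros simp: D_def fun_eq_iff blinfun.bilinear_simps bounded_linear_Blinfun_apply[OF bl])
  moreover have "continuous_on U D" unfolding D_def by (intro continuous_intros)
  ultimately show ?thesis unfolding C1_on_def by blast
qed

text \<open>The hypotheses on the fields in the form used by the estimates: a common speed bound and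
  membership in the uniform classes, where \<open>max 1 (r - wt i)\<close> is the regularity
  \<open>reg r i\<close>.\<close>

locale flows =
  fixes \<Omega> \<Omega>' :: "'a::euclidean_space set" and \<Theta> :: "(nat \<Rightarrow> 'a \<Rightarrow> 'a) set" and n r :: nat and M :: real
  assumes open_\<Omega>: "open \<Omega>" and cpt: "compact (closure \<Omega>')" "closure \<Omega>' \<subseteq> \<Omega>" and r2: "2 \<le> r"
    and M: "0 \<le> M" "\<And>X i x. X \<in> \<Theta> \<Longrightarrow> i \<le> n \<Longrightarrow> x \<in> \<Omega> \<Longrightarrow> norm (X i x) \<le> M"
    and UCk_fields: "\<And>i. i \<le> n \<Longrightarrow> germs.UCk \<Theta> \<Omega>' (max 1 (r - wt i)) (\<lambda>X. X i)"
begin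

sublocale germs \<Theta> \<Omega>' .

text \<open>A step \<open>(s, i)\<close> follows \<open>X\<^sub>i\<close> forwards if \<open>s\<close> holds and backwards otherwise.\<close>

definition sfield :: "bool \<times> nat \<Rightarrow> (nat \<Rightarrow> 'a \<Rightarrow> 'a) \<Rightarrow> 'a \<Rightarrow> 'a" where
  "sfield e X x = (if fst e then X (snd e) x else - X (snd e) x)"

definition sflow :: "bool \<times> nat \<Rightarrow> real \<Rightarrow> (nat \<Rightarrow> 'a \<Rightarrow> 'a) \<Rightarrow> 'a \<Rightarrow> 'a" where
  "sflow e t X x = flow \<Omega> (sfield e X) (t ^ wt (snd e)) x"

definition sflip :: "bool \<times> nat \<Rightarrow> bool \<times> nat" where
  "sflip e = (\<not> fst e, snd e)"

abbreviation steps_set :: "(bool \<times> nat) set" where "steps_set \<equiv> UNIV \<times> {0..n}"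

lemma UCk_sfield: "e \<in> steps_set \<Longrightarrow> UCk (max 1 (r - wt (snd e))) (sfield e)"
proof -
  assume e: "e \<in> steps_set"
  then have f: "UCk (max 1 (r - wt (snd e))) (\<lambda>X. X (snd e))" by (intro UCk_fields) auto
  show ?thesis
  proof (cases "fst e")
    case True
    then have "sfield e = (\<lambda>X. X (snd e))" by (auto simp: sfield_def fun_eq_iff)
    then show ?thesis using f by simp
  next
    case False
    then have "sfield e = (\<lambda>X x. (-1) *\<^sub>R X (snd e) x)" by (auto simp: sfield_def fun_eq_iff)
    then show ?thesis using UCk_scaleR_const[OF f, of "-1"] by simp
  qed
qed

lemma wt_pos: "0 < wt i"
  by (simp add: wt_def)

text \<open>All sizes are taken from the uniform classes, so that one box serves every member of
  \<Theta>. The bound \<open>T \<le> 1\<close> makes t^wt at most t.\<close>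

lemma sfield_box:
  assumes e: "e \<in> steps_set"
  shows "\<exists>\<delta> T L. 0 < \<delta> \<and> 0 < T \<and> T \<le> 1 \<and> 0 \<le> L \<and>
    (\<forall>X\<in>\<Theta>. flow_box \<Omega> (nb \<Omega>' (4 * \<delta>)) (nb \<Omega>' \<delta>) (sfield e X) (dblin (sfield e X)) T \<delta> M L)"
proof -
  have c1: "UCk (Suc 0) (sfield e)" by (rule UCk_mono[OF UCk_sfield[OF e]]) simp
  from UC_dblin[OF c1] obtain \<rho> L where \<rho>: "0 < \<rho>" "0 \<le> L"
    "\<And>\<rho>' X x. \<rho>' \<le> \<rho> \<Longrightarrow> X \<in> \<Theta> \<Longrightarrow> x \<in> nb \<Omega>' \<rho>' \<Longrightarrow> norm (dblin (sfield e X) x) \<le> L"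
    "\<And>e'. 0 < e' \<Longrightarrow> \<exists>d>0. osc_le \<rho> d e' (\<lambda>X. dblin (sfield e X))"
    by (rule UC_E) blast
  have "near (\<lambda>X x. sfield e X differentiable (at x))" using c1 by simp
  then obtain \<rho>2 where \<rho>2: "\<rho>2 > 0" "\<And>X x. X \<in> \<Theta> \<Longrightarrow> x \<in> nb \<Omega>' \<rho>2 \<Longrightarrow> sfield e X differentiable (at x)"
    unfolding near_def by blast
  obtain \<rho>3 where \<rho>3: "\<rho>3 > 0" "nb \<Omega>' \<rho>3 \<subseteq> \<Omega>" using nb_subset_open[OF cpt(1) open_\<Omega> cpt(2)] by blast
  define \<delta> where "\<delta> = min \<rho> (min \<rho>2 \<rho>3) / 4"
  have \<delta>: "0 < \<delta>" "4 * \<delta> \<le> \<rho>" "4 * \<delta> \<le> \<rho>2" "4 * \<delta> \<le> \<rho>3" using \<rho>(1) \<rho>2(1) \<rho>3(1) by (auto simp: \<delta>_def)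
  \<comment> \<open>The last two entries of the minimum ensure \<open>M * T \<le> \<delta>\<close>
    and \<open>L * T \<le> 1/2\<close>, as \<open>flow_box\<close> demands; the added 1 keeps the
    denominators positive.\<close>
  define T where "T = min 1 (min (\<delta> / (M + 1)) (1 / (2 * (L + 1))))"
  have T: "0 < T" "T \<le> 1" using \<delta> M(1) \<rho>(2) by (auto simp: T_def)
  have "M * T \<le> (M + 1) * (\<delta> / (M + 1))" using M(1) \<delta> T by (intro mult_mono) (auto simp: T_def)
  then have MT: "M * T \<le> \<delta>" using M(1) by simp
  have "L * T \<le> (L + 1) * (1 / (2 * (L + 1)))" using \<rho>(2) T by (intro mult_mono) (auto simp: T_def)
  also have "\<dots> = 1/2" using \<rho>(2) by simp
  finally have LT: "L * T \<le> 1/2" .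
  have "flow_box \<Omega> (nb \<Omega>' (4 * \<delta>)) (nb \<Omega>' \<delta>) (sfield e X) (dblin (sfield e X)) T \<delta> M L" if X: "X \<in> \<Theta>" for X
  proof
    show "nb \<Omega>' (4 * \<delta>) \<subseteq> \<Omega>" using nb_mono[OF \<delta>(4), of \<Omega>'] \<rho>3(2) by blast
    show "norm (sfield e X x) \<le> M" if "x \<in> \<Omega>" for x using M(2)[OF X _ that, of "snd e"] e by (auto simp: sfield_def)
    show "(sfield e X has_derivative blinfun_apply (dblin (sfield e X) x)) (at x)" if "x \<in> nb \<Omega>' (4 * \<delta>)" for x
      using \<rho>2(2)[OF X subsetD[OF nb_mono[OF \<delta>(3)] that]] by (rule dblin_has_derivative)
    show "uniformly_continuous_on (nb \<Omega>' (4 * \<delta>)) (dblin (sfield e X))"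
      unfolding uniformly_continuous_on_def
    proof (intro allI impI)
      fix \<epsilon> :: real assume "\<epsilon> > 0"
      then have "\<epsilon>/2 > 0" by simp
      from \<rho>(4)[OF this] obtain d where d: "d > 0" "osc_le \<rho> d (\<epsilon>/2) (\<lambda>X. dblin (sfield e X))" by blast
      show "\<exists>d>0. \<forall>x\<in>nb \<Omega>' (4 * \<delta>). \<forall>x'\<in>nb \<Omega>' (4 * \<delta>). dist x' x < d \<longrightarrow> dist (dblin (sfield e X) x') (dblin (sfield e X) x) < \<epsilon>"
      proof (intro exI[of _ d] conjI ballI impI d(1))
        fix x x' assume "x \<in> nb \<Omega>' (4 * \<delta>)" "x' \<in> nb \<Omega>' (4 * \<delta>)" "dist x' x < d"
        then have "norm (dblin (sfield e X) x' - dblin (sfield e X) x) \<le> \<epsilon>/2" using d(2) \<delta>(2) X by blast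
        then show "dist (dblin (sfield e X) x') (dblin (sfield e X) x) < \<epsilon>" using \<open>\<epsilon> > 0\<close> by (simp add: dist_norm)
      qed
    qed
    show "norm (dblin (sfield e X) x) \<le> L" if "x \<in> nb \<Omega>' (4 * \<delta>)" for x using \<rho>(3)[OF \<delta>(2) X that] .
    show "cball x (3 * \<delta>) \<subseteq> nb \<Omega>' (4 * \<delta>)" if "x \<in> nb \<Omega>' \<delta>" for x
      using cball_subset_nb[OF that, of "3 * \<delta>"] by simp
  qed (use open_nb T \<delta> M(1) \<rho>(2) MT LT in auto)
  then show ?thesis using \<delta>(1) T \<rho>(2) by blast
qed

lemma power_wt_bounds: "0 \<le> t \<Longrightarrow> t \<le> 1 \<Longrightarrow> 0 \<le> t ^ wt i \<and> t ^ wt i \<le> (t::real)"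
  using power_decreasing[of 1 "wt i" t] wt_pos[of i] by simp

definition sflow_ok :: "bool \<times> nat \<Rightarrow> real \<Rightarrow> real \<Rightarrow> real \<Rightarrow> (nat \<Rightarrow> 'a \<Rightarrow> 'a) \<Rightarrow> bool" where
  "sflow_ok e \<delta> d L X \<longleftrightarrow>
     (\<forall>t x y. 0 \<le> t \<longrightarrow> t < d \<longrightarrow> x \<in> nb \<Omega>' \<delta> \<longrightarrow> ((x, y) \<in> exp_rel \<Omega> (sfield e X) (t ^ wt (snd e)) \<longleftrightarrow> y = sflow e t X x)) \<and>
     (\<forall>t x. 0 < t \<longrightarrow> t < d \<longrightarrow> x \<in> nb \<Omega>' \<delta> \<longrightarrow> norm (sflow e t X x - x) \<le> M * t ^ wt (snd e) \<and>
        ((\<lambda>t. sflow e t X x) has_vector_derivative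
          (real (wt (snd e)) * t ^ (wt (snd e) - 1)) *\<^sub>R sfield e X (sflow e t X x)) (at t)) \<and>
     (\<forall>t x y. 0 < t \<longrightarrow> t < d \<longrightarrow> x \<in> nb \<Omega>' \<delta> \<longrightarrow> y \<in> nb \<Omega>' \<delta> \<longrightarrow> norm (x - y) \<le> \<delta> \<longrightarrow>
        norm ((sflow e t X x - x) - (sflow e t X y - y)) \<le> 2 * L * t ^ wt (snd e) * norm (x - y)) \<and>
     C1_on (\<lambda>(t, x). sflow e t X x) ({0<..<d} \<times> nb \<Omega>' \<delta>)"

lemma sflow_okD:
  assumes "sflow_ok e \<delta> d L X"
  shows "0 \<le> t \<Longrightarrow> t < d \<Longrightarrow> x \<in> nb \<Omega>' \<delta> \<Longrightarrow> (x, y) \<in> exp_rel \<Omega> (sfield e X) (t ^ wt (snd e)) \<longleftrightarrow> y = sflow e t X x"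
    and "0 < t \<Longrightarrow> t < d \<Longrightarrow> x \<in> nb \<Omega>' \<delta> \<Longrightarrow> norm (sflow e t X x - x) \<le> M * t ^ wt (snd e)"
    and "0 < t \<Longrightarrow> t < d \<Longrightarrow> x \<in> nb \<Omega>' \<delta> \<Longrightarrow> ((\<lambda>t. sflow e t X x) has_vector_derivative
          (real (wt (snd e)) * t ^ (wt (snd e) - 1)) *\<^sub>R sfield e X (sflow e t X x)) (at t)"
    and "0 < t \<Longrightarrow> t < d \<Longrightarrow> x \<in> nb \<Omega>' \<delta> \<Longrightarrow> y \<in> nb \<Omega>' \<delta> \<Longrightarrow> norm (x - y) \<le> \<delta> \<Longrightarrow>
        norm ((sflow e t X x - x) - (sflow e t X y - y)) \<le> 2 * L * t ^ wt (snd e) * norm (x - y)"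
    and "C1_on (\<lambda>(t, x). sflow e t X x) ({0<..<d} \<times> nb \<Omega>' \<delta>)"
  using assms unfolding sflow_ok_def by simp_all

lemma sflow_facts:
  assumes e: "e \<in> steps_set"
  obtains \<delta> d L where "0 < \<delta>" "0 < d" "0 \<le> L" "\<And>X. X \<in> \<Theta> \<Longrightarrow> sflow_ok e \<delta> d L X"
proof -
  obtain \<delta> T L where T: "0 < \<delta>" "0 < T" "T \<le> 1" "0 \<le> L"
    "\<And>X. X \<in> \<Theta> \<Longrightarrow> flow_box \<Omega> (nb \<Omega>' (4 * \<delta>)) (nb \<Omega>' \<delta>) (sfield e X) (dblin (sfield e X)) T \<delta> M L"
    using sfield_box[OF e] by blast
  let ?p = "wt (snd e)"
  have tp: "0 \<le> t ^ ?p" "t ^ ?p < T" if "0 \<le> t" "t < T" for t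
    using power_wt_bounds[of t "snd e"] that T by auto
  show ?thesis
  proof (rule that[OF T(1,2,4)], unfold sflow_ok_def, intro conjI)
    fix X assume X: "X \<in> \<Theta>"
    interpret flow_box \<Omega> "nb \<Omega>' (4 * \<delta>)" "nb \<Omega>' \<delta>" "sfield e X" "dblin (sfield e X)" T \<delta> M L by (rule T(5)[OF X])
    show "\<forall>t x y. 0 \<le> t \<longrightarrow> t < T \<longrightarrow> x \<in> nb \<Omega>' \<delta> \<longrightarrow> ((x, y) \<in> exp_rel \<Omega> (sfield e X) (t ^ ?p) \<longleftrightarrow> y = sflow e t X x)"
      unfolding sflow_def by (intro allI impI exp_rel_flow) (use tp in \<open>auto simp: less_imp_le\<close>)
    show "\<forall>t x. 0 < t \<longrightarrow> t < T \<longrightarrow> x \<in> nb \<Omega>' \<delta> \<longrightarrow> norm (sflow e t X x - x) \<le> M * t ^ ?p \<and>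
        ((\<lambda>t. sflow e t X x) has_vector_derivative (real ?p * t ^ (?p - 1)) *\<^sub>R sfield e X (sflow e t X x)) (at t)"
    proof (intro allI impI conjI)
      fix t x assume t: "0 < t" "t < T" and x: "x \<in> nb \<Omega>' \<delta>"
      show "norm (sflow e t X x - x) \<le> M * t ^ ?p"
        unfolding sflow_def by (rule flow_near[OF x]) (use tp[of t] t in auto)
      have "((\<lambda>t. flow \<Omega> (sfield e X) t x) has_vector_derivative sfield e X (flow \<Omega> (sfield e X) (t ^ ?p) x)) (at (t ^ ?p))"
        by (rule has_vector_derivative_interior[OF flow_vector_derivative[OF x]]) (use tp[of t] t in auto)
      moreover have "((\<lambda>t. t ^ ?p) has_vector_derivative (real ?p * t ^ (?p - 1))) (at t)"
        using DERIV_pow[of ?p t] by (simp add: has_real_derivative_iff_has_vector_derivative)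
      ultimately show "((\<lambda>t. sflow e t X x) has_vector_derivative (real ?p * t ^ (?p - 1)) *\<^sub>R sfield e X (sflow e t X x)) (at t)"
        unfolding sflow_def using vector_diff_chain_at[of "\<lambda>t. t ^ ?p"] by (auto simp: o_def)
    qed
    show "\<forall>t x y. 0 < t \<longrightarrow> t < T \<longrightarrow> x \<in> nb \<Omega>' \<delta> \<longrightarrow> y \<in> nb \<Omega>' \<delta> \<longrightarrow> norm (x - y) \<le> \<delta> \<longrightarrow>
        norm ((sflow e t X x - x) - (sflow e t X y - y)) \<le> 2 * L * t ^ ?p * norm (x - y)"
      unfolding sflow_def by (intro allI impI flow_lip(2)) (use tp in \<open>auto simp: less_imp_le\<close>)
    have "C1_on (\<lambda>z. (\<lambda>(t, x). flow \<Omega> (sfield e X) t x) ((\<lambda>(t, x). (t ^ ?p, x)) z)) ({0<..<T} \<times> nb \<Omega>' \<delta>)"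
      by (rule C1_on_compose[OF flow_C1 C1_on_time_power]) (use tp in auto)
    then show "C1_on (\<lambda>(t, x). sflow e t X x) ({0<..<T} \<times> nb \<Omega>' \<delta>)"
      by (simp add: case_prod_unfold sflow_def)
  qed
qed

lemma sflow_rel:
  assumes "e \<in> steps_set"
  shows "evt (\<lambda>t X x. \<forall>y. (x, y) \<in> exp_rel \<Omega> (sfield e X) (t ^ wt (snd e)) \<longleftrightarrow> y = sflow e t X x)"
proof -
  obtain \<delta> d L where D: "0 < \<delta>" "0 < d" "\<And>X. X \<in> \<Theta> \<Longrightarrow> sflow_ok e \<delta> d L X"
    by (rule sflow_facts[OF assms]) blast
  show ?thesis by (rule evtI[OF D(1,2)]) (simp add: sflow_okD(1)[OF D(3)])
qed

lemma sflow_pointwise: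
  assumes "e \<in> steps_set"
  shows "evt (\<lambda>t X x. norm (sflow e t X x - x) \<le> M * t ^ wt (snd e))"
    and "evt (\<lambda>t X x. ((\<lambda>t. sflow e t X x) has_vector_derivative
          (real (wt (snd e)) * t ^ (wt (snd e) - 1)) *\<^sub>R sfield e X (sflow e t X x)) (at t))"
proof -
  obtain \<delta> d L where D: "0 < \<delta>" "0 < d" "\<And>X. X \<in> \<Theta> \<Longrightarrow> sflow_ok e \<delta> d L X"
    by (rule sflow_facts[OF assms]) blast
  show "evt (\<lambda>t X x. norm (sflow e t X x - x) \<le> M * t ^ wt (snd e))"
    by (rule evtI[OF D(1,2)]) (rule sflow_okD(2)[OF D(3)])
  show "evt (\<lambda>t X x. ((\<lambda>t. sflow e t X x) has_vector_derivative
          (real (wt (snd e)) * t ^ (wt (snd e) - 1)) *\<^sub>R sfield e X (sflow e t X x)) (at t))"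
    by (rule evtI[OF D(1,2)]) (rule sflow_okD(3)[OF D(3)])
qed

lemma sflow_lipo:
  assumes "e \<in> steps_set" "k < wt (snd e)"
  shows "lipo k (\<lambda>t X x. sflow e t X x - x)"
proof -
  obtain \<delta> d L where D: "0 < \<delta>" "0 < d" "0 \<le> L" "\<And>X. X \<in> \<Theta> \<Longrightarrow> sflow_ok e \<delta> d L X"
    by (rule sflow_facts[OF assms(1)]) blast
  have "evt_at (\<delta>/2) (\<lambda>t X x. \<forall>y. dist x y < \<delta>/2 \<longrightarrow>
      norm ((sflow e t X x - x) - (sflow e t X y - y)) \<le> c * t ^ k * norm (x - y))" if "c > 0" for c
    unfolding evt_at_def
  \<comment> \<open>As the weight exceeds k, one spare power of t is available, and the last bound
    lets it absorb the constant \<open>2 * L\<close>.\<close>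
  proof (intro exI[of _ "min 1 (min d (c / (2 * L + 1)))"] conjI allI impI)
    show "0 < min 1 (min d (c / (2 * L + 1)))" using D that by simp
    fix t X x y
    assume t: "0 < t" "t < min 1 (min d (c / (2 * L + 1)))" and X: "X \<in> \<Theta>" and x: "x \<in> nb \<Omega>' (\<delta>/2)"
      and xy: "dist x y < \<delta>/2"
    have "x \<in> nb \<Omega>' \<delta>" "y \<in> nb \<Omega>' \<delta>"
      using nb_step[OF x, of y "\<delta>/2"] nb_step[OF x, of x "\<delta>/2"] xy D(1) by auto
    then have "norm ((sflow e t X x - x) - (sflow e t X y - y)) \<le> 2 * L * t ^ wt (snd e) * norm (x - y)"
      by (intro sflow_okD(4)[OF D(4)[OF X]]) (use D(1) t xy in \<open>auto simp: dist_norm\<close>)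
    also have "\<dots> \<le> c * t ^ k * norm (x - y)"
    proof (rule mult_right_mono)
      have "t ^ wt (snd e) \<le> t ^ Suc k" using t assms(2) by (intro power_decreasing) auto
      then have "2 * L * t ^ wt (snd e) \<le> 2 * L * t ^ Suc k" using D(3) by (intro mult_left_mono) auto
      also have "\<dots> \<le> ((2 * L + 1) * t) * t ^ k" using t by (simp add: algebra_simps)
      also have "\<dots> \<le> c * t ^ k"
        using t D(3) by (intro mult_right_mono) (auto simp: pos_less_divide_eq mult.commute less_imp_le)
      finally show "2 * L * t ^ wt (snd e) \<le> c * t ^ k" .
    qed simp
    finally show "norm ((sflow e t X x - x) - (sflow e t X y - y)) \<le> c * t ^ k * norm (x - y)" .
  qed
  then show ?thesis unfolding lipo_def using D(1) by (intro exI[of _ "\<delta>/2"]) auto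
qed

lemma sflow_C1:
  assumes "e \<in> steps_set"
  shows "\<exists>\<delta>>0. \<exists>d>0. \<forall>X\<in>\<Theta>. C1_on (\<lambda>(t, x). sflow e t X x) ({0<..<d} \<times> nb \<Omega>' \<delta>)"
  by (rule sflow_facts[OF assms]) (use sflow_okD(5) in blast)

lemma sflow_near_id: "e \<in> steps_set \<Longrightarrow> nid (sflow e)"
  unfolding nid_def by (rule smallo_bigo[OF sflow_pointwise(1) wt_pos])

lemma exp_rel_sflip: "exp_rel \<Omega> (sfield (sflip e) X) t = (exp_rel \<Omega> (sfield e X) t)\<inverse>"
proof -
  have "exp_rel \<Omega> (sfield (sflip e) X) t = exp_rel \<Omega> (sfield e X) (- t)"
  proof (cases "fst e")
    case True
    then have "sfield (sflip e) X = (\<lambda>x. - sfield e X x)" by (auto simp: sfield_def sflip_def)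
    then show ?thesis using exp_rel_uminus by metis
  next
    case False
    then have "sfield e X = (\<lambda>x. - sfield (sflip e) X x)" by (auto simp: sfield_def sflip_def)
    then show ?thesis using exp_rel_uminus[of \<Omega> "sfield (sflip e) X" "- t"] by simp
  qed
  then show ?thesis using exp_rel_converse[of _ _ \<Omega> "sfield e X" t] by auto
qed

text \<open>The trajectory read backwards is a trajectory of the opposite field, and by uniqueness
  it is the one that the flipped step follows.\<close>

lemma sflow_inverse:
  assumes e: "e \<in> steps_set"
  shows "evt (\<lambda>t X x. sflow (sflip e) t X (sflow e t X x) = x)"
proof -
  have e': "sflip e \<in> steps_set" using e by (auto simp: sflip_def)
  from evt_conj[OF sflow_rel[OF e] evt_comp[OF sflow_near_id[OF e] sflow_rel[OF e']]]
  show ?thesis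
  proof (rule evt_mono)
    fix t X x
    assume a: "(\<forall>y. (x, y) \<in> exp_rel \<Omega> (sfield e X) (t ^ wt (snd e)) \<longleftrightarrow> y = sflow e t X x) \<and>
      (\<forall>y. (sflow e t X x, y) \<in> exp_rel \<Omega> (sfield (sflip e) X) (t ^ wt (snd (sflip e))) \<longleftrightarrow> y = sflow (sflip e) t X (sflow e t X x))"
    then have "(x, sflow e t X x) \<in> exp_rel \<Omega> (sfield e X) (t ^ wt (snd e))" by simp
    then have "(sflow e t X x, x) \<in> exp_rel \<Omega> (sfield (sflip e) X) (t ^ wt (snd (sflip e)))"
      unfolding exp_rel_sflip by (simp add: sflip_def)
    then show "sflow (sflip e) t X (sflow e t X x) = x" using a by metis
  qed
qed

sublocale invertible_steps \<Theta> \<Omega>' sflow sfield "\<lambda>e. wt (snd e)" steps_set r sflip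
proof
  fix e assume e: "e \<in> steps_set"
  show "wt (snd e) = 1 \<or> wt (snd e) = 2" by (auto simp: wt_def)
  show "UCk (max 1 (r - wt (snd e))) (sfield e)" by (rule UCk_sfield[OF e])
  show "\<exists>C. evt (\<lambda>t X x. norm (sflow e t X x - x) \<le> C * t ^ wt (snd e))" using sflow_pointwise(1)[OF e] by blast
  show "lipo k (\<lambda>t X x. sflow e t X x - x)" if "k < wt (snd e)" for k by (rule sflow_lipo[OF e that])
  show "evt (\<lambda>t X x. ((\<lambda>t. sflow e t X x) has_vector_derivative
          (real (wt (snd e)) * t ^ (wt (snd e) - 1)) *\<^sub>R sfield e X (sflow e t X x)) (at t))"
    by (rule sflow_pointwise(2)[OF e])
  obtain \<delta> d where D: "\<delta> > 0" "d > 0" "\<And>X. X \<in> \<Theta> \<Longrightarrow> C1_on (\<lambda>(t, x). sflow e t X x) ({0<..<d} \<times> nb \<Omega>' \<delta>)"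
    using sflow_C1[OF e] by blast
  show "evt (\<lambda>t X x. (\<lambda>(t, x). sflow e t X x) differentiable at (t, x))"
  proof (rule evtI[OF D(1,2)])
    fix t X x assume "0 < t" "t < d" "X \<in> \<Theta>" "x \<in> nb \<Omega>' \<delta>"
    then show "(\<lambda>(t, x). sflow e t X x) differentiable at (t, x)"
      using D(3)[of X] unfolding C1_on_def differentiable_def by force
  qed
  show "sflip e \<in> steps_set" using e by (auto simp: sflip_def)
  show "evt (\<lambda>t X x. sflow (sflip e) t X (sflow e t X x) = x)" by (rule sflow_inverse[OF e])
next
  show "1 \<le> r" using r2 by simp
  show "bounded \<Omega>'" using cpt(1) compact_imp_bounded bounded_subset closure_subset by blast
  show "sflip (sflip e) = e" for e by (simp add: sflip_def)
qed

lemma run_C1: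
  assumes "set l \<subseteq> steps_set"
  shows "\<exists>\<delta>>0. \<exists>d>0. \<forall>X\<in>\<Theta>. C1_on (\<lambda>(t, x). run l t X x) ({0<..<d} \<times> nb \<Omega>' \<delta>)"
  using assms
proof (induction l)
  case Nil
  have "C1_on (\<lambda>(t::real, x::'a). x) U" for U
    using C1_on_linear[OF bounded_linear_snd] by (simp add: case_prod_unfold)
  then show ?case by (auto intro!: exI[of _ 1])
next
  case (Cons e l)
  then have e: "e \<in> steps_set" and l: "set l \<subseteq> steps_set" by auto
  obtain \<delta>1 d1 where 1: "\<delta>1 > 0" "d1 > 0" "\<And>X. X \<in> \<Theta> \<Longrightarrow> C1_on (\<lambda>(t, x). run l t X x) ({0<..<d1} \<times> nb \<Omega>' \<delta>1)"
    using Cons.IH[OF l] by blast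
  obtain \<delta>2 d2 where 2: "\<delta>2 > 0" "d2 > 0" "\<And>X. X \<in> \<Theta> \<Longrightarrow> C1_on (\<lambda>(t, x). sflow e t X x) ({0<..<d2} \<times> nb \<Omega>' \<delta>2)"
    using sflow_C1[OF e] by blast
  have "near (\<lambda>X x. x \<in> nb \<Omega>' \<delta>2)" unfolding near_def using 2(1) by auto
  from evt_comp[OF nid_run[OF l] near_evt[OF this]] obtain \<delta>3 d3 where 3: "\<delta>3 > 0" "d3 > 0"
    "\<And>t X x. 0 < t \<Longrightarrow> t < d3 \<Longrightarrow> X \<in> \<Theta> \<Longrightarrow> x \<in> nb \<Omega>' \<delta>3 \<Longrightarrow> run l t X x \<in> nb \<Omega>' \<delta>2"
    unfolding evt_def evt_at_def by auto
  define \<delta> where "\<delta> = min \<delta>1 \<delta>3"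
  define d where "d = min d1 (min d2 d3)"
  have pos: "\<delta> > 0" "d > 0" using 1 2 3 by (auto simp: \<delta>_def d_def)
  have sub: "x \<in> nb \<Omega>' \<delta> \<Longrightarrow> x \<in> nb \<Omega>' \<delta>1" "x \<in> nb \<Omega>' \<delta> \<Longrightarrow> x \<in> nb \<Omega>' \<delta>3" for x
    using nb_mono[of \<delta> \<delta>1 \<Omega>'] nb_mono[of \<delta> \<delta>3 \<Omega>'] by (auto simp: \<delta>_def)
  have "C1_on (\<lambda>(t, x). run (e # l) t X x) ({0<..<d} \<times> nb \<Omega>' \<delta>)" if X: "X \<in> \<Theta>" for X
  proof -
    \<comment> \<open>Carrying the time along as a first component turns the composition of the
      steps into one of maps of the pair (t, x).\<close>
    have "C1_on (\<lambda>z. (fst z, (\<lambda>(t, x). run l t X x) z)) ({0<..<d} \<times> nb \<Omega>' \<delta>)"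
      by (intro C1_on_Pair C1_on_linear[OF bounded_linear_fst] C1_on_subset[OF 1(3)[OF X]])
         (use sub in \<open>auto simp: d_def\<close>)
    from C1_on_compose[OF 2(3)[OF X] this]
    show ?thesis using 3(3) X sub by (auto simp: case_prod_unfold d_def image_subset_iff)
  qed
  then show ?case using pos by blast
qed

end


section \<open>Quasiexponential maps\<close>

text \<open>With \<open>w\<close> the commutator at x, this is the derivative of (h, x) -> E_I(h)(x)
  at h = 0.\<close>

definition shear :: "'a \<Rightarrow> (real \<times> 'a) \<Rightarrow>\<^sub>L 'a::real_normed_vector" where
  "shear w = (blinfun_scaleR_left w o\<^sub>L fst_blinfun) + snd_blinfun"

lemma shear_apply: "shear w z = fst z *\<^sub>R w + snd z"
  by (simp add: shear_def blinfun.bilinear_simps)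

lemma norm_shear_diff: "norm (shear w - shear w') \<le> norm (w - w')"
proof (rule norm_blinfun_bound)
  fix z :: "real \<times> 'a"
  have "(shear w - shear w') z = fst z *\<^sub>R (w - w')"
    by (simp add: blinfun.bilinear_simps shear_apply algebra_simps)
  then have "norm ((shear w - shear w') z) = \<bar>fst z\<bar> * norm (w - w')" by simp
  also have "\<dots> \<le> norm z * norm (w - w')"
    using norm_fst_le[of "fst z" "snd z"] by (intro mult_right_mono) auto
  finally show "norm ((shear w - shear w') z) \<le> norm (w - w') * norm z" by (simp add: mult.commute)
qed simp

definition reflect_blinfun :: "(real \<times> 'a) \<Rightarrow>\<^sub>L (real \<times> 'a::real_normed_vector)" where
  "reflect_blinfun = Blinfun (\<lambda>z. (- fst z, snd z))"

lemma reflect_blinfun_apply: "reflect_blinfun z = (- fst z, snd z)"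
  unfolding reflect_blinfun_def
  by (subst bounded_linear_Blinfun_apply)
     (auto intro!: bounded_linear_Pair bounded_linear_minus bounded_linear_fst bounded_linear_snd)

lemma norm_compose_reflect: "norm (D o\<^sub>L reflect_blinfun) \<le> norm D"
proof -
  have "norm (reflect_blinfun :: (real \<times> 'a) \<Rightarrow>\<^sub>L (real \<times> 'a)) \<le> 1"
    by (rule norm_blinfun_bound) (auto simp: reflect_blinfun_apply norm_Pair norm_prod_def)
  then have "norm D * norm (reflect_blinfun :: (real \<times> 'a) \<Rightarrow>\<^sub>L (real \<times> 'a)) \<le> norm D * 1"
    by (intro mult_left_mono) auto
  then show ?thesis using norm_blinfun_compose[of D reflect_blinfun] by linarith
qed

text \<open>The two halves, run forward in h and in -h, are glued along h = 0. Differentiability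
  there comes from the first order expansions \<open>P0\<close> and \<open>N0\<close>, continuity of
  the derivative from \<open>bdP\<close> and \<open>bdN\<close>. In the second conclusion the range
  \<open>c\<close> is passed on unchanged, so that a range common to all fields remains
  common.\<close>

lemma two_sided_C1:
  fixes P N :: "real \<times> 'a::euclidean_space \<Rightarrow> 'a" and V :: "'a \<Rightarrow> 'a"
  assumes d: "0 < d" and W: "open W" and P: "C1_on P ({0<..<d} \<times> W)" and N: "C1_on N ({0<..<d} \<times> W)"
    and V: "continuous_on W V"
    and bdP: "\<And>e. 0 < e \<Longrightarrow> \<exists>c>0. \<forall>h x. 0 < h \<longrightarrow> h < c \<longrightarrow> x \<in> W \<longrightarrow> norm (bd P (h, x) - shear (V x)) \<le> e"
    and bdN: "\<And>e. 0 < e \<Longrightarrow> \<exists>c>0. \<forall>h x. 0 < h \<longrightarrow> h < c \<longrightarrow> x \<in> W \<longrightarrow> norm (bd N (h, x) - shear (- V x)) \<le> e"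
    and P0: "\<And>e. 0 < e \<Longrightarrow> \<exists>c>0. \<forall>h x. 0 < h \<longrightarrow> h < c \<longrightarrow> x \<in> W \<longrightarrow> norm (P (h, x) - x - h *\<^sub>R V x) \<le> e * h"
    and N0: "\<And>e. 0 < e \<Longrightarrow> \<exists>c>0. \<forall>h x. 0 < h \<longrightarrow> h < c \<longrightarrow> x \<in> W \<longrightarrow> norm (N (h, x) - x + h *\<^sub>R V x) \<le> e * h"
    and G: "G = (\<lambda>(h, x). if h > 0 then P (h, x) else if h < 0 then N (- h, x) else x)"
  shows "C1_on G ({-d<..<d} \<times> W)"
    and "\<And>e c h x. 0 < e \<Longrightarrow> c \<le> d \<Longrightarrow>
      (\<And>h x. 0 < h \<Longrightarrow> h < c \<Longrightarrow> x \<in> W \<Longrightarrow> norm (bd P (h, x) - shear (V x)) \<le> e) \<Longrightarrow>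
      (\<And>h x. 0 < h \<Longrightarrow> h < c \<Longrightarrow> x \<in> W \<Longrightarrow> norm (bd N (h, x) - shear (- V x)) \<le> e) \<Longrightarrow>
      \<bar>h\<bar> < c \<Longrightarrow> x \<in> W \<Longrightarrow> norm (bd G (h, x) - shear (V x)) \<le> e"
proof -
  define G' where "G' z = (if fst z > 0 then bd P z else if fst z < 0 then bd N (- fst z, snd z) o\<^sub>L reflect_blinfun
      else shear (V (snd z)))" for z
  define refl where "refl z = (- fst z, snd z)" for z :: "real \<times> 'a"
  have refl_d: "(refl has_derivative blinfun_apply reflect_blinfun) (at z)" for z
    unfolding refl_def by (auto simp: fun_eq_iff reflect_blinfun_apply intro!: derivative_eq_intros)
  have op: "open ({0<..<d} \<times> W)" "open ({-d<..<0} \<times> W)" using W by (auto intro: open_Times)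
  have Gp: "(G has_derivative blinfun_apply (G' z)) (at z)" if z: "z \<in> {0<..<d} \<times> W" for z
  proof (rule has_derivative_transform_within_open[OF _ op(1) z])
    show "(P has_derivative blinfun_apply (G' z)) (at z)" using C1_on_bd(1)[OF P z] z by (auto simp: G'_def)
  qed (auto simp: G)
  have Gn: "(G has_derivative blinfun_apply (G' z)) (at z)" if z: "z \<in> {-d<..<0} \<times> W" for z
  proof (rule has_derivative_transform_within_open[OF _ op(2) z])
    have "refl z \<in> {0<..<d} \<times> W" using z by (auto simp: refl_def)
    from has_derivative_compose[OF refl_d C1_on_bd(1)[OF N this]]
    show "((\<lambda>z. N (refl z)) has_derivative blinfun_apply (G' z)) (at z)"
      using z by (auto simp: G'_def refl_def blinfun_compose.rep_eq o_def)
  qed (auto simp: G refl_def)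
  \<comment> \<open>The error is G(h, y) - y - h V(y), small by the expansions from both sides, plus
    h (V(y) - V(x)), small by continuity of \<open>V\<close>.\<close>
  have G0: "(G has_derivative blinfun_apply (G' (0, x))) (at (0, x))" if x: "x \<in> W" for x
    unfolding has_derivative_at_alt
  proof (intro conjI allI impI blinfun.bounded_linear_right)
    fix e :: real assume "0 < e"
    then have e2: "0 < e/2" by simp
    obtain c1 where c1: "c1 > 0" "\<And>h x. 0 < h \<Longrightarrow> h < c1 \<Longrightarrow> x \<in> W \<Longrightarrow> norm (P (h, x) - x - h *\<^sub>R V x) \<le> e/2 * h"
      using P0[OF e2] by blast
    obtain c2 where c2: "c2 > 0" "\<And>h x. 0 < h \<Longrightarrow> h < c2 \<Longrightarrow> x \<in> W \<Longrightarrow> norm (N (h, x) - x + h *\<^sub>R V x) \<le> e/2 * h"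
      using N0[OF e2] by blast
    obtain c3 where c3: "c3 > 0" "ball x c3 \<subseteq> W" using W x open_contains_ball by blast
    obtain c4 where c4: "c4 > 0" "\<And>y. y \<in> W \<Longrightarrow> dist y x < c4 \<Longrightarrow> dist (V y) (V x) < e/2"
      using V x e2 unfolding continuous_on_iff by blast
    show "\<exists>c>0. \<forall>z. norm (z - (0, x)) < c \<longrightarrow> norm (G z - G (0, x) - G' (0, x) (z - (0, x))) \<le> e * norm (z - (0, x))"
    proof (intro exI[of _ "min (min c1 c2) (min c3 c4)"] conjI allI impI)
      fix z :: "real \<times> 'a" assume z: "norm (z - (0, x)) < min (min c1 c2) (min c3 c4)"
      obtain h y where zz: "z = (h, y)" by force
      have le: "\<bar>h\<bar> \<le> norm (z - (0, x))" "norm (y - x) \<le> norm (z - (0, x))"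
        using norm_fst_le[of h "y - x"] norm_snd_le[of "y - x" h] by (auto simp: zz)
      have y: "y \<in> W" using c3 le z by (auto simp: dist_norm norm_minus_commute)
      have "norm (V y - V x) \<le> e/2" using c4(2)[OF y] le z by (simp add: dist_norm)
      from mult_left_mono[OF this abs_ge_zero[of h]]
      have Vyx: "norm (h *\<^sub>R (V y - V x)) \<le> \<bar>h\<bar> * (e/2)" by simp
      have "norm (G (h, y) - y - h *\<^sub>R V y) \<le> e/2 * \<bar>h\<bar>"
      proof -
        consider "h > 0" | "h < 0" | "h = 0" by linarith
        then show ?thesis
        proof cases
          case 1 then show ?thesis using c1(2)[of h y] y le z by (simp add: G)
        next
          case 2 then show ?thesis using c2(2)[of "- h" y] y le z by (simp add: G)
        qed (simp add: G)
      qed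
      moreover have "G z - G (0, x) - G' (0, x) (z - (0, x)) = (G (h, y) - y - h *\<^sub>R V y) + h *\<^sub>R (V y - V x)"
        by (simp add: zz G'_def shear_apply G algebra_simps)
      ultimately have "norm (G z - G (0, x) - G' (0, x) (z - (0, x))) \<le> e/2 * \<bar>h\<bar> + \<bar>h\<bar> * (e/2)"
        using Vyx norm_triangle_mono by metis
      also have "\<dots> = e * \<bar>h\<bar>" by simp
      also have "\<dots> \<le> e * norm (z - (0, x))" using le \<open>0 < e\<close> by (intro mult_left_mono) auto
      finally show "norm (G z - G (0, x) - G' (0, x) (z - (0, x))) \<le> e * norm (z - (0, x))" .
    qed (use c1 c2 c3 c4 in auto)
  qed
  have Gd: "(G has_derivative blinfun_apply (G' z)) (at z)" if "z \<in> {-d<..<d} \<times> W" for z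
  proof -
    obtain h x where z: "z = (h, x)" by force
    consider "h > 0" | "h < 0" | "h = 0" by linarith
    then show ?thesis using Gp[of z] Gn[of z] G0[of x] that z by cases auto
  qed
  have bound': "norm (G' (h, x) - shear (V x)) \<le> e"
    if e: "0 < e" and c1: "\<And>h x. 0 < h \<Longrightarrow> h < c \<Longrightarrow> x \<in> W \<Longrightarrow> norm (bd P (h, x) - shear (V x)) \<le> e"
      and c2: "\<And>h x. 0 < h \<Longrightarrow> h < c \<Longrightarrow> x \<in> W \<Longrightarrow> norm (bd N (h, x) - shear (- V x)) \<le> e"
      and h: "\<bar>h\<bar> < c" and x: "x \<in> W" for e c h :: real and x
  proof -
    consider "h > 0" | "h < 0" | "h = 0" by linarith
    then show ?thesis
    proof cases
      case 1 then show ?thesis using c1[of h x] h x by (simp add: G'_def)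
    next
      case 2
      \<comment> \<open>The sign of the field and that of the time cancel: the limits of the
        derivative from both sides coincide.\<close>
      have "shear (V x) = shear (- V x) o\<^sub>L reflect_blinfun"
        by (rule blinfun_eqI) (simp add: shear_apply reflect_blinfun_apply)
      then have "G' (h, x) - shear (V x) = (bd N (- h, x) - shear (- V x)) o\<^sub>L reflect_blinfun"
        using 2 by (intro blinfun_eqI) (simp add: G'_def blinfun.bilinear_simps)
      then show ?thesis using norm_compose_reflect[of "bd N (- h, x) - shear (- V x)"] c2[of "- h" x] 2 h x
        by simp
    next
      case 3 then show ?thesis using e by (simp add: G'_def)
    qed
  qed
  have bound: "\<exists>c>0. \<forall>h x. \<bar>h\<bar> < c \<longrightarrow> x \<in> W \<longrightarrow> norm (G' (h, x) - shear (V x)) \<le> e" if e: "0 < e" for e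
  proof -
    obtain c1 where c1: "c1 > 0" "\<And>h x. 0 < h \<Longrightarrow> h < c1 \<Longrightarrow> x \<in> W \<Longrightarrow> norm (bd P (h, x) - shear (V x)) \<le> e"
      using bdP[OF e] by blast
    obtain c2 where c2: "c2 > 0" "\<And>h x. 0 < h \<Longrightarrow> h < c2 \<Longrightarrow> x \<in> W \<Longrightarrow> norm (bd N (h, x) - shear (- V x)) \<le> e"
      using bdN[OF e] by blast
    have "norm (G' (h, x) - shear (V x)) \<le> e" if "\<bar>h\<bar> < min c1 c2" "x \<in> W" for h x
      by (rule bound'[OF e _ _ that]) (use c1 c2 in auto)
    then show ?thesis using c1 c2 by (intro exI[of _ "min c1 c2"]) auto
  qed
  have Gcont: "continuous_on ({-d<..<d} \<times> W) G'"
  proof (rule continuous_at_imp_continuous_on, rule ballI)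
    fix z assume z: "z \<in> {-d<..<d} \<times> W"
    obtain h x where zz: "z = (h, x)" by force
    consider "h > 0" | "h < 0" | "h = 0" by linarith
    then show "isCont G' z"
    proof cases
      case 1
      then have z': "z \<in> {0<..<d} \<times> W" using z zz by auto
      have "isCont (bd P) z"
        by (rule bspec[OF iffD1[OF continuous_on_eq_continuous_at[OF op(1)] C1_on_bd(2)[OF P]] z'])
      moreover have "\<forall>\<^sub>F w in nhds z. G' w = bd P w"
        using op(1) z' by (intro eventually_nhds[THEN iffD2] exI[of _ "{0<..<d} \<times> W"]) (auto simp: G'_def)
      ultimately show ?thesis using isCont_cong[of G' "bd P" z] by simp
    next
      case 2
      then have z': "z \<in> {-d<..<0} \<times> W" "refl z \<in> {0<..<d} \<times> W" using z zz by (auto simp: refl_def)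
      have "isCont (bd N) (refl z)"
        by (rule bspec[OF iffD1[OF continuous_on_eq_continuous_at[OF op(1)] C1_on_bd(2)[OF N]] z'(2)])
      moreover have "isCont refl z" by (rule has_derivative_continuous[OF refl_d])
      ultimately have "isCont (\<lambda>w. bd N (refl w)) z" by (rule isCont_o2[rotated])
      then have "isCont (\<lambda>w. bd N (refl w) o\<^sub>L reflect_blinfun) z"
        by (intro bounded_bilinear.continuous[OF bounded_bilinear_blinfun_compose] continuous_const)
      moreover have "\<forall>\<^sub>F w in nhds z. G' w = bd N (refl w) o\<^sub>L reflect_blinfun"
        using op(2) z' by (intro eventually_nhds[THEN iffD2] exI[of _ "{-d<..<0} \<times> W"]) (auto simp: G'_def refl_def)
      ultimately show ?thesis using isCont_cong[of G' "\<lambda>w. bd N (refl w) o\<^sub>L reflect_blinfun" z] by simp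
    next
      case 3
      have x: "x \<in> W" using z zz by simp
      show ?thesis unfolding continuous_at_eps_delta
      proof (intro allI impI)
        fix e :: real assume "0 < e"
        then have e3: "0 < e/3" by simp
        obtain c1 where c1: "c1 > 0" "\<And>h y. \<bar>h\<bar> < c1 \<Longrightarrow> y \<in> W \<Longrightarrow> norm (G' (h, y) - shear (V y)) \<le> e/3"
          using bound[OF e3] by blast
        obtain c3 where c3: "c3 > 0" "ball x c3 \<subseteq> W" using W x open_contains_ball by blast
        obtain c4 where c4: "c4 > 0" "\<And>y. y \<in> W \<Longrightarrow> dist y x < c4 \<Longrightarrow> dist (V y) (V x) < e/3"
          using V x e3 unfolding continuous_on_iff by blast
        show "\<exists>c>0. \<forall>w. dist w z < c \<longrightarrow> dist (G' w) (G' z) < e"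
        proof (intro exI[of _ "min c1 (min c3 c4)"] conjI allI impI)
          fix w assume w: "dist w z < min c1 (min c3 c4)"
          obtain s y where ww: "w = (s, y)" by force
          have le: "\<bar>s\<bar> \<le> dist w z" "dist y x \<le> dist w z"
            using dist_fst_le[of w z] dist_snd_le[of w z] 3 by (auto simp: ww zz dist_norm)
          have y: "y \<in> W" using c3 le w by (auto simp: dist_commute)
          have 1: "norm (G' w - shear (V y)) \<le> e/3" using c1(2)[of s y] y le w by (simp add: ww)
          have "norm (shear (V y) - shear (V x)) \<le> norm (V y - V x)" by (rule norm_shear_diff)
          also have "\<dots> < e/3" using c4(2)[OF y] le w by (simp add: dist_norm)
          finally have 2: "norm (shear (V y) - shear (V x)) < e/3" .
          have "G' z = shear (V x)" using 3 by (simp add: G'_def zz)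
          then have "dist (G' w) (G' z) \<le> norm (G' w - shear (V y)) + norm (shear (V y) - shear (V x))"
            unfolding dist_norm by (metis norm_triangle_ineq diff_add_cancel add_diff_eq)
          then show "dist (G' w) (G' z) < e" using 1 2 \<open>0 < e\<close> by linarith
        qed (use c1 c3 c4 in auto)
      qed
    qed
  qed
  show "C1_on G ({-d<..<d} \<times> W)" by (rule C1_on_bdI[OF Gd Gcont])
  show "norm (bd G (h, x) - shear (V x)) \<le> e"
    if e: "0 < e" and c: "c \<le> d" and c1: "\<And>h x. 0 < h \<Longrightarrow> h < c \<Longrightarrow> x \<in> W \<Longrightarrow> norm (bd P (h, x) - shear (V x)) \<le> e"
      and c2: "\<And>h x. 0 < h \<Longrightarrow> h < c \<Longrightarrow> x \<in> W \<Longrightarrow> norm (bd N (h, x) - shear (- V x)) \<le> e"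
      and h: "\<bar>h\<bar> < c" and x: "x \<in> W" for e c h :: real and x
  proof -
    have "bd G (h, x) = G' (h, x)"
      by (rule bd_eq[OF Gd]) (use h c x in auto)
    then show ?thesis using bound'[OF e c1 c2 h x] by simp
  qed
qed

section \<open>The substitution of the time by a root\<close>

context germs
begin

lemma evt_at_root:
  assumes "evt_at \<rho> P" "0 < k"
  shows "evt_at \<rho> (\<lambda>h. P (root k h))"
proof -
  obtain d where d: "d > 0" "\<And>t X x. 0 < t \<Longrightarrow> t < d \<Longrightarrow> X \<in> \<Theta> \<Longrightarrow> x \<in> nb S \<rho> \<Longrightarrow> P t X x"
    using assms(1) unfolding evt_at_def by blast
  show ?thesis unfolding evt_at_def
  proof (intro exI[of _ "d ^ k"] conjI allI impI)
    fix h X x assume h: "0 < h" "h < d ^ k" and X: "X \<in> \<Theta>" "x \<in> nb S \<rho>"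
    have "root k h < root k (d ^ k)" by (rule real_root_less_mono[OF assms(2) h(2)])
    then have "root k h < d" using d(1) assms(2) by (simp add: real_root_power_cancel)
    moreover have "0 < root k h" using h assms(2) by simp
    ultimately show "P (root k h) X x" using d(2) X by blast
  qed (use d in simp)
qed

lemma evt_root: "evt P \<Longrightarrow> 0 < k \<Longrightarrow> evt (\<lambda>h. P (root k h))"
  unfolding evt_def using evt_at_root by blast

lemma smallo_root: "smallo 0 g \<Longrightarrow> 0 < k \<Longrightarrow> smallo 0 (\<lambda>h. g (root k h))"
  unfolding smallo_def smallo_at_def using evt_at_root[where k = k] by fastforce

lemma smallo_divide:
  assumes "smallo m g"
  shows "smallo 0 (\<lambda>t X x. (1 / t ^ m) *\<^sub>R g t X x)"
proof -
  obtain \<rho> where \<rho>: "\<rho> > 0" "smallo_at \<rho> m g" using assms unfolding smallo_def by auto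
  have "smallo_at \<rho> 0 (\<lambda>t X x. (1 / t ^ m) *\<^sub>R g t X x)" unfolding smallo_at_def
  proof (intro allI impI)
    fix e :: real assume "e > 0"
    then have "evt_at \<rho> (\<lambda>t X x. norm (g t X x) \<le> e * t ^ m)" using \<rho> by (simp add: smallo_at_def)
    then show "evt_at \<rho> (\<lambda>t X x. norm ((1 / t ^ m) *\<^sub>R g t X x) \<le> e * t ^ 0)"
      by (rule evt_at_mono) (auto simp: divide_simps)
  qed
  then show ?thesis using \<rho> smallo_def by auto
qed

text \<open>The derivative of A - id is bounded by its local Lipschitz constant, which tends to 0
  with t.\<close>

lemma lipo_derivative_near_id:
  assumes A: "lipo 0 (\<lambda>t X x. A t X x - x)" and d: "evt (\<lambda>t X x. A t X differentiable (at x))"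
  shows "smallo 0 (\<lambda>t X x. bd (A t X) x - id_blinfun)"
proof -
  obtain \<rho> where \<rho>: "\<rho> > 0" "\<And>e. e > 0 \<Longrightarrow> evt_at \<rho> (\<lambda>t X x. \<forall>y. dist x y < \<rho> \<longrightarrow>
      norm (A t X x - x - (A t X y - y)) \<le> e * t ^ 0 * norm (x - y))" using A unfolding lipo_def by auto
  obtain \<rho>2 where \<rho>2: "\<rho>2 > 0" "evt_at \<rho>2 (\<lambda>t X x. A t X differentiable (at x))" using d unfolding evt_def by auto
  have "smallo_at (min \<rho> \<rho>2) 0 (\<lambda>t X x. bd (A t X) x - id_blinfun)"
    unfolding smallo_at_def
  proof (intro allI impI)
    fix e :: real assume e: "e > 0"
    from evt_at_conj[OF evt_at_antimono[OF \<rho>(2)[OF e], of "min \<rho> \<rho>2"] evt_at_antimono[OF \<rho>2(2), of "min \<rho> \<rho>2"]]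
    show "evt_at (min \<rho> \<rho>2) (\<lambda>t X x. norm (bd (A t X) x - id_blinfun) \<le> e * t ^ 0)"
    proof (rule evt_at_mono)
      fix t X x assume a: "(\<forall>y. dist x y < \<rho> \<longrightarrow> norm (A t X x - x - (A t X y - y)) \<le> e * t ^ 0 * norm (x - y)) \<and>
        A t X differentiable (at x)"
      then have D: "(A t X has_derivative frechet_derivative (A t X) (at x)) (at x)" by (simp add: frechet_derivative_works[symmetric])
      have bd: "blinfun_apply (bd (A t X) x) = frechet_derivative (A t X) (at x)"
        using has_derivative_bounded_linear[OF D] by (simp add: bd_def bounded_linear_Blinfun_apply)
      show "norm (bd (A t X) x - id_blinfun) \<le> e * t ^ 0"
      proof (rule norm_blinfun_bound)
        fix v
        have "norm (frechet_derivative (A t X) (at x) v - v) \<le> e * norm v"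
          by (rule has_derivative_lipschitz_bound[OF has_derivative_diff[OF D has_derivative_ident] \<rho>(1)]) (use a in simp)
        then show "norm ((bd (A t X) x - id_blinfun) v) \<le> e * t ^ 0 * norm v"
          by (simp add: blinfun.bilinear_simps bd)
      qed (use e in simp)
    qed auto
  qed
  then show ?thesis using \<rho> \<rho>2 unfolding smallo_def by (intro exI[of _ "min \<rho> \<rho>2"]) auto
qed

end

lemma C1_on_root: "0 < k \<Longrightarrow> C1_on (\<lambda>(h::real, x::'a::euclidean_space). (root k h, x)) ({0<..<d} \<times> W)"
proof -
  assume k: "0 < k"
  define D :: "real \<times> 'a \<Rightarrow> (real \<times> 'a) \<Rightarrow>\<^sub>L (real \<times> 'a)" where
    "D z = (inverse (real k * root k (fst z) ^ (k - Suc 0))) *\<^sub>R (blinfun_scaleR_left (1, 0) o\<^sub>L fst_blinfun) +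
        (Blinfun (\<lambda>x. (0, x)) o\<^sub>L snd_blinfun)" for z
  have bl: "bounded_linear (\<lambda>x::'a. (0::real, x))"
    by (intro bounded_linear_Pair bounded_linear_zero bounded_linear_ident)
  have "((\<lambda>(h, x). (root k h, x)) has_derivative blinfun_apply (D z)) (at z)" if z: "z \<in> {0<..<d} \<times> W" for z
  proof -
    have "(root k has_derivative (*) (inverse (real k * root k (fst z) ^ (k - Suc 0)))) (at (fst z))"
      using DERIV_real_root[of k "fst z"] k z unfolding has_field_derivative_def by auto
    from has_derivative_compose[OF has_derivative_fst[OF has_derivative_ident] this]
    have "((\<lambda>z. (root k (fst z), snd z)) has_derivative
        (\<lambda>h. (inverse (real k * root k (fst z) ^ (k - Suc 0)) * fst h, snd h))) (at z)"
      by (intro has_derivative_Pair has_derivative_snd has_derivative_ident)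
    moreover have "(\<lambda>h. (inverse (real k * root k (fst z) ^ (k - Suc 0)) * fst h, snd h)) = blinfun_apply (D z)"
      by (auto simp: D_def fun_eq_iff blinfun.bilinear_simps bounded_linear_Blinfun_apply[OF bl] mult.commute)
    ultimately show ?thesis by (simp add: case_prod_unfold)
  qed
  moreover have "continuous_on ({0<..<d} \<times> W) D" unfolding D_def
    by (intro continuous_intros) (use k in auto)
  ultimately show ?thesis unfolding C1_on_def by blast
qed

section \<open>Quasiexponential maps as words in flows\<close>

context flows
begin

text \<open>The flows whose composition is the quasiexponential map of a multiindex, the last one acting first.\<close>

fun word :: "nat list \<Rightarrow> (bool \<times> nat) list" where
  "word [] = []"
| "word [i] = [(True, i)]"
| "word (i # j # I) = bwl (word (j # I)) @ (False, i) # word (j # I) @ [(True, i)]"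

primrec lrel :: "(nat \<Rightarrow> 'a \<Rightarrow> 'a) \<Rightarrow> real \<Rightarrow> (bool \<times> nat) list \<Rightarrow> ('a \<times> 'a) set" where
  "lrel X t [] = Id"
| "lrel X t (e # l) = lrel X t l O exp_rel \<Omega> (sfield e X) (t ^ wt (snd e))"

lemma lrel_append: "lrel X t (l @ l') = lrel X t l' O lrel X t l"
  by (induction l) auto

lemma lrel_bwl: "lrel X t (bwl l) = (lrel X t l)\<inverse>"
proof (induction l)
  case Nil then show ?case by (simp add: bwl_def)
next
  case (Cons e l)
  have "bwl (e # l) = bwl l @ [sflip e]" by (simp add: bwl_def)
  then show ?case using Cons by (simp add: lrel_append exp_rel_sflip converse_relcomp) (simp add: sflip_def)
qed

lemma sfield_signed: "sfield (True, i) X = X i" "sfield (False, i) X = (\<lambda>x. - X i x)"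
  by (auto simp: sfield_def)

text \<open>Converses become reversed words of opposite flows and negative times become opposite
  fields, so that only forward flows at positive times remain to be studied.\<close>

lemma C_rel_eq_lrel: "I \<noteq> [] \<Longrightarrow> C_rel \<Omega> X t I = lrel X t (word I)"
  by (induction I rule: word.induct)
     (auto simp: lrel_append lrel_bwl sfield_signed exp_rel_uminus O_assoc simp del: relcomp_unfold)

lemma lrel_0: "x \<in> \<Omega> \<Longrightarrow> (x, y) \<in> lrel X 0 l \<longleftrightarrow> y = x"
proof (induction l arbitrary: y)
  case (Cons e l)
  then show ?case using wt_pos[of "snd e"] by (auto simp: exp_rel_0 relcomp_unfold power_0_left)
qed auto

lemma lrel_run: "set l \<subseteq> steps_set \<Longrightarrow> evt (\<lambda>t X x. \<forall>y. (x, y) \<in> lrel X t l \<longleftrightarrow> y = run l t X x)"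
proof (induction l)
  case Nil then show ?case by (auto intro: evt_mono[OF evt_True])
next
  case (Cons e l)
  then have e: "e \<in> steps_set" and l: "set l \<subseteq> steps_set" by auto
  from evt_conj[OF Cons.IH[OF l] evt_comp[OF nid_run[OF l] sflow_rel[OF e]]]
  show ?case by (rule evt_mono) (auto simp: relcomp_unfold)
qed

lemma weight_Cons: "weight (i # I) = wt i + weight I"
  by (simp add: weight_def)

lemma weight_pos: "I \<noteq> [] \<Longrightarrow> 0 < weight I"
  using wt_pos by (cases I) (auto simp: weight_Cons add_pos_nonneg)

lemma word_set: "set I \<subseteq> {0..n} \<Longrightarrow> set (word I) \<subseteq> steps_set"
proof (induction I rule: word.induct)
  case (3 i j I)
  then have w: "set (word (j # I)) \<subseteq> steps_set" by simp
  then show ?case using set_bwl[OF w] "3.prems" by auto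
qed auto

text \<open>Each bracket with X_i lowers the class by the weight of i, so that a commutator of
  weight r is still uniformly continuous.\<close>

lemma UCk_commutator:
  "I \<noteq> [] \<Longrightarrow> set I \<subseteq> {0..n} \<Longrightarrow> weight I \<le> r \<Longrightarrow> UCk (r - weight I) (\<lambda>X. commutator X I)"
proof (induction I rule: word.induct)
  case (2 i)
  then show ?case using UCk_mono[OF UCk_fields[of i], of "r - wt i"] by (simp add: weight_def)
next
  case (3 i j I)
  let ?w = "weight (j # I)" and ?Y = "\<lambda>X. commutator X (j # I)"
  have w: "0 < ?w" "wt i + ?w \<le> r" using "3.prems"(3) weight_pos[of "j # I"] by (auto simp: weight_Cons)
  have Y: "UCk (r - ?w) ?Y" using 3 w by auto
  have Xi: "UCk (max 1 (r - wt i)) (\<lambda>X. X i)" using UCk_fields[of i] "3.prems"(2) by auto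
  have k: "r - weight (i # j # I) = r - wt i - ?w" by (simp add: weight_Cons[of i])
  have "UCk (r - wt i - ?w) (\<lambda>X x. lie (\<lambda>X. X i) ?Y X x - lie ?Y (\<lambda>X. X i) X x)"
    by (intro UCk_diff UCk_lie UCk_mono[OF Y] UCk_mono[OF Xi]) (use w wt_pos[of i] in auto)
  then show ?case unfolding k by (simp add: lie_def lie_bracket_def[abs_def])
qed simp

lemma word_leading:
  "I \<noteq> [] \<Longrightarrow> set I \<subseteq> {0..n} \<Longrightarrow> weight I \<le> r \<Longrightarrow>
    smallo (weight I) (\<lambda>t X x. run (word I) t X x - x - t ^ weight I *\<^sub>R commutator X I x)"
proof (induction I rule: word.induct)
  case (2 i)
  then have "(True, i) \<in> steps_set" by simp
  from st_leading[OF this] show ?case by (simp add: weight_def sfield_signed)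
next
  case (3 i j I)
  let ?w = "weight (j # I)" and ?Y = "\<lambda>X. commutator X (j # I)"
  have w: "0 < ?w" "wt i + ?w \<le> r" using "3.prems"(3) weight_pos[of "j # I"] by (auto simp: weight_Cons)
  have e: "(True, i) \<in> steps_set" using "3.prems"(2) by simp
  \<comment> \<open>The inner multiindex has weight at most r - 1, so its commutator is still of
    class C^1.\<close>
  have Y: "UCk 1 ?Y"
    by (rule UCk_mono[OF UCk_commutator]) (use "3.prems"(2) w wt_pos[of i] in auto)
  have "smallo (wt (snd (True, i)) + ?w) (\<lambda>t X x. run (bwl (word (j # I)) @ sflip (True, i) # word (j # I) @ [(True, i)]) t X x - x
      - t ^ (wt (snd (True, i)) + ?w) *\<^sub>R (lie (sfield (True, i)) ?Y X x - lie ?Y (sfield (True, i)) X x))"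
    by (rule commutator_leading[OF e word_set w(1) _ "3.IH"(1) Y]) (use "3.prems" w in auto)
  then show ?case
    by (simp add: weight_Cons[of i] sflip_def lie_def lie_bracket_def sfield_signed)
qed simp

text \<open>Substituting t = h^(1/k) multiplies the t-derivative by the factor 1/(k t^(k-1)), which
  is unbounded for k > 1. The leading term of the t-derivative cancels it exactly, and the error
  o(t^(k-1)) becomes o(1).\<close>

lemma half_derivative:
  assumes l: "set l \<subseteq> steps_set" and k: "0 < k" "k \<le> r"
    and V: "smallo k (\<lambda>t X x. run l t X x - x - t ^ k *\<^sub>R V X x)"
  shows "\<exists>\<delta>>0. \<exists>d>0. \<forall>X\<in>\<Theta>. C1_on (\<lambda>(h, x). run l (root k h) X x) ({0<..<d} \<times> nb \<Omega>' \<delta>)"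
    and "smallo 0 (\<lambda>h X x. bd (\<lambda>(h, x). run l (root k h) X x) (h, x) - shear (V X x))"
proof -
  obtain \<delta> d where D: "\<delta> > 0" "d > 0" "\<And>X. X \<in> \<Theta> \<Longrightarrow> C1_on (\<lambda>(t, x). run l t X x) ({0<..<d} \<times> nb \<Omega>' \<delta>)"
    using run_C1[OF l] by blast
  have lt: "root k h < d" if "0 < h" "h < d ^ k" for h
    using real_root_less_mono[OF k(1) that(2)] D(2) k(1) by (simp add: real_root_power_cancel)
  have C1: "C1_on (\<lambda>(h, x). run l (root k h) X x) ({0<..<d ^ k} \<times> nb \<Omega>' \<delta>)" if X: "X \<in> \<Theta>" for X
  proof -
    have "C1_on (\<lambda>z. (\<lambda>(t, x). run l t X x) ((\<lambda>(h, x). (root k h, x)) z)) ({0<..<d ^ k} \<times> nb \<Omega>' \<delta>)"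
      by (rule C1_on_compose[OF D(3)[OF X] C1_on_root[OF k(1)]]) (use k(1) lt in auto)
    then show ?thesis by (simp add: case_prod_unfold)
  qed
  then show "\<exists>\<delta>>0. \<exists>d>0. \<forall>X\<in>\<Theta>. C1_on (\<lambda>(h, x). run l (root k h) X x) ({0<..<d} \<times> nb \<Omega>' \<delta>)"
    using D(1,2) by (intro exI[of _ \<delta>] conjI exI[of _ "d ^ k"]) auto
  obtain Dt where Dt: "evt (\<lambda>t X x. ((\<lambda>t. run l t X x) has_vector_derivative Dt t X x) (at t))"
    "smallo k (\<lambda>t X x. t *\<^sub>R Dt t X x - (real k * t ^ k) *\<^sub>R V X x)"
    using run_leading_derivative[OF l k V] by blast
  \<comment> \<open>The errors of the two partial derivatives: \<open>a\<close> measures that in h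
    against the field, \<open>b\<close> that in x against the identity.\<close>
  define a where "a t X x = (1 / real k) *\<^sub>R ((1 / t ^ k) *\<^sub>R (t *\<^sub>R Dt t X x - (real k * t ^ k) *\<^sub>R V X x))" for t X x
  define b where "b t X x = bd (run l t X) x - id_blinfun" for t X x
  have "evt (\<lambda>t X x. run l t X differentiable (at x))"
    by (rule evt_mono[OF run_diff[OF l]]) (auto dest: differentiable_snd)
  from lipo_derivative_near_id[OF lipo_run[OF l] this]
  have b: "smallo 0 b" unfolding b_def .
  have a: "smallo 0 a" unfolding a_def by (intro smallo_scaleR_const smallo_divide Dt(2))
  have bl1: "bounded_linear (\<lambda>w::'a. blinfun_scaleR_left w o\<^sub>L (fst_blinfun :: (real \<times> 'a) \<Rightarrow>\<^sub>L real))"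
    by (rule bounded_linear_compose[OF bounded_bilinear.bounded_linear_left[OF bounded_bilinear_blinfun_compose]
        bounded_linear_blinfun_scaleR_left])
  have bl2: "bounded_linear (\<lambda>J::'a \<Rightarrow>\<^sub>L 'a. J o\<^sub>L (snd_blinfun :: (real \<times> 'a) \<Rightarrow>\<^sub>L 'a))"
    by (rule bounded_bilinear.bounded_linear_left[OF bounded_bilinear_blinfun_compose])
  have sm: "smallo 0 (\<lambda>t X x. (blinfun_scaleR_left (a t X x) o\<^sub>L (fst_blinfun :: (real \<times> 'a) \<Rightarrow>\<^sub>L real)) + (b t X x o\<^sub>L snd_blinfun))"
    by (intro smallo_add smallo_linear[OF bl1 a] smallo_linear[OF bl2 b])
  show "smallo 0 (\<lambda>h X x. bd (\<lambda>(h, x). run l (root k h) X x) (h, x) - shear (V X x))"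
  proof (rule smallo_cong[OF smallo_root[OF sm k(1)]])
    have "evt (\<lambda>h X x. (\<lambda>(h, x). run l (root k h) X x) differentiable (at (h, x)))"
    proof (rule evtI[OF D(1), of "d ^ k"])
      show "(\<lambda>(h, x). run l (root k h) X x) differentiable (at (h, x))"
        if "0 < h" "h < d ^ k" "X \<in> \<Theta>" "x \<in> nb \<Omega>' \<delta>" for h X x
        using C1[of X] that unfolding C1_on_def differentiable_def by force
    qed (use D in simp)
    from evt_conj[OF this evt_root[OF evt_conj[OF run_diff[OF l] Dt(1)] k(1)]]
    show "evt (\<lambda>h X x. bd (\<lambda>(h, x). run l (root k h) X x) (h, x) - shear (V X x) =
        (blinfun_scaleR_left (a (root k h) X x) o\<^sub>L fst_blinfun) + (b (root k h) X x o\<^sub>L snd_blinfun))"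
    proof (rule evt_mono)
      fix h X x
      assume h: "0 < h" and H: "(\<lambda>(h, x). run l (root k h) X x) differentiable (at (h, x)) \<and>
        (\<lambda>(t, x). run l t X x) differentiable (at (root k h, x)) \<and>
        ((\<lambda>t. run l t X x) has_vector_derivative Dt (root k h) X x) (at (root k h))"
      define t where "t = root k h"
      have t: "t > 0" "t ^ k = h" using h k(1) by (simp_all add: t_def)
      obtain P where P: "((\<lambda>(t, x). run l t X x) has_derivative P) (at (t, x))"
        using H unfolding differentiable_def t_def by blast
      have linP: "linear P" using P has_derivative_linear by blast
      have Px: "(run l t X has_derivative (\<lambda>v. P (0, v))) (at x)"
      proof -
        have "((\<lambda>y. (t, y)) has_derivative (\<lambda>v. (0, v))) (at x)" by (auto intro!: derivative_eq_intros)
        from has_derivative_compose[OF this P] show ?thesis by simp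
      qed
      have Pt: "P (1, 0) = Dt t X x"
      proof -
        have "((\<lambda>s. (s, x)) has_vector_derivative (1, 0)) (at t)"
          by (intro has_vector_derivative_Pair has_vector_derivative_id has_vector_derivative_const)
        from has_vector_derivative_chain[OF this P] have "((\<lambda>t. run l t X x) has_vector_derivative P (1, 0)) (at t)" by simp
        then show ?thesis using H vector_derivative_unique_at unfolding t_def by blast
      qed
      have bdx: "blinfun_apply (bd (run l t X) x) v = P (0, v)" for v
        using has_derivative_bounded_linear[OF Px] by (simp add: bd_def frechet_eq[OF Px] bounded_linear_Blinfun_apply)
      have "((\<lambda>z::real \<times> 'a. (root k (fst z), snd z)) has_derivative
          (\<lambda>z. (fst z * inverse (real k * t ^ (k - Suc 0)), snd z))) (at (h, x))"
      proof -
        have "(root k has_derivative (\<lambda>s. s * inverse (real k * t ^ (k - Suc 0)))) (at h)"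
          by (rule has_derivative_eq_rhs[OF DERIV_real_root[OF k(1) h, unfolded has_field_derivative_def]])
             (auto simp: mult.commute t_def)
        then have "(root k has_derivative (\<lambda>s. s * inverse (real k * t ^ (k - Suc 0)))) (at (fst (h, x)))" by simp
        from has_derivative_compose[OF has_derivative_fst[OF has_derivative_ident] this]
        show ?thesis by (intro has_derivative_Pair has_derivative_snd has_derivative_ident)
      qed
      moreover have "((\<lambda>(t, x). run l t X x) has_derivative P) (at ((\<lambda>z::real \<times> 'a. (root k (fst z), snd z)) (h, x)))"
        using P by (simp add: t_def)
      ultimately have "((\<lambda>z. (\<lambda>(t, x). run l t X x) (root k (fst z), snd z)) has_derivative
          (\<lambda>z. P (fst z * inverse (real k * t ^ (k - Suc 0)), snd z))) (at (h, x))"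
        by (rule has_derivative_compose)
      then have DH: "((\<lambda>(h, x). run l (root k h) X x) has_derivative
          (\<lambda>z. P (fst z * inverse (real k * t ^ (k - Suc 0)), snd z))) (at (h, x))"
        by (simp add: case_prod_unfold)
      have Psplit: "P (s, v) = s *\<^sub>R Dt t X x + P (0, v)" for s v
        using linear_add[OF linP, of "s *\<^sub>R (1, 0)" "(0, v)"] linear_scale[OF linP, of s "(1, 0)"] Pt by simp
      have tk: "t ^ k = t * t ^ (k - Suc 0)" using k(1) by (cases k) auto
      \<comment> \<open>The factor is dt/dh, so this is the derivative in h: the field plus the
        error \<open>a\<close>.\<close>
      have cD: "inverse (real k * t ^ (k - Suc 0)) *\<^sub>R Dt t X x = a t X x + V X x"
        using k(1) t(1) unfolding a_def tk by (simp add: scaleR_diff_right field_simps)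
      show "bd (\<lambda>(h, x). run l (root k h) X x) (h, x) - shear (V X x) =
        (blinfun_scaleR_left (a (root k h) X x) o\<^sub>L fst_blinfun) + (b (root k h) X x o\<^sub>L snd_blinfun)"
      proof (rule blinfun_eqI)
        fix z :: "real \<times> 'a"
        have "blinfun_apply (bd (\<lambda>(h, x). run l (root k h) X x) (h, x)) z = P (fst z * inverse (real k * t ^ (k - Suc 0)), snd z)"
          using has_derivative_bounded_linear[OF DH] by (simp add: bd_def frechet_eq[OF DH] bounded_linear_Blinfun_apply)
        also have "\<dots> = fst z *\<^sub>R (a t X x + V X x) + P (0, snd z)"
          unfolding Psplit[of "fst z * _"] cD[symmetric] by simp
        finally show "blinfun_apply (bd (\<lambda>(h, x). run l (root k h) X x) (h, x) - shear (V X x)) z =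
          blinfun_apply ((blinfun_scaleR_left (a (root k h) X x) o\<^sub>L fst_blinfun) + (b (root k h) X x o\<^sub>L snd_blinfun)) z"
          by (simp add: blinfun.bilinear_simps shear_apply b_def bdx t_def[symmetric] scaleR_add_right)
      qed
    qed
  qed
qed

definition Emap :: "nat list \<Rightarrow> (nat \<Rightarrow> 'a \<Rightarrow> 'a) \<Rightarrow> real \<times> 'a \<Rightarrow> 'a" where
  "Emap I X = (\<lambda>(h, x). if h > 0 then run (word I) (root (weight I) h) X x
     else if h < 0 then run (bwl (word I)) (root (weight I) (- h)) X x else x)"

lemma Emap_rel:
  assumes I: "I \<in> multiindices n r"
  shows "\<exists>d>0. \<forall>X\<in>\<Theta>. \<forall>h x y. \<bar>h\<bar> < d \<longrightarrow> x \<in> nb \<Omega>' d \<longrightarrow> ((x, y) \<in> E_rel \<Omega> X I h \<longleftrightarrow> y = Emap I X (h, x))"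
proof -
  have I': "I \<noteq> []" "set I \<subseteq> {0..n}" using I by (auto simp: multiindices_def)
  have k: "0 < weight I" using weight_pos[OF I'(1)] .
  note w = word_set[OF I'(2)]
  \<comment> \<open>For h = 0 the relation is the identity on \<Omega> only, so the neighbourhood
    must lie in \<Omega>.\<close>
  obtain d0 where d0: "d0 > 0" "nb \<Omega>' d0 \<subseteq> \<Omega>" using nb_subset_open[OF cpt(1) open_\<Omega> cpt(2)] by blast
  obtain \<rho> d where d: "\<rho> > 0" "d > 0" "\<And>h X x. 0 < h \<Longrightarrow> h < d \<Longrightarrow> X \<in> \<Theta> \<Longrightarrow> x \<in> nb \<Omega>' \<rho> \<Longrightarrow>
      (\<forall>y. (x, y) \<in> lrel X (root (weight I) h) (word I) \<longleftrightarrow> y = run (word I) (root (weight I) h) X x) \<and>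
      (\<forall>y. (x, y) \<in> lrel X (root (weight I) h) (bwl (word I)) \<longleftrightarrow> y = run (bwl (word I)) (root (weight I) h) X x)"
    using evt_root[OF evt_conj[OF lrel_run[OF w] lrel_run[OF set_bwl[OF w]]] k] unfolding evt_def evt_at_def by auto
  define \<delta> where "\<delta> = min d0 (min \<rho> d)"
  have "\<delta> > 0" using d0 d by (simp add: \<delta>_def)
  moreover have "(x, y) \<in> E_rel \<Omega> X I h \<longleftrightarrow> y = Emap I X (h, x)"
    if X: "X \<in> \<Theta>" and h: "\<bar>h\<bar> < \<delta>" and x: "x \<in> nb \<Omega>' \<delta>" for X h x y
  proof -
    have "\<delta> \<le> \<rho>" "\<delta> \<le> d0" by (auto simp: \<delta>_def)
    then have x1: "x \<in> nb \<Omega>' \<rho>" "x \<in> \<Omega>"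
      using x nb_mono[of \<delta> \<rho> \<Omega>'] nb_mono[of \<delta> d0 \<Omega>'] d0(2) by auto
    consider "h > 0" | "h < 0" | "h = 0" by linarith
    then show ?thesis
    proof cases
      case 1 then show ?thesis using d(3)[of h X x] h X x1 by (simp add: E_rel_def Emap_def C_rel_eq_lrel[OF I'(1)] \<delta>_def)
    next
      case 2 then show ?thesis using d(3)[of "- h" X x] h X x1
        by (simp add: E_rel_def Emap_def C_rel_eq_lrel[OF I'(1)] \<delta>_def lrel_bwl)
    next
      case 3 then show ?thesis using lrel_0[OF x1(2)] by (simp add: E_rel_def Emap_def C_rel_eq_lrel[OF I'(1)])
    qed
  qed
  ultimately show ?thesis by blast
qed

lemma UC_commutator: "I \<in> multiindices n r \<Longrightarrow> UC (\<lambda>X. commutator X I)"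
  using UCk_UC[OF UCk_commutator[of I]] by (auto simp: multiindices_def)

text \<open>For h > 0 the map runs the word, for h < 0 its inverse, whose leading term is opposite
  by \<open>bwl_leading\<close>. One radius \<open>\<rho>\<close> collects all requirements, and the
  ranges of h for the derivative estimates are common to all fields.\<close>

lemma Emap_C1:
  assumes I: "I \<in> multiindices n r"
  shows "\<exists>d>0. \<forall>X\<in>\<Theta>. C1_on (Emap I X) ({-d<..<d} \<times> nb \<Omega>' d)"
    and "\<And>e. 0 < e \<Longrightarrow> \<exists>d>0. \<forall>X\<in>\<Theta>. \<forall>h x. \<bar>h\<bar> < d \<longrightarrow> x \<in> nb \<Omega>' d \<longrightarrow>
      norm (bd (Emap I X) (h, x) - shear (commutator X I x)) \<le> e"
proof -
  have I': "I \<noteq> []" "set I \<subseteq> {0..n}" "weight I \<le> r" using I by (auto simp: multiindices_def)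
  define k where "k = weight I"
  define V where "V X = commutator X I" for X :: "nat \<Rightarrow> 'a \<Rightarrow> 'a"
  have k: "0 < k" "k \<le> r" using weight_pos[OF I'(1)] I'(3) by (auto simp: k_def)
  note w = word_set[OF I'(2)]
  have UCV: "UC V" unfolding V_def by (rule UC_commutator[OF I])
  have lead: "smallo k (\<lambda>t X x. run (word I) t X x - x - t ^ k *\<^sub>R V X x)"
    unfolding k_def V_def by (rule word_leading[OF I'])
  have lead': "smallo k (\<lambda>t X x. run (bwl (word I)) t X x - x - t ^ k *\<^sub>R (- V X x))"
    by (rule bwl_leading[OF w lead UCV])
  define P where "P X = (\<lambda>(h, x). run (word I) (root k h) X x)" for X
  define N where "N X = (\<lambda>(h, x). run (bwl (word I)) (root k h) X x)" for X
  note half = half_derivative[OF w k lead, folded P_def] and half' = half_derivative[OF set_bwl[OF w] k lead', folded N_def]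
  obtain \<delta>1 d1 where 1: "\<delta>1 > 0" "d1 > 0" "\<And>X. X \<in> \<Theta> \<Longrightarrow> C1_on (P X) ({0<..<d1} \<times> nb \<Omega>' \<delta>1)"
    using half(1) by blast
  obtain \<delta>2 d2 where 2: "\<delta>2 > 0" "d2 > 0" "\<And>X. X \<in> \<Theta> \<Longrightarrow> C1_on (N X) ({0<..<d2} \<times> nb \<Omega>' \<delta>2)"
    using half'(1) by blast
  obtain \<rho>3 where 3: "\<rho>3 > 0" "smallo_at \<rho>3 0 (\<lambda>h X x. bd (P X) (h, x) - shear (V X x))"
    using half(2) unfolding smallo_def by auto
  obtain \<rho>4 where 4: "\<rho>4 > 0" "smallo_at \<rho>4 0 (\<lambda>h X x. bd (N X) (h, x) - shear (- V X x))"
    using half'(2) unfolding smallo_def by auto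
  obtain \<rho>5 where 5: "\<rho>5 > 0" "smallo_at \<rho>5 k (\<lambda>t X x. run (word I) t X x - x - t ^ k *\<^sub>R V X x)"
    using lead unfolding smallo_def by auto
  obtain \<rho>6 where 6: "\<rho>6 > 0" "smallo_at \<rho>6 k (\<lambda>t X x. run (bwl (word I)) t X x - x - t ^ k *\<^sub>R (- V X x))"
    using lead' unfolding smallo_def by auto
  from UCV obtain \<rho>7 where 7: "0 < \<rho>7"
    "\<And>e. 0 < e \<Longrightarrow> \<exists>d>0. osc_le \<rho>7 d e V"
    by (rule UC_E) blast
  define \<rho> where "\<rho> = Min {\<delta>1, \<delta>2, \<rho>3, \<rho>4, \<rho>5, \<rho>6, \<rho>7}"
  have \<rho>: "\<rho> > 0" "\<rho> \<le> \<delta>1" "\<rho> \<le> \<delta>2" "\<rho> \<le> \<rho>3" "\<rho> \<le> \<rho>4" "\<rho> \<le> \<rho>5" "\<rho> \<le> \<rho>6" "\<rho> \<le> \<rho>7"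
  proof -
    show "\<rho> > 0" unfolding \<rho>_def using 1(1) 2(1) 3(1) 4(1) 5(1) 6(1) 7(1) by (subst Min_gr_iff) auto
  qed (unfold \<rho>_def, (rule Min_le; simp)+)
  define d where "d = min d1 d2"
  have d: "d > 0" using 1 2 by (simp add: d_def)
  define W where "W = nb \<Omega>' \<rho>"
  have bdP: "\<exists>c>0. \<forall>h X x. 0 < h \<longrightarrow> h < c \<longrightarrow> X \<in> \<Theta> \<longrightarrow> x \<in> W \<longrightarrow> norm (bd (P X) (h, x) - shear (V X x)) \<le> e" if "0 < e" for e
    using smallo_at_mono[OF 3(2) \<rho>(4)] that unfolding smallo_at_def evt_at_def W_def by auto
  have bdN: "\<exists>c>0. \<forall>h X x. 0 < h \<longrightarrow> h < c \<longrightarrow> X \<in> \<Theta> \<longrightarrow> x \<in> W \<longrightarrow> norm (bd (N X) (h, x) - shear (- V X x)) \<le> e" if "0 < e" for e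
    using smallo_at_mono[OF 4(2) \<rho>(5)] that unfolding smallo_at_def evt_at_def W_def by auto
  have P0: "\<exists>c>0. \<forall>h x. 0 < h \<longrightarrow> h < c \<longrightarrow> x \<in> W \<longrightarrow> norm (P X (h, x) - x - h *\<^sub>R V X x) \<le> e * h"
    if X: "X \<in> \<Theta>" and e: "0 < e" for X e
  proof -
    have "evt_at \<rho> (\<lambda>t X x. norm (run (word I) t X x - x - t ^ k *\<^sub>R V X x) \<le> e * t ^ k)"
      using smallo_at_mono[OF 5(2) \<rho>(6)] e unfolding smallo_at_def by blast
    from evt_at_root[OF this k(1)] show ?thesis using X k(1) unfolding evt_at_def W_def P_def by auto
  qed
  have N0: "\<exists>c>0. \<forall>h x. 0 < h \<longrightarrow> h < c \<longrightarrow> x \<in> W \<longrightarrow> norm (N X (h, x) - x + h *\<^sub>R V X x) \<le> e * h"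
    if X: "X \<in> \<Theta>" and e: "0 < e" for X e
  proof -
    have "evt_at \<rho> (\<lambda>t X x. norm (run (bwl (word I)) t X x - x - t ^ k *\<^sub>R (- V X x)) \<le> e * t ^ k)"
      using smallo_at_mono[OF 6(2) \<rho>(7)] e unfolding smallo_at_def by blast
    from evt_at_root[OF this k(1)] show ?thesis using X k(1) unfolding evt_at_def W_def N_def by auto
  qed
  have Vc: "continuous_on W (V X)" if X: "X \<in> \<Theta>" for X
    unfolding continuous_on_iff
  proof (intro ballI allI impI)
    fix x e assume x: "x \<in> W" and e: "0 < (e::real)"
    then obtain d where d: "d > 0" "osc_le \<rho>7 d (e/2) V"
      using 7(2)[of "e/2"] by auto
    show "\<exists>d>0. \<forall>y\<in>W. dist y x < d \<longrightarrow> dist (V X y) (V X x) < e"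
    proof (intro exI[of _ d] conjI ballI impI d(1))
      fix y assume "y \<in> W" "dist y x < d"
      then have "norm (V X y - V X x) \<le> e/2" using d(2) \<rho>(8) X x unfolding W_def by blast
      then show "dist (V X y) (V X x) < e" using e by (simp add: dist_norm)
    qed
  qed
  have G: "Emap I X = (\<lambda>(h, x). if h > 0 then P X (h, x) else if h < 0 then N X (- h, x) else x)" for X
    by (auto simp: Emap_def P_def N_def k_def fun_eq_iff)
  have sub: "W \<subseteq> nb \<Omega>' \<delta>1" "W \<subseteq> nb \<Omega>' \<delta>2"
    unfolding W_def using nb_mono[OF \<rho>(2), of \<Omega>'] nb_mono[OF \<rho>(3), of \<Omega>'] by auto
  have CP: "C1_on (P X) ({0<..<d} \<times> W)" and CN: "C1_on (N X) ({0<..<d} \<times> W)" if X: "X \<in> \<Theta>" for X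
    by (rule C1_on_subset[OF 1(3)[OF X]] C1_on_subset[OF 2(3)[OF X]], use sub in \<open>auto simp: d_def\<close>)+
  have W: "open W" by (simp add: W_def open_nb)
  have bdP1: "\<exists>c>0. \<forall>h x. 0 < h \<longrightarrow> h < c \<longrightarrow> x \<in> W \<longrightarrow> norm (bd (P X) (h, x) - shear (V X x)) \<le> e"
    and bdN1: "\<exists>c>0. \<forall>h x. 0 < h \<longrightarrow> h < c \<longrightarrow> x \<in> W \<longrightarrow> norm (bd (N X) (h, x) - shear (- V X x)) \<le> e"
    if "X \<in> \<Theta>" "0 < e" for X e
    using bdP[OF that(2)] bdN[OF that(2)] that(1) by meson+
  have "C1_on (Emap I X) ({-min d \<rho><..<min d \<rho>} \<times> nb \<Omega>' (min d \<rho>))" if X: "X \<in> \<Theta>" for X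
    by (rule C1_on_subset[OF two_sided_C1(1)[OF d W CP[OF X] CN[OF X] Vc[OF X] bdP1[OF X] bdN1[OF X] P0[OF X] N0[OF X] G]]) (use nb_mono[of "min d \<rho>" \<rho> \<Omega>'] in \<open>auto simp: W_def\<close>)
  then show "\<exists>d>0. \<forall>X\<in>\<Theta>. C1_on (Emap I X) ({-d<..<d} \<times> nb \<Omega>' d)"
    using d \<rho>(1) by (intro exI[of _ "min d \<rho>"]) auto
  show "\<exists>d>0. \<forall>X\<in>\<Theta>. \<forall>h x. \<bar>h\<bar> < d \<longrightarrow> x \<in> nb \<Omega>' d \<longrightarrow>
      norm (bd (Emap I X) (h, x) - shear (commutator X I x)) \<le> e" if e: "0 < e" for e
  proof -
    obtain c1 where c1: "c1 > 0" "\<And>h X x. 0 < h \<Longrightarrow> h < c1 \<Longrightarrow> X \<in> \<Theta> \<Longrightarrow> x \<in> W \<Longrightarrow> norm (bd (P X) (h, x) - shear (V X x)) \<le> e"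
      using bdP[OF e] by blast
    obtain c2 where c2: "c2 > 0" "\<And>h X x. 0 < h \<Longrightarrow> h < c2 \<Longrightarrow> X \<in> \<Theta> \<Longrightarrow> x \<in> W \<Longrightarrow> norm (bd (N X) (h, x) - shear (- V X x)) \<le> e"
      using bdN[OF e] by blast
    define c where "c = min d (min c1 c2)"
    have c: "0 < c" "c \<le> d" "c \<le> c1" "c \<le> c2" using d c1 c2 by (auto simp: c_def)
    have "norm (bd (Emap I X) (h, x) - shear (V X x)) \<le> e" if X: "X \<in> \<Theta>" and h: "\<bar>h\<bar> < c" and x: "x \<in> W" for X h x
      by (rule two_sided_C1(2)[OF d W CP[OF X] CN[OF X] Vc[OF X] bdP1[OF X] bdN1[OF X] P0[OF X] N0[OF X] G e c(2) _ _ h x]) (use X c c1(2) c2(2) in auto)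
    then show ?thesis using c(1) \<rho>(1) nb_mono[of "min c \<rho>" \<rho> \<Omega>']
      by (intro exI[of _ "min c \<rho>"]) (auto simp: W_def V_def)
  qed
qed

end


section \<open>Products of quasiexponential maps\<close>

context germs
begin

definition hevt :: "('h::real_normed_vector \<Rightarrow> 'x \<Rightarrow> 'a \<Rightarrow> bool) \<Rightarrow> bool" where
  "hevt P \<longleftrightarrow> (\<exists>d>0. \<forall>X\<in>\<Theta>. \<forall>h x. norm h < d \<longrightarrow> x \<in> nb S d \<longrightarrow> P h X x)"

lemma hevt_mono: "hevt P \<Longrightarrow> (\<And>h X x. X \<in> \<Theta> \<Longrightarrow> P h X x \<Longrightarrow> Q h X x) \<Longrightarrow> hevt Q"
  unfolding hevt_def by meson

lemma hevt_conj:
  assumes "hevt P" "hevt Q" shows "hevt (\<lambda>h X x. P h X x \<and> Q h X x)"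
proof -
  from assms obtain d e where "d > 0" "e > 0"
    "\<And>X h x. X \<in> \<Theta> \<Longrightarrow> norm h < d \<Longrightarrow> x \<in> nb S d \<Longrightarrow> P h X x"
    "\<And>X h x. X \<in> \<Theta> \<Longrightarrow> norm h < e \<Longrightarrow> x \<in> nb S e \<Longrightarrow> Q h X x"
    unfolding hevt_def by metis
  then show ?thesis unfolding hevt_def
    using nb_mono[of "min d e" d S] nb_mono[of "min d e" e S] by (intro exI[of _ "min d e"]) auto
qed

lemma near_hevt: "near P \<Longrightarrow> hevt (\<lambda>h. P)"
  unfolding near_def hevt_def by blast

lemma hevt_ge: "0 < d \<Longrightarrow> hevt (\<lambda>h X x. norm h < d \<and> x \<in> nb S d)"
  unfolding hevt_def by blast

text \<open>In applications \<open>q\<close> extracts the component of h belonging to one factor,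
  and \<open>F\<close> is the product of the factors that act before it.\<close>

lemma hevt_comp:
  fixes P :: "'h::real_normed_vector \<Rightarrow> 'x \<Rightarrow> 'a \<Rightarrow> bool" and F :: "'x \<Rightarrow> ('k::real_normed_vector \<times> 'a) \<Rightarrow> 'a"
  assumes P: "hevt P" and F: "\<And>e. 0 < e \<Longrightarrow> hevt (\<lambda>h X x. norm (F X (h, x) - x) \<le> e)"
    and q: "\<And>h. norm (q h) \<le> norm h"
  shows "hevt (\<lambda>h X x. P (q h) X (F X (h, x)))"
proof -
  obtain d where d: "d > 0" "\<And>X h x. X \<in> \<Theta> \<Longrightarrow> norm h < d \<Longrightarrow> x \<in> nb S d \<Longrightarrow> P h X x"
    using P unfolding hevt_def by blast
  have "0 < d/2" using d by simp
  from hevt_conj[OF F[OF this] hevt_ge[OF this]] show ?thesis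
  proof (rule hevt_mono)
    fix h X x assume X: "X \<in> \<Theta>" and a: "norm (F X (h, x) - x) \<le> d/2 \<and> norm h < d/2 \<and> x \<in> nb S (d/2)"
    have "F X (h, x) \<in> nb S (d/2 + d/2)"
      by (rule nb_step[of x]) (use a in \<open>auto simp: dist_norm norm_minus_commute\<close>)
    moreover have "norm (q h) < d" using q[of h] a d(1) by linarith
    ultimately show "P (q h) X (F X (h, x))" using d(2)[OF X] by simp
  qed
qed

lemma UC_hevt:
  fixes F :: "'x \<Rightarrow> ('k::real_normed_vector \<times> 'a) \<Rightarrow> 'a"
  assumes "UC f" and F: "\<And>e. 0 < e \<Longrightarrow> hevt (\<lambda>h X x. norm (F X (h, x) - x) \<le> e)" and e: "0 < e"
  shows "hevt (\<lambda>h X x. norm (f X (F X (h, x)) - f X x) \<le> e)"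
proof -
  from \<open>UC f\<close> obtain \<rho> where f: "0 < \<rho>"
    "\<And>e. 0 < e \<Longrightarrow> \<exists>d>0. osc_le \<rho> d e f"
    by (rule UC_E) blast
  obtain d where d: "d > 0" "osc_le \<rho> d e f"
    using f(2)[OF e] by blast
  have pos: "0 < min (d/2) (\<rho>/2)" "0 < \<rho>/2" using d f by auto
  from hevt_conj[OF F[OF pos(1)] hevt_ge[OF pos(2)]] show ?thesis
  proof (rule hevt_mono)
    fix h X x assume X: "X \<in> \<Theta>" and a: "norm (F X (h, x) - x) \<le> min (d/2) (\<rho>/2) \<and> norm h < \<rho>/2 \<and> x \<in> nb S (\<rho>/2)"
    have "F X (h, x) \<in> nb S (\<rho>/2 + \<rho>/2)"
      by (rule nb_step[of x]) (use a in \<open>auto simp: dist_norm norm_minus_commute\<close>)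
    moreover have "x \<in> nb S \<rho>" using a nb_mono[of "\<rho>/2" \<rho> S] f(1) by auto
    moreover have "dist (F X (h, x)) x < d" using a d(1) by (auto simp: dist_norm)
    ultimately show "norm (f X (F X (h, x)) - f X x) \<le> e" using d(2) X by auto
  qed
qed

end

context flows
begin

lemma Emap_near:
  assumes I: "I \<in> multiindices n r" and e: "0 < e"
  shows "hevt (\<lambda>h X x. norm (Emap I X (h, x) - x) \<le> e)"
proof -
  have I': "I \<noteq> []" "set I \<subseteq> {0..n}" using I by (auto simp: multiindices_def)
  note w = word_set[OF I'(2)] and k = weight_pos[OF I'(1)]
  from evt_root[OF evt_conj[OF smallo_E[OF nid_run[OF w, unfolded nid_def] e]
        smallo_E[OF nid_run[OF set_bwl[OF w], unfolded nid_def] e]] k]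
  obtain \<rho> d where d: "\<rho> > 0" "d > 0" "\<And>h X x. 0 < h \<Longrightarrow> h < d \<Longrightarrow> X \<in> \<Theta> \<Longrightarrow> x \<in> nb \<Omega>' \<rho> \<Longrightarrow>
      norm (run (word I) (root (weight I) h) X x - x) \<le> e \<and> norm (run (bwl (word I)) (root (weight I) h) X x - x) \<le> e"
    unfolding evt_def evt_at_def by auto
  define c where "c = min \<rho> d"
  have c: "c > 0" "c \<le> \<rho>" "c \<le> d" using d by (auto simp: c_def)
  have "norm (Emap I X (h, x) - x) \<le> e" if X: "X \<in> \<Theta>" and h: "norm h < c" and x: "x \<in> nb \<Omega>' c" for X h x
  proof -
    have x': "x \<in> nb \<Omega>' \<rho>" using x nb_mono[OF c(2), of \<Omega>'] by blast
    consider "h > 0" | "h < 0" | "h = 0" by linarith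
    then show ?thesis using d(3)[of h X x] d(3)[of "- h" X x] h c(3) X x' e
      by cases (auto simp: Emap_def)
  qed
  then show ?thesis using c(1) unfolding hevt_def by blast
qed

primrec Fmap :: "('j::finite \<Rightarrow> nat list) \<Rightarrow> 'j list \<Rightarrow> (nat \<Rightarrow> 'a \<Rightarrow> 'a) \<Rightarrow> (real^'j) \<times> 'a \<Rightarrow> 'a" where
  "Fmap \<eta> [] X z = snd z"
| "Fmap \<eta> (j # js) X z = Emap (\<eta> j) X (fst z $ j, Fmap \<eta> js X z)"

text \<open>The derivative of \<^const>\<open>Fmap\<close> at \<open>(0, x)\<close>.\<close>

definition Flin :: "('j::finite \<Rightarrow> nat list) \<Rightarrow> 'j list \<Rightarrow> (nat \<Rightarrow> 'a \<Rightarrow> 'a) \<Rightarrow> 'a \<Rightarrow> (real^'j) \<times> 'a \<Rightarrow> 'a" where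
  "Flin \<eta> js X x w = (\<Sum>j\<leftarrow>js. (fst w $ j) *\<^sub>R commutator X (\<eta> j) x) + snd w"

lemma Flin_bound:
  assumes "\<eta> \<in> families n r"
  shows "\<exists>C\<ge>0. near (\<lambda>X x. \<forall>w. norm (Flin \<eta> js X x w) \<le> C * norm w)"
proof (induction js)
  case Nil
  have "near (\<lambda>X x. \<forall>w. norm (Flin \<eta> [] X x w) \<le> 1 * norm w)"
    unfolding near_def by (intro exI[of _ 1]) (simp add: Flin_def norm_snd_le)
  then show ?case by (intro exI[of _ 1]) simp
next
  case (Cons j js)
  then obtain C where C: "C \<ge> 0" "near (\<lambda>X x. \<forall>w. norm (Flin \<eta> js X x w) \<le> C * norm w)" by blast
  have "UC (\<lambda>X. commutator X (\<eta> j))" using assms by (intro UC_commutator) (auto simp: families_def)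
  then obtain B where B: "B \<ge> 0" "near (\<lambda>X x. norm (commutator X (\<eta> j) x) \<le> B)" using UC_bounded by blast
  have "near (\<lambda>X x. \<forall>w. norm (Flin \<eta> (j # js) X x w) \<le> (B + C) * norm w)"
  proof (rule near_mono[OF near_conj[OF B(2) C(2)]], rule allI)
    fix X x and w :: "(real^'b) \<times> 'a"
    assume a: "norm (commutator X (\<eta> j) x) \<le> B \<and> (\<forall>w. norm (Flin \<eta> js X x w) \<le> C * norm w)"
    have "\<bar>fst w $ j\<bar> \<le> norm w"
      using component_le_norm_cart[of "fst w" j] norm_fst_le[of "fst w" "snd w"] by simp
    then have "norm ((fst w $ j) *\<^sub>R commutator X (\<eta> j) x) \<le> norm w * B"
      using a by (auto intro: mult_mono)
    moreover have "Flin \<eta> (j # js) X x w = (fst w $ j) *\<^sub>R commutator X (\<eta> j) x + Flin \<eta> js X x w"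
      by (simp add: Flin_def)
    moreover have "norm (Flin \<eta> js X x w) \<le> C * norm w" using a by blast
    ultimately have "norm (Flin \<eta> (j # js) X x w) \<le> norm w * B + C * norm w"
      using norm_triangle_mono by metis
    then show "norm (Flin \<eta> (j # js) X x w) \<le> (B + C) * norm w" by (simp add: algebra_simps)
  qed
  then show ?case using B C by (intro exI[of _ "B + C"]) simp
qed

text \<open>The three facts are proved together, as the derivative estimate for one more factor
  needs the other two for the preceding ones. By the chain rule the outer derivative is close to the
  shear at the inner point, which is close to the shear at x.\<close>

lemma Fmap_facts:
  assumes \<eta>: "\<eta> \<in> families n r"
  shows "0 < e \<Longrightarrow> hevt (\<lambda>h X x. norm (Fmap \<eta> js X (h, x) - x) \<le> e)"
    and "\<exists>d>0. \<forall>X\<in>\<Theta>. C1_on (Fmap \<eta> js X) (ball 0 d \<times> nb \<Omega>' d)"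
    and "0 < e \<Longrightarrow> hevt (\<lambda>h X x. \<forall>w. norm (bd (Fmap \<eta> js X) (h, x) w - Flin \<eta> js X x w) \<le> e * norm w)"
proof (induction js arbitrary: e)
  case Nil
  {
    case 1
    then show ?case unfolding hevt_def by (intro exI[of _ 1]) auto
  next
    case 2
    have "Fmap \<eta> [] X = snd" for X by auto
    then show ?case using C1_on_linear[OF bounded_linear_snd] by (intro exI[of _ 1]) auto
  next
    case 3
    have "Fmap \<eta> [] X = snd" for X by auto
    moreover have "bd snd z = snd_blinfun" for z :: "(real^'b) \<times> 'a"
      by (rule bd_eq) (simp add: bounded_linear_imp_has_derivative[OF bounded_linear_snd])
    ultimately show ?case using 3 unfolding hevt_def by (intro exI[of _ 1]) (auto simp: Flin_def)
  }
next
  case (Cons j js)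
  note near = Cons.IH(1)
  let ?I = "\<eta> j"
  have I: "?I \<in> multiindices n r" using \<eta> by (simp add: families_def)
  have q: "norm (h $ j) \<le> norm h" for h :: "real^'b" using component_le_norm_cart[of h j] by simp
  have Fcons: "Fmap \<eta> (j # js) X = (\<lambda>z. Emap ?I X (fst z $ j, Fmap \<eta> js X z))" for X by (rule ext) simp
  have comp: "hevt P \<Longrightarrow> hevt (\<lambda>h X x. P (h $ j) X (Fmap \<eta> js X (h, x)))" for P
    by (rule hevt_comp[OF _ near q])
  {
    case 1
    then have "0 < e/2" by simp
    from hevt_conj[OF comp[OF Emap_near[OF I this]] near[OF this]]
    show ?case
    proof (rule hevt_mono)
      fix h X x assume "norm (Emap ?I X (h $ j, Fmap \<eta> js X (h, x)) - Fmap \<eta> js X (h, x)) \<le> e/2 \<and> norm (Fmap \<eta> js X (h, x) - x) \<le> e/2"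
      then show "norm (Fmap \<eta> (j # js) X (h, x) - x) \<le> e"
        using norm_triangle_ineq[of "Emap ?I X (h $ j, Fmap \<eta> js X (h, x)) - Fmap \<eta> js X (h, x)" "Fmap \<eta> js X (h, x) - x"]
        by simp
    qed
  next
    case 2
    obtain d1 where d1: "d1 > 0" "\<And>X. X \<in> \<Theta> \<Longrightarrow> C1_on (Fmap \<eta> js X) (ball 0 d1 \<times> nb \<Omega>' d1)" using Cons.IH(2) by blast
    obtain d2 where d2: "d2 > 0" "\<And>X. X \<in> \<Theta> \<Longrightarrow> C1_on (Emap ?I X) ({-d2<..<d2} \<times> nb \<Omega>' d2)" using Emap_C1(1)[OF I] by blast
    obtain d3 where d3: "d3 > 0" "\<And>X h x. X \<in> \<Theta> \<Longrightarrow> norm h < d3 \<Longrightarrow> x \<in> nb \<Omega>' d3 \<Longrightarrow>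
        norm (h $ j) < d2 \<and> Fmap \<eta> js X (h, x) \<in> nb \<Omega>' d2"
      using comp[OF hevt_ge[OF d2(1)]] unfolding hevt_def by blast
    define d where "d = min d1 d3"
    have d: "d > 0" "d \<le> d1" "d \<le> d3" using d1 d3 by (auto simp: d_def)
    have "C1_on (Fmap \<eta> (j # js) X) (ball 0 d \<times> nb \<Omega>' d)" if X: "X \<in> \<Theta>" for X
    proof -
      have "C1_on (\<lambda>z. Emap ?I X ((\<lambda>z. (fst z $ j, Fmap \<eta> js X z)) z)) (ball 0 d \<times> nb \<Omega>' d)"
      proof (rule C1_on_compose[OF d2(2)[OF X] C1_on_Pair])
        show "C1_on (\<lambda>z::(real^'b) \<times> 'a. fst z $ j) (ball 0 d \<times> nb \<Omega>' d)"
          by (intro C1_on_linear bounded_linear_compose[OF bounded_linear_vec_nth bounded_linear_fst])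
        show "C1_on (Fmap \<eta> js X) (ball 0 d \<times> nb \<Omega>' d)"
          by (rule C1_on_subset[OF d1(2)[OF X]]) (use d nb_mono[OF d(2), of \<Omega>'] in auto)
        show "(\<lambda>z. (fst z $ j, Fmap \<eta> js X z)) ` (ball 0 d \<times> nb \<Omega>' d) \<subseteq> {-d2<..<d2} \<times> nb \<Omega>' d2"
        proof (rule image_subsetI)
          fix z :: "(real^'b) \<times> 'a" assume "z \<in> ball 0 d \<times> nb \<Omega>' d"
          then have "norm (fst z) < d3" "snd z \<in> nb \<Omega>' d3" using d nb_mono[OF d(3), of \<Omega>'] by auto
          then show "(fst z $ j, Fmap \<eta> js X z) \<in> {-d2<..<d2} \<times> nb \<Omega>' d2"
            using d3(2)[OF X, of "fst z" "snd z"] by auto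
        qed
      qed
      then show ?thesis unfolding Fcons .
    qed
    then show ?case using d(1) by blast
  next
    case 3
    obtain C where C: "C \<ge> 0" "near (\<lambda>X x. \<forall>w. norm (Flin \<eta> js X x w) \<le> C * norm w)" using Flin_bound[OF \<eta>] by blast
    \<comment> \<open>With \<open>c \<le> 1\<close> the argument of the outer derivative has norm at
      most \<open>(C + 2) * norm w\<close>. Two errors are of that size times c, and the third is
      \<open>c * norm w\<close>.\<close>
    define c where "c = min 1 (e / (2 * (C + 2) + 1))"
    have c: "0 < c" "c \<le> 1" "(2 * (C + 2) + 1) * c \<le> e"
    proof -
      have "0 < 2 * (C + 2) + 1" using C(1) by simp
      then show "0 < c" "c \<le> 1" "(2 * (C + 2) + 1) * c \<le> e"
        using 3 by (auto simp: c_def min_def divide_simps mult_ac)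
    qed
    obtain d1 where d1: "d1 > 0" "\<And>X. X \<in> \<Theta> \<Longrightarrow> C1_on (Fmap \<eta> js X) (ball 0 d1 \<times> nb \<Omega>' d1)" using Cons.IH(2) by blast
    obtain d2 where d2: "d2 > 0" "\<And>X. X \<in> \<Theta> \<Longrightarrow> C1_on (Emap ?I X) ({-d2<..<d2} \<times> nb \<Omega>' d2)" using Emap_C1(1)[OF I] by blast
    have E: "hevt (\<lambda>h X x. norm (bd (Emap ?I X) (h, x) - shear (commutator X ?I x)) \<le> c)"
      using Emap_C1(2)[OF I c(1)] unfolding hevt_def by simp
    have Vc: "hevt (\<lambda>h X x. norm (commutator X ?I (Fmap \<eta> js X (h, x)) - commutator X ?I x) \<le> c)"
      by (rule UC_hevt[OF UC_commutator[OF I] near c(1)])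
    from hevt_conj[OF near_hevt[OF C(2)] hevt_conj[OF Cons.IH(3)[OF c(1)] hevt_conj[OF hevt_ge[OF d1(1)]
          hevt_conj[OF comp[OF hevt_ge[OF d2(1)]] hevt_conj[OF comp[OF E] Vc]]]]]
    show ?case
    proof (rule hevt_mono, intro allI)
      fix h :: "real^'b" and X x and w :: "(real^'b) \<times> 'a"
      assume X: "X \<in> \<Theta>" and H: "(\<forall>w. norm (Flin \<eta> js X x w) \<le> C * norm w) \<and>
        (\<forall>w. norm (bd (Fmap \<eta> js X) (h, x) w - Flin \<eta> js X x w) \<le> c * norm w) \<and>
        (norm h < d1 \<and> x \<in> nb \<Omega>' d1) \<and>
        (norm (h $ j) < d2 \<and> Fmap \<eta> js X (h, x) \<in> nb \<Omega>' d2) \<and>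
        norm (bd (Emap ?I X) (h $ j, Fmap \<eta> js X (h, x)) - shear (commutator X ?I (Fmap \<eta> js X (h, x)))) \<le> c \<and>
        norm (commutator X ?I (Fmap \<eta> js X (h, x)) - commutator X ?I x) \<le> c"
      let ?y = "Fmap \<eta> js X (h, x)" and ?V = "commutator X ?I"
      define u where "u = (fst w $ j, bd (Fmap \<eta> js X) (h, x) w)"
      have dF: "(Fmap \<eta> js X has_derivative bd (Fmap \<eta> js X) (h, x)) (at (h, x))"
        by (rule C1_on_bd(1)[OF d1(2)[OF X]]) (use H in auto)
      have dE: "(Emap ?I X has_derivative bd (Emap ?I X) (h $ j, ?y)) (at (h $ j, ?y))"
        by (rule C1_on_bd(1)[OF d2(2)[OF X]]) (use H in auto)
      have "((\<lambda>z. (fst z $ j, Fmap \<eta> js X z)) has_derivative (\<lambda>w. (fst w $ j, bd (Fmap \<eta> js X) (h, x) w))) (at (h, x))"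
        by (intro has_derivative_Pair dF bounded_linear_imp_has_derivative
            bounded_linear_compose[OF bounded_linear_vec_nth bounded_linear_fst])
      from has_derivative_compose[OF this, of "Emap ?I X"] dE
      have dd: "(Fmap \<eta> (j # js) X has_derivative (\<lambda>w. bd (Emap ?I X) (h $ j, ?y) (fst w $ j, bd (Fmap \<eta> js X) (h, x) w))) (at (h, x))"
        unfolding Fcons by simp
      have bdF: "bd (Fmap \<eta> (j # js) X) (h, x) w = bd (Emap ?I X) (h $ j, ?y) u"
        using has_derivative_bounded_linear[OF dd] by (simp add: bd_def frechet_eq[OF dd] bounded_linear_Blinfun_apply u_def)
      have wj: "\<bar>fst w $ j\<bar> \<le> norm w"
        using q[of "fst w"] norm_fst_le[of "fst w" "snd w"] by simp
      have 1: "norm (bd (Fmap \<eta> js X) (h, x) w - Flin \<eta> js X x w) \<le> c * norm w" using H by blast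
      have "norm (bd (Fmap \<eta> js X) (h, x) w) \<le> norm (bd (Fmap \<eta> js X) (h, x) w - Flin \<eta> js X x w) + norm (Flin \<eta> js X x w)" by norm
      also have "\<dots> \<le> c * norm w + C * norm w" by (rule add_mono[OF 1]) (use H in blast)
      also have "\<dots> \<le> 1 * norm w + C * norm w" using c by (intro add_right_mono mult_right_mono) auto
      finally have "norm (bd (Fmap \<eta> js X) (h, x) w) \<le> norm w + C * norm w" by simp
      moreover have "norm u \<le> \<bar>fst w $ j\<bar> + norm (bd (Fmap \<eta> js X) (h, x) w)"
        using norm_Pair_le[of "fst w $ j" "bd (Fmap \<eta> js X) (h, x) w"] by (simp add: u_def)
      ultimately have u: "norm u \<le> (C + 2) * norm w" using wj by (simp add: algebra_simps)
      have 2: "norm ((bd (Emap ?I X) (h $ j, ?y) - shear (?V ?y)) u) \<le> c * ((C + 2) * norm w)"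
        using H u c by (intro order_trans[OF norm_blinfun] mult_mono) auto
      have "norm (shear (?V ?y) - shear (?V x)) \<le> c" using norm_shear_diff order_trans H by blast
      then have 3: "norm ((shear (?V ?y) - shear (?V x)) u) \<le> c * ((C + 2) * norm w)"
        using u c by (intro order_trans[OF norm_blinfun] mult_mono) auto
      \<comment> \<open>The three errors: the outer derivative against its shear, the shear at the
        moved point against that at x, and the inner derivative against its linear model.\<close>
      have "bd (Fmap \<eta> (j # js) X) (h, x) w - Flin \<eta> (j # js) X x w =
          (bd (Emap ?I X) (h $ j, ?y) - shear (?V ?y)) u + (shear (?V ?y) - shear (?V x)) u
          + (bd (Fmap \<eta> js X) (h, x) w - Flin \<eta> js X x w)"
        unfolding bdF by (simp add: blinfun.bilinear_simps shear_apply Flin_def u_def)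
      also have "norm \<dots> \<le> c * ((C + 2) * norm w) + c * ((C + 2) * norm w) + c * norm w"
        by (intro norm_triangle_le add_mono 1 2 3 order_trans[OF norm_triangle_ineq])
      also have "\<dots> = ((2 * (C + 2) + 1) * c) * norm w" by (simp add: algebra_simps)
      also have "\<dots> \<le> e * norm w" using c by (intro mult_right_mono) auto
      finally show "norm (bd (Fmap \<eta> (j # js) X) (h, x) w - Flin \<eta> (j # js) X x w) \<le> e * norm w" .
    qed
  }
qed

lemma Fmap_rel:
  assumes \<eta>: "\<eta> \<in> families n r"
  shows "hevt (\<lambda>h X x. \<forall>y. (x, y) \<in> foldr (\<lambda>j R. R O E_rel \<Omega> X (\<eta> j) (h $ j)) js Id \<longleftrightarrow> y = Fmap \<eta> js X (h, x))"
proof (induction js)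
  case Nil show ?case unfolding hevt_def by (intro exI[of _ 1]) auto
next
  case (Cons j js)
  have I: "\<eta> j \<in> multiindices n r" using \<eta> by (simp add: families_def)
  have q: "norm (h $ j) \<le> norm h" for h :: "real^'b" using component_le_norm_cart[of h j] by simp
  have "hevt (\<lambda>h X x. \<forall>y. (x, y) \<in> E_rel \<Omega> X (\<eta> j) h \<longleftrightarrow> y = Emap (\<eta> j) X (h, x))"
    using Emap_rel[OF I] unfolding hevt_def by simp
  then have "hevt (\<lambda>h X x. \<forall>y. (Fmap \<eta> js X (h, x), y) \<in> E_rel \<Omega> X (\<eta> j) (h $ j) \<longleftrightarrow>
      y = Emap (\<eta> j) X (h $ j, Fmap \<eta> js X (h, x)))"
    by (rule hevt_comp[OF _ Fmap_facts(1)[OF \<eta>] q])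
  from hevt_conj[OF Cons.IH this]
  show ?case by (rule hevt_mono) (auto simp: relcomp_unfold)
qed

end


section \<open>Inversion of the product map\<close>

lemma norm_matrix_le:
  fixes A :: "real^'n^'m"
  assumes "\<And>i j. \<bar>A $ i $ j\<bar> \<le> B"
  shows "norm A \<le> real CARD('m) * (real CARD('n) * B)"
proof -
  have "norm A \<le> (\<Sum>i\<in>UNIV. norm (A $ i))"
    unfolding norm_vec_def by (rule L2_set_le_sum) simp
  also have "\<dots> \<le> (\<Sum>i\<in>(UNIV :: 'm set). real CARD('n) * B)"
  proof (rule sum_mono)
    fix i
    have "norm (A $ i) \<le> (\<Sum>j\<in>UNIV. \<bar>A $ i $ j\<bar>)" by (rule norm_le_l1_cart)
    also have "\<dots> \<le> (\<Sum>j\<in>(UNIV :: 'n set). B)" by (intro sum_mono assms)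
    finally show "norm (A $ i) \<le> real CARD('n) * B" by simp
  qed
  finally show ?thesis by simp
qed

text \<open>By compactness of the set of these matrices.\<close>

lemma matrix_lower_bound:
  fixes B \<delta> :: real
  assumes "0 < \<delta>"
  shows "\<exists>c>0. \<forall>A :: real^'n^'n. norm A \<le> B \<longrightarrow> \<delta> \<le> \<bar>det A\<bar> \<longrightarrow> (\<forall>k. c * norm k \<le> norm (A *v k))"
proof -
  \<comment> \<open>By homogeneity unit vectors suffice. On this compact set the norm of the image
    is positive, so its minimum is a positive constant.\<close>
  define K where "K = {A :: real^'n^'n. norm A \<le> B \<and> \<delta> \<le> \<bar>det A\<bar>} \<times> sphere (0 :: real^'n) 1"
  have cont_det: "continuous_on UNIV (det :: real^'n^'n \<Rightarrow> real)"
    unfolding det_def by (intro continuous_intros)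
  have "closed {A :: real^'n^'n. norm A \<le> B \<and> \<delta> \<le> \<bar>det A\<bar>}"
    by (intro closed_Collect_conj closed_Collect_le continuous_intros cont_det)
  moreover have "bounded {A :: real^'n^'n. norm A \<le> B \<and> \<delta> \<le> \<bar>det A\<bar>}"
    unfolding bounded_iff by blast
  ultimately have "compact {A :: real^'n^'n. norm A \<le> B \<and> \<delta> \<le> \<bar>det A\<bar>}" by (simp add: compact_eq_bounded_closed)
  then have K: "compact K" unfolding K_def by (intro compact_Times) auto
  have mv: "(A *v k) = (\<chi> i. \<Sum>j\<in>UNIV. A $ i $ j * k $ j)" for A :: "real^'n^'n" and k
    by (simp add: matrix_vector_mult_def)
  have cont: "continuous_on K (\<lambda>p. norm (fst p *v snd p))"
    unfolding mv by (intro continuous_intros)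
  have "\<exists>c>0. \<forall>p\<in>K. c \<le> norm (fst p *v snd p)"
  proof (cases "K = {}")
    case False
    obtain p where p: "p \<in> K" "\<And>q. q \<in> K \<Longrightarrow> norm (fst p *v snd p) \<le> norm (fst q *v snd q)"
      using continuous_attains_inf[OF K False cont] by blast
    have "det (fst p) \<noteq> 0" "snd p \<noteq> 0" using p(1) assms by (auto simp: K_def)
    then have "fst p *v snd p \<noteq> 0"
      using matrix_left_invertible_ker[of "fst p"] invertible_det_nz[of "fst p"] unfolding invertible_def by blast
    then show ?thesis using p(2) by (intro exI[of _ "norm (fst p *v snd p)"]) auto
  qed (auto intro: exI[of _ 1])
  then obtain c where c: "c > 0" "\<And>p. p \<in> K \<Longrightarrow> c \<le> norm (fst p *v snd p)" by blast
  have "c * norm k \<le> norm (A *v k)" if A: "norm A \<le> B" "\<delta> \<le> \<bar>det A\<bar>" for A :: "real^'n^'n" and k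
  proof (cases "k = 0")
    case False
    then have "(A, (1 / norm k) *\<^sub>R k) \<in> K" using A by (simp add: K_def)
    from c(2)[OF this] have "c \<le> norm (A *v k) / norm k" by (simp add: matrix_vector_mult_scaleR)
    then show ?thesis using False by (simp add: pos_le_divide_eq)
  qed simp
  then show ?thesis using c(1) by blast
qed

lemma C1_on_imp_Ck_on:
  fixes g :: "'a::euclidean_space \<Rightarrow> 'b::real_normed_vector"
  assumes "C1_on g S"
  shows "Ck_on 1 g S"
proof -
  have cg: "continuous_on S g" by (rule C1_on_imp_continuous_on[OF assms])
  have cp: "continuous_on S (partial b g)" for b
  proof (rule continuous_on_eq)
    show "continuous_on S (\<lambda>z. bd g z b)" by (intro continuous_intros C1_on_bd(2) assms)
    show "bd g z b = partial b g z" if "z \<in> S" for z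
      using frechet_eq[OF C1_on_bd(1)[OF assms that]] by (simp add: partial_def)
  qed
  have "continuous_on S (iter_partial bs g)" if "bs \<in> dirs_upto 1" for bs
    using that cg cp by (cases bs) (auto simp: dirs_upto_def)
  moreover have "iter_partial bs g differentiable (at z)" if "length bs < 1" "z \<in> S" for bs z
    using that C1_on_bd(1)[OF assms that(2)] by (auto simp: differentiable_def)
  ultimately show ?thesis unfolding Ck_on_def by blast
qed

text \<open>An inverse function theorem with explicit radii. The Lipschitz constant c/2 of f - A is
  set against the lower bound c of A, hence f stretches distances by at least c/2; injectivity, the
  size of the image and the estimates for the inverse follow from this.\<close>

lemma local_diffeo:
  fixes f :: "'a::euclidean_space \<Rightarrow> 'a"
  assumes f: "C1_on f (ball 0 R)" and A: "bounded_linear A" and c: "0 < c" and \<delta>: "0 < \<delta>" "\<delta> < R"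
    and lower: "\<And>k. c * norm k \<le> norm (A k)"
    and close: "\<And>h k. h \<in> ball 0 R \<Longrightarrow> norm (bd f h k - A k) \<le> c/2 * norm k"
  shows "\<exists>U. C1_diffeo_onto f (ball 0 \<delta>) U \<and> f 0 \<in> U \<and> ball (f 0) (c/2 * \<delta>) \<subseteq> U"
proof -
  have fd: "(f has_derivative bd f h) (at h)" if "h \<in> ball 0 R" for h by (rule C1_on_bd(1)[OF f that])
  have linA: "A (x - y) = A x - A y" for x y by (rule linear_diff[OF bounded_linear.linear[OF A]])
  have dev: "norm ((f h - A h) - (f h' - A h')) \<le> c/2 * norm (h - h')" if "h \<in> ball 0 R" "h' \<in> ball 0 R" for h h'
  proof (rule lipschitz_segment[where C = "ball 0 R" and V = "\<lambda>h. f h - A h" and V' = "\<lambda>h k. bd f h k - A k"])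
    show "((\<lambda>h. f h - A h) has_derivative (\<lambda>k. bd f h k - A k)) (at h)" if "h \<in> ball 0 R" for h
      by (intro has_derivative_diff fd that bounded_linear_imp_has_derivative A)
    show "onorm (\<lambda>k. bd f h k - A k) \<le> c/2" if "h \<in> ball 0 R" for h
      by (rule onorm_bound) (use c close[OF that] in auto)
  qed (use that in auto)
  have expand: "c/2 * norm (h - h') \<le> norm (f h - f h')" if "h \<in> ball 0 R" "h' \<in> ball 0 R" for h h'
  proof -
    have "norm (A (h - h')) \<le> norm (f h - f h') + norm ((f h - A h) - (f h' - A h'))"
      unfolding linA by norm
    then show ?thesis using lower[of "h - h'"] dev[OF that] by linarith
  qed
  have sub: "ball 0 \<delta> \<subseteq> ball (0::'a) R" "cball 0 \<delta> \<subseteq> ball (0::'a) R" using \<delta> by auto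
  have inj: "inj_on f (ball 0 R)"
  proof (rule inj_onI)
    fix h h' assume "h \<in> ball 0 R" "h' \<in> ball 0 R" "f h = f h'"
    then have "c/2 * norm (h - h') \<le> 0" using expand[of h h'] by simp
    then show "h = h'" using c by (simp add: mult_le_0_iff)
  qed
  have fc: "continuous_on (ball 0 R) f" by (rule C1_on_imp_continuous_on[OF f])
  define U where "U = f ` ball 0 \<delta>"
  have inj': "inj_on f (ball 0 \<delta>)" by (rule inj_on_subset[OF inj sub(1)])
  \<comment> \<open>A continuous injective map between spaces of equal dimension is open.\<close>
  have oU: "open U" unfolding U_def
    by (rule invariance_of_domain[OF continuous_on_subset[OF fc sub(1)] _ inj']) simp
  \<comment> \<open>\<open>U\<close> is relatively open and closed in this connected ball, which does not meet the image of the
    sphere of radius \<open>\<delta>\<close>.\<close>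
  have incl: "ball (f 0) (c/2 * \<delta>) \<subseteq> U"
  proof -
    let ?W = "ball (f 0) (c/2 * \<delta>)"
    have "compact (f ` cball 0 \<delta>)" by (intro compact_continuous_image continuous_on_subset[OF fc sub(2)]) simp
    then have cl: "closed (f ` cball 0 \<delta>)" by (rule compact_imp_closed)
    have eq: "U \<inter> ?W = f ` cball 0 \<delta> \<inter> ?W"
    proof
      show "f ` cball 0 \<delta> \<inter> ?W \<subseteq> U \<inter> ?W"
      proof
        fix y assume y: "y \<in> f ` cball 0 \<delta> \<inter> ?W"
        then obtain h where h: "h \<in> cball 0 \<delta>" "y = f h" by blast
        have "c/2 * norm (h - 0) \<le> norm (f h - f 0)" using h sub \<delta> by (intro expand) auto
        also have "\<dots> < c/2 * \<delta>" using y h by (simp add: dist_norm norm_minus_commute)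
        finally have "norm h < \<delta>" using c by simp
        then show "y \<in> U \<inter> ?W" using y h by (auto simp: U_def)
      qed
    qed (auto simp: U_def)
    have "openin (top_of_set ?W) (U \<inter> ?W)" by (subst Int_commute) (rule openin_open_Int[OF oU])
    moreover have "closedin (top_of_set ?W) (U \<inter> ?W)" unfolding eq by (subst Int_commute) (rule closedin_closed_Int[OF cl])
    moreover have "connected ?W" by (rule convex_connected) simp
    moreover have "f 0 \<in> U \<inter> ?W" using \<delta> c by (auto simp: U_def)
    ultimately have "U \<inter> ?W = ?W" unfolding connected_clopen by blast
    then show ?thesis by blast
  qed
  define g where "g = inv_into (ball 0 \<delta>) f"
  have g: "g y \<in> ball 0 \<delta>" "f (g y) = y" if "y \<in> U" for y
    using that inv_into_into[of y f "ball 0 \<delta>"] f_inv_into_f[of y f "ball 0 \<delta>"] unfolding U_def g_def by auto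
  have g_lip: "c/2 * norm (g y - g z) \<le> norm (y - z)" if "y \<in> U" "z \<in> U" for y z
    using expand[OF subsetD[OF sub(1) g(1)] subsetD[OF sub(1) g(1)], OF that] g(2) that by simp
  have g_cont: "continuous_on U g" unfolding continuous_on_iff
  proof (intro ballI allI impI)
    fix y e assume y: "y \<in> U" and e: "0 < (e::real)"
    show "\<exists>d>0. \<forall>z\<in>U. dist z y < d \<longrightarrow> dist (g z) (g y) < e"
    proof (intro exI[of _ "c/2 * e"] conjI ballI impI)
      fix z assume "z \<in> U" "dist z y < c/2 * e"
      then have "c/2 * dist (g z) (g y) < c/2 * e" using g_lip[of z y] y by (simp add: dist_norm)
      then show "dist (g z) (g y) < e" using c by simp
    qed (use c e in simp)
  qed
  define L where "L y = bd f (g y)" for y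
  \<comment> \<open>The derivative at each point inherits the lower bound c/2, so it is injective
    and therefore invertible.\<close>
  have Llow: "c/2 * norm k \<le> norm (L y k)" if "y \<in> U" for y k
  proof -
    have "norm (L y k - A k) \<le> c/2 * norm k" unfolding L_def by (rule close) (use g[OF that] sub in auto)
    moreover have "norm (A k) \<le> norm (L y k) + norm (L y k - A k)" by norm
    ultimately show ?thesis using lower[of k] by linarith
  qed
  have "\<exists>L'. linear L' \<and> L' \<circ> L y = id \<and> L y \<circ> L' = id" if y: "y \<in> U" for y
  proof -
    have lin: "linear (L y)" by (simp add: blinfun.bounded_linear_right bounded_linear.linear)
    have "inj (L y)" unfolding linear_injective_0[OF lin] 
    proof (intro allI impI)
      fix k assume "L y k = 0"
      then have "c/2 * norm k \<le> 0" using Llow[OF y, of k] by simp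
      then show "k = 0" using c by (simp add: mult_le_0_iff)
    qed
    then show ?thesis using linear_injective_isomorphism[OF lin] by (auto simp: fun_eq_iff)
  qed
  then obtain L' where L': "\<And>y. y \<in> U \<Longrightarrow> linear (L' y)" "\<And>y k. y \<in> U \<Longrightarrow> L' y (L y k) = k"
    "\<And>y k. y \<in> U \<Longrightarrow> L y (L' y k) = k"
    by (metis comp_eq_dest_lhs id_apply)
  have gd: "(g has_derivative L' y) (at y)" if y: "y \<in> U" for y
  proof (rule has_derivative_inverse_basic[where f = f and f' = "L y" and T = U])
    show "(f has_derivative blinfun_apply (L y)) (at (g y))" unfolding L_def by (rule fd) (use g[OF y] sub in auto)
    show "bounded_linear (L' y)" using L'(1)[OF y] by (simp add: linear_conv_bounded_linear)
    show "L' y \<circ> blinfun_apply (L y) = id" using L'(2)[OF y] by (simp add: fun_eq_iff)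
    show "continuous (at y) g" using g_cont y oU continuous_on_eq_continuous_at by blast
  qed (use oU y g in auto)
  have L'c: "continuous_on U (\<lambda>y. L' y b)" for b
    unfolding continuous_on_iff
  proof (intro ballI allI impI)
    fix y e assume y: "y \<in> U" and e: "0 < (e::real)"
    define K where "K = norm (L' y b) + 1"
    have "continuous_on U L" unfolding L_def
      by (rule continuous_on_compose2[OF C1_on_bd(2)[OF f] g_cont]) (use g sub in auto)
    moreover have "0 < c/2 * e / K" using c e by (simp add: K_def add_nonneg_pos)
    ultimately obtain d where d: "d > 0" "\<And>z. z \<in> U \<Longrightarrow> dist z y < d \<Longrightarrow> dist (L z) (L y) < c/2 * e / K"
      using y unfolding continuous_on_iff by blast
    show "\<exists>d>0. \<forall>z\<in>U. dist z y < d \<longrightarrow> dist (L' z b) (L' y b) < e"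
    proof (intro exI[of _ d] conjI ballI impI d(1))
      fix z assume z: "z \<in> U" "dist z y < d"
      \<comment> \<open>Continuity of the inverse derivatives by the resolvent identity: applied to
        the difference of the inverses at b, L(z) gives (L(y) - L(z)) L'(y) b.\<close>
      have "c/2 * norm (L' z b - L' y b) \<le> norm (L z (L' z b - L' y b))" by (rule Llow[OF z(1)])
      also have "L z (L' z b - L' y b) = (L y - L z) (L' y b)"
        using L'(3)[OF z(1), of b] L'(3)[OF y, of b] by (simp add: blinfun.bilinear_simps)
      also have "norm \<dots> \<le> norm (L y - L z) * norm (L' y b)" by (rule norm_blinfun)
      also have "\<dots> \<le> norm (L y - L z) * K" by (intro mult_left_mono) (auto simp: K_def)
      also have "\<dots> < (c/2 * e / K) * K"
        using d(2)[OF z] by (intro mult_strict_right_mono) (auto simp: dist_norm norm_minus_commute K_def add_nonneg_pos)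
      also have "\<dots> = c/2 * e"
      proof -
        have "K \<noteq> 0" unfolding K_def using norm_ge_zero[of "L' y b"] by linarith
        then show ?thesis by simp
      qed
      finally show "dist (L' z b) (L' y b) < e" using c by (simp add: dist_norm)
    qed
  qed
  have "Ck_on 1 g U"
  proof -
    have "continuous_on U (partial b g)" for b
      by (rule continuous_on_eq[OF L'c[of b]]) (simp add: partial_def frechet_eq[OF gd])
    then have "continuous_on U (iter_partial bs g)" if "bs \<in> dirs_upto 1" for bs
      using that g_cont by (cases bs) (auto simp: dirs_upto_def)
    moreover have "iter_partial bs g differentiable (at z)" if "length bs < 1" "z \<in> U" for bs z
      using that gd[OF that(2)] by (auto simp: differentiable_def)
    ultimately show ?thesis unfolding Ck_on_def by blast
  qed
  moreover have "Ck_on 1 f (ball 0 \<delta>)" by (rule C1_on_imp_Ck_on[OF C1_on_subset[OF f sub(1)]])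
  moreover have "bij_betw f (ball 0 \<delta>) U" using inj' by (simp add: bij_betw_def U_def)
  moreover have "f 0 \<in> U" using \<delta> by (auto simp: U_def)
  ultimately show ?thesis using oU incl unfolding C1_diffeo_onto_def g_def by (intro exI[of _ U]) auto
qed

section \<open>From the given data to the uniform classes\<close>

lemma finite_dirs_upto: "finite (dirs_upto k :: 'a::euclidean_space list set)"
  unfolding dirs_upto_def by (rule finite_lists_length_le[OF finite_Basis])

text \<open>The supremum dominates its members only if it is taken over a bounded set. Boundedness
  comes from the continuous extensions to the compact closure and from the finite number of
  derivatives.\<close>

lemma norm_iter_partial_le_Ck_norm:
  fixes f :: "'a::euclidean_space \<Rightarrow> 'b::real_normed_vector"
  assumes f: "Ck_closure k f S" and S: "bounded S" and bs: "bs \<in> dirs_upto k" and x: "x \<in> S"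
  shows "norm (iter_partial bs f x) \<le> Ck_norm k f S"
proof -
  have "bdd_above ((\<lambda>x. norm (iter_partial bs f x)) ` S)" if "bs \<in> dirs_upto k" for bs
  proof -
    obtain g where g: "continuous_on (closure S) g" "\<And>x. x \<in> S \<Longrightarrow> g x = iter_partial bs f x"
      using f \<open>bs \<in> dirs_upto k\<close> unfolding Ck_closure_def by blast
    have "compact (closure S)" using S by simp
    then have "bounded (g ` closure S)" using compact_continuous_image[OF g(1)] compact_imp_bounded by blast
    then obtain B where "\<And>x. x \<in> closure S \<Longrightarrow> norm (g x) \<le> B" unfolding bounded_iff by auto
    then show ?thesis using g(2) closure_subset[of S] by (intro bdd_aboveI2[of _ _ B]) (metis subsetD)
  qed
  then have "bdd_above (\<Union>bs\<in>dirs_upto k. (\<lambda>x. norm (iter_partial bs f x)) ` S)"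
    by (simp add: finite_dirs_upto)
  moreover have "(\<lambda>(bs, x). norm (iter_partial bs f x)) ` (dirs_upto k \<times> S) =
      (\<Union>bs\<in>dirs_upto k. (\<lambda>x. norm (iter_partial bs f x)) ` S)" by force
  ultimately have "bdd_above ((\<lambda>(bs, x). norm (iter_partial bs f x)) ` (dirs_upto k \<times> S))" by simp
  from cSUP_upper[OF _ this, of "(bs, x)"] show ?thesis using bs x by (simp add: Ck_norm_def)
qed

context germs
begin

text \<open>Bounded partial derivatives give a Lipschitz constant on small balls, hence a modulus of
  continuity common to all fields.\<close>

lemma UC_from_partials:
  assumes d: "near (\<lambda>X x. f X differentiable (at x))" and B: "0 \<le> B" "near (\<lambda>X x. norm (f X x) \<le> B)"
    and pB: "\<And>b. b \<in> Basis \<Longrightarrow> near (\<lambda>X x. norm (partial b (f X) x) \<le> B)"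
  shows "UC f"
proof -
  have "near (\<lambda>X x. (f X differentiable (at x) \<and> norm (f X x) \<le> B) \<and> (\<forall>b\<in>Basis. norm (partial b (f X) x) \<le> B))"
    by (intro near_conj d B(2) near_ball_Basis finite_Basis pB)
  then obtain \<rho> where \<rho>: "\<rho> > 0" "\<And>X x. X \<in> \<Theta> \<Longrightarrow> x \<in> nb S \<rho> \<Longrightarrow>
      f X differentiable (at x) \<and> norm (f X x) \<le> B \<and> (\<forall>b\<in>Basis. norm (partial b (f X) x) \<le> B)"
    unfolding near_def by blast
  define K where "K = real DIM('a) * B"
  have K: "0 \<le> K" using B by (simp add: K_def)
  have sub: "nb S (\<rho>/2) \<subseteq> nb S \<rho>" by (rule nb_mono) (use \<rho> in simp)
  show ?thesis
  proof (rule UC_I[of "\<rho>/2" _ B])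
    show "norm (f X x) \<le> B" if "X \<in> \<Theta>" "x \<in> nb S (\<rho>/2)" for X x using \<rho>(2)[of X x] that sub by blast
    fix e :: real assume e: "0 < e"
    show "\<exists>d>0. \<forall>X\<in>\<Theta>. \<forall>x\<in>nb S (\<rho>/2). \<forall>y\<in>nb S (\<rho>/2). dist x y < d \<longrightarrow> norm (f X x - f X y) \<le> e"
    proof (intro exI[of _ "min (\<rho>/2) (e / (K + 1))"] conjI ballI impI)
      show "0 < min (\<rho>/2) (e / (K + 1))" using \<rho> e K by simp
      fix X x y assume X: "X \<in> \<Theta>" and x: "x \<in> nb S (\<rho>/2)" and xy: "dist x y < min (\<rho>/2) (e / (K + 1))"
      have b: "ball x (\<rho>/2) \<subseteq> nb S \<rho>" using ball_subset_nb[OF x, of "\<rho>/2"] by simp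
      have "norm (f X x - f X y) \<le> K * norm (x - y)"
      proof (rule lipschitz_segment[where C = "ball x (\<rho>/2)" and V' = "\<lambda>z. blinfun_apply (dblin (f X) z)"])
        fix z assume "z \<in> ball x (\<rho>/2)"
        then have z: "f X differentiable (at z)" "\<forall>b\<in>Basis. norm (partial b (f X) z) \<le> B"
          using \<rho>(2)[OF X subsetD[OF b]] by auto
        show "(f X has_derivative blinfun_apply (dblin (f X) z)) (at z)" by (rule dblin_has_derivative[OF z(1)])
        show "onorm (blinfun_apply (dblin (f X) z)) \<le> K"
        proof (rule onorm_bound[OF K])
          fix v :: 'a
          have "norm (dblin (f X) z v) \<le> (\<Sum>b\<in>(Basis :: 'a set). norm v * B)"
            unfolding dblin_apply
            by (rule sum_norm_le) (use z(2) Basis_le_norm in \<open>auto intro!: mult_mono\<close>)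
          then show "norm (dblin (f X) z v) \<le> K * norm v" by (simp add: K_def mult_ac)
        qed
      qed (use xy \<rho> in auto)
      also have "\<dots> \<le> (K + 1) * norm (x - y)" by (intro mult_right_mono) auto
      also have "\<dots> \<le> (K + 1) * (e / (K + 1))" using xy K by (intro mult_left_mono) (auto simp: dist_norm)
      also have "\<dots> = e" using K by simp
      finally show "norm (f X x - f X y) \<le> e" .
    qed
  qed (use \<rho> in simp)
qed

text \<open>The induction runs from the derivatives of order k downwards. The modulus
  \<open>\<omega>\<close> is given at the top; each lower derivative is Lipschitz because the next
  ones are bounded by \<open>M\<close>.\<close>

lemma UCk_from_data:
  fixes f :: "'x \<Rightarrow> 'a \<Rightarrow> 'b::real_normed_vector"
  assumes W: "0 < d0" "nb S d0 \<subseteq> W"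
    and Ck: "\<And>X. X \<in> \<Theta> \<Longrightarrow> Ck_on k (f X) W"
    and M: "0 \<le> M" "\<And>X bs x. X \<in> \<Theta> \<Longrightarrow> bs \<in> dirs_upto k \<Longrightarrow> x \<in> W \<Longrightarrow> norm (iter_partial bs (f X) x) \<le> M"
    and top: "\<And>X. X \<in> \<Theta> \<Longrightarrow> top_modulus k (f X) W \<omega>" and \<omega>: "(\<omega> \<longlongrightarrow> 0) (at_right 0)"
  shows "UCk k f"
proof -
  have bdd: "near (\<lambda>X x. norm (iter_partial bs (f X) x) \<le> M)" if "bs \<in> dirs_upto k" for bs
    unfolding near_def using W M(2) that by blast
  have "UCk j (\<lambda>X. iter_partial bs (f X))" if "length bs + j = k" "set bs \<subseteq> Basis" for j and bs :: "'a list"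
    using that
  proof (induction j arbitrary: bs)
    case 0
    then have bs: "bs \<in> dirs_upto k" "length bs = k" by (auto simp: dirs_upto_def)
    have "UC (\<lambda>X. iter_partial bs (f X))"
    proof (rule UC_I[OF W(1), of _ M])
      show "norm (iter_partial bs (f X) x) \<le> M" if "X \<in> \<Theta>" "x \<in> nb S d0" for X x
        using M(2) bs W that by blast
      fix e :: real assume e: "0 < e"
      then obtain d where d: "d > 0" "\<And>s. 0 < s \<Longrightarrow> s < d \<Longrightarrow> \<omega> s < e"
        using order_tendstoD(2)[OF \<omega> e] unfolding eventually_at_right_field by auto
      show "\<exists>d>0. \<forall>X\<in>\<Theta>. \<forall>x\<in>nb S d0. \<forall>y\<in>nb S d0. dist x y < d \<longrightarrow> norm (iter_partial bs (f X) x - iter_partial bs (f X) y) \<le> e"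
      proof (intro exI[of _ d] conjI ballI impI d(1))
        fix X x y assume a: "X \<in> \<Theta>" "x \<in> nb S d0" "y \<in> nb S d0" "dist x y < d"
        show "norm (iter_partial bs (f X) x - iter_partial bs (f X) y) \<le> e"
        \<comment> \<open>The modulus is controlled at positive distances only.\<close>
        proof (cases "x = y")
          case False
          then have "norm (iter_partial bs (f X) x - iter_partial bs (f X) y) \<le> \<omega> (dist x y)"
            using top[OF a(1)] bs a(2,3) W(2) unfolding top_modulus_def by blast
          also have "\<dots> < e" using d(2)[of "dist x y"] False a(4) by simp
          finally show ?thesis by simp
        qed (use e in simp)
      qed
    qed
    then show ?case by simp
  next
    case (Suc j)
    then have bs: "bs \<in> dirs_upto k" "length bs < k" by (auto simp: dirs_upto_def)
    have diff: "near (\<lambda>X x. iter_partial bs (f X) differentiable (at x))"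
      unfolding near_def using W Ck bs unfolding Ck_on_def by blast
    have p: "partial b (iter_partial bs (f X)) = iter_partial (b # bs) (f X)" for b X by simp
    have bbs: "b # bs \<in> dirs_upto k" if "b \<in> Basis" for b using Suc.prems that by (auto simp: dirs_upto_def)
    have "UC (\<lambda>X. iter_partial bs (f X))"
      by (rule UC_from_partials[OF diff M(1) bdd[OF bs(1)]]) (unfold p, rule bdd[OF bbs])
    moreover have "UCk j (\<lambda>X. partial b (iter_partial bs (f X)))" if "b \<in> Basis" for b
      unfolding p by (rule Suc.IH) (use Suc.prems that in auto)
    ultimately show ?case using diff by simp
  qed
  from this[of "[]" k] show ?thesis by simp
qed

end


section \<open>Choice of the constants and conclusion\<close>

lemma reg_eq: "2 \<le> r \<Longrightarrow> reg r i = max 1 (r - wt i)"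
  by (auto simp: reg_def wt_def)

lemma finite_multiindices: "finite (multiindices n r)"
proof (rule finite_subset)
  have "length I \<le> weight I" for I
    by (induction I) (auto simp: weight_def wt_def)
  then show "multiindices n r \<subseteq> {I. set I \<subseteq> {0..n} \<and> length I \<le> r}"
    unfolding multiindices_def using order_trans by blast
  show "finite {I. set I \<subseteq> {0..n} \<and> length I \<le> r}" by (rule finite_lists_length_le) simp
qed

lemma finite_families: "finite (families n r :: ('p::finite \<Rightarrow> nat list) set)"
proof -
  have "(families n r :: ('p \<Rightarrow> nat list) set) = PiE UNIV (\<lambda>_. multiindices n r)"
    by (auto simp: families_def)
  then show ?thesis using finite_PiE[of "UNIV :: 'p set" "\<lambda>_. multiindices n r"] finite_multiindices by simp
qed

lemma finite_common_radius:
  fixes Q :: "'i \<Rightarrow> real \<Rightarrow> bool"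
  assumes "finite I" "\<And>i. i \<in> I \<Longrightarrow> \<exists>d>0. Q i d" "\<And>i d d'. Q i d \<Longrightarrow> 0 < d' \<Longrightarrow> d' \<le> d \<Longrightarrow> Q i d'"
  shows "\<exists>d>0. \<forall>i\<in>I. Q i d"
  using assms(1,2)
proof (induction I)
  case empty show ?case by (auto intro: exI[of _ 1])
next
  case (insert i I)
  then obtain d where "d > 0" "\<forall>i\<in>I. Q i d" by auto
  moreover obtain d' where "d' > 0" "Q i d'" using insert.prems[of i] by auto
  ultimately show ?case using assms(3) by (intro exI[of _ "min d d'"]) auto
qed

text \<open>The dependence of the constants is expressed by the order of the quantifiers: \<delta>1
  and \<delta>2 are chosen before the fields, the point and the family. The function
  \<open>F\<close>, whose graph is the product relation, shows that this relation is single-valued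
  and everywhere defined in the range considered.\<close>

theorem theorem5p1:
  fixes \<Omega> \<Omega>' :: "(real, 'p::{finite,linorder}) vec set"
    and n r :: nat
    and \<epsilon> M c0 :: real
    and \<omega> :: "real \<Rightarrow> real"
  assumes "r \<ge> 2"
    and "is_domain \<Omega>" and "bounded \<Omega>"
    and "compactly_inside \<Omega>' \<Omega>"
    and "0 < \<epsilon>" and "\<epsilon> < 1"
    and "c0 > 0"
    and "(\<omega> \<longlongrightarrow> 0) (at_right 0)"
  shows "\<exists>\<delta>1>0. \<exists>\<delta>2>0.
    \<forall>X :: nat \<Rightarrow> (real, 'p) vec \<Rightarrow> (real, 'p) vec.
      assumptions_C n r \<Omega> X \<longrightarrow> data_bounds n r \<Omega> \<Omega>' M \<omega> c0 X \<longrightarrow>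
      (\<forall>x0\<in>\<Omega>'. \<forall>\<eta>\<in>families n r.
         span (range (\<lambda>j. commutator X (\<eta> j) x0)) = UNIV \<longrightarrow>
         \<bar>family_det X \<eta> x0\<bar> \<ge> (1 - \<epsilon>) * max_det n r X x0 \<longrightarrow>
         (\<exists>F :: (real, 'p) vec \<times> (real, 'p) vec \<Rightarrow> (real, 'p) vec.
            (\<forall>h\<in>ball 0 \<delta>1. \<forall>x\<in>\<Omega>'. \<forall>y. (x, y) \<in> E_prod \<Omega> X \<eta> h \<longleftrightarrow> y = F (h, x)) \<and>
            (\<exists>U. C1_diffeo_onto (\<lambda>h. F (h, x0)) (ball 0 \<delta>1) U \<and> x0 \<in> U \<and> ball x0 \<delta>2 \<subseteq> U) \<and>
            Ck_on 1 F (ball 0 \<delta>1 \<times> \<Omega>')))"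
proof -
  define \<Theta> where "\<Theta> = {X. assumptions_C n r \<Omega> X \<and> data_bounds n r \<Omega> \<Omega>' M \<omega> c0 X}"
  define M' where "M' = max 0 M"
  have open_\<Omega>: "open \<Omega>" using assms(2) by (simp add: is_domain_def)
  have cpt: "compact (closure \<Omega>')" "closure \<Omega>' \<subseteq> \<Omega>" "open \<Omega>'"
    using assms(4) by (auto simp: compactly_inside_def is_domain_def)
  obtain d0 where d0: "d0 > 0" "nb \<Omega>' d0 \<subseteq> \<Omega>" using nb_subset_open[OF cpt(1) open_\<Omega> cpt(2)] by blast
  interpret g: germs \<Theta> \<Omega>' .
  have Ck: "Ck_closure (reg r i) (\<lambda>x. X i x $ j) \<Omega>" if "X \<in> \<Theta>" "i \<le> n" for X i j
    using that by (auto simp: \<Theta>_def assumptions_C_def)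
  have Ckn: "Ck_norm (reg r i) (\<lambda>x. X i x $ j) \<Omega> \<le> M'" "top_modulus (reg r i) (\<lambda>x. X i x $ j) \<Omega> \<omega>"
    if "X \<in> \<Theta>" "i \<le> n" for X i j
    using that by (auto simp: \<Theta>_def data_bounds_def M'_def le_max_iff_disj)
  have bnd: "norm (iter_partial bs (\<lambda>x. X i x $ j) x) \<le> M'"
    if "X \<in> \<Theta>" "i \<le> n" "bs \<in> dirs_upto (reg r i)" "x \<in> \<Omega>" for X i j bs x
    using norm_iter_partial_le_Ck_norm[OF Ck[OF that(1,2)] assms(3) that(3,4)] Ckn(1)[OF that(1,2)] order_trans by blast
  interpret flows \<Omega> \<Omega>' \<Theta> n r "real CARD('p) * M'"
  proof
    show "0 \<le> real CARD('p) * M'" by (simp add: M'_def)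
    show "norm (X i x) \<le> real CARD('p) * M'" if "X \<in> \<Theta>" "i \<le> n" "x \<in> \<Omega>" for X i x
    proof -
      have "[] \<in> dirs_upto (reg r i)" by (simp add: dirs_upto_def)
      from bnd[OF that(1,2) this that(3)] have "\<bar>X i x $ j\<bar> \<le> M'" for j by simp
      then have "(\<Sum>j\<in>UNIV. \<bar>X i x $ j\<bar>) \<le> (\<Sum>j\<in>(UNIV :: 'p set). M')" by (intro sum_mono)
      then show ?thesis using norm_le_l1_cart[of "X i x"] by simp
    qed
    show "g.UCk (max 1 (r - wt i)) (\<lambda>X. X i)" if i: "i \<le> n" for i
    proof -
      have "g.UCk (reg r i) (\<lambda>X x. X i x $ j)" for j
      proof (rule g.UCk_from_data[OF d0, where M = M'])
        show "Ck_on (reg r i) (\<lambda>x. X i x $ j) \<Omega>" if "X \<in> \<Theta>" for X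
          using Ck[OF that i] by (simp add: Ck_closure_def)
      qed (use bnd i Ckn(2) assms(8) in \<open>auto simp: M'_def\<close>)
      then have "g.UCk (reg r i) (\<lambda>X x. \<Sum>j\<in>UNIV. X i x $ j *\<^sub>R (axis j 1 :: (real, 'p) vec))"
        by (intro g.UCk_sum g.UCk_linear[OF bounded_linear_scaleR_left])
      moreover have "(\<Sum>j\<in>UNIV. v $ j *\<^sub>R axis j 1) = v" for v :: "(real, 'p) vec"
        using basis_expansion[of v] by (simp add: scalar_mult_eq_scaleR)
      ultimately show ?thesis by (simp add: reg_eq[OF assms(1)])
    qed
  qed (use open_\<Omega> cpt assms(1) in auto)
  have "\<forall>I\<in>multiindices n r. \<exists>B\<ge>0. g.near (\<lambda>X x. norm (commutator X I x) \<le> B)"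
    using g.UC_bounded[OF UC_commutator] by blast
  then obtain b where b: "\<And>I. I \<in> multiindices n r \<Longrightarrow> 0 \<le> b I"
    "\<And>I. I \<in> multiindices n r \<Longrightarrow> g.near (\<lambda>X x. norm (commutator X I x) \<le> b I)" by metis
  \<comment> \<open>The sum of the individual bounds is a bound for all commutators of weight at
    most r at once.\<close>
  define B where "B = (\<Sum>I\<in>multiindices n r. b I)"
  have bnear: "g.near (\<lambda>X x. \<forall>I\<in>multiindices n r. norm (commutator X I x) \<le> b I)"
    by (rule g.near_ball_Basis[OF finite_multiindices b(2)])
  have comm: "norm (commutator X I x) \<le> B" if "X \<in> \<Theta>" "x \<in> \<Omega>'" "I \<in> multiindices n r" for X x I
  proof -
    from bnear obtain d where "d > 0" "\<forall>X\<in>\<Theta>. \<forall>x\<in>nb \<Omega>' d. \<forall>I\<in>multiindices n r. norm (commutator X I x) \<le> b I"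
      unfolding g.near_def by blast
    then have "norm (commutator X I x) \<le> b I" using that subset_nb by blast
    also have "b I \<le> B" unfolding B_def by (rule member_le_sum) (use that b(1) finite_multiindices in auto)
    finally show ?thesis .
  qed
  \<comment> \<open>The bound of \<open>norm_matrix_le\<close> for a square matrix with entries at
    most \<open>B\<close>.\<close>
  define BB where "BB = real CARD('p) * (real CARD('p) * B)"
  have pos: "0 < (1 - \<epsilon>) * c0" using assms(6,7) by simp
  obtain c where c: "c > 0" "\<And>(A :: ((real, 'p) vec, 'p) vec) k. norm A \<le> BB \<Longrightarrow> (1 - \<epsilon>) * c0 \<le> \<bar>det A\<bar> \<Longrightarrow> c * norm k \<le> norm (A *v k)"
    using matrix_lower_bound[OF pos, of BB] by blast
  define js where "js = sorted_list_of_set (UNIV :: 'p set)"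
  \<comment> \<open>The tolerance \<open>c/2\<close> is the one that \<open>local_diffeo\<close>
    admits against the lower bound \<open>c\<close>, which is therefore fixed before the
    radius.\<close>
  define Q where "Q \<eta> d \<longleftrightarrow> (\<forall>X\<in>\<Theta>. C1_on (Fmap \<eta> js X) (ball 0 d \<times> nb \<Omega>' d) \<and>
      (\<forall>h x. norm h < d \<longrightarrow> x \<in> nb \<Omega>' d \<longrightarrow> (\<forall>y. (x, y) \<in> E_prod \<Omega> X \<eta> h \<longleftrightarrow> y = Fmap \<eta> js X (h, x)) \<and>
        (\<forall>w. norm (bd (Fmap \<eta> js X) (h, x) w - Flin \<eta> js X x w) \<le> c/2 * norm w)))" for \<eta> d
  have Q_mono: "Q \<eta> d'" if "Q \<eta> d" "0 < d'" "d' \<le> d" for \<eta> d d'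
  proof -
    have sub: "nb \<Omega>' d' \<subseteq> nb \<Omega>' d" by (rule nb_mono[OF that(3)])
    show ?thesis unfolding Q_def
    proof (intro ballI conjI)
      fix X assume X: "X \<in> \<Theta>"
      show "C1_on (Fmap \<eta> js X) (ball 0 d' \<times> nb \<Omega>' d')"
        by (rule C1_on_subset[of _ "ball 0 d \<times> nb \<Omega>' d"]) (use that(1,3) X sub in \<open>auto simp: Q_def\<close>)
      show "\<forall>h x. norm h < d' \<longrightarrow> x \<in> nb \<Omega>' d' \<longrightarrow> (\<forall>y. (x, y) \<in> E_prod \<Omega> X \<eta> h \<longleftrightarrow> y = Fmap \<eta> js X (h, x)) \<and>
        (\<forall>w. norm (bd (Fmap \<eta> js X) (h, x) w - Flin \<eta> js X x w) \<le> c/2 * norm w)"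
      proof (intro allI impI)
        fix h x :: "(real, 'p) vec" assume "norm h < d'" "x \<in> nb \<Omega>' d'"
        then have "norm h < d" "x \<in> nb \<Omega>' d" using that(3) sub by auto
        then show "(\<forall>y. (x, y) \<in> E_prod \<Omega> X \<eta> h \<longleftrightarrow> y = Fmap \<eta> js X (h, x)) \<and>
          (\<forall>w. norm (bd (Fmap \<eta> js X) (h, x) w - Flin \<eta> js X x w) \<le> c/2 * norm w)"
          using that(1) X unfolding Q_def by blast
      qed
    qed
  qed
  have Q_ex: "\<exists>d>0. Q \<eta> d" if \<eta>: "\<eta> \<in> families n r" for \<eta>
  proof -
    obtain d1 where d1: "d1 > 0" "\<And>X. X \<in> \<Theta> \<Longrightarrow> C1_on (Fmap \<eta> js X) (ball 0 d1 \<times> nb \<Omega>' d1)"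
      using Fmap_facts(2)[OF \<eta>, of js] by blast
    have "0 < c/2" using c by simp
    from g.hevt_conj[OF Fmap_rel[OF \<eta>, of js] Fmap_facts(3)[OF \<eta> this, of js]]
    obtain d2 where d2: "d2 > 0" "\<And>X h x. X \<in> \<Theta> \<Longrightarrow> norm h < d2 \<Longrightarrow> x \<in> nb \<Omega>' d2 \<Longrightarrow>
        (\<forall>y. (x, y) \<in> E_prod \<Omega> X \<eta> h \<longleftrightarrow> y = Fmap \<eta> js X (h, x)) \<and>
        (\<forall>w. norm (bd (Fmap \<eta> js X) (h, x) w - Flin \<eta> js X x w) \<le> c/2 * norm w)"
      unfolding g.hevt_def E_prod_def js_def by blast
    define d where "d = min d1 d2"
    have d: "d > 0" "d \<le> d1" "d \<le> d2" using d1 d2 by (auto simp: d_def)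
    have sub: "nb \<Omega>' d \<subseteq> nb \<Omega>' d1" "nb \<Omega>' d \<subseteq> nb \<Omega>' d2" by (auto intro: nb_mono[THEN subsetD] d)
    have "Q \<eta> d" unfolding Q_def
    proof (intro ballI conjI)
      fix X assume X: "X \<in> \<Theta>"
      show "C1_on (Fmap \<eta> js X) (ball 0 d \<times> nb \<Omega>' d)"
        by (rule C1_on_subset[OF d1(2)[OF X]]) (use d sub in auto)
      show "\<forall>h x. norm h < d \<longrightarrow> x \<in> nb \<Omega>' d \<longrightarrow> (\<forall>y. (x, y) \<in> E_prod \<Omega> X \<eta> h \<longleftrightarrow> y = Fmap \<eta> js X (h, x)) \<and>
        (\<forall>w. norm (bd (Fmap \<eta> js X) (h, x) w - Flin \<eta> js X x w) \<le> c/2 * norm w)"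
        by (intro allI impI d2(2)[OF X]) (use d sub in auto)
    qed
    then show ?thesis using d(1) by blast
  qed
  \<comment> \<open>There are finitely many families, so that the radius can be chosen before the
    family.\<close>
  have "\<exists>R>0. \<forall>\<eta>\<in>families n r. Q \<eta> R"
    by (rule finite_common_radius[OF finite_families]) (fact Q_ex, fact Q_mono)
  then obtain R where R: "R > 0" "\<And>\<eta>. \<eta> \<in> families n r \<Longrightarrow> Q \<eta> R" by blast
  \<comment> \<open>Half of the radius leaves room for the closed ball inside
    \<open>local_diffeo\<close>, which also determines the radius in the image.\<close>
  show ?thesis
  proof (rule exI[of _ "R/2"], rule conjI, goal_cases)
    case 2
    show ?case
    proof (rule exI[of _ "c/2 * (R/2)"], rule conjI, goal_cases)
      case 2
      show ?case
      proof (intro allI impI ballI, goal_cases)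
      case (1 X x0 \<eta>)
      then have X: "X \<in> \<Theta>" and x0: "x0 \<in> \<Omega>'" and \<eta>: "\<eta> \<in> families n r" by (auto simp: \<Theta>_def)
      define F where "F = Fmap \<eta> js X"
      have F1: "C1_on F (ball 0 R \<times> nb \<Omega>' R)" and F2: "\<And>h x y. norm h < R \<Longrightarrow> x \<in> nb \<Omega>' R \<Longrightarrow>
          (x, y) \<in> E_prod \<Omega> X \<eta> h \<longleftrightarrow> y = F (h, x)"
        and F3: "\<And>h x w. norm h < R \<Longrightarrow> x \<in> nb \<Omega>' R \<Longrightarrow> norm (bd F (h, x) w - Flin \<eta> js X x w) \<le> c/2 * norm w"
        using R(2)[OF \<eta>] X unfolding Q_def F_def by blast+
      have sub: "\<Omega>' \<subseteq> nb \<Omega>' R" by (rule subset_nb[OF R(1)])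
      have x0R: "x0 \<in> nb \<Omega>' R" using x0 sub by blast
      define A :: "((real, 'p) vec, 'p) vec" where "A = (\<chi> i j. commutator X (\<eta> j) x0 $ i)"
      have \<eta>j: "\<eta> j \<in> multiindices n r" for j using \<eta> by (simp add: families_def)
      have A_bd: "norm A \<le> BB" unfolding BB_def
      proof (rule norm_matrix_le)
        show "\<bar>A $ i $ j\<bar> \<le> B" for i j
          using component_le_norm_cart[of "commutator X (\<eta> j) x0" i] comm[OF X x0 \<eta>j[of j]] by (simp add: A_def)
      qed
      have fin: "finite ((\<lambda>\<zeta>. \<bar>family_det X \<zeta> x\<bar>) ` (families n r :: ('p \<Rightarrow> nat list) set))" for x
        by (rule finite_imageI[OF finite_families])
      \<comment> \<open>Nonnegativity bounds the values from below, so that the infimum over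
        \<Omega>' in the data is a lower bound at x0.\<close>
      have "0 \<le> max_det n r X x" for x
      proof -
        have "\<bar>family_det X \<eta> x\<bar> \<le> max_det n r X x" unfolding max_det_def
          by (rule Max_ge[OF fin]) (use \<eta> in blast)
        then show ?thesis using abs_ge_zero order_trans by blast
      qed
      then have "bdd_below ((\<lambda>x. max_det n r X x) ` \<Omega>')" by (intro bdd_belowI2)
      then have "(INF x\<in>\<Omega>'. max_det n r X x) \<le> max_det n r X x0" by (rule cINF_lower[OF _ x0])
      then have "c0 \<le> max_det n r X x0" using X by (auto simp: \<Theta>_def data_bounds_def)
      then have "(1 - \<epsilon>) * c0 \<le> (1 - \<epsilon>) * max_det n r X x0" using assms(6) by (intro mult_left_mono) auto
      then have "(1 - \<epsilon>) * c0 \<le> \<bar>det A\<bar>" using 1(6) by (simp add: A_def family_det_def)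
      note lower = c(2)[OF A_bd this]
      \<comment> \<open>With x0 fixed, only variations of h remain, and the linear model becomes the
        matrix of the commutators.\<close>
      have Flin: "Flin \<eta> js X x0 (k, 0) = A *v k" for k
      proof -
        have "Flin \<eta> js X x0 (k, 0) = (\<Sum>j\<in>UNIV. k $ j *\<^sub>R commutator X (\<eta> j) x0)"
          by (simp add: Flin_def js_def sum_list_distinct_conv_sum_set)
        also have "\<dots> = A *v k"
          by (simp add: vec_eq_iff A_def matrix_vector_mult_def mult.commute)
        finally show ?thesis .
      qed
      define f where "f h = F (h, x0)" for h
      have inj: "C1_on (\<lambda>h. (h, x0)) (ball 0 R)"
        by (rule C1_on_bdI[of _ _ "\<lambda>_. Blinfun (\<lambda>h. (h, 0))"])
           (auto intro!: derivative_eq_intros simp: bounded_linear_Blinfun_apply[OF bounded_linear_Pair[OF bounded_linear_ident bounded_linear_zero]])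
      have f: "C1_on f (ball 0 R)"
        unfolding f_def by (rule C1_on_compose[OF F1 inj]) (use x0R in auto)
      have bdf: "bd f h k = bd F (h, x0) (k, 0)" if h: "h \<in> ball 0 R" for h k
      proof -
        have "(F has_derivative bd F (h, x0)) (at (h, x0))" by (rule C1_on_bd(1)[OF F1]) (use h x0R in auto)
        moreover have "((\<lambda>h. (h, x0)) has_derivative (\<lambda>k. (k, 0))) (at h)" by (auto intro!: derivative_eq_intros)
        ultimately have D: "(f has_derivative (\<lambda>k. bd F (h, x0) (k, 0))) (at h)"
          unfolding f_def by (rule has_derivative_compose[rotated])
        from has_derivative_bounded_linear[OF D] show ?thesis
          by (simp add: bd_def[of f] frechet_eq[OF D] bounded_linear_Blinfun_apply)
      qed
      \<comment> \<open>At h = 0 every factor relates x0 to itself, since all its flows run for time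
        0; single-valuedness of the product yields the value.\<close>
      have f0: "f 0 = x0"
      proof -
        have "E_rel \<Omega> X (\<eta> j) 0 = C_rel \<Omega> X 0 (\<eta> j)" for j by (simp add: E_rel_def)
        then have "(x0, x0) \<in> E_rel \<Omega> X (\<eta> j) 0" for j
          using C_rel_eq_lrel[of "\<eta> j" X 0] lrel_0[of x0 x0 X "word (\<eta> j)"] \<eta>j[of j] x0 cpt(2) closure_subset[of \<Omega>']
          by (auto simp: multiindices_def)
        then have "(x0, x0) \<in> foldr (\<lambda>j R. R O E_rel \<Omega> X (\<eta> j) ((0 :: (real, 'p) vec) $ j)) ls Id" for ls
          by (induction ls) auto
        then have "(x0, x0) \<in> E_prod \<Omega> X \<eta> 0" unfolding E_prod_def .
        then show ?thesis using F2[of 0 x0 x0] R(1) x0R by (simp add: f_def)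
      qed
      have "\<exists>U. C1_diffeo_onto f (ball 0 (R/2)) U \<and> f 0 \<in> U \<and> ball (f 0) (c/2 * (R/2)) \<subseteq> U"
      proof (rule local_diffeo[OF f _ c(1), of "(*v) A"])
        show "bounded_linear ((*v) A)" by (rule matrix_vector_mul_bounded_linear)
        show "norm (bd f h k - A *v k) \<le> c/2 * norm k" if "h \<in> ball 0 R" for h k
          using F3[of h x0 "(k, 0)"] that x0R by (simp add: bdf[OF that] Flin norm_Pair)
      qed (use R(1) lower in auto)
      then have "\<exists>U. C1_diffeo_onto (\<lambda>h. F (h, x0)) (ball 0 (R/2)) U \<and> x0 \<in> U \<and> ball x0 (c/2 * (R/2)) \<subseteq> U"
        unfolding f0 unfolding f_def .
      moreover have "Ck_on 1 F (ball 0 (R/2) \<times> \<Omega>')"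
        by (rule C1_on_imp_Ck_on[OF C1_on_subset[OF F1]]) (use sub R(1) in auto)
      moreover have "\<forall>h\<in>ball 0 (R/2). \<forall>x\<in>\<Omega>'. \<forall>y. (x, y) \<in> E_prod \<Omega> X \<eta> h \<longleftrightarrow> y = F (h, x)"
        using F2 sub R(1) by auto
      ultimately show ?case by blast
      qed
    qed (use c(1) R(1) in simp)
  qed (use R(1) in simp)
qed


end
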